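(* Let $\boldsymbol{L}=(\boldsymbol{L}_t)_{t\in\mathbb{R}}$ be a two-sided Lévy process in $\mathbb{R}^d$ with characteristic triplet $(\boldsymbol{b},\mathfrak{S},\Lambda)$ such that $\mathbf{E}[\|\boldsymbol{L}_1\|^2]<\infty$ and $\mathbf{E}[\boldsymbol{L}_1]=\boldsymbol{0}$. Let $\boldsymbol{X}$ be the stationary Lévy-driven Ornstein–Uhlenbeck process $$\boldsymbol{X}_t=\int_{-\infty}^te^{A(t-s)}\Sigma\,\mathrm{d}\boldsymbol{L}_s,\quad t\geqslant0,$$ for some stable $A\in\mathbb{M}_d$ and some $\Sigma\in\mathbb{M}_d$ such that $\det(\Sigma)\neq0$. (i) If $\mathfrak{S}=0$ and $\boldsymbol{0}\in\operatorname{int}\operatorname{conv}\operatorname{supp}\Lambda_\varepsilon$ for any $\varepsilon>0$, then $(\boldsymbol{X}_t)_{t\in[0,T]}$ has the conditional small ball property (CSBP) with respect to $\big(\mathscr{F}^{\boldsymbol{L},\mathrm{inc}}_t\big)_{t\in[0,T]}$ for any $T>0$. (ii) If $\Lambda=0$ and $\det(\mathfrak{S})\neq0$, then $(\boldsymbol{X}_t)_{t\in[0,T]}$ has conditional full support (CFS) with respect to $\big(\mathscr{F}^{\boldsymbol{L},\mathrm{inc}}_t\big)_{t\in[0,T]}$ for any $T>0$.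
   Context: $d\in\mathbb{N}$; $\mathbb{M}_d$ is the space of real $d\times d$ matrices; $A\in\mathbb{M}_d$ is stable if all its eigenvalues have strictly negative real parts; $e^{A}$ is the matrix exponential. In the triplet, $\boldsymbol{b}$ is the drift, $\mathfrak{S}$ the Gaussian covariance matrix and $\Lambda$ the Lévy measure. The two-sided process is obtained from a càdlàg Lévy process $(\boldsymbol{L}_t)_{t\geqslant0}$ and an independent copy $\boldsymbol{L}'$ by $\boldsymbol{L}_t=-\boldsymbol{L}'_{(-t)-}$ for $t<0$. The stochastic integral is in the sense of Rajput and Rosiński (limit in probability of integrals of simple deterministic functions), and $\boldsymbol{X}$ is identified with its càdlàg (in case (ii), continuous) modification. Filtration: $\mathscr{F}^{\boldsymbol{L},\mathrm{inc}}_t=\sigma(\boldsymbol{L}_u-\boldsymbol{L}_v:-\infty<v<u\leqslant t)$. CSBP and CFS: a càdlàg $\mathbb{R}^d$-valued process $\boldsymbol{Y}=(\boldsymbol{Y}_t)_{t\in[0,T]}$ has the CSBP with respect to a filtration $(\mathscr{F}_t)_{t\in[0,T]}$ if it is adapted to it and, for any $t_0\in[0,T)$, any continuous $\boldsymbol{f}:[t_0,T]\to\mathbb{R}^d$ with $\boldsymbol{f}(t_0)=\boldsymbol{0}$ and any $\varepsilon>0$, $\mathbf{P}\big[\sup_{t\in[t_0,T]}\|\boldsymbol{Y}_t-\boldsymbol{Y}_{t_0}-\boldsymbol{f}(t)\|<\varepsilon\,\big|\,\mathscr{F}_{t_0}\big]>0$ almost surely. If in addition $\boldsymbol{Y}$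 is continuous, it is said to have CFS. Restricted Lévy measure: $\Lambda_\varepsilon(B)=\Lambda\big(B\cap B(\boldsymbol{0},\varepsilon)\big)$ for Borel $B\subset\mathbb{R}^d$, where $B(\boldsymbol{0},\varepsilon)$ is the open ball of radius $\varepsilon$ centred at the origin; $\operatorname{supp}$ is the closed support of a measure, $\operatorname{conv}$ the convex hull, $\operatorname{int}$ the interior in $\mathbb{R}^d$. *)

theory Defs
  imports "HOL-Probability.Probability"
begin

section \<open>Matrices\<close>

text \<open>The type class product on \<open>real ^ 'd ^ 'd\<close> is entrywise, so the powers are formed with \<^term>\<open>(**)\<close>.\<close>

definition mat_exp :: "real ^ 'd ^ 'd \<Rightarrow> real ^ 'd ^ 'd" where
  "mat_exp A = (\<Sum>k. (1 / fact k) *\<^sub>R (((**) A) ^^ k) (mat 1))"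

definition is_eigenvalue :: "real ^ 'd ^ 'd \<Rightarrow> complex \<Rightarrow> bool" where
  "is_eigenvalue A z \<longleftrightarrow>
     (\<exists>v :: complex ^ 'd. v \<noteq> 0 \<and> map_matrix complex_of_real A *v v = z *s v)"

definition stable_matrix :: "real ^ 'd ^ 'd \<Rightarrow> bool" where
  "stable_matrix A \<longleftrightarrow> (\<forall>z. is_eigenvalue A z \<longrightarrow> Re z < 0)"


section \<open>Paths, convergence in probability, support of a measure\<close>

text \<open>At the left (right) end point of an interval \<open>S\<close> the filter for the left (right) limit is
  trivial, so no condition is imposed there.\<close>

definition cadlag_on :: "real set \<Rightarrow> (real \<Rightarrow> 'a::topological_space) \<Rightarrow> bool" where
  "cadlag_on S f \<longleftrightarrow>
     (\<forall>t\<in>S. (f \<longlongrightarrow> f t) (at t within (S \<inter> {t<..})) \<and>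
            (\<exists>l. (f \<longlongrightarrow> l) (at t within (S \<inter> {..<t}))))"

definition tendsto_in_prob ::
    "'w measure \<Rightarrow> (nat \<Rightarrow> 'w \<Rightarrow> 'a::metric_space) \<Rightarrow> ('w \<Rightarrow> 'a) \<Rightarrow> bool" where
  "tendsto_in_prob M Y Z \<longleftrightarrow>
     (\<forall>\<epsilon>>0. (\<lambda>n. measure M {\<omega> \<in> space M. dist (Y n \<omega>) (Z \<omega>) > \<epsilon>}) \<longlonglongrightarrow> 0)"

definition measure_support :: "'a::topological_space measure \<Rightarrow> 'a set" where
  "measure_support \<mu> = {x. \<forall>U. open U \<and> x \<in> U \<longrightarrow> emeasure \<mu> U > 0}"

definition restrict_ball :: "'a::real_normed_vector measure \<Rightarrow> real \<Rightarrow> 'a measure" where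
  "restrict_ball \<mu> \<epsilon> = density \<mu> (indicator (ball 0 \<epsilon>))"

lemma emeasure_restrict_ball:
  assumes "sets \<mu> = sets borel" "B \<in> sets borel"
  shows "emeasure (restrict_ball \<mu> \<epsilon>) B = emeasure \<mu> (B \<inter> ball 0 \<epsilon>)"
proof -
  have B: "B \<in> sets \<mu>" and U: "ball 0 \<epsilon> \<in> sets \<mu>"
    using assms by auto
  have "emeasure (restrict_ball \<mu> \<epsilon>) B = (\<integral>\<^sup>+x. indicator (ball 0 \<epsilon>) x * indicator B x \<partial>\<mu>)"
    unfolding restrict_ball_def using B U by (intro emeasure_density) auto
  also have "\<dots> = (\<integral>\<^sup>+x. indicator (B \<inter> ball 0 \<epsilon>) x \<partial>\<mu>)"
    by (intro nn_integral_cong) (auto split: split_indicator)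
  also have "\<dots> = emeasure \<mu> (B \<inter> ball 0 \<epsilon>)"
    using B U by (intro nn_integral_indicator) auto
  finally show ?thesis .
qed


section \<open>Levy processes\<close>

text \<open>A process with time set \<open>[0,\<infinity>)\<close> is a function on \<^typ>\<open>real\<close> whose values at negative times
  are irrelevant.\<close>

definition levy_process :: "'w measure \<Rightarrow> (real \<Rightarrow> 'w \<Rightarrow> real ^ 'd) \<Rightarrow> bool" where
  "levy_process M L \<longleftrightarrow>
     (\<forall>t\<ge>0. L t \<in> borel_measurable M) \<and>
     (AE \<omega> in M. L 0 \<omega> = 0) \<and>
     (\<forall>(n::nat) (t::nat \<Rightarrow> real). 0 \<le> t 0 \<and> mono t \<longrightarrow>
        prob_space.indep_vars M (\<lambda>_. borel) (\<lambda>i \<omega>. L (t (Suc i)) \<omega> - L (t i) \<omega>) {..<n}) \<and>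
     (\<forall>s t. 0 \<le> s \<and> s \<le> t \<longrightarrow>
        distr M borel (\<lambda>\<omega>. L t \<omega> - L s \<omega>) = distr M borel (L (t - s))) \<and>
     (\<forall>\<omega>\<in>space M. cadlag_on {0..} (\<lambda>t. L t \<omega>))"

definition path_map :: "(real \<Rightarrow> 'w \<Rightarrow> 'a) \<Rightarrow> 'w \<Rightarrow> real \<Rightarrow> 'a" where
  "path_map L \<omega> = (\<lambda>t\<in>{0..}. L t \<omega>)"

abbreviation path_space :: "(real \<Rightarrow> 'a::topological_space) measure" where
  "path_space \<equiv> Pi\<^sub>M {0..} (\<lambda>_. borel)"

definition two_sided_levy_process :: "'w measure \<Rightarrow> (real \<Rightarrow> 'w \<Rightarrow> real ^ 'd) \<Rightarrow> bool" where
  "two_sided_levy_process M L \<longleftrightarrow>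
     levy_process M L \<and>
     (\<exists>L'. levy_process M L' \<and>
           distr M path_space (path_map L') = distr M path_space (path_map L) \<and>
           prob_space.indep_var M path_space (path_map L) path_space (path_map L') \<and>
           (\<forall>t<0. \<forall>\<omega>\<in>space M. L t \<omega> = - Lim (at_left (- t)) (\<lambda>s. L' s \<omega>)))"

definition levy_measure :: "(real ^ 'd) measure \<Rightarrow> bool" where
  "levy_measure \<Lambda> \<longleftrightarrow>
     sets \<Lambda> = sets borel \<and> emeasure \<Lambda> {0} = 0 \<and>
     (\<integral>\<^sup>+x. ennreal (min 1 ((norm x)\<^sup>2)) \<partial>\<Lambda>) < \<infinity>"

definition levy_khintchine_exponent ::
    "real ^ 'd \<Rightarrow> real ^ 'd ^ 'd \<Rightarrow> (real ^ 'd) measure \<Rightarrow> real ^ 'd \<Rightarrow> complex" where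
  "levy_khintchine_exponent b S \<Lambda> \<theta> =
     \<i> * complex_of_real (b \<bullet> \<theta>) - complex_of_real (\<theta> \<bullet> (S *v \<theta>) / 2) +
     (LINT x|\<Lambda>. iexp (\<theta> \<bullet> x) - 1 - \<i> * complex_of_real (indicator (cball 0 1) x * (\<theta> \<bullet> x)))"

definition has_triplet ::
    "'w measure \<Rightarrow> (real \<Rightarrow> 'w \<Rightarrow> real ^ 'd) \<Rightarrow>
     real ^ 'd \<Rightarrow> real ^ 'd ^ 'd \<Rightarrow> (real ^ 'd) measure \<Rightarrow> bool" where
  "has_triplet M L b S \<Lambda> \<longleftrightarrow>
     transpose S = S \<and> (\<forall>x. 0 \<le> x \<bullet> (S *v x)) \<and> levy_measure \<Lambda> \<and>
     (\<forall>t\<ge>0. \<forall>\<theta>. (LINT \<omega>|M. iexp (\<theta> \<bullet> L t \<omega>)) =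
        exp (complex_of_real t * levy_khintchine_exponent b S \<Lambda> \<theta>))"


section \<open>The Rajput--Rosinski integral\<close>

definition bounded_borel :: "real set set" where
  "bounded_borel = {B \<in> sets borel. bounded B}"

text \<open>The independently scattered random measure on the delta-ring of bounded Borel sets that
  extends the increments of \<open>L\<close>; these determine it up to modification.\<close>

definition levy_random_measure ::
    "'w measure \<Rightarrow> (real \<Rightarrow> 'w \<Rightarrow> real ^ 'd) \<Rightarrow> (real set \<Rightarrow> 'w \<Rightarrow> real ^ 'd) \<Rightarrow> bool" where
  "levy_random_measure M L Z \<longleftrightarrow>
     (\<forall>B\<in>bounded_borel. Z B \<in> borel_measurable M) \<and>
     (\<forall>B::nat \<Rightarrow> real set. range B \<subseteq> bounded_borel \<and> disjoint_family B \<longrightarrow>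
        prob_space.indep_vars M (\<lambda>_. borel) (\<lambda>n. Z (B n)) UNIV \<and>
        ((\<Union>n. B n) \<in> bounded_borel \<longrightarrow>
           (AE \<omega> in M. (\<lambda>n. Z (B n) \<omega>) sums Z (\<Union>n. B n) \<omega>))) \<and>
     (\<forall>a b. a < b \<longrightarrow> (AE \<omega> in M. Z {a<..b} \<omega> = L b \<omega> - L a \<omega>))"

definition simple_integrand :: "(real \<Rightarrow> real ^ 'd ^ 'd) \<Rightarrow> bool" where
  "simple_integrand g \<longleftrightarrow> finite (range g) \<and> (\<forall>C. C \<noteq> 0 \<longrightarrow> g -` {C} \<in> bounded_borel)"

definition simple_stoch_integral ::
    "(real set \<Rightarrow> 'w \<Rightarrow> real ^ 'd) \<Rightarrow> real set \<Rightarrow> (real \<Rightarrow> real ^ 'd ^ 'd) \<Rightarrow> 'w \<Rightarrow> real ^ 'd" where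
  "simple_stoch_integral Z B g \<omega> = (\<Sum>C\<in>range g - {0}. C *v Z (B \<inter> g -` {C}) \<omega>)"

text \<open>The exceptional sets for the convergence of the integrands are Lebesgue null sets: by
  stationarity of the increments, Lebesgue measure is a control measure. Convergence of the
  integrals over all Borel sets \<open>B\<close> is what makes the limit independent of the approximating
  sequence.\<close>

definition has_stoch_integral ::
    "'w measure \<Rightarrow> (real \<Rightarrow> 'w \<Rightarrow> real ^ 'd) \<Rightarrow>
     (real \<Rightarrow> real ^ 'd ^ 'd) \<Rightarrow> ('w \<Rightarrow> real ^ 'd) \<Rightarrow> bool" where
  "has_stoch_integral M L f Y \<longleftrightarrow>
     f \<in> borel_measurable borel \<and> Y \<in> borel_measurable M \<and>
     (\<exists>Z g. levy_random_measure M L Z \<and> (\<forall>n. simple_integrand (g n)) \<and>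
        (AE s in lborel. (\<lambda>n. g n s) \<longlonglongrightarrow> f s) \<and>
        (\<forall>B\<in>sets borel. \<exists>W\<in>borel_measurable M.
           tendsto_in_prob M (\<lambda>n. simple_stoch_integral Z B (g n)) W) \<and>
        tendsto_in_prob M (\<lambda>n. simple_stoch_integral Z UNIV (g n)) Y)"

definition levy_ou_process ::
    "'w measure \<Rightarrow> (real \<Rightarrow> 'w \<Rightarrow> real ^ 'd) \<Rightarrow> real ^ 'd ^ 'd \<Rightarrow> real ^ 'd ^ 'd \<Rightarrow>
     (real \<Rightarrow> 'w \<Rightarrow> real ^ 'd) \<Rightarrow> bool" where
  "levy_ou_process M L A \<Sigma> X \<longleftrightarrow>
     (\<forall>t\<ge>0. has_stoch_integral M L
        (\<lambda>s. indicator {..t} s *\<^sub>R (mat_exp ((t - s) *\<^sub>R A) ** \<Sigma>)) (X t))"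


section \<open>Filtrations, modifications, CSBP and CFS\<close>

definition incr_filtration ::
    "'w measure \<Rightarrow> (real \<Rightarrow> 'w \<Rightarrow> real ^ 'd) \<Rightarrow> real \<Rightarrow> 'w measure" where
  "incr_filtration M L t = sigma (space M)
     {(\<lambda>\<omega>. L u \<omega> - L v \<omega>) -` B \<inter> space M | u v B. v < u \<and> u \<le> t \<and> B \<in> sets borel}"

lemma filtration_incr_filtration: "filtration (space M) (incr_filtration M L)"
proof
  fix i j :: real assume "i \<le> j"
  then show "sets (incr_filtration M L i) \<subseteq> sets (incr_filtration M L j)"
    unfolding incr_filtration_def
    by (subst (1 2) sets_measure_of) (auto intro!: sigma_sets_mono' dest: order_trans)
qed (simp add: incr_filtration_def space_measure_of_conv)

lemma subalgebra_incr_filtration: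
  assumes "\<And>u. L u \<in> borel_measurable M"
  shows "subalgebra M (incr_filtration M L t)"
proof -
  have "(\<lambda>\<omega>. L u \<omega> - L v \<omega>) -` B \<inter> space M \<in> sets M" if "B \<in> sets borel" for u v B
  proof (rule measurable_sets[OF _ that])
    show "(\<lambda>\<omega>. L u \<omega> - L v \<omega>) \<in> borel_measurable M"
      using assms[of u] assms[of v] by measurable
  qed
  then show ?thesis
    unfolding subalgebra_def incr_filtration_def
    by (subst sets_measure_of)
       (auto simp: space_measure_of_conv intro!: sets.sigma_sets_subset)
qed

definition adapted_on ::
    "real set \<Rightarrow> (real \<Rightarrow> 'w measure) \<Rightarrow> (real \<Rightarrow> 'w \<Rightarrow> 'a::topological_space) \<Rightarrow> bool" where
  "adapted_on I F Y \<longleftrightarrow> (\<forall>t\<in>I. Y t \<in> borel_measurable (F t))"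

definition modification_of ::
    "'w measure \<Rightarrow> (real \<Rightarrow> 'w \<Rightarrow> 'a) \<Rightarrow> (real \<Rightarrow> 'w \<Rightarrow> 'a) \<Rightarrow> bool" where
  "modification_of M X Y \<longleftrightarrow> (\<forall>t\<ge>0. AE \<omega> in M. Y t \<omega> = X t \<omega>)"

text \<open>The conditional probability given \<open>F t\<^sub>0\<close> is the conditional expectation of the indicator.
  The supremum is taken in \<^typ>\<open>real\<close>; it is over a bounded set because the paths are cadlag.\<close>

definition CSBP ::
    "'w measure \<Rightarrow> (real \<Rightarrow> 'w measure) \<Rightarrow> real \<Rightarrow> (real \<Rightarrow> 'w \<Rightarrow> real ^ 'd) \<Rightarrow> bool" where
  "CSBP M F T Y \<longleftrightarrow>
     (\<forall>\<omega>\<in>space M. cadlag_on {0..T} (\<lambda>t. Y t \<omega>)) \<and>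
     adapted_on {0..T} F Y \<and>
     (\<forall>t\<^sub>0 f \<epsilon>. 0 \<le> t\<^sub>0 \<and> t\<^sub>0 < T \<and> continuous_on {t\<^sub>0..T} f \<and> f t\<^sub>0 = 0 \<and> 0 < \<epsilon> \<longrightarrow>
        (AE \<omega> in M. 0 < real_cond_exp M (F t\<^sub>0)
           (indicator {\<omega> \<in> space M. (SUP t\<in>{t\<^sub>0..T}. norm (Y t \<omega> - Y t\<^sub>0 \<omega> - f t)) < \<epsilon>}) \<omega>))"

definition CFS ::
    "'w measure \<Rightarrow> (real \<Rightarrow> 'w measure) \<Rightarrow> real \<Rightarrow> (real \<Rightarrow> 'w \<Rightarrow> real ^ 'd) \<Rightarrow> bool" where
  "CFS M F T Y \<longleftrightarrow>
     CSBP M F T Y \<and> (\<forall>\<omega>\<in>space M. continuous_on {0..T} (\<lambda>t. Y t \<omega>))"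

text \<open>\<open>X\<close> is only given up to modification, each \<open>X t\<close> being a limit in probability. The filtration
  is not completed, so a cadlag modification of \<open>X\<close> can fail to be adapted by a change on a null
  set; the representatives of \<open>X\<close> are therefore its adapted cadlag (continuous) modifications.
  Any two of them are indistinguishable.\<close>

definition cadlag_representative ::
    "'w measure \<Rightarrow> (real \<Rightarrow> 'w measure) \<Rightarrow> (real \<Rightarrow> 'w \<Rightarrow> real ^ 'd) \<Rightarrow>
     (real \<Rightarrow> 'w \<Rightarrow> real ^ 'd) \<Rightarrow> bool" where
  "cadlag_representative M F X Y \<longleftrightarrow>
     modification_of M X Y \<and> adapted_on {0..} F Y \<and> (\<forall>\<omega>\<in>space M. cadlag_on {0..} (\<lambda>t. Y t \<omega>))"

definition continuous_representative ::
    "'w measure \<Rightarrow> (real \<Rightarrow> 'w measure) \<Rightarrow> (real \<Rightarrow> 'w \<Rightarrow> real ^ 'd) \<Rightarrow>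
     (real \<Rightarrow> 'w \<Rightarrow> real ^ 'd) \<Rightarrow> bool" where
  "continuous_representative M F X Y \<longleftrightarrow>
     modification_of M X Y \<and> adapted_on {0..} F Y \<and> (\<forall>\<omega>\<in>space M. continuous_on {0..} (\<lambda>t. Y t \<omega>))"

end

theory Submission
  imports Defs
begin

text \<open>
  Riemann sums converge to the stochastic integral in probability and, by summation by parts, also pathwise.
  Hence \<open>X t = e\<^sup>t\<^sup>A X 0 + F t (L - L 0)\<close> almost surely, where \<open>F t\<close> is continuous for the
  supremum norm and \<open>X 0\<close> is determined by the past. As \<open>\<Sigma>\<close> is invertible, every target path \<open>f\<close> is reached from
  a given initial value by a continuous driving path \<open>g\<close>. So it suffices that, on every event of the past of
  positive probability, \<open>L - L t\<^sub>0\<close> stays close to \<open>g\<close> with positive probability.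

  This is achieved by feedback on a fine grid: given that the deviation from \<open>g\<close> lies in a compact set \<open>K\<close>, the next
  increment brings it back to \<open>K\<close> with positive probability, and increments are independent of the past.
  In case (i), \<open>K = - R conv S\<close> with \<open>S = supp \<Lambda>\<^sub>\<epsilon>\<close>: by Caratheodory's theorem every \<open>y\<close> in \<open>conv S\<close> has an
  \<open>x\<close> in \<open>S\<close> such that \<open>R y - x\<close> lies in \<open>(R - 1) conv S\<close>, and in a short time \<open>t\<close> a jump close to \<open>x\<close> has
  probability at least \<open>c t\<close>. In case (ii), \<open>K\<close> is a ball of radius \<open>R \<surd>h\<close>, \<open>h\<close> being the
  step of the grid, and an increment of order \<open>\<surd>h\<close> against the deviation has a probability bounded from below.
\<close>

text \<open>An integral is given only through some random measure and some simple integrands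
  converging almost everywhere, neither of which is tied to Riemann sums. The link is uniform
  absolute continuity of the approximating integrals, which convergence over every Borel set yields
  by a Vitali--Hahn--Saks argument; an exceptional set of small measure is then split off as in
  Egorov's theorem. No Levy--Ito decomposition enters: jump probabilities are read off from the
  exponent. Averaging a characteristic function over a standard normal variable gives the
  expectation of a Gaussian function of the random vector, which bounds tails. A second difference
  of the exponent cancels drift and compensation and leaves the Fourier transform of the finite
  measure with density \<open>1 - cos (u \<bullet> y)\<close> with respect to \<Lambda>; this yields
  the order \<open>t\<close> of the probability of a jump. Since the filtration is not completed,
  representatives have to be built by measurable operations on past increments: \<open>X 0\<close>
  as the limit of a subsequence of Riemann sums and, in case (ii), a driving path that is stopped
  when it ceases to be continuous.\<close>

section \<open>Cadlag paths\<close>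

lemma cadlag_on_subset: "cadlag_on T f \<Longrightarrow> S \<subseteq> T \<Longrightarrow> cadlag_on S f"
  unfolding cadlag_on_def
  by (intro ballI) (blast intro: tendsto_within_subset)

text \<open>The sequence may also take the value \<open>s\<close>, as grid points do. Since the
  right limit is \<open>f s\<close>, the function is continuous within
  \<open>S \<inter> {s..}\<close>, and no case distinction arises.\<close>

lemma cadlag_on_right_sequence:
  fixes f :: "real \<Rightarrow> 'a::metric_space"
  assumes f: "cadlag_on S f" and s: "s \<in> S" and x: "\<And>n. x n \<in> S" "\<And>n. s \<le> x n" "x \<longlonglongrightarrow> s"
  shows "(\<lambda>n::nat. f (x n)) \<longlonglongrightarrow> f s"
proof -
  have "(f \<longlongrightarrow> f s) (at s within (S \<inter> {s<..}))"
    using f s by (auto simp: cadlag_on_def)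
  moreover have "at s within (S \<inter> {s<..}) = at s within (S \<inter> {s..})"
    by (auto simp: at_within_def intro!: arg_cong2[where f=inf] arg_cong[where f=principal])
  ultimately have "continuous (at s within (S \<inter> {s..})) f"
    by (simp add: continuous_within)
  moreover have "x n \<in> S \<inter> {s..}" for n using x(1,2) by simp
  ultimately show ?thesis
    using x(3) continuous_within_tendsto_compose' by blast
qed

text \<open>Near a point the values to its left are close to the left limit and those to its right
  are close to the value there; compactness turns these local bounds into one.\<close>

lemma cadlag_on_bounded:
  fixes f :: "real \<Rightarrow> 'a::real_normed_vector"
  assumes f: "cadlag_on {a..b} f"
  shows "bounded (f ` {a..b})"
proof -
  have "\<exists>d>0. \<exists>K. \<forall>s\<in>{a..b}. dist s t < d \<longrightarrow> norm (f s) \<le> K" if t: "t \<in> {a..b}" for t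
  proof -
    obtain l where l: "(f \<longlongrightarrow> l) (at t within ({a..b} \<inter> {..<t}))"
      and r: "(f \<longlongrightarrow> f t) (at t within ({a..b} \<inter> {t<..}))"
      using f t unfolding cadlag_on_def by blast
    obtain d1 where d1: "d1 > 0" "\<forall>s\<in>{a..b} \<inter> {..<t}. s \<noteq> t \<and> dist s t < d1 \<longrightarrow> dist (f s) l < 1"
      using tendstoD[OF l zero_less_one] unfolding eventually_at by blast
    obtain d2 where d2: "d2 > 0" "\<forall>s\<in>{a..b} \<inter> {t<..}. s \<noteq> t \<and> dist s t < d2 \<longrightarrow> dist (f s) (f t) < 1"
      using tendstoD[OF r zero_less_one] unfolding eventually_at by blast
    have "norm (f s) \<le> norm l + norm (f t) + 1" if "s \<in> {a..b}" "dist s t < min d1 d2" for s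
    proof -
      consider "s < t" | "s = t" | "s > t" by linarith
      then show ?thesis
      proof cases
        case 1
        then have "dist (f s) l < 1" using d1 that by auto
        then have "norm (f s) \<le> norm l + 1"
          using norm_triangle_sub[of "f s" l] by (simp add: dist_norm)
        then show ?thesis using norm_ge_zero[of "f t"] by linarith
      next
        case 3
        then have "dist (f s) (f t) < 1" using d2 that by auto
        then have "norm (f s) \<le> norm (f t) + 1"
          using norm_triangle_sub[of "f s" "f t"] by (simp add: dist_norm)
        then show ?thesis using norm_ge_zero[of l] by linarith
      next
        case 2
        then show ?thesis using norm_ge_zero[of l] by simp
      qed
    qed
    then show ?thesis using d1(1) d2(1) by (intro exI[of _ "min d1 d2"] conjI exI[of _ "norm l + norm (f t) + 1"]) auto
  qed
  then have "\<forall>t. \<exists>d K. t \<in> {a..b} \<longrightarrow> d > 0 \<and> (\<forall>s\<in>{a..b}. dist s t < d \<longrightarrow> norm (f s) \<le> K)"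
    by blast
  then obtain d K where dK: "\<forall>t. t \<in> {a..b} \<longrightarrow> d t > 0 \<and> (\<forall>s\<in>{a..b}. dist s t < d t \<longrightarrow> norm (f s) \<le> K t)"
    by (auto simp only: choice_iff)
  then have d: "\<And>t. t \<in> {a..b} \<Longrightarrow> d t > 0"
    and K: "\<And>t s. t \<in> {a..b} \<Longrightarrow> s \<in> {a..b} \<Longrightarrow> dist s t < d t \<Longrightarrow> norm (f s) \<le> K t"
    by blast+
  have cov: "{a..b} \<subseteq> (\<Union>t\<in>{a..b}. ball t (d t))"
    using d by force
  obtain C where C: "C \<subseteq> {a..b}" "finite C" "{a..b} \<subseteq> (\<Union>t\<in>C. ball t (d t))"
    by (rule compactE_image[OF compact_Icc _ cov]) auto
  have "norm (f s) \<le> Max (K ` C)" if s: "s \<in> {a..b}" for s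
  proof -
    obtain t where t: "t \<in> C" "dist s t < d t" using C(3) s by (auto simp: dist_commute)
    then have "norm (f s) \<le> K t" using K C(1) s by auto
    also have "K t \<le> Max (K ` C)" using t C(2) by auto
    finally show ?thesis .
  qed
  then show ?thesis unfolding bounded_iff by blast
qed

text \<open>Every point other than \<open>b\<close> is a limit from the right of points of
  \<open>D\<close>; nothing lies to the right of \<open>b\<close>, so \<open>b\<close> itself has to
  belong to \<open>D\<close>. This reduces conditions on a whole path to countably many
  times.\<close>

lemma cadlag_on_dense_closed:
  fixes f :: "real \<Rightarrow> 'a::metric_space"
  assumes f: "cadlag_on {a..b} f" and C: "closed C"
    and D: "D \<subseteq> {a..b}" "b \<in> D" "\<And>s t. a \<le> s \<Longrightarrow> s < t \<Longrightarrow> t \<le> b \<Longrightarrow> \<exists>d\<in>D. s < d \<and> d < t"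
    and fD: "\<And>d. d \<in> D \<Longrightarrow> f d \<in> C" and s: "s \<in> {a..b}"
  shows "f s \<in> C"
proof (cases "s = b")
  case False
  then have sb: "s < b" using s by auto
  have "\<exists>d\<in>D. s < d \<and> d < s + (b - s) / real (Suc n)" for n
  proof (intro D(3))
    have "(b - s) / real (Suc n) \<le> (b - s) / 1"
      using sb by (intro divide_left_mono) auto
    then show "s + (b - s) / real (Suc n) \<le> b" by simp
  qed (use s sb in auto)
  then obtain d where d: "\<And>n. d n \<in> D" "\<And>n. s < d n" "\<And>n. d n < s + (b - s) / real (Suc n)"
    by metis
  have "(\<lambda>n. s + (b - s) / real (Suc n)) \<longlonglongrightarrow> s + 0"
    by (intro tendsto_add tendsto_const) (rule LIMSEQ_Suc, rule lim_const_over_n)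
  then have "d \<longlonglongrightarrow> s"
    by (intro tendsto_sandwich[of "\<lambda>_. s" d sequentially "\<lambda>n. s + (b - s) / real (Suc n)"])
       (use d in \<open>auto intro!: always_eventually less_imp_le simp del: of_nat_Suc\<close>)
  then have "(\<lambda>n. f (d n)) \<longlonglongrightarrow> f s"
    using d D(1) s by (intro cadlag_on_right_sequence[OF f]) (blast intro: less_imp_le)+
  then show ?thesis
    using closed_sequentially[OF C, of "\<lambda>n. f (d n)"] fD d(1) by blast
qed (use fD D in auto)

lemma cadlag_left_limit:
  fixes f :: "real \<Rightarrow> 'a::t2_space"
  assumes f: "cadlag_on {0..} f" and s: "0 < s"
  shows "(f \<longlongrightarrow> Lim (at_left s) f) (at_left s)"
proof -
  obtain l where "(f \<longlongrightarrow> l) (at s within ({0..} \<inter> {..<s}))"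
    using f s unfolding cadlag_on_def by (meson atLeast_iff less_imp_le)
  moreover have "at s within ({0..} \<inter> {..<s}) = at_left s"
    by (rule at_within_nhd[of s "{0<..}"]) (use s in auto)
  ultimately show ?thesis
    using tendsto_Lim[of "at_left s" f l] by simp
qed

lemma cadlag_on_diff_continuous:
  fixes f g :: "real \<Rightarrow> 'a::real_normed_vector"
  assumes f: "cadlag_on S f" and g: "continuous_on S g"
  shows "cadlag_on S (\<lambda>t. f t - g t)"
  unfolding cadlag_on_def
proof (intro ballI conjI)
  fix t assume t: "t \<in> S"
  have g': "(g \<longlongrightarrow> g t) (at t within (S \<inter> U))" for U
    using g t by (auto simp: continuous_on_def intro: tendsto_within_subset)
  show "((\<lambda>t. f t - g t) \<longlongrightarrow> f t - g t) (at t within (S \<inter> {t<..}))"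
    using f t by (intro tendsto_diff g') (auto simp: cadlag_on_def)
  show "\<exists>l. ((\<lambda>t. f t - g t) \<longlongrightarrow> l) (at t within (S \<inter> {..<t}))"
    using f t tendsto_diff[OF _ g'] unfolding cadlag_on_def by blast
qed

lemma continuous_on_imp_cadlag_on: "continuous_on S f \<Longrightarrow> cadlag_on S f"
  unfolding cadlag_on_def continuous_on_def by (intro ballI) (blast intro: tendsto_within_subset)

section \<open>The matrix exponential and Riemann sums\<close>

text \<open>The product \<open>**\<close> is not the type class product, so limits, derivatives and
  series of matrix products are all obtained from bilinearity.\<close>

lemma bounded_bilinear_matrix_matrix_mult:
  "bounded_bilinear ((**) :: real^'n^'m \<Rightarrow> real^'p^'n \<Rightarrow> real^'p^'m)"
  by (subst bilinear_conv_bounded_bilinear[symmetric])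
     (auto simp: bilinear_def linear_iff vec_eq_iff matrix_matrix_mult_def sum.distrib algebra_simps sum_distrib_left)

lemma bounded_bilinear_matrix_vector_mult:
  "bounded_bilinear ((*v) :: real^'n^'m \<Rightarrow> real^'n \<Rightarrow> real^'m)"
  by (subst bilinear_conv_bounded_bilinear[symmetric])
     (auto simp: bilinear_def linear_iff vec_eq_iff matrix_vector_mult_def sum.distrib algebra_simps sum_distrib_left)

text \<open>The norm of a matrix is the Euclidean norm of its entries, so Cauchy--Schwarz in each
  row suffices.\<close>

lemma norm_matrix_vector_mult_le: "norm (A *v x) \<le> norm A * norm (x::real^'n)"
  for A :: "real^'n^'m"
proof -
  have "norm (A *v x) = L2_set (\<lambda>i. \<bar>A $ i \<bullet> x\<bar>) UNIV"
    unfolding norm_vec_def by (simp add: matrix_vector_mul_component L2_set_def)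
  also have "\<dots> \<le> L2_set (\<lambda>i. norm (A $ i) * norm x) UNIV"
    by (intro L2_set_mono) (auto simp: Cauchy_Schwarz_ineq2)
  also have "\<dots> = norm A * norm x"
    unfolding norm_vec_def[of A] by (simp add: L2_set_left_distrib)
  finally show ?thesis .
qed

definition mexp :: "real^'d^'d \<Rightarrow> real \<Rightarrow> real^'d^'d" where
  "mexp A t = mat_exp (t *\<^sub>R A)"

definition mexp_coeff :: "real^'d^'d \<Rightarrow> nat \<Rightarrow> real^'d^'d" where
  "mexp_coeff A k = (1 / fact k) *\<^sub>R (((**) A) ^^ k) (mat 1)"

lemma matrix_power_scaleR: "(((**) (t *\<^sub>R A)) ^^ k) (mat 1) = t ^ k *\<^sub>R (((**) A) ^^ k) (mat 1)"
  for A :: "real^'d^'d"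
  by (induction k) (auto simp:
       bounded_bilinear.scaleR_left[OF bounded_bilinear_matrix_matrix_mult]
       bounded_bilinear.scaleR_right[OF bounded_bilinear_matrix_matrix_mult])

text \<open>The norm of a product is controlled up to a factor \<open>K\<close>, which is absorbed
  into the argument of a dominating exponential series.\<close>

lemma summable_mexp_coeff:
  fixes A :: "real^'d^'d"
  shows "summable (\<lambda>k. t ^ k *\<^sub>R mexp_coeff A k)"
proof -
  obtain K where K: "K > 0" "\<And>(B :: real^'d^'d) (C :: real^'d^'d). norm (B ** C) \<le> norm B * norm C * K"
    using bounded_bilinear.pos_bounded[OF bounded_bilinear_matrix_matrix_mult] by blast
  have pow: "norm ((((**) A) ^^ k) (mat 1 :: real^'d^'d)) \<le> (norm A * K) ^ k * norm (mat 1 :: real^'d^'d)" for k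
  proof (induction k)
    case (Suc k)
    have "norm ((((**) A) ^^ Suc k) (mat 1 :: real^'d^'d)) \<le> norm A * norm ((((**) A) ^^ k) (mat 1 :: real^'d^'d)) * K"
      using K(2)[of A "(((**) A) ^^ k) (mat 1 :: real^'d^'d)"] by simp
    also have "\<dots> \<le> norm A * ((norm A * K) ^ k * norm (mat 1 :: real^'d^'d)) * K"
      using Suc K(1) by (intro mult_right_mono mult_left_mono) auto
    finally show ?case by (simp add: algebra_simps)
  qed simp
  show ?thesis
  proof (rule summable_comparison_test)
    show "\<exists>N. \<forall>k\<ge>N. norm (t ^ k *\<^sub>R mexp_coeff A k)
        \<le> (1 / fact k) * (\<bar>t\<bar> * (norm A * K)) ^ k * norm (mat 1 :: real^'d^'d)"
    proof (intro exI allI impI)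
      fix k
      have "norm (t ^ k *\<^sub>R mexp_coeff A k) = \<bar>t\<bar> ^ k * (1 / fact k) * norm ((((**) A) ^^ k) (mat 1 :: real^'d^'d))"
        by (simp add: mexp_coeff_def power_abs)
      also have "\<dots> \<le> \<bar>t\<bar> ^ k * (1 / fact k) * ((norm A * K) ^ k * norm (mat 1 :: real^'d^'d))"
        by (intro mult_left_mono pow) auto
      finally show "norm (t ^ k *\<^sub>R mexp_coeff A k)
        \<le> (1 / fact k) * (\<bar>t\<bar> * (norm A * K)) ^ k * norm (mat 1 :: real^'d^'d)"
        by (simp add: power_mult_distrib mult_ac)
    qed
    have "summable (\<lambda>k. (\<bar>t\<bar> * (norm A * K)) ^ k /\<^sub>R fact k)"
      by (rule summable_exp_generic)
    then show "summable (\<lambda>k. (1 / fact k) * (\<bar>t\<bar> * (norm A * K)) ^ k * norm (mat 1 :: real^'d^'d))"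
      by (intro summable_mult2) (simp add: divide_inverse mult.commute)
  qed
qed

lemma mexp_eq_suminf: "mexp A t = (\<Sum>k. t ^ k *\<^sub>R mexp_coeff A k)"
  unfolding mexp_def mat_exp_def matrix_power_scaleR mexp_coeff_def
  by (intro suminf_cong) (simp add: mult.commute)

lemma mexp_0 [simp]: "mexp A 0 = mat 1"
proof -
  have "(\<Sum>k. 0 ^ k *\<^sub>R mexp_coeff A k) = (\<Sum>k\<in>{0}. 0 ^ k *\<^sub>R mexp_coeff A k)"
    by (rule suminf_finite) (auto simp: power_0_left)
  then show ?thesis by (simp add: mexp_eq_suminf mexp_coeff_def)
qed

lemma mult_mexp_sums: "(\<lambda>k. t ^ k *\<^sub>R (A ** mexp_coeff A k)) sums (A ** mexp A t)"
proof -
  have bl: "bounded_linear (\<lambda>B. A ** B)"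
    by (rule bounded_bilinear.bounded_linear_right[OF bounded_bilinear_matrix_matrix_mult])
  have "(\<lambda>k. A ** (t ^ k *\<^sub>R mexp_coeff A k)) sums (A ** mexp A t)"
    unfolding mexp_eq_suminf
    by (intro bounded_linear.sums[OF bl] summable_sums summable_mexp_coeff)
  then show ?thesis
    by (simp add: bounded_bilinear.scaleR_right[OF bounded_bilinear_matrix_matrix_mult])
qed

lemma mexp_coeff_commute: "mexp_coeff A k ** A = A ** mexp_coeff A k"
proof -
  have "(((**) A) ^^ k) (mat 1) ** A = A ** (((**) A) ^^ k) (mat 1)"
    by (induction k) (auto simp: matrix_mul_assoc[symmetric])
  then show ?thesis
    by (simp add: mexp_coeff_def bounded_bilinear.scaleR_left[OF bounded_bilinear_matrix_matrix_mult]
      bounded_bilinear.scaleR_right[OF bounded_bilinear_matrix_matrix_mult])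
qed

lemma mexp_commute: "mexp A t ** A = A ** mexp A t"
proof -
  have bl: "bounded_linear (\<lambda>B. B ** A)"
    by (rule bounded_bilinear.bounded_linear_left[OF bounded_bilinear_matrix_matrix_mult])
  have "(\<lambda>k. (t ^ k *\<^sub>R mexp_coeff A k) ** A) sums (mexp A t ** A)"
    unfolding mexp_eq_suminf
    by (intro bounded_linear.sums[OF bl] summable_sums summable_mexp_coeff)
  then have "(\<lambda>k. t ^ k *\<^sub>R (A ** mexp_coeff A k)) sums (mexp A t ** A)"
    by (simp add: bounded_bilinear.scaleR_left[OF bounded_bilinear_matrix_matrix_mult] mexp_coeff_commute)
  then show ?thesis using mult_mexp_sums sums_unique2 by blast
qed

text \<open>Each entry is an everywhere convergent real power series and may be differentiated term
  by term; \<open>diffs\<close> shifts its coefficients, which amounts to multiplication by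
  \<open>A\<close>.\<close>

lemma mexp_has_vector_derivative:
  fixes A :: "real^'d^'d"
  shows "(mexp A has_vector_derivative A ** mexp A t) (at t)"
proof -
  have comp: "((\<lambda>s. mexp A s $ i $ j) has_field_derivative (A ** mexp A t) $ i $ j) (at t)" for i j
  proof -
    have bl: "bounded_linear (\<lambda>B::real^'d^'d. B $ i $ j)"
      using bounded_linear_compose[OF bounded_linear_vec_nth[of j] bounded_linear_vec_nth[of i]] by simp
    have sm: "(\<lambda>k. mexp_coeff A k $ i $ j * s ^ k) sums (mexp A s $ i $ j)" for s
      using bounded_linear.sums[OF bl summable_sums[OF summable_mexp_coeff[of s A]]]
      by (simp add: mexp_eq_suminf mult.commute)
    have "((\<lambda>s. \<Sum>k. mexp_coeff A k $ i $ j * s ^ k) has_field_derivative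
       (\<Sum>k. diffs (\<lambda>k. mexp_coeff A k $ i $ j) k * t ^ k)) (at t)"
      using sm by (intro termdiffs_strong_converges_everywhere) (auto simp: sums_iff)
    moreover have "diffs (\<lambda>k. mexp_coeff A k $ i $ j) k = (A ** mexp_coeff A k) $ i $ j" for k
      by (simp add: diffs_def mexp_coeff_def bounded_bilinear.scaleR_right[OF bounded_bilinear_matrix_matrix_mult] del: of_nat_Suc)
    moreover have "(\<lambda>k. (A ** mexp_coeff A k) $ i $ j * t ^ k) sums ((A ** mexp A t) $ i $ j)"
      using bounded_linear.sums[OF bl mult_mexp_sums[of t A]] by (simp add: mult.commute)
    ultimately show ?thesis
      using sm by (simp add: sums_iff)
  qed
  have "((\<lambda>s. mexp A s) has_derivative (\<lambda>x. x *\<^sub>R (A ** mexp A t))) (at t)"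
  proof (subst has_derivative_componentwise_within, intro ballI)
    fix e :: "real^'d^'d" assume "e \<in> Basis"
    then obtain i j where e: "e = axis i (axis j 1)"
      by (auto simp: Basis_vec_def)
    show "((\<lambda>s. mexp A s \<bullet> e) has_derivative (\<lambda>x. (x *\<^sub>R (A ** mexp A t)) \<bullet> e)) (at t)"
      using comp[of i j] unfolding e
      by (simp add: inner_axis has_field_derivative_def mult_commute_abs)
  qed
  then show ?thesis by (simp add: has_vector_derivative_def)
qed

lemma mexp_has_vector_derivative_within [derivative_intros]:
  assumes "(f has_vector_derivative f') (at t within S)"
  shows "((\<lambda>s. mexp A (f s)) has_vector_derivative f' *\<^sub>R (A ** mexp A (f t))) (at t within S)"
  using vector_diff_chain_within[OF assms has_vector_derivative_at_within[OF mexp_has_vector_derivative[of A "f t"]]]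
  by (simp add: comp_def)

lemma continuous_on_mexp [continuous_intros]:
  assumes "continuous_on S f" shows "continuous_on S (\<lambda>s. mexp A (f s))"
proof -
  have "continuous_on UNIV (mexp A)"
    by (meson continuous_at_imp_continuous_on has_vector_derivative_continuous mexp_has_vector_derivative)
  then show ?thesis
    using assms continuous_on_compose2 by blast
qed

text \<open>The product in \<open>h\<close> has derivative zero, since \<open>A\<close> commutes
  with its exponential. Its values at \<open>0\<close> and at \<open>t\<close> are the two
  sides.\<close>

lemma mexp_add: "mexp A (s + t) = mexp A s ** mexp A t"
proof -
  define h where "h = (\<lambda>u. mexp A (s + t - u) ** mexp A u)"
  have "(h has_vector_derivative 0) (at u)" for u
  proof -
    have "((\<lambda>u. mexp A (s + t - u)) has_vector_derivative (- 1) *\<^sub>R (A ** mexp A (s + t - u))) (at u)"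
      by (rule derivative_eq_intros refl | simp)+
    from bounded_bilinear.has_vector_derivative[OF bounded_bilinear_matrix_matrix_mult this mexp_has_vector_derivative[of A u]]
    have "(h has_vector_derivative mexp A (s + t - u) ** (A ** mexp A u)
       + (- 1) *\<^sub>R (A ** mexp A (s + t - u)) ** mexp A u) (at u)"
      by (simp add: h_def)
    moreover have "mexp A (s + t - u) ** (A ** mexp A u) = (A ** mexp A (s + t - u)) ** mexp A u"
      by (simp add: matrix_mul_assoc mexp_commute)
    ultimately show ?thesis
      by (simp add: bounded_bilinear.scaleR_left[OF bounded_bilinear_matrix_matrix_mult]
         bounded_bilinear.minus_left[OF bounded_bilinear_matrix_matrix_mult])
  qed
  then have "h t = h 0"
    using has_derivative_zero_unique[of UNIV h t 0] by (auto simp: has_vector_derivative_def)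
  then show ?thesis by (simp add: h_def)
qed

section \<open>Uniform grids, Riemann sums and summation by parts\<close>

definition grid :: "real \<Rightarrow> real \<Rightarrow> nat \<Rightarrow> nat \<Rightarrow> real" where
  "grid a b k i = a + real i * ((b - a) / real k)"

definition riem_sum :: "(real \<Rightarrow> real^'n^'m) \<Rightarrow> (real \<Rightarrow> real^'n) \<Rightarrow> real \<Rightarrow> real \<Rightarrow> nat \<Rightarrow> real^'m" where
  "riem_sum F l a b k = (\<Sum>i<k. F (grid a b k i) *v (l (grid a b k (Suc i)) - l (grid a b k i)))"

lemma grid_0 [simp]: "grid a b k 0 = a" by (simp add: grid_def)
lemma grid_end [simp]: "k > 0 \<Longrightarrow> grid a b k k = b" by (simp add: grid_def)
lemma grid_mono: "a \<le> b \<Longrightarrow> i \<le> j \<Longrightarrow> grid a b k i \<le> grid a b k j"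
  unfolding grid_def by (intro add_left_mono mult_right_mono) auto
lemma grid_strict_mono: "a < b \<Longrightarrow> k > 0 \<Longrightarrow> i < j \<Longrightarrow> grid a b k i < grid a b k j"
  unfolding grid_def by (intro add_strict_left_mono mult_strict_right_mono) auto
lemma grid_mem: "a \<le> b \<Longrightarrow> i \<le> k \<Longrightarrow> grid a b k i \<in> {a..b}"
  using grid_mono[of a b 0 i k] grid_mono[of a b i k k] by (cases "k = 0") auto

text \<open>Abel summation moves the increments from the rough path to the smooth kernel;
  \<open>l\<close> is then evaluated at the right end points of the cells.\<close>

lemma riem_sum_by_parts:
  fixes F :: "nat \<Rightarrow> real^'n^'m" and l :: "nat \<Rightarrow> real^'n"
  shows "(\<Sum>i<k. F i *v (l (Suc i) - l i)) = F k *v l k - F 0 *v l 0 - (\<Sum>i<k. (F (Suc i) - F i) *v l (Suc i))"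
  by (induction k) (auto simp: matrix_vector_mult_diff_rdistrib matrix_vector_mult_diff_distrib)

text \<open>After summation by parts the remaining sum is the integral of \<open>F'\<close> against
  \<open>l\<close> read off at the next grid point. That point tends to \<open>s\<close> from the
  right, so right-continuity and dominated convergence give the limit.\<close>

lemma riem_sum_tendsto:
  fixes F F' :: "real \<Rightarrow> real^'n^'m" and l :: "real \<Rightarrow> real^'n"
  assumes ab: "a < b" and l: "cadlag_on {a..b} l"
    and F: "\<And>s. s \<in> {a..b} \<Longrightarrow> (F has_vector_derivative F' s) (at s within {a..b})"
    and F': "continuous_on {a..b} F'"
  shows "(\<lambda>s. F' s *v l s) integrable_on {a..b}"
    and "riem_sum F l a b \<longlonglongrightarrow> F b *v l b - F a *v l a - integral {a..b} (\<lambda>s. F' s *v l s)"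
proof -
  \<comment> \<open>The smallest grid point that is not smaller than \<open>s\<close>.\<close>
  define up where "up k s = a + real_of_int \<lceil>(s - a) * real k / (b - a)\<rceil> * ((b - a) / real k)" for k s
  define f where "f k s = F' s *v l (up k s)" for k s
  define J where "J k j = (\<Sum>i<j. (F (grid a b k (Suc i)) - F (grid a b k i)) *v l (grid a b k (Suc i)))" for k j
  have up: "s \<le> up k s" "up k s \<le> b" "up k s \<le> s + (b - a) / real k" if "s \<in> {a..b}" "k > 0" for k s
  proof -
    have p: "(b - a) / real k > 0" using ab that by simp
    have e: "(s - a) * real k / (b - a) * ((b - a) / real k) = s - a" using ab that by simp
    have "(s - a) * real k / (b - a) * ((b - a) / real k)
      \<le> real_of_int \<lceil>(s - a) * real k / (b - a)\<rceil> * ((b - a) / real k)"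
      using p by (intro mult_right_mono) auto
    then show "s \<le> up k s" unfolding e by (simp add: up_def)
    have "(s - a) * real k / (b - a) \<le> real k"
      using ab that by (simp add: divide_le_eq mult.commute mult_right_mono)
    then have "\<lceil>(s - a) * real k / (b - a)\<rceil> \<le> int k" by (simp add: ceiling_le_iff)
    then have "real_of_int \<lceil>(s - a) * real k / (b - a)\<rceil> * ((b - a) / real k) \<le> real k * ((b - a) / real k)"
      using p by (intro mult_right_mono) linarith+
    then show "up k s \<le> b" using that by (simp add: up_def)
    have "real_of_int \<lceil>(s - a) * real k / (b - a)\<rceil> * ((b - a) / real k)
      \<le> ((s - a) * real k / (b - a) + 1) * ((b - a) / real k)"
      using p by (intro mult_right_mono) linarith+
    also have "\<dots> = s - a + (b - a) / real k" unfolding distrib_right e by simp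
    finally show "up k s \<le> s + (b - a) / real k" by (simp add: up_def)
  qed
  have claim: "(f k has_integral J k j) {a..grid a b k j}" if k: "k > 0" and "j \<le> k" for k j
    using \<open>j \<le> k\<close>
  proof (induction j)
    case 0 show ?case by (simp add: J_def has_integral_refl)
  next
    case (Suc j)
    let ?g = "grid a b k"
    have le: "?g j \<le> ?g (Suc j)" using ab by (intro grid_mono) auto
    have mem: "{?g j..?g (Suc j)} \<subseteq> {a..b}"
      using grid_mem[of a b j k] grid_mem[of a b "Suc j" k] ab Suc.prems by auto
    have bl: "bounded_linear (\<lambda>B. B *v l (?g (Suc j)))"
      by (rule bounded_bilinear.bounded_linear_left[OF bounded_bilinear_matrix_vector_mult])
    have hi1: "((\<lambda>s. F' s *v l (?g (Suc j))) has_integral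
       F (?g (Suc j)) *v l (?g (Suc j)) - F (?g j) *v l (?g (Suc j))) {?g j..?g (Suc j)}"
      using mem by (intro fundamental_theorem_of_calculus[OF le] bounded_linear.has_vector_derivative[OF bl])
        (auto intro!: has_vector_derivative_within_subset[OF F mem])
    \<comment> \<open>At the left end point of the cell \<open>up\<close> is that point itself and
      not the next one; a single point does not affect the integral.\<close>
    have eq1: "f k s = F' s *v l (?g (Suc j))" if "s \<in> {?g j..?g (Suc j)} - {?g j}" for s
    proof -
      have "(s - a) * real k / (b - a) > real j"
        using that ab k by (auto simp: grid_def field_simps)
      moreover have "(s - a) * real k / (b - a) \<le> real j + 1"
        using that ab k by (auto simp: grid_def field_simps)
      ultimately have "\<lceil>(s - a) * real k / (b - a)\<rceil> = int (Suc j)"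
        by (intro ceiling_unique) auto
      then show ?thesis by (simp add: f_def up_def grid_def)
    qed
    have "(f k has_integral
       F (?g (Suc j)) *v l (?g (Suc j)) - F (?g j) *v l (?g (Suc j))) {?g j..?g (Suc j)}"
      using has_integral_spike_finite[of "{?g j}", OF _ eq1 hi1] by simp
    with Suc have "(f k has_integral J k j +
       (F (?g (Suc j)) *v l (?g (Suc j)) - F (?g j) *v l (?g (Suc j)))) {a..?g (Suc j)}"
      using le grid_mem[of a b j k] ab by (intro has_integral_combine[of a "?g j"]) auto
    then show ?case by (simp add: J_def matrix_vector_mult_diff_rdistrib)
  qed
  have hi: "(f k has_integral J k k) {a..b}" if "k > 0" for k
    using claim[of k k] that by simp
  obtain B1 where "\<forall>x\<in>F' ` {a..b}. norm x \<le> B1"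
    using compact_imp_bounded[OF compact_continuous_image[OF F' compact_Icc]] unfolding bounded_iff by blast
  then have B1: "\<And>s. s \<in> {a..b} \<Longrightarrow> norm (F' s) \<le> B1" by blast
  obtain B2 where "\<forall>x\<in>l ` {a..b}. norm x \<le> B2"
    using cadlag_on_bounded[OF l] unfolding bounded_iff by blast
  then have B2: "\<And>s. s \<in> {a..b} \<Longrightarrow> norm (l s) \<le> B2" by blast
  have B1': "B1 \<ge> 0" using B1[of a] ab by (auto intro: order_trans[OF norm_ge_zero])
  \<comment> \<open>The index \<open>Suc k\<close> avoids the empty partition, whose mesh is zero by
    the convention on division.\<close>
  have bound: "norm (f (Suc k) s) \<le> B1 * B2" if s: "s \<in> {a..b}" for k s
  proof -
    have "norm (f (Suc k) s) \<le> norm (F' s) * norm (l (up (Suc k) s))"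
      unfolding f_def by (rule norm_matrix_vector_mult_le)
    also have "\<dots> \<le> B1 * B2"
      using up[OF s, of "Suc k"] s B1' by (intro mult_mono B1 B2) auto
    finally show ?thesis .
  qed
  have lim: "(\<lambda>k. f (Suc k) s) \<longlonglongrightarrow> F' s *v l s" if s: "s \<in> {a..b}" for s
  proof -
    have "(\<lambda>k. (b - a) / real (Suc k)) \<longlonglongrightarrow> 0"
      by (rule LIMSEQ_Suc, rule lim_const_over_n)
    then have "(\<lambda>k. s + (b - a) / real (Suc k)) \<longlonglongrightarrow> s"
      using tendsto_add[OF tendsto_const[of s]] by fastforce
    note lim_up = this
    have us: "s \<le> up (Suc k) s" "up (Suc k) s \<le> b" "up (Suc k) s \<le> s + (b - a) / real (Suc k)" for k
      using up[OF s, of "Suc k"] by blast+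
    have "(\<lambda>k. up (Suc k) s) \<longlonglongrightarrow> s"
      by (rule tendsto_sandwich[OF always_eventually always_eventually tendsto_const lim_up])
         (blast intro: us)+
    moreover have "up (Suc k) s \<in> {a..b}" for k using us(1,2)[of k] s by simp
    ultimately have "(\<lambda>k. l (up (Suc k) s)) \<longlonglongrightarrow> l s"
      using us(1) by (rule cadlag_on_right_sequence[OF l s, rotated 2])
    then show ?thesis
      unfolding f_def by (intro bounded_bilinear.tendsto[OF bounded_bilinear_matrix_vector_mult] tendsto_const)
  qed
  have int: "f (Suc k) integrable_on {a..b}" for k
    using hi[of "Suc k"] by (auto simp: has_integral_integrable)
  note dc = dominated_convergence[where f = "\<lambda>k. f (Suc k)" and h = "\<lambda>_. B1 * B2" and g = "\<lambda>s. F' s *v l s" and S = "{a..b}",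
      OF int integrable_const_ivl bound lim]
  show "(\<lambda>s. F' s *v l s) integrable_on {a..b}"
    by (rule dc(1))
  have "(\<lambda>k. integral {a..b} (f (Suc k))) \<longlonglongrightarrow> integral {a..b} (\<lambda>s. F' s *v l s)"
    by (rule dc(2))
  then have "(\<lambda>k. F b *v l b - F a *v l a - integral {a..b} (f (Suc k))) \<longlonglongrightarrow>
      F b *v l b - F a *v l a - integral {a..b} (\<lambda>s. F' s *v l s)"
    by (intro tendsto_intros)
  moreover have "F b *v l b - F a *v l a - integral {a..b} (f (Suc k)) = riem_sum F l a b (Suc k)" for k
    unfolding riem_sum_def integral_unique[OF hi[of "Suc k", simplified]] J_def
    by (subst riem_sum_by_parts) simp
  ultimately have "(\<lambda>k. riem_sum F l a b (Suc k)) \<longlonglongrightarrow>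
      F b *v l b - F a *v l a - integral {a..b} (\<lambda>s. F' s *v l s)"
    by simp
  then show "riem_sum F l a b \<longlonglongrightarrow> F b *v l b - F a *v l a - integral {a..b} (\<lambda>s. F' s *v l s)"
    by (rule LIMSEQ_imp_Suc)
qed

section \<open>Characteristic functions and the random measure\<close>

text \<open>Averaging \<open>iexp (\<xi> \<bullet> y)\<close> over \<xi> with this law turns
  characteristic functions into expectations of Gaussian functions, which localise a random vector
  without an inversion formula.\<close>

definition std_gauss :: "(real^'d) measure" where
  "std_gauss = distr (PiM UNIV (\<lambda>_::'d. std_normal_distribution)) borel (\<lambda>f. \<chi> i. f i)"

lemma measurable_vec_lambda_std_normal [measurable]:
  "(\<lambda>f. \<chi> i. f i) \<in> borel_measurable (PiM UNIV (\<lambda>_::'d::finite. std_normal_distribution))"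
proof (subst borel_measurable_euclidean_space, intro ballI)
  fix e :: "real^'d" assume "e \<in> Basis"
  then obtain i where e: "e = axis i 1" by (auto simp: Basis_vec_def)
  have "(\<lambda>f. f i) \<in> borel_measurable (PiM UNIV (\<lambda>_::'d. std_normal_distribution))"
    using measurable_component_singleton[of i UNIV "\<lambda>_. std_normal_distribution"] by simp
  then show "(\<lambda>f. (\<chi> i. f i) \<bullet> e) \<in> borel_measurable (PiM UNIV (\<lambda>_::'d. std_normal_distribution))"
    by (simp add: e inner_axis)
qed

lemma product_prob_space_std_normal: "product_prob_space (\<lambda>_. std_normal_distribution)"
  by (intro product_prob_spaceI prob_space_normal_density) simp

lemma sets_std_gauss [simp, measurable_cong]: "sets std_gauss = sets borel"
  and space_std_gauss [simp]: "space std_gauss = UNIV"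
  by (auto simp: std_gauss_def)

lemma prob_space_std_gauss: "prob_space (std_gauss :: (real^'d) measure)"
proof -
  interpret product_prob_space "\<lambda>_::'d. std_normal_distribution" UNIV
    by (rule product_prob_space_std_normal)
  show ?thesis unfolding std_gauss_def
    by (intro prob_space.prob_space_distr P.prob_space_axioms) simp
qed

lemma std_gauss_char:
  "(LINT \<xi>|std_gauss. iexp (\<xi> \<bullet> y)) = complex_of_real (exp (- (norm y)\<^sup>2 / 2))" for y :: "real^'d"
proof -
  interpret product_prob_space "\<lambda>_::'d. std_normal_distribution" UNIV
    by (rule product_prob_space_std_normal)
  interpret D: real_distribution std_normal_distribution by (rule real_dist_normal_dist)
  have "(LINT \<xi>|std_gauss. iexp (\<xi> \<bullet> y)) =
    (LINT f|PiM UNIV (\<lambda>_::'d. std_normal_distribution). iexp ((\<chi> i. f i) \<bullet> y))"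
    unfolding std_gauss_def by (subst integral_distr) auto
  also have "\<dots> = (LINT f|PiM UNIV (\<lambda>_::'d. std_normal_distribution). (\<Prod>i\<in>UNIV. iexp (y $ i * f i)))"
    by (intro Bochner_Integration.integral_cong)
       (auto simp: inner_vec_def sum_distrib_left exp_sum[symmetric] mult.commute simp flip: exp_sum)
  also have "\<dots> = (\<Prod>i\<in>UNIV. (LINT x|std_normal_distribution. iexp (y $ i * x)))"
  proof (subst product_integral_prod)
    show "complex_integrable std_normal_distribution (\<lambda>x. iexp (y $ i * x))" for i
      by (intro finite_measure.integrable_const_bound[of std_normal_distribution _ 1]
          prob_space.finite_measure prob_space_normal_density) auto
  qed auto
  also have "\<dots> = (\<Prod>i\<in>UNIV. complex_of_real (exp (- (y $ i)\<^sup>2 / 2)))"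
    using char_std_normal_distribution by (simp add: char_def fun_eq_iff)
  also have "\<dots> = complex_of_real (exp (\<Sum>i\<in>UNIV. - (y $ i)\<^sup>2 / 2))"
    by (simp add: exp_sum)
  also have "(\<Sum>i\<in>UNIV. - (y $ i)\<^sup>2 / 2) = - (norm y)\<^sup>2 / 2"
    by (simp add: norm_vec_def L2_set_def sum_nonneg sum_negf sum_divide_distrib)
  finally show ?thesis .
qed

lemma integrable_std_gauss_norm2: "integrable std_gauss (\<lambda>\<xi>::real^'d. (norm \<xi>)\<^sup>2)"
proof -
  interpret product_prob_space "\<lambda>_::'d. std_normal_distribution" UNIV
    by (rule product_prob_space_std_normal)
  have 1: "integrable (PiM UNIV (\<lambda>_::'d. std_normal_distribution)) (\<lambda>f. (f i)\<^sup>2)" for i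
  proof -
    have "integrable (distr (PiM UNIV (\<lambda>_::'d. std_normal_distribution)) std_normal_distribution (\<lambda>f. f i)) (\<lambda>x. x\<^sup>2)"
      by (subst PiM_component) (auto intro: integrable_std_normal_distribution_moment)
    then show ?thesis
      by (rule integrable_distr[rotated]) simp
  qed
  show ?thesis
    unfolding std_gauss_def
    by (subst integrable_distr_eq) (use 1 in \<open>auto simp: norm_vec_def L2_set_def sum_nonneg\<close>)
qed

text \<open>Stated for finite measures and not only for probabilities: it is later applied to
  measures weighted by \<open>1 - cos (u \<bullet> y)\<close>.\<close>

lemma std_gauss_Fubini:
  fixes X :: "'w \<Rightarrow> real^'d"
  assumes "finite_measure M" and [measurable]: "X \<in> borel_measurable M"
  shows "(LINT \<xi>|std_gauss. LINT w|M. iexp (\<xi> \<bullet> X w)) = complex_of_real (LINT w|M. exp (- (norm (X w))\<^sup>2 / 2))"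
    and "integrable std_gauss (\<lambda>\<xi>. LINT w|M. iexp (\<xi> \<bullet> X w))"
proof -
  interpret M: finite_measure M by fact
  interpret G: prob_space "std_gauss :: (real^'d) measure" by (rule prob_space_std_gauss)
  interpret P: pair_sigma_finite "std_gauss :: (real^'d) measure" M ..
  have fin: "finite_measure ((std_gauss :: (real^'d) measure) \<Otimes>\<^sub>M M)"
    using finite_measure_pair_measure[OF M.finite_measure_axioms G.finite_measure_axioms] by simp
  have int: "integrable ((std_gauss :: (real^'d) measure) \<Otimes>\<^sub>M M) (\<lambda>(\<xi>, w). iexp (\<xi> \<bullet> X w))"
    by (intro finite_measure.integrable_const_bound[OF fin, of _ 1]) auto
  show "integrable std_gauss (\<lambda>\<xi>. LINT w|M. iexp (\<xi> \<bullet> X w))"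
    using P.integrable_fst[OF int] by simp
  have "(LINT \<xi>|std_gauss. LINT w|M. iexp (\<xi> \<bullet> X w)) = (LINT w|M. LINT \<xi>|std_gauss. iexp (\<xi> \<bullet> X w))"
    using P.Fubini_integral[OF int] by simp
  also have "\<dots> = complex_of_real (LINT w|M. exp (- (norm (X w))\<^sup>2 / 2))"
    by (subst std_gauss_char) simp
  finally show "(LINT \<xi>|std_gauss. LINT w|M. iexp (\<xi> \<bullet> X w)) = complex_of_real (LINT w|M. exp (- (norm (X w))\<^sup>2 / 2))" .
qed

text \<open>Markov's inequality for \<open>1 - exp (- (norm (X w))\<^sup>2 / 2)\<close>, whose
  expectation is a Gaussian average of the characteristic function: a quantitative form of Levy's
  continuity theorem.\<close>

lemma (in prob_space) prob_norm_gt_le_char: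
  fixes X :: "'a \<Rightarrow> real^'d"
  assumes [measurable]: "X \<in> borel_measurable M" and e: "e > 0"
  shows "prob {w\<in>space M. norm (X w) > e} \<le>
    (LINT \<xi>|std_gauss. 1 - Re (LINT w|M. iexp (\<xi> \<bullet> X w))) / (1 - exp (- e\<^sup>2 / 2))"
proof -
  interpret G: prob_space "std_gauss :: (real^'d) measure" by (rule prob_space_std_gauss)
  note F = std_gauss_Fubini[OF finite_measure_axioms assms(1)]
  define c where "c = 1 - exp (- e\<^sup>2 / 2)"
  have c: "c > 0" using e by (simp add: c_def)
  have "Re (LINT \<xi>|std_gauss. LINT w|M. iexp (\<xi> \<bullet> X w)) = (LINT \<xi>|std_gauss. Re (LINT w|M. iexp (\<xi> \<bullet> X w)))"
    using F(2) by simp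
  then have "(LINT \<xi>|std_gauss. 1 - Re (LINT w|M. iexp (\<xi> \<bullet> X w))) = 1 - (LINT w|M. exp (- (norm (X w))\<^sup>2 / 2))"
    using F by (subst Bochner_Integration.integral_diff) (auto simp: G.prob_space[unfolded space_std_gauss])
  also have "\<dots> = (LINT w|M. 1 - exp (- (norm (X w))\<^sup>2 / 2))"
    by (subst Bochner_Integration.integral_diff)
       (auto simp: prob_space intro!: integrable_const_bound[of _ 1])
  also have "\<dots> \<ge> (LINT w|M. c * indicator {w\<in>space M. norm (X w) > e} w)"
  proof (rule integral_mono)
    show "integrable M (\<lambda>w. 1 - exp (- (norm (X w))\<^sup>2 / 2))"
      by (intro integrable_const_bound[of _ 1]) auto
    show "integrable M (\<lambda>w. c * indicator {w\<in>space M. norm (X w) > e} w)"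
      by (intro integrable_mult_right integrable_real_indicator) (auto simp: less_top[symmetric])
    fix w assume "w \<in> space M"
    have "exp (- (norm (X w))\<^sup>2 / 2) \<le> exp (- e\<^sup>2 / 2)" if "norm (X w) > e"
      using that e by (auto intro!: power_mono)
    then show "c * indicator {w\<in>space M. norm (X w) > e} w \<le> 1 - exp (- (norm (X w))\<^sup>2 / 2)"
      by (auto simp: c_def split: split_indicator)
  qed
  finally have "c * prob {w\<in>space M. norm (X w) > e} \<le> (LINT \<xi>|std_gauss. 1 - Re (LINT w|M. iexp (\<xi> \<bullet> X w)))"
    by simp
  then show ?thesis using c by (simp add: c_def field_simps)
qed

section \<open>The Levy--Khintchine exponent: growth and continuity\<close>

lemma integrable_levy_measure_min:
  fixes \<Lambda> :: "(real^'d) measure"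
  assumes "levy_measure \<Lambda>" shows "integrable \<Lambda> (\<lambda>x. min 1 ((norm x)\<^sup>2))"
proof (rule integrableI_nonneg)
  have [measurable_cong]: "sets \<Lambda> = sets borel" using assms by (simp add: levy_measure_def)
  show "(\<lambda>x. min 1 ((norm x)\<^sup>2)) \<in> borel_measurable \<Lambda>" by measurable
  show "(\<integral>\<^sup>+x. ennreal (min 1 ((norm x)\<^sup>2)) \<partial>\<Lambda>) < \<infinity>" using assms by (simp add: levy_measure_def)
qed auto

definition lk_kernel :: "real^'d \<Rightarrow> real^'d \<Rightarrow> complex" where
  "lk_kernel \<xi> x = iexp (\<xi> \<bullet> x) - 1 - \<i> * complex_of_real (indicator (cball 0 1) x * (\<xi> \<bullet> x))"

text \<open>Second order Taylor expansion where the compensator is active, and the trivial bound for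
  larger jumps. The right-hand side is integrable for every Levy measure.\<close>

lemma lk_kernel_bound: "cmod (lk_kernel \<xi> x) \<le> (2 + (norm \<xi>)\<^sup>2) * min 1 ((norm x)\<^sup>2)"
proof (cases "norm x \<le> 1")
  case True
  have "cmod (lk_kernel \<xi> x) \<le> (\<xi> \<bullet> x)\<^sup>2 / 2"
    using iexp_approx1[of "\<xi> \<bullet> x" 1] True by (simp add: lk_kernel_def numeral_2_eq_2 algebra_simps)
  also have "\<dots> \<le> (norm \<xi>)\<^sup>2 * (norm x)\<^sup>2"
  proof -
    have "(\<xi> \<bullet> x)\<^sup>2 \<le> (norm \<xi>)\<^sup>2 * (norm x)\<^sup>2"
      using power_mono[OF Cauchy_Schwarz_ineq2[of \<xi> x] abs_ge_zero, of 2]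
      by (simp add: power_mult_distrib)
    moreover have "0 \<le> (\<xi> \<bullet> x)\<^sup>2" by simp
    ultimately show ?thesis by linarith
  qed
  also have "\<dots> \<le> (2 + (norm \<xi>)\<^sup>2) * (norm x)\<^sup>2"
    by (intro mult_right_mono) auto
  also have "(norm x)\<^sup>2 = min 1 ((norm x)\<^sup>2)"
    using True by (simp add: min_absorb2 power_le_one)
  finally show ?thesis .
next
  case False
  then have "min 1 ((norm x)\<^sup>2) = 1" by (simp add: min_def)
  moreover have "cmod (lk_kernel \<xi> x) \<le> 2"
    using False by (simp add: lk_kernel_def) (metis norm_exp_i_times norm_one norm_triangle_ineq4 one_add_one)
  ultimately show ?thesis
    by (metis add.commute add_increasing mult.right_neutral zero_le_power2)
qed

lemma measurable_lk_kernel [measurable]: fixes \<xi> :: "real^'d" shows "lk_kernel \<xi> \<in> borel_measurable borel"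
proof -
  have [measurable]: "(\<lambda>x::real^'d. indicator (cball 0 1) x :: real) \<in> borel_measurable borel"
    by (intro borel_measurable_indicator) auto
  have [measurable]: "(\<lambda>x. \<xi> \<bullet> x) \<in> borel_measurable borel"
    by (intro borel_measurable_inner) auto
  have "(\<lambda>x. lk_kernel \<xi> x) \<in> borel_measurable borel"
    unfolding lk_kernel_def by measurable
  then show ?thesis by simp
qed

lemma integrable_lk_kernel:
  fixes \<Lambda> :: "(real^'d) measure"
  assumes "levy_measure \<Lambda>" shows "integrable \<Lambda> (lk_kernel \<xi>)"
proof (rule Bochner_Integration.integrable_bound)
  have [measurable_cong]: "sets \<Lambda> = sets borel" using assms by (simp add: levy_measure_def)
  show "integrable \<Lambda> (\<lambda>x. (2 + (norm \<xi>)\<^sup>2) * min 1 ((norm x)\<^sup>2))"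
    using integrable_levy_measure_min[OF assms] by simp
  show "lk_kernel \<xi> \<in> borel_measurable \<Lambda>" by measurable
  show "AE x in \<Lambda>. norm (lk_kernel \<xi> x) \<le> norm ((2 + (norm \<xi>)\<^sup>2) * min 1 ((norm x)\<^sup>2))"
    using lk_kernel_bound[of \<xi>] by (intro AE_I2) (simp add: abs_mult)
qed

text \<open>Quadratic growth makes the exponent integrable against the Gaussian law
  \<open>std_gauss\<close>.\<close>

lemma lk_exponent_bound:
  fixes \<Lambda> :: "(real^'d) measure"
  assumes "levy_measure \<Lambda>"
  obtains K where "K \<ge> 0" "\<And>\<xi>. cmod (levy_khintchine_exponent b S \<Lambda> \<xi>) \<le> K * (1 + (norm \<xi>)\<^sup>2)"
proof
  define I where "I = (LINT x|\<Lambda>. min 1 ((norm x)\<^sup>2))"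
  have I: "I \<ge> 0" unfolding I_def by (intro integral_nonneg_AE) auto
  define B where "B = onorm ((*v) S)"
  have bl: "bounded_linear ((*v) S)" by simp
  have B: "B \<ge> 0" unfolding B_def by (rule onorm_pos_le[OF bl])
  show "norm b + B + 2 * I \<ge> 0" using I B by simp
  fix \<xi> :: "real^'d"
  have "cmod (\<i> * complex_of_real (b \<bullet> \<xi>)) \<le> norm b * norm \<xi>"
    using Cauchy_Schwarz_ineq2[of b \<xi>] by (simp add: norm_mult)
  also have "\<dots> \<le> norm b * (1 + (norm \<xi>)\<^sup>2)"
  proof (intro mult_left_mono)
    have "0 \<le> (norm \<xi> - 1)\<^sup>2 + (norm \<xi>)\<^sup>2 + 1" by simp
    then show "norm \<xi> \<le> 1 + (norm \<xi>)\<^sup>2" by (simp add: power2_eq_square algebra_simps)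
  qed simp
  finally have 1: "cmod (\<i> * complex_of_real (b \<bullet> \<xi>)) \<le> norm b * (1 + (norm \<xi>)\<^sup>2)" .
  have "\<bar>\<xi> \<bullet> (S *v \<xi>)\<bar> \<le> norm \<xi> * (B * norm \<xi>)"
    using Cauchy_Schwarz_ineq2[of \<xi> "S *v \<xi>"] mult_left_mono[OF onorm[OF bl, of \<xi>] norm_ge_zero[of \<xi>]]
    unfolding B_def by linarith
  also have "norm \<xi> * (B * norm \<xi>) = B * (norm \<xi>)\<^sup>2" by (simp add: power2_eq_square)
  finally have "cmod (complex_of_real (\<xi> \<bullet> (S *v \<xi>) / 2)) \<le> B * (norm \<xi>)\<^sup>2 / 2"
    by (simp only: norm_of_real abs_divide)
  also have "\<dots> \<le> B * (1 + (norm \<xi>)\<^sup>2)" using B by (simp add: algebra_simps)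
  finally have 2: "cmod (complex_of_real (\<xi> \<bullet> (S *v \<xi>) / 2)) \<le> B * (1 + (norm \<xi>)\<^sup>2)" .
  have "cmod (LINT x|\<Lambda>. lk_kernel \<xi> x) \<le> (LINT x|\<Lambda>. cmod (lk_kernel \<xi> x))"
    by (rule integral_norm_bound)
  also have "\<dots> \<le> (LINT x|\<Lambda>. (2 + (norm \<xi>)\<^sup>2) * min 1 ((norm x)\<^sup>2))"
    using integrable_lk_kernel[OF assms] integrable_levy_measure_min[OF assms]
    by (intro integral_mono lk_kernel_bound) auto
  also have "\<dots> = (2 + (norm \<xi>)\<^sup>2) * I" by (simp add: I_def)
  also have "\<dots> \<le> 2 * I * (1 + (norm \<xi>)\<^sup>2)" using I by (simp add: algebra_simps)
  finally have 3: "cmod (LINT x|\<Lambda>. lk_kernel \<xi> x) \<le> 2 * I * (1 + (norm \<xi>)\<^sup>2)" .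
  have "cmod (levy_khintchine_exponent b S \<Lambda> \<xi>) \<le> cmod (\<i> * complex_of_real (b \<bullet> \<xi>))
     + cmod (complex_of_real (\<xi> \<bullet> (S *v \<xi>) / 2)) + cmod (LINT x|\<Lambda>. lk_kernel \<xi> x)"
    unfolding levy_khintchine_exponent_def lk_kernel_def[symmetric]
    by (rule order_trans[OF norm_triangle_ineq]) (intro add_right_mono norm_triangle_ineq4)
  then show "cmod (levy_khintchine_exponent b S \<Lambda> \<xi>) \<le> (norm b + B + 2 * I) * (1 + (norm \<xi>)\<^sup>2)"
    using 1 2 3 by (simp add: distrib_right)
qed

lemma continuous_lk_exponent:
  fixes \<Lambda> :: "(real^'d) measure"
  assumes L: "levy_measure \<Lambda>"
  shows "continuous_on UNIV (levy_khintchine_exponent b S \<Lambda>)"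
proof -
  have [measurable_cong]: "sets \<Lambda> = sets borel" using assms by (simp add: levy_measure_def)
  have "isCont (\<lambda>\<xi>. LINT x|\<Lambda>. lk_kernel \<xi> x) \<xi>" for \<xi>
  proof (rule continuous_at_sequentiallyI)
    fix u :: "nat \<Rightarrow> real^'d" assume u: "u \<longlonglongrightarrow> \<xi>"
    obtain B where B: "\<And>n. norm (u n) \<le> B"
      using Bseq_eq_bounded convergent_imp_Bseq[of u] u by (auto simp: convergent_def Bseq_def)
    show "(\<lambda>n. LINT x|\<Lambda>. lk_kernel (u n) x) \<longlonglongrightarrow> (LINT x|\<Lambda>. lk_kernel \<xi> x)"
    proof (rule integral_dominated_convergence)
      show "integrable \<Lambda> (\<lambda>x. (2 + B\<^sup>2) * min 1 ((norm x)\<^sup>2))"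
        using integrable_levy_measure_min[OF L] by simp
      show "AE x in \<Lambda>. (\<lambda>n. lk_kernel (u n) x) \<longlonglongrightarrow> lk_kernel \<xi> x"
        unfolding lk_kernel_def by (intro AE_I2 tendsto_intros u)
      show "AE x in \<Lambda>. cmod (lk_kernel (u n) x) \<le> (2 + B\<^sup>2) * min 1 ((norm x)\<^sup>2)" for n
      proof (intro AE_I2 order_trans[OF lk_kernel_bound] mult_right_mono add_left_mono power_mono B)
      qed auto
    qed measurable
  qed
  then have "continuous_on UNIV (\<lambda>\<xi>. LINT x|\<Lambda>. lk_kernel \<xi> x)"
    by (simp add: continuous_at_imp_continuous_on)
  then show ?thesis
    unfolding levy_khintchine_exponent_def lk_kernel_def[symmetric]
    by (intro continuous_intros continuous_on_compose2[OF linear_continuous_on[of "(*v) S"]]) auto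
qed

text \<open>The derivative of \<open>exp\<close> is bounded by \<open>1\<close> on the convex half
  plane of nonpositive real parts. So a characteristic function differs from \<open>1\<close> by at
  most the modulus of its exponent.\<close>

lemma norm_exp_minus_1_le:
  fixes z :: complex assumes "Re z \<le> 0" shows "cmod (exp z - 1) \<le> cmod z"
proof -
  have "cmod (exp z - exp 0) \<le> 1 * cmod (z - 0)"
    by (rule field_differentiable_bound[where S = "{z. Re z \<le> 0}" and f' = exp])
       (use assms in \<open>auto intro!: derivative_eq_intros convex_halfspace_Re_le\<close>)
  then show ?thesis by simp
qed

section \<open>Bounded Borel sets and the law of the random measure\<close>

lemma bounded_borelD: "B \<in> bounded_borel \<Longrightarrow> B \<in> sets borel" "B \<in> bounded_borel \<Longrightarrow> bounded B"
  by (simp_all add: bounded_borel_def)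
lemma bounded_borel_subset: "A \<in> bounded_borel \<Longrightarrow> B \<in> sets borel \<Longrightarrow> B \<subseteq> A \<Longrightarrow> B \<in> bounded_borel"
  by (auto simp: bounded_borel_def intro: bounded_subset)
lemma bounded_borel_empty [simp]: "{} \<in> bounded_borel"
  by (simp add: bounded_borel_def)
lemma bounded_borel_Ioc [simp]: "{a<..b} \<in> bounded_borel"
  by (simp add: bounded_borel_def bounded_subset[OF bounded_closed_interval[of a b]] greaterThanAtMost_subseteq_atLeastAtMost_iff)
lemma bounded_borel_Un: "A \<in> bounded_borel \<Longrightarrow> B \<in> bounded_borel \<Longrightarrow> A \<union> B \<in> bounded_borel"
  by (auto simp: bounded_borel_def)
lemma bounded_borel_Int1: "A \<in> bounded_borel \<Longrightarrow> B \<in> sets borel \<Longrightarrow> A \<inter> B \<in> bounded_borel"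
  and bounded_borel_Int2: "A \<in> bounded_borel \<Longrightarrow> B \<in> sets borel \<Longrightarrow> B \<inter> A \<in> bounded_borel"
  and bounded_borel_Diff: "A \<in> bounded_borel \<Longrightarrow> B \<in> sets borel \<Longrightarrow> A - B \<in> bounded_borel"
  by (auto simp: bounded_borel_def intro: bounded_subset)
lemma bounded_borel_UN:
  "finite I \<Longrightarrow> (\<And>i. i \<in> I \<Longrightarrow> E i \<in> bounded_borel) \<Longrightarrow> (\<Union>i\<in>I. E i) \<in> bounded_borel"
  by (induction I rule: finite_induct) (auto intro: bounded_borel_Un)
lemma emeasure_bounded_borel: "A \<in> bounded_borel \<Longrightarrow> emeasure lborel A < \<infinity>"
  using emeasure_bounded_finite by (auto simp: bounded_borel_def)

lemma disjoint_family_on_reindex: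
  assumes h: "bij_betw h J I" and E: "disjoint_family_on E I"
  shows "disjoint_family_on (\<lambda>i. E (h i)) J"
  unfolding disjoint_family_on_def
proof (intro ballI impI)
  fix m n assume "m \<in> J" "n \<in> J" "m \<noteq> n"
  then have "h m \<in> I" "h n \<in> I" "h m \<noteq> h n"
    using h by (auto simp: bij_betw_def inj_on_def)
  then show "E (h m) \<inter> E (h n) = {}" using E by (auto simp: disjoint_family_on_def)
qed

text \<open>What the identification of the integrals rests on: a random measure extending the
  increments, and the exponent \<psi> of the increments on the whole time line. Independence is
  carried by \<open>Z\<close>.\<close>

locale levy_noise = prob_space M for M :: "'w measure" +
  fixes L :: "real \<Rightarrow> 'w \<Rightarrow> real^'d" and Z :: "real set \<Rightarrow> 'w \<Rightarrow> real^'d" and \<psi> :: "real^'d \<Rightarrow> complex"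
  assumes Z: "levy_random_measure M L Z"
    and L_measurable [measurable]: "\<And>t. L t \<in> borel_measurable M"
    and incr_char: "\<And>a b \<xi>. a < b \<Longrightarrow>
      (LINT w|M. iexp (\<xi> \<bullet> (L b w - L a w))) = exp (complex_of_real (b - a) * \<psi> \<xi>)"
    and psi_continuous: "continuous_on UNIV \<psi>"
    and psi_0: "\<psi> 0 = 0"
    and psi_bound: "\<exists>K\<ge>0. \<forall>\<xi>. cmod (\<psi> \<xi>) \<le> K * (1 + (norm \<xi>)\<^sup>2)"
begin

lemma psi_measurable [measurable]: "\<psi> \<in> borel_measurable borel"
  using psi_continuous by (rule borel_measurable_continuous_onI)

text \<open>A characteristic function has modulus at most \<open>1\<close>.\<close>

lemma Re_psi: "Re (\<psi> \<xi>) \<le> 0"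
proof -
  have "cmod (LINT w|M. iexp (\<xi> \<bullet> (L 1 w - L 0 w))) \<le> 1"
    using integral_norm_bound[of M "\<lambda>w. iexp (\<xi> \<bullet> (L 1 w - L 0 w))"] by (simp add: prob_space)
  then show ?thesis by (subst (asm) incr_char) auto
qed

lemma Z_measurable: "B \<in> bounded_borel \<Longrightarrow> Z B \<in> borel_measurable M"
  using Z by (simp add: levy_random_measure_def)

lemma Z_indep:
  assumes "\<And>n::nat. B n \<in> bounded_borel" "disjoint_family B"
  shows "indep_vars (\<lambda>_. borel) (\<lambda>n. Z (B n)) UNIV"
proof -
  have "range B \<subseteq> bounded_borel" using assms by auto
  then show ?thesis using Z assms(2) unfolding levy_random_measure_def by blast
qed

lemma Z_sums:
  assumes "\<And>n::nat. B n \<in> bounded_borel" "disjoint_family B" "(\<Union>n. B n) \<in> bounded_borel"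
  shows "AE w in M. (\<lambda>n. Z (B n) w) sums Z (\<Union>n. B n) w"
proof -
  have "range B \<subseteq> bounded_borel" using assms(1) by auto
  then show ?thesis using Z assms(2,3) unfolding levy_random_measure_def by blast
qed

lemma Z_incr: "a < b \<Longrightarrow> AE w in M. Z {a<..b} w = L b w - L a w"
  using Z by (simp add: levy_random_measure_def)

text \<open>Countable additivity for a sequence of empty sets: a convergent series with equal terms
  has terms zero.\<close>

lemma Z_empty: "AE w in M. Z {} w = 0"
proof -
  have "AE w in M. (\<lambda>n::nat. Z {} w) sums Z (\<Union>n::nat. {}) w"
    by (rule Z_sums) (auto simp: disjoint_family_on_def)
  then show ?thesis
  proof (eventually_elim)
    case (elim w)
    then have "(\<lambda>n::nat. Z {} w) \<longlonglongrightarrow> 0" by (intro summable_LIMSEQ_zero sums_summable)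
    then show ?case by (simp add: LIMSEQ_const_iff)
  qed
qed

text \<open>Padding with empty sets reduces finite to countable additivity; by
  \<open>Z_empty\<close> the added terms vanish almost surely.\<close>

lemma Z_finite_additive_nat:
  assumes E: "\<And>i. i < n \<Longrightarrow> E i \<in> bounded_borel" "disjoint_family_on E {..<n::nat}"
  shows "AE w in M. Z (\<Union>i<n. E i) w = (\<Sum>i<n. Z (E i) w)"
proof -
  define B where "B i = (if i < n then E i else {})" for i
  have U: "(\<Union>i. B i) = (\<Union>i<n. E i)" by (auto simp: B_def split: if_splits)
  have "AE w in M. (\<lambda>i. Z (B i) w) sums Z (\<Union>i. B i) w"
    using E by (intro Z_sums) (auto simp: U B_def disjoint_family_on_def intro!: bounded_borel_UN)
  then show ?thesis
    using Z_empty
  proof eventually_elim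
    case (elim w)
    have "(\<lambda>i. Z (B i) w) sums (\<Sum>i<n. Z (B i) w)"
      by (rule sums_finite) (auto simp: B_def elim)
    then have "Z (\<Union>i. B i) w = (\<Sum>i<n. Z (B i) w)" using sums_unique2[OF elim(1)] by blast
    also have "\<dots> = (\<Sum>i<n. Z (E i) w)" by (intro sum.cong) (auto simp: B_def)
    finally show ?case by (simp only: U)
  qed
qed

lemma Z_finite_additive:
  assumes I: "finite I" and E: "\<And>i. i \<in> I \<Longrightarrow> E i \<in> bounded_borel" "disjoint_family_on E I"
  shows "AE w in M. Z (\<Union>i\<in>I. E i) w = (\<Sum>i\<in>I. Z (E i) w)"
proof -
  obtain h where "bij_betw h {0..<card I} I" using ex_bij_betw_nat_finite[OF I] by blast
  then have h: "bij_betw h {..<card I} I" by (simp add: atLeast0LessThan)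
  have "AE w in M. Z (\<Union>i<card I. E (h i)) w = (\<Sum>i<card I. Z (E (h i)) w)"
  proof (rule Z_finite_additive_nat)
    show "disjoint_family_on (\<lambda>i. E (h i)) {..<card I}"
      by (rule disjoint_family_on_reindex[OF h E(2)])
  qed (use E h in \<open>auto simp: bij_betw_def\<close>)
  moreover have "(\<Union>i<card I. E (h i)) = (\<Union>i\<in>I. E i)"
  proof -
    have "(\<Union>i<card I. E (h i)) = (\<Union>i\<in>h ` {..<card I}. E i)" by simp
    then show ?thesis by (simp only: bij_betw_imp_surj_on[OF h])
  qed
  moreover have "(\<Sum>i<card I. Z (E (h i)) w) = (\<Sum>i\<in>I. Z (E i) w)" for w
    by (rule sum.reindex_bij_betw[OF h])
  ultimately show ?thesis by simp
qed

lemma char_sum_prod_nat: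
  assumes E: "\<And>i. i < n \<Longrightarrow> E i \<in> bounded_borel" "disjoint_family_on E {..<n::nat}"
  shows "(LINT w|M. iexp (\<xi> \<bullet> (\<Sum>i<n. (c i :: real^'d^'d) *v Z (E i) w))) =
    (\<Prod>i<n. LINT w|M. iexp ((\<xi> v* c i) \<bullet> Z (E i) w))"
proof -
  define B where "B i = (if i < n then E i else {})" for i
  have "indep_vars (\<lambda>_. borel) (\<lambda>i. Z (B i)) UNIV"
    using E by (intro Z_indep) (auto simp: B_def disjoint_family_on_def)
  then have "indep_vars (\<lambda>_. borel) (\<lambda>i. Z (B i)) {..<n}"
    by (rule indep_vars_subset) simp
  then have "indep_vars (\<lambda>_. borel) (\<lambda>i. Z (E i)) {..<n}"
    by (subst (asm) indep_vars_cong[of _ "{..<n}" _ "\<lambda>i. Z (E i)" _ "\<lambda>_. borel"]) (auto simp: B_def)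
  then have ind: "indep_vars (\<lambda>_. borel) (\<lambda>i w. iexp ((\<xi> v* c i) \<bullet> Z (E i) w)) {..<n}"
    by (rule indep_vars_compose2) measurable
  have "(LINT w|M. iexp (\<xi> \<bullet> (\<Sum>i<n. c i *v Z (E i) w))) =
      (LINT w|M. (\<Prod>i<n. iexp ((\<xi> v* c i) \<bullet> Z (E i) w)))"
    by (intro Bochner_Integration.integral_cong)
       (auto simp: exp_sum[symmetric] inner_sum_right sum_distrib_left dot_lmul_matrix)
  also have "\<dots> = (\<Prod>i<n. LINT w|M. iexp ((\<xi> v* c i) \<bullet> Z (E i) w))"
  proof (rule indep_vars_lebesgue_integral[OF _ ind])
    fix i assume "i \<in> {..<n}"
    then have [measurable]: "Z (E i) \<in> borel_measurable M" by (intro Z_measurable E) simp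
    show "integrable M (\<lambda>w. iexp ((\<xi> v* c i) \<bullet> Z (E i) w))"
      by (intro integrable_const_bound[of _ 1]) auto
  qed simp
  finally show ?thesis .
qed

lemma char_add:
  assumes "A \<in> bounded_borel" "B \<in> bounded_borel" "A \<inter> B = {}"
  shows "(LINT w|M. iexp (\<xi> \<bullet> Z (A \<union> B) w)) = (LINT w|M. iexp (\<xi> \<bullet> Z A w)) * (LINT w|M. iexp (\<xi> \<bullet> Z B w))"
proof -
  define E where "E i = (if i = 0 then A else B)" for i :: nat
  have E: "\<And>i. i < 2 \<Longrightarrow> E i \<in> bounded_borel" "disjoint_family_on E {..<2::nat}"
    using assms by (auto simp: E_def disjoint_family_on_def)
  have U: "(\<Union>i<2. E i) = A \<union> B" by (auto simp: E_def lessThan_Suc numeral_2_eq_2)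
  have [measurable]: "Z A \<in> borel_measurable M" "Z B \<in> borel_measurable M" "Z (A \<union> B) \<in> borel_measurable M"
    using assms by (auto intro!: Z_measurable bounded_borel_Un)
  have "(LINT w|M. iexp (\<xi> \<bullet> Z (A \<union> B) w)) = (LINT w|M. iexp (\<xi> \<bullet> (\<Sum>i<2. mat 1 *v Z (E i) w)))"
  proof (intro integral_cong_AE)
    show "AE w in M. iexp (\<xi> \<bullet> Z (A \<union> B) w) = iexp (\<xi> \<bullet> (\<Sum>i<2. mat 1 *v Z (E i) w))"
    proof -
      have "AE w in M. Z (\<Union>i<2. E i) w = (\<Sum>i<2. Z (E i) w)"
        using E by (intro Z_finite_additive_nat)
      then show ?thesis unfolding U by eventually_elim simp
    qed
  qed (auto simp: E_def numeral_2_eq_2)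
  also have "\<dots> = (\<Prod>i<2. LINT w|M. iexp ((\<xi> v* mat 1) \<bullet> Z (E i) w))"
    by (rule char_sum_prod_nat[OF E])
  finally show ?thesis
    by (simp add: E_def numeral_2_eq_2 mult.commute)
qed

lemma Z_char_interval: "a \<le> b \<Longrightarrow> (LINT w|M. iexp (\<xi> \<bullet> Z {a<..b} w)) = exp (complex_of_real (b - a) * \<psi> \<xi>)"
proof (cases "a < b")
  case True
  have [measurable]: "Z {a<..b} \<in> borel_measurable M" by (intro Z_measurable) simp
  have "(LINT w|M. iexp (\<xi> \<bullet> Z {a<..b} w)) = (LINT w|M. iexp (\<xi> \<bullet> (L b w - L a w)))"
  proof (rule integral_cong_AE)
    show "AE w in M. iexp (\<xi> \<bullet> Z {a<..b} w) = iexp (\<xi> \<bullet> (L b w - L a w))"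
      using Z_incr[OF True] by eventually_elim simp
  qed measurable
  then show ?thesis by (simp only: incr_char[OF True])
next
  case False
  assume "a \<le> b"
  with False have "b = a" by simp
  have [measurable]: "Z {} \<in> borel_measurable M" by (intro Z_measurable) simp
  have "(LINT w|M. iexp (\<xi> \<bullet> Z {} w)) = (LINT w|M. 1)"
  proof (rule integral_cong_AE)
    show "AE w in M. iexp (\<xi> \<bullet> Z {} w) = 1"
      using Z_empty by eventually_elim simp
  qed measurable
  then show ?thesis using \<open>b = a\<close> by (simp add: prob_space)
qed

text \<open>The half-open intervals form an intersection-stable generator of the Borel sets on which
  the law is known; it propagates through complements and disjoint unions.\<close>

lemma Z_char:
  assumes B: "B \<in> bounded_borel"
  shows "(LINT w|M. iexp (\<xi> \<bullet> Z B w)) = exp (complex_of_real (measure lborel B) * \<psi> \<xi>)"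
proof -
  obtain R where R: "R > 0" "B \<subseteq> {-R<..R}"
  proof -
    obtain e where "e > 0" "\<And>x. x \<in> B \<Longrightarrow> norm x \<le> e"
      using bounded_borelD(2)[OF B] bounded_pos by blast
    then show thesis by (intro that[of "e + 1"]) (force simp: abs_le_iff)+
  qed
  \<comment> \<open>\<open>Z\<close> is only additive on bounded sets, whereas the induction runs
    through all Borel sets, so every set is cut with the fixed window \<open>J\<close>.\<close>
  define J where "J = {-R<..R}"
  have J: "J \<in> bounded_borel" by (simp add: J_def)
  have JI: "A \<inter> J \<in> bounded_borel" if "A \<in> sets borel" for A
    using that J by (intro bounded_borel_Int2) auto
  let ?G = "range (\<lambda>(a, b). {a <.. b::real})"
  have sb: "sigma_sets UNIV ?G = sets borel"
    by (subst borel_sigma_sets_Ioc) simp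
  have "(LINT w|M. iexp (\<xi> \<bullet> Z (B \<inter> J) w)) = exp (complex_of_real (measure lborel (B \<inter> J)) * \<psi> \<xi>)"
  proof (rule sigma_sets_induct_disjoint[of ?G UNIV B])
    show "Int_stable ?G"
    proof (rule Int_stableI)
      fix a b assume "a \<in> ?G" "b \<in> ?G"
      then obtain p q r s where "a = {p<..q}" "b = {r<..s}" by auto
      then have "a \<inter> b = {max p r<..min q s}" by auto
      then show "a \<inter> b \<in> ?G" by auto
    qed
    show "B \<in> sigma_sets UNIV ?G" using bounded_borelD(1)[OF B] sb by simp
  next
    fix A assume "A \<in> ?G"
    then obtain a b where "A = {a<..b}" by auto
    then have A: "A \<inter> J = {max a (-R)<..min b R}" by (auto simp: J_def)
    show "(LINT w|M. iexp (\<xi> \<bullet> Z (A \<inter> J) w)) = exp (complex_of_real (measure lborel (A \<inter> J)) * \<psi> \<xi>)"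
    proof (cases "max a (-R) \<le> min b R")
      case True
      then show ?thesis unfolding A by (subst Z_char_interval) auto
    next
      case False
      then have "A \<inter> J = {0<..0}" unfolding A by auto
      then show ?thesis using Z_char_interval[of 0 0] by simp
    qed
  next
    show "(LINT w|M. iexp (\<xi> \<bullet> Z ({} \<inter> J) w)) = exp (complex_of_real (measure lborel ({} \<inter> J)) * \<psi> \<xi>)"
      using Z_char_interval[of 0 0] by simp
  next
    fix A assume "A \<in> sigma_sets UNIV ?G"
      and IH: "(LINT w|M. iexp (\<xi> \<bullet> Z (A \<inter> J) w)) = exp (complex_of_real (measure lborel (A \<inter> J)) * \<psi> \<xi>)"
    then have A: "A \<in> sets borel" using sb by simp
    then have cA: "UNIV - A \<in> sets borel" by auto
    have U: "(A \<inter> J) \<union> ((UNIV - A) \<inter> J) = J" by auto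
    have "exp (complex_of_real (2 * R) * \<psi> \<xi>) = (LINT w|M. iexp (\<xi> \<bullet> Z J w))"
      unfolding J_def using R by (subst Z_char_interval) auto
    also have "\<dots> = exp (complex_of_real (measure lborel (A \<inter> J)) * \<psi> \<xi>) * (LINT w|M. iexp (\<xi> \<bullet> Z ((UNIV - A) \<inter> J) w))"
      using char_add[OF JI[OF A] JI[OF cA]] by (simp add: U IH Int_Diff disjoint_iff)
    \<comment> \<open>The factor that is divided out is an exponential and hence never zero; this is
      what makes the passage to complements work.\<close>
    finally have 1: "(LINT w|M. iexp (\<xi> \<bullet> Z ((UNIV - A) \<inter> J) w)) =
        exp (complex_of_real (2 * R) * \<psi> \<xi> - complex_of_real (measure lborel (A \<inter> J)) * \<psi> \<xi>)"
      by (simp add: exp_diff field_simps)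
    have "measure lborel ((A \<inter> J) \<union> ((UNIV - A) \<inter> J)) = measure lborel (A \<inter> J) + measure lborel ((UNIV - A) \<inter> J)"
      using emeasure_bounded_borel[OF JI[OF A]] emeasure_bounded_borel[OF JI[OF cA]] A
      by (intro measure_Union) (auto simp: J_def)
    then have m2: "measure lborel ((UNIV - A) \<inter> J) = 2 * R - measure lborel (A \<inter> J)"
      unfolding U using R by (simp add: J_def)
    then show "(LINT w|M. iexp (\<xi> \<bullet> Z ((UNIV - A) \<inter> J) w)) =
        exp (complex_of_real (measure lborel ((UNIV - A) \<inter> J)) * \<psi> \<xi>)"
      unfolding 1 by (simp only: m2 of_real_diff left_diff_distrib)
  next
    fix A :: "nat \<Rightarrow> real set"
    assume dis: "disjoint_family A" and "range A \<subseteq> sigma_sets UNIV ?G"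
      and IH: "\<And>i. (LINT w|M. iexp (\<xi> \<bullet> Z (A i \<inter> J) w)) = exp (complex_of_real (measure lborel (A i \<inter> J)) * \<psi> \<xi>)"
    then have A: "\<And>i. A i \<in> sets borel" using sb by auto
    define E where "E i = A i \<inter> J" for i
    have E: "\<And>i. E i \<in> bounded_borel" "disjoint_family E"
      using JI[OF A] dis by (auto simp: E_def disjoint_family_on_def)
    have U: "(\<Union>i. A i) \<inter> J = (\<Union>i. E i)" by (auto simp: E_def)
    have Ub: "(\<Union>i. E i) \<in> bounded_borel" unfolding U[symmetric] using A by (intro JI) auto
    have [measurable]: "\<And>i. Z (E i) \<in> borel_measurable M" "Z (\<Union>i. E i) \<in> borel_measurable M"
      using E Ub by (auto intro: Z_measurable)
    have "(\<lambda>n. LINT w|M. iexp (\<xi> \<bullet> (\<Sum>i<n. Z (E i) w))) \<longlonglongrightarrow> (LINT w|M. iexp (\<xi> \<bullet> Z (\<Union>i. E i) w))"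
    proof (rule integral_dominated_convergence[where w = "\<lambda>_. 1"])
      show "AE w in M. (\<lambda>n. iexp (\<xi> \<bullet> (\<Sum>i<n. Z (E i) w))) \<longlonglongrightarrow> iexp (\<xi> \<bullet> Z (\<Union>i. E i) w)"
        using Z_sums[OF E Ub] by eventually_elim (auto simp: sums_def intro!: tendsto_intros)
    qed auto
    moreover have "(LINT w|M. iexp (\<xi> \<bullet> (\<Sum>i<n. Z (E i) w))) = exp (complex_of_real (\<Sum>i<n. measure lborel (E i)) * \<psi> \<xi>)" for n
    proof -
      have "disjoint_family_on E {..<n}" using E(2) by (auto simp: disjoint_family_on_def)
      then have "(LINT w|M. iexp (\<xi> \<bullet> (\<Sum>i<n. mat 1 *v Z (E i) w))) = (\<Prod>i<n. LINT w|M. iexp ((\<xi> v* mat 1) \<bullet> Z (E i) w))"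
        using E by (intro char_sum_prod_nat) auto
      also have "\<dots> = (\<Prod>i<n. exp (complex_of_real (measure lborel (E i)) * \<psi> \<xi>))"
        using IH by (intro prod.cong) (auto simp: E_def)
      finally show ?thesis by (simp add: exp_sum[symmetric] sum_distrib_right)
    qed
    moreover have "(\<lambda>n. exp (complex_of_real (\<Sum>i<n. measure lborel (E i)) * \<psi> \<xi>)) \<longlonglongrightarrow>
        exp (complex_of_real (measure lborel (\<Union>i. E i)) * \<psi> \<xi>)"
    proof (intro tendsto_intros)
      have "(\<lambda>i. measure lborel (E i)) sums measure lborel (\<Union>i. E i)"
        using E bounded_borelD(1)[OF E(1)] emeasure_bounded_borel[OF Ub] by (intro measure_UNION) auto
      then show "(\<lambda>n. \<Sum>i<n. measure lborel (E i)) \<longlonglongrightarrow> measure lborel (\<Union>i. E i)" by (simp add: sums_def)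
    qed
    ultimately show "(LINT w|M. iexp (\<xi> \<bullet> Z ((\<Union>i. A i) \<inter> J) w)) =
        exp (complex_of_real (measure lborel ((\<Union>i. A i) \<inter> J)) * \<psi> \<xi>)"
      unfolding U using LIMSEQ_unique by auto
  qed auto
  moreover have "B \<inter> J = B" using R by (auto simp: J_def)
  ultimately show ?thesis by simp
qed

lemma Z_sum_char:
  assumes I: "finite I" and E: "\<And>i. i \<in> I \<Longrightarrow> E i \<in> bounded_borel" "disjoint_family_on E I"
  shows "(LINT w|M. iexp (\<xi> \<bullet> (\<Sum>i\<in>I. (c i :: real^'d^'d) *v Z (E i) w))) =
    exp (\<Sum>i\<in>I. complex_of_real (measure lborel (E i)) * \<psi> (\<xi> v* c i))"
proof -
  obtain h where "bij_betw h {0..<card I} I" using ex_bij_betw_nat_finite[OF I] by blast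
  then have h: "bij_betw h {..<card I} I" by (simp add: atLeast0LessThan)
  have hI: "h i \<in> I" if "i < card I" for i using h that by (auto simp: bij_betw_def)
  have "(LINT w|M. iexp (\<xi> \<bullet> (\<Sum>i<card I. c (h i) *v Z (E (h i)) w))) =
      (\<Prod>i<card I. LINT w|M. iexp ((\<xi> v* c (h i)) \<bullet> Z (E (h i)) w))"
  proof (rule char_sum_prod_nat)
    show "disjoint_family_on (\<lambda>i. E (h i)) {..<card I}"
      by (rule disjoint_family_on_reindex[OF h E(2)])
  qed (use E hI in auto)
  also have "\<dots> = (\<Prod>i<card I. exp (complex_of_real (measure lborel (E (h i))) * \<psi> (\<xi> v* c (h i))))"
    using E hI by (intro prod.cong) (auto simp: Z_char)
  also have "\<dots> = exp (\<Sum>i<card I. complex_of_real (measure lborel (E (h i))) * \<psi> (\<xi> v* c (h i)))"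
    by (simp add: exp_sum)
  also have "(\<Sum>i<card I. complex_of_real (measure lborel (E (h i))) * \<psi> (\<xi> v* c (h i))) =
      (\<Sum>i\<in>I. complex_of_real (measure lborel (E i)) * \<psi> (\<xi> v* c i))"
    by (rule sum.reindex_bij_betw[OF h])
  finally show ?thesis
    using sum.reindex_bij_betw[OF h, of "\<lambda>i. c i *v Z (E i) _"] by simp
qed

text \<open>The size of a coefficient matrix as seen by the noise: by \<open>Z_sum_tail\<close>, the
  Lebesgue integral of \<open>Psi\<close> along a simple integrand bounds its stochastic integral in
  probability.\<close>

definition Psi :: "real^'d^'d \<Rightarrow> real" where
  "Psi C = (LINT \<xi>|std_gauss. cmod (\<psi> (\<xi> v* C)))"

lemma norm_vector_matrix_mult_le: "norm (\<xi> v* C) \<le> norm (C :: real^'d^'d) * norm \<xi>"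
proof (cases "\<xi> v* C = 0")
  case False
  have "norm (\<xi> v* C) * norm (\<xi> v* C) = \<xi> \<bullet> (C *v (\<xi> v* C))"
    by (simp add: dot_lmul_matrix[symmetric] power2_norm_eq_inner flip: power2_eq_square)
  also have "\<dots> \<le> norm \<xi> * (norm C * norm (\<xi> v* C))"
    by (rule order_trans[OF norm_cauchy_schwarz]) (intro mult_left_mono norm_matrix_vector_mult_le norm_ge_zero)
  finally show ?thesis using False by (simp add: mult_ac)
qed simp

lemma measurable_vector_matrix_mult [measurable]: "(\<lambda>\<xi>. \<xi> v* C) \<in> borel_measurable borel" for C :: "real^'d^'d"
proof -
  have "(\<lambda>\<xi>. transpose C *v \<xi>) \<in> borel_measurable borel"
    by (intro borel_measurable_continuous_onI linear_continuous_on matrix_vector_mul_bounded_linear)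
  then show ?thesis by simp
qed

lemma integrable_psi: "integrable std_gauss (\<lambda>\<xi>. cmod (\<psi> (\<xi> v* (C :: real^'d^'d))))"
  and Psi_bounded: "\<exists>K\<ge>0. \<forall>C. Psi C \<le> K * (1 + (norm C)\<^sup>2)"
proof -
  interpret G: prob_space "std_gauss :: (real^'d) measure" by (rule prob_space_std_gauss)
  obtain K where K: "K \<ge> 0" "\<And>\<xi>. cmod (\<psi> \<xi>) \<le> K * (1 + (norm \<xi>)\<^sup>2)" using psi_bound by blast
  have bd: "cmod (\<psi> (\<xi> v* C)) \<le> K * (1 + (norm C)\<^sup>2 * (norm \<xi>)\<^sup>2)" for \<xi> and C :: "real^'d^'d"
    using K(1) power_mono[OF norm_vector_matrix_mult_le norm_ge_zero, of \<xi> C 2]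
    by (intro order_trans[OF K(2)] mult_left_mono add_left_mono) (auto simp: power_mult_distrib)
  have int: "integrable (std_gauss :: (real^'d) measure) (\<lambda>\<xi>. K * (1 + (norm C)\<^sup>2 * (norm \<xi>)\<^sup>2))" for C :: "real^'d^'d"
    using integrable_std_gauss_norm2 by (intro integrable_mult_right Bochner_Integration.integrable_add) auto
  show ip: "integrable std_gauss (\<lambda>\<xi>. cmod (\<psi> (\<xi> v* (C :: real^'d^'d))))" for C
    using bd K(1) by (intro Bochner_Integration.integrable_bound[OF int[of C]]) (auto intro!: AE_I2)
  define m where "m = (LINT \<xi>|(std_gauss :: (real^'d) measure). (norm \<xi>)\<^sup>2)"
  have m: "m \<ge> 0" unfolding m_def by (intro integral_nonneg_AE) auto
  show "\<exists>K\<ge>0. \<forall>C. Psi C \<le> K * (1 + (norm C)\<^sup>2)"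
  proof (intro exI[of _ "K * (1 + m)"] conjI allI)
    fix C :: "real^'d^'d"
    have "Psi C \<le> (LINT \<xi>::real^'d|std_gauss. K * (1 + (norm C)\<^sup>2 * (norm \<xi>)\<^sup>2))"
      unfolding Psi_def using ip int bd by (intro integral_mono) auto
    also have "\<dots> = K * (1 + (norm C)\<^sup>2 * m)"
    proof -
      have "(LINT \<xi>::real^'d|std_gauss. 1 + (norm C)\<^sup>2 * (norm \<xi>)\<^sup>2) = 1 + (norm C)\<^sup>2 * m"
        using integrable_std_gauss_norm2 G.prob_space
        by (subst Bochner_Integration.integral_add) (auto simp: m_def)
      then show ?thesis by simp
    qed
    also have "\<dots> \<le> K * ((1 + m) * (1 + (norm C)\<^sup>2))"
      using K(1) m by (intro mult_left_mono) (auto simp: algebra_simps)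
    finally show "Psi C \<le> K * (1 + m) * (1 + (norm C)\<^sup>2)" by (simp add: mult.assoc)
  qed (use K m in auto)
qed

lemma Psi_nonneg: "Psi C \<ge> 0"
  unfolding Psi_def by (intro integral_nonneg_AE) auto

text \<open>\<open>Psi\<close> is continuous at zero by dominated convergence, with the quadratic
  growth of \<psi> as the dominating function, and vanishes there because of
  \<open>\<psi> 0 = 0\<close>.\<close>

lemma Psi_small: assumes e: "e > 0" obtains r where "r > 0" "\<And>C. norm C \<le> r \<Longrightarrow> Psi C \<le> e"
proof -
  interpret G: prob_space "std_gauss :: (real^'d) measure" by (rule prob_space_std_gauss)
  obtain K where K: "K \<ge> 0" "\<And>\<xi>. cmod (\<psi> \<xi>) \<le> K * (1 + (norm \<xi>)\<^sup>2)" using psi_bound by blast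
  have "isCont Psi 0"
  proof (rule continuous_at_sequentiallyI)
    fix u :: "nat \<Rightarrow> real^'d^'d" assume u: "u \<longlonglongrightarrow> 0"
    obtain B where B: "\<And>n. norm (u n) \<le> B"
      using convergent_imp_Bseq[of u] u by (auto simp: convergent_def Bseq_def)
    show "(\<lambda>n. Psi (u n)) \<longlonglongrightarrow> Psi 0"
      unfolding Psi_def
    proof (rule integral_dominated_convergence)
      show "integrable (std_gauss :: (real^'d) measure) (\<lambda>\<xi>. K * (1 + B\<^sup>2 * (norm \<xi>)\<^sup>2))"
        using integrable_std_gauss_norm2 by (intro integrable_mult_right Bochner_Integration.integrable_add) auto
      show "AE \<xi> in std_gauss. (\<lambda>n. cmod (\<psi> (\<xi> v* u n))) \<longlonglongrightarrow> cmod (\<psi> (\<xi> v* 0))"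
      proof (rule AE_I2)
        fix \<xi> :: "real^'d"
        have "(\<lambda>n. transpose (u n) *v \<xi>) \<longlonglongrightarrow> transpose 0 *v \<xi>"
        proof (intro bounded_bilinear.tendsto[OF bounded_bilinear_matrix_vector_mult] tendsto_const)
          show "(\<lambda>n. transpose (u n)) \<longlonglongrightarrow> transpose 0"
            unfolding transpose_def using u by (intro tendsto_intros)
        qed
        then have "(\<lambda>n. \<xi> v* u n) \<longlonglongrightarrow> \<xi> v* 0" by simp
        then have "(\<lambda>n. \<psi> (\<xi> v* u n)) \<longlonglongrightarrow> \<psi> (\<xi> v* 0)"
          using psi_continuous by (auto simp: continuous_on_eq_continuous_at intro: isCont_tendsto_compose)
        then show "(\<lambda>n. cmod (\<psi> (\<xi> v* u n))) \<longlonglongrightarrow> cmod (\<psi> (\<xi> v* 0))" by (rule tendsto_norm)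
      qed
      show "AE \<xi> in std_gauss. norm (cmod (\<psi> (\<xi> v* u n))) \<le> K * (1 + B\<^sup>2 * (norm \<xi>)\<^sup>2)" for n
      proof (rule AE_I2)
        fix \<xi> :: "real^'d"
        have "norm (\<xi> v* u n) \<le> B * norm \<xi>"
          by (rule order_trans[OF norm_vector_matrix_mult_le]) (intro mult_right_mono B norm_ge_zero)
        then have "(norm (\<xi> v* u n))\<^sup>2 \<le> B\<^sup>2 * (norm \<xi>)\<^sup>2"
          using power_mono[of "norm (\<xi> v* u n)" "B * norm \<xi>" 2] by (simp add: power_mult_distrib)
        then show "norm (cmod (\<psi> (\<xi> v* u n))) \<le> K * (1 + B\<^sup>2 * (norm \<xi>)\<^sup>2)"
          using K order_trans[OF K(2) mult_left_mono] by simp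
      qed
    qed measurable
  qed
  moreover have "Psi 0 = 0" by (simp add: Psi_def psi_0 vector_matrix_mult_def zero_vec_def[symmetric])
  ultimately have "\<forall>e>0. \<exists>d>0. \<forall>C. norm C < d \<longrightarrow> \<bar>Psi C\<bar> < e"
    by (simp add: continuous_at_eps_delta dist_norm)
  then obtain d where "d > 0" "\<And>C. norm C < d \<Longrightarrow> \<bar>Psi C\<bar> < e" using e by blast
  note d = this
  show thesis
  proof (rule that[of "d / 2"])
    fix C :: "real^'d^'d" assume "norm C \<le> d / 2"
    then have "\<bar>Psi C\<bar> < e" using d by (intro d(2)) linarith
    then show "Psi C \<le> e" by linarith
  qed (use d in simp)
qed

text \<open>The characteristic function of the sum is \<open>exp\<close> of a number with
  nonpositive real part, so its distance to \<open>1\<close> is at most the modulus of that number.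
  Averaging over \<xi> turns this into a tail bound.\<close>

lemma Z_sum_tail:
  assumes I: "finite I" and E: "\<And>i. i \<in> I \<Longrightarrow> E i \<in> bounded_borel" "disjoint_family_on E I" and e: "e > 0"
  shows "prob {w\<in>space M. norm (\<Sum>i\<in>I. (c i :: real^'d^'d) *v Z (E i) w) > e} \<le>
    (\<Sum>i\<in>I. measure lborel (E i) * Psi (c i)) / (1 - exp (- e\<^sup>2 / 2))"
proof -
  have c: "1 - exp (- e\<^sup>2 / 2) > 0" using e by simp
  define X where "X w = (\<Sum>i\<in>I. c i *v Z (E i) w)" for w
  have X [measurable]: "X \<in> borel_measurable M"
    unfolding X_def
  proof (intro borel_measurable_sum)
    fix i assume "i \<in> I"
    then have [measurable]: "Z (E i) \<in> borel_measurable M" by (intro Z_measurable E)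
    have [measurable]: "(\<lambda>x. c i *v x) \<in> borel_measurable borel"
      by (intro borel_measurable_continuous_onI linear_continuous_on) simp
    show "(\<lambda>w. c i *v Z (E i) w) \<in> borel_measurable M" by measurable
  qed
  interpret G: prob_space "std_gauss :: (real^'d) measure" by (rule prob_space_std_gauss)
  have "(LINT \<xi>|std_gauss. 1 - Re (LINT w|M. iexp (\<xi> \<bullet> X w))) \<le>
     (LINT \<xi>|std_gauss. (\<Sum>i\<in>I. measure lborel (E i) * cmod (\<psi> (\<xi> v* c i))))"
  proof (rule integral_mono)
    show "integrable std_gauss (\<lambda>\<xi>. 1 - Re (LINT w|M. iexp (\<xi> \<bullet> X w)))"
      using std_gauss_Fubini(2)[OF finite_measure_axioms X] by (intro Bochner_Integration.integrable_diff) auto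
    show "integrable std_gauss (\<lambda>\<xi>. (\<Sum>i\<in>I. measure lborel (E i) * cmod (\<psi> (\<xi> v* c i))))"
      by (intro Bochner_Integration.integrable_sum integrable_mult_right integrable_psi)
    fix \<xi> :: "real^'d"
    let ?z = "\<Sum>i\<in>I. complex_of_real (measure lborel (E i)) * \<psi> (\<xi> v* c i)"
    have "Re ?z \<le> 0"
      by (simp add: sum_nonpos mult_nonneg_nonpos Re_psi)
    have "1 - Re (LINT w|M. iexp (\<xi> \<bullet> X w)) = - Re (exp ?z - 1)"
      unfolding X_def by (subst Z_sum_char[OF I E]) auto
    also have "\<dots> \<le> cmod (exp ?z - 1)" using complex_Re_le_cmod[of "- (exp ?z - 1)"] by (simp only: norm_minus_cancel uminus_complex.sel)
    also have "\<dots> \<le> cmod ?z" by (rule norm_exp_minus_1_le) fact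
    also have "\<dots> \<le> (\<Sum>i\<in>I. measure lborel (E i) * cmod (\<psi> (\<xi> v* c i)))"
      by (rule order_trans[OF norm_sum]) (simp add: norm_mult)
    finally show "1 - Re (LINT w|M. iexp (\<xi> \<bullet> X w)) \<le> (\<Sum>i\<in>I. measure lborel (E i) * cmod (\<psi> (\<xi> v* c i)))" .
  qed
  also have "\<dots> = (\<Sum>i\<in>I. measure lborel (E i) * Psi (c i))"
    by (simp add: Psi_def integrable_psi)
  finally show ?thesis
    using order_trans[OF prob_norm_gt_le_char[OF X e] divide_right_mono] c unfolding X_def by simp
qed

end

section \<open>Stochastic integrals as limits of Riemann sums\<close>

context prob_space begin

text \<open>It metrises convergence in probability and satisfies the triangle inequality, so that
  such limits can be handled by norm estimates.\<close>

definition prob_norm :: "('a \<Rightarrow> 'b::real_normed_vector) \<Rightarrow> real" where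
  "prob_norm X = expectation (\<lambda>w. min 1 (norm (X w)))"

lemma integrable_min_norm:
  fixes X :: "'a \<Rightarrow> 'b::{second_countable_topology, real_normed_vector}"
  shows "X \<in> borel_measurable M \<Longrightarrow> integrable M (\<lambda>w. min 1 (norm (X w)))"
  by (intro integrable_const_bound[of _ 1]) auto

lemma prob_norm_nonneg: "0 \<le> prob_norm X"
  unfolding prob_norm_def by (intro integral_nonneg_AE) auto

lemma prob_norm_cong:
  fixes X Y :: "'a \<Rightarrow> 'b::{second_countable_topology, real_normed_vector}"
  shows "X \<in> borel_measurable M \<Longrightarrow> Y \<in> borel_measurable M \<Longrightarrow> AE w in M. X w = Y w \<Longrightarrow> prob_norm X = prob_norm Y"
  unfolding prob_norm_def by (intro integral_cong_AE) auto

lemma prob_norm_minus: "prob_norm (\<lambda>w. X w - Y w) = prob_norm (\<lambda>w. Y w - X w)"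
  unfolding prob_norm_def by (simp add: norm_minus_commute)

lemma prob_norm_triangle:
  fixes X Y :: "'a \<Rightarrow> 'b::{second_countable_topology, real_normed_vector}"
  assumes [measurable]: "X \<in> borel_measurable M" "Y \<in> borel_measurable M"
  shows "prob_norm (\<lambda>w. X w + Y w) \<le> prob_norm X + prob_norm Y"
proof -
  have "prob_norm (\<lambda>w. X w + Y w) \<le> (LINT w|M. min 1 (norm (X w)) + min 1 (norm (Y w)))"
    unfolding prob_norm_def
  proof (intro integral_mono)
    fix w show "min 1 (norm (X w + Y w)) \<le> min 1 (norm (X w)) + min 1 (norm (Y w))"
      using norm_triangle_ineq[of "X w" "Y w"] norm_ge_zero[of "X w"] norm_ge_zero[of "Y w"] by linarith
  qed (auto intro!: integrable_min_norm Bochner_Integration.integrable_add)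
  then show ?thesis
    unfolding prob_norm_def by (subst (asm) Bochner_Integration.integral_add) (auto intro!: integrable_min_norm)
qed

lemma prob_norm_diff:
  fixes X Y W :: "'a \<Rightarrow> 'b::{second_countable_topology, real_normed_vector}"
  assumes [measurable]: "X \<in> borel_measurable M" "Y \<in> borel_measurable M" "W \<in> borel_measurable M"
  shows "prob_norm (\<lambda>w. X w - Y w) \<le> prob_norm (\<lambda>w. X w - W w) + prob_norm (\<lambda>w. W w - Y w)"
  using prob_norm_triangle[of "\<lambda>w. X w - W w" "\<lambda>w. W w - Y w"] by simp

lemma prob_norm_le:
  fixes X :: "'a \<Rightarrow> 'b::{second_countable_topology, real_normed_vector}"
  assumes [measurable]: "X \<in> borel_measurable M" and e: "0 \<le> e"
  shows "prob_norm X \<le> e + prob {w\<in>space M. norm (X w) > e}"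
proof -
  have "prob_norm X \<le> (LINT w|M. e + indicator {w\<in>space M. norm (X w) > e} w)"
    unfolding prob_norm_def
    by (intro integral_mono integrable_min_norm Bochner_Integration.integrable_add integrable_real_indicator)
       (use e in \<open>auto simp: less_top[symmetric] split: split_indicator\<close>)
  then show ?thesis
    by (subst (asm) Bochner_Integration.integral_add) (auto simp: prob_space less_top[symmetric] intro!: integrable_real_indicator)
qed

lemma prob_le_prob_norm:
  fixes X :: "'a \<Rightarrow> 'b::{second_countable_topology, real_normed_vector}"
  assumes [measurable]: "X \<in> borel_measurable M" and e: "0 < e" "e \<le> 1"
  shows "prob {w\<in>space M. norm (X w) > e} \<le> prob_norm X / e"
proof -
  have "(LINT w|M. e * indicator {w\<in>space M. norm (X w) > e} w) \<le> prob_norm X"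
    unfolding prob_norm_def
    by (intro integral_mono integrable_min_norm integrable_mult_right integrable_real_indicator)
       (use e in \<open>auto simp: less_top[symmetric] split: split_indicator\<close>)
  then show ?thesis using e by (simp add: field_simps)
qed

lemma tendsto_in_prob_iff_prob_norm:
  fixes Y :: "nat \<Rightarrow> 'a \<Rightarrow> 'b::{second_countable_topology, real_normed_vector}"
  assumes [measurable]: "\<And>n. Y n \<in> borel_measurable M" "W \<in> borel_measurable M"
  shows "tendsto_in_prob M Y W \<longleftrightarrow> (\<lambda>n. prob_norm (\<lambda>w. Y n w - W w)) \<longlonglongrightarrow> 0"
proof
  assume *: "tendsto_in_prob M Y W"
  show "(\<lambda>n. prob_norm (\<lambda>w. Y n w - W w)) \<longlonglongrightarrow> 0"
  proof (rule LIMSEQ_I)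
    fix e :: real assume e: "e > 0"
    have "(\<lambda>n. prob {w\<in>space M. dist (Y n w) (W w) > e / 2}) \<longlonglongrightarrow> 0"
      using * half_gt_zero[OF e] unfolding tendsto_in_prob_def by blast
    from LIMSEQ_D[OF this, of "e / 2"] e obtain N
      where N: "\<And>n. n \<ge> N \<Longrightarrow> prob {w\<in>space M. norm (Y n w - W w) > e / 2} < e / 2"
      by (auto simp: dist_norm)
    have "norm (prob_norm (\<lambda>w. Y n w - W w) - 0) < e" if "n \<ge> N" for n
      using prob_norm_le[of "\<lambda>w. Y n w - W w" "e / 2"] N[OF that] e
        prob_norm_nonneg[of "\<lambda>w. Y n w - W w"] by simp
    then show "\<exists>N. \<forall>n\<ge>N. norm (prob_norm (\<lambda>w. Y n w - W w) - 0) < e" by blast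
  qed
next
  assume *: "(\<lambda>n. prob_norm (\<lambda>w. Y n w - W w)) \<longlonglongrightarrow> 0"
  show "tendsto_in_prob M Y W"
    unfolding tendsto_in_prob_def
  proof (intro allI impI)
    fix e :: real assume e: "e > 0"
    define d where "d = min 1 e"
    have d: "0 < d" "d \<le> 1" "d \<le> e" using e by (auto simp: d_def)
    have up: "prob {w\<in>space M. dist (Y n w) (W w) > e} \<le> prob_norm (\<lambda>w. Y n w - W w) / d" for n
    proof -
      have "prob {w\<in>space M. dist (Y n w) (W w) > e} \<le> prob {w\<in>space M. norm (Y n w - W w) > d}"
        using d by (intro finite_measure_mono) (auto simp: dist_norm)
      also have "\<dots> \<le> prob_norm (\<lambda>w. Y n w - W w) / d"
        using d by (intro prob_le_prob_norm) auto
      finally show ?thesis .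
    qed
    have "(\<lambda>n. prob_norm (\<lambda>w. Y n w - W w) / d) \<longlonglongrightarrow> 0 / d"
      using d by (intro tendsto_divide * tendsto_const) auto
    then have lim: "(\<lambda>n. prob_norm (\<lambda>w. Y n w - W w) / d) \<longlonglongrightarrow> 0" by simp
    show "(\<lambda>n. prob {w\<in>space M. dist (Y n w) (W w) > e}) \<longlonglongrightarrow> 0"
      by (rule Lim_null_comparison[OF always_eventually lim]) (simp add: up)
  qed
qed

lemma prob_norm_eq_0:
  fixes X :: "'a \<Rightarrow> 'b::{second_countable_topology, real_normed_vector}"
  assumes [measurable]: "X \<in> borel_measurable M" and 0: "prob_norm X \<le> 0"
  shows "AE w in M. X w = 0"
proof -
  have "AE w in M. min 1 (norm (X w)) = 0"
    using 0 prob_norm_nonneg[of X] integrable_min_norm[of X] unfolding prob_norm_def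
    by (subst integral_nonneg_eq_0_iff_AE[symmetric]) auto
  then show ?thesis by eventually_elim (auto simp: min_def split: if_splits)
qed

text \<open>Baire category argument in the measure algebra of \<open>\<mu>\<close>.\<close>

lemma vitali_hahn_saks_prob:
  fixes q :: "nat \<Rightarrow> 's set \<Rightarrow> 'a \<Rightarrow> 'b::{second_countable_topology, real_normed_vector}"
  assumes \<mu>: "finite_measure \<mu>"
    and q_meas [measurable]: "\<And>n B. B \<in> sets \<mu> \<Longrightarrow> q n B \<in> borel_measurable M"
    and q_add: "\<And>n A B. A \<in> sets \<mu> \<Longrightarrow> B \<in> sets \<mu> \<Longrightarrow> A \<inter> B = {} \<Longrightarrow>
        AE w in M. q n (A \<union> B) w = q n A w + q n B w"
    and q_ac: "\<And>n e. e > 0 \<Longrightarrow> \<exists>\<eta>>0. \<forall>B\<in>sets \<mu>. measure \<mu> B < \<eta> \<longrightarrow> prob_norm (q n B) \<le> e"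
    and q_Cauchy: "\<And>B e. B \<in> sets \<mu> \<Longrightarrow> e > 0 \<Longrightarrow>
        \<exists>N. \<forall>n\<ge>N. \<forall>m\<ge>N. prob_norm (\<lambda>w. q n B w - q m B w) \<le> e"
    and e: "e > 0"
  shows "\<exists>\<eta>>0. \<exists>N. \<forall>n\<ge>N. \<forall>B\<in>sets \<mu>. measure \<mu> B < \<eta> \<longrightarrow> prob_norm (q n B) \<le> e"
proof -
  interpret \<mu>: finite_measure \<mu> by fact
  define d where "d n m B = prob_norm (\<lambda>w. q n B w - q m B w)" for n m B
  define e3 where "e3 = e / 3"
  have e3: "e3 > 0" using e by (simp add: e3_def)
  have split_q: "AE w in M. q n B w = q n (B \<inter> C) w + q n (B - C) w"
    if "B \<in> sets \<mu>" "C \<in> sets \<mu>" for n B C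
    using q_add[of "B \<inter> C" "B - C" n] that by (simp add: Int_Diff_Un Int_Diff_disjoint)
  \<comment> \<open>\<open>B\<close> is reached from \<open>B'\<close> by removing
    \<open>B' - B\<close> and adding \<open>B - B'\<close>; additivity bounds the resulting change
    of \<open>d\<close>.\<close>
  have d_le: "d n m B \<le> d n m B' + (prob_norm (q n (B - B')) + prob_norm (q m (B - B'))) +
      (prob_norm (q n (B' - B)) + prob_norm (q m (B' - B)))"
    if [measurable]: "B \<in> sets \<mu>" "B' \<in> sets \<mu>" for n m B B'
  proof -
    have "d n m B = prob_norm (\<lambda>w. (q n B' w - q m B' w) +
       ((q n (B - B') w - q m (B - B') w) + (q m (B' - B) w - q n (B' - B) w)))"
      unfolding d_def
    proof (rule prob_norm_cong)
      show "AE w in M. q n B w - q m B w = (q n B' w - q m B' w) +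
       ((q n (B - B') w - q m (B - B') w) + (q m (B' - B) w - q n (B' - B) w))"
        using split_q[OF that, of n] split_q[OF that, of m] split_q[OF that(2,1), of n] split_q[OF that(2,1), of m]
        by eventually_elim (simp add: Int_commute)
    qed measurable
    also have "\<dots> \<le> d n m B' + (prob_norm (\<lambda>w. q n (B - B') w - q m (B - B') w)
        + prob_norm (\<lambda>w. q m (B' - B) w - q n (B' - B) w))"
      unfolding d_def
      by (rule order_trans[OF prob_norm_triangle]) (auto intro!: add_left_mono prob_norm_triangle)
    also have "prob_norm (\<lambda>w. q n (B - B') w - q m (B - B') w) \<le> prob_norm (q n (B - B')) + prob_norm (q m (B - B'))"
      using prob_norm_diff[of "q n (B - B')" "q m (B - B')" "\<lambda>_. 0"] prob_norm_minus[of "\<lambda>_. 0" "q m (B - B')"] by simp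
    also have "prob_norm (\<lambda>w. q m (B' - B) w - q n (B' - B) w) \<le> prob_norm (q n (B' - B)) + prob_norm (q m (B' - B))"
      using prob_norm_diff[of "q m (B' - B)" "q n (B' - B)" "\<lambda>_. 0"] prob_norm_minus[of "\<lambda>_. 0" "q n (B' - B)"] by simp
    finally show ?thesis by simp
  qed
  \<comment> \<open>The sets \<open>B\<close> with \<open>d n m B > e3\<close> are open for the
    pseudometric given by the measure of symmetric differences, because \<open>q n\<close> and
    \<open>q m\<close> are absolutely continuous.\<close>
  have stable: "\<exists>r>0. \<forall>B'\<in>sets \<mu>. measure \<mu> (B - B') < r \<and> measure \<mu> (B' - B) < r \<longrightarrow> d n m B' > e3"
    if B: "B \<in> sets \<mu>" and "d n m B > e3" for n m B
  proof -
    \<comment> \<open>Four terms of size \<open>u\<close> are lost in \<open>d_le\<close>; the fifth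
      keeps the inequality strict.\<close>
    define u where "u = (d n m B - e3) / 5"
    have u: "u > 0" using that by (simp add: u_def)
    obtain r1 where r1: "r1 > 0" "\<forall>B\<in>sets \<mu>. measure \<mu> B < r1 \<longrightarrow> prob_norm (q n B) \<le> u" using q_ac[OF u] by blast
    obtain r2 where r2: "r2 > 0" "\<forall>B\<in>sets \<mu>. measure \<mu> B < r2 \<longrightarrow> prob_norm (q m B) \<le> u" using q_ac[OF u] by blast
    show ?thesis
    proof (intro exI[of _ "min r1 r2"] conjI ballI impI)
      fix B' assume B': "B' \<in> sets \<mu>" and "measure \<mu> (B - B') < min r1 r2 \<and> measure \<mu> (B' - B) < min r1 r2"
      then have "prob_norm (q n (B - B')) \<le> u" "prob_norm (q m (B - B')) \<le> u"
         "prob_norm (q n (B' - B)) \<le> u" "prob_norm (q m (B' - B)) \<le> u"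
        using r1 r2 B by auto
      then have "d n m B \<le> d n m B' + 4 * u" using d_le[OF B B', of n m] by linarith
      then show "d n m B' > e3" using u by (simp add: u_def field_simps)
    qed (use r1 r2 in auto)
  qed
  \<comment> \<open>Some ball of the measure algebra lies in one of the sets where all
    \<open>d n m\<close> with \<open>n, m \<ge> k\<close> are small. Otherwise nested balls can be
    chosen, the next one inside the set where some late pair \<open>n, m\<close> is bad, and their
    common point contradicts the Cauchy property.\<close>
  have "\<exists>k B0 r. B0 \<in> sets \<mu> \<and> r > 0 \<and> (\<forall>B\<in>sets \<mu>. measure \<mu> (B - B0) < r \<and> measure \<mu> (B0 - B) < r \<longrightarrow>
      (\<forall>n\<ge>k. \<forall>m\<ge>k. d n m B \<le> e3))"
  proof (rule ccontr)
    assume "\<not> ?thesis"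
    then have neg: "\<exists>B\<in>sets \<mu>. measure \<mu> (B - B0) < r \<and> measure \<mu> (B0 - B) < r \<and> (\<exists>n\<ge>k. \<exists>m\<ge>k. d n m B > e3)"
      if "B0 \<in> sets \<mu>" "r > 0" for B0 r k
      using that by (meson not_le)
    define P where "P k x = (fst x \<in> sets \<mu> \<and> snd x > 0)" for k :: nat and x :: "'s set \<times> real"
    \<comment> \<open>Radii and displacements shrink by a factor of four, so the total displacement
      from the \<open>k\<close>-th centre is at most \<open>r k / 3\<close>, which is inside its
      ball.\<close>
    define R where "R k x y = (measure \<mu> (fst y - fst x) < snd x / 4 \<and> measure \<mu> (fst x - fst y) < snd x / 4 \<and>
       snd y \<le> snd x / 4 \<and> (\<forall>B'\<in>sets \<mu>. measure \<mu> (fst y - B') < snd y \<and> measure \<mu> (B' - fst y) < snd y \<longrightarrow>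
         (\<exists>n\<ge>k. \<exists>m\<ge>k. d n m B' > e3)))" for k :: nat and x y :: "'s set \<times> real"
    have "\<exists>f. \<forall>k. P k (f k) \<and> R k (f k) (f (Suc k))"
    proof (rule dependent_nat_choice)
      show "\<exists>x. P 0 x" by (intro exI[of _ "({}, 1)"]) (auto simp: P_def)
    next
      fix x k assume "P k x"
      then have x: "fst x \<in> sets \<mu>" "snd x / 4 > 0" by (auto simp: P_def)
      obtain B n m where B: "B \<in> sets \<mu>" "measure \<mu> (B - fst x) < snd x / 4" "measure \<mu> (fst x - B) < snd x / 4"
        "n \<ge> k" "m \<ge> k" "d n m B > e3" using neg[OF x, of k] by blast
      obtain r where r: "r > 0" "\<forall>B'\<in>sets \<mu>. measure \<mu> (B - B') < r \<and> measure \<mu> (B' - B) < r \<longrightarrow> d n m B' > e3"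
        using stable[OF B(1,6)] by blast
      have "P (Suc k) (B, min r (snd x / 4)) \<and> R k x (B, min r (snd x / 4))"
      proof -
        have "\<exists>n\<ge>k. \<exists>m\<ge>k. d n m B' > e3"
          if "B' \<in> sets \<mu>" "measure \<mu> (B - B') < r" "measure \<mu> (B' - B) < r" for B'
          using that r(2) B(4,5) by blast
        then show ?thesis using B(1-3) r(1) x unfolding P_def R_def by auto
      qed
      then show "\<exists>y. P (Suc k) y \<and> R k x y" by blast
    qed
    then obtain f where f: "\<And>k. P k (f k)" "\<And>k. R k (f k) (f (Suc k))" by blast
    define B r where "B k = fst (f k)" and "r k = snd (f k)" for k
    have B [measurable]: "\<And>k. B k \<in> sets \<mu>" and r: "\<And>k. r k > 0" using f(1) by (auto simp: P_def B_def r_def)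
    have step: "measure \<mu> (B (Suc k) - B k) < r k / 4" "measure \<mu> (B k - B (Suc k)) < r k / 4" "r (Suc k) \<le> r k / 4" for k
      using f(2)[of k] by (auto simp: R_def B_def r_def)
    have bad: "\<exists>n\<ge>k. \<exists>m\<ge>k. d n m B' > e3"
      if "B' \<in> sets \<mu>" "measure \<mu> (B (Suc k) - B') < r (Suc k)" "measure \<mu> (B' - B (Suc k)) < r (Suc k)" for k B'
      using f(2)[of k] that by (auto simp: R_def B_def r_def)
    \<comment> \<open>The upper limit of the centres serves as their limit in the measure
      algebra.\<close>
    define S where "S = (\<Inter>n. \<Union>j\<in>{n..}. B j)"
    have S [measurable]: "S \<in> sets \<mu>" unfolding S_def by measurable
    have rk: "r (k + j) \<le> r k * (1/4) ^ j" for k j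
    proof (induction j)
      case (Suc j)
      then show ?case using step(3)[of "k + j"] by simp
    qed simp
    have sub_up: "B j \<subseteq> B k \<union> (\<Union>i. B (Suc (k + i)) - B (k + i))" if "j \<ge> k" for j k
      using that
    proof (induction j rule: dec_induct)
      case (step j)
      then obtain i where "j = k + i" using le_Suc_ex by blast
      then have "B (Suc j) \<subseteq> B j \<union> (B (Suc (k + i)) - B (k + i))" by auto
      with step.IH show ?case by blast
    qed auto
    have sub_dn: "B k \<subseteq> B j \<union> (\<Union>i. B (k + i) - B (Suc (k + i)))" if "j \<ge> k" for j k
      using that
    proof (induction j rule: dec_induct)
      case (step j)
      then obtain i where "j = k + i" using le_Suc_ex by blast
      then have "B j \<subseteq> B (Suc j) \<union> (B (k + i) - B (Suc (k + i)))" by auto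
      with step.IH show ?case by blast
    qed auto
    have geo: "(\<lambda>j. r k / 4 * (1/4) ^ j) sums (r k / 3)" for k
      using sums_mult[OF geometric_sums[of "1/4::real"], of "r k / 4"] by simp
    have tail: "measure \<mu> (\<Union>i. D i) < r k" if D [measurable]: "\<And>i. D i \<in> sets \<mu>"
      and "\<And>i. measure \<mu> (D i) \<le> r (k + i) / 4" for D :: "nat \<Rightarrow> 's set" and k
    proof -
      have Di: "measure \<mu> (D i) \<le> r k / 4 * (1/4) ^ i" for i
        using that(2)[of i] rk[of k i] by simp
      have sm: "summable (\<lambda>i. measure \<mu> (D i))"
        by (rule summable_comparison_test[OF _ sums_summable[OF geo[of k]]]) (use Di in auto)
      have "measure \<mu> (\<Union>i. D i) \<le> (\<Sum>i. measure \<mu> (D i))"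
        using sm D by (intro \<mu>.finite_measure_subadditive_countably) auto
      also have "\<dots> \<le> (\<Sum>i. r k / 4 * (1/4) ^ i)"
        by (intro suminf_le Di sm sums_summable[OF geo])
      also have "\<dots> = r k / 3" using geo[of k] by (simp add: sums_iff)
      finally show ?thesis using r[of k] by simp
    qed
    have near: "measure \<mu> (S - B k) < r k" "measure \<mu> (B k - S) < r k" for k
    proof -
      have "S \<subseteq> (\<Union>j\<in>{k..}. B j)" unfolding S_def by blast
      then have "S - B k \<subseteq> (\<Union>i. B (Suc (k + i)) - B (k + i))" using sub_up[of k] by fastforce
      then have "measure \<mu> (S - B k) \<le> measure \<mu> (\<Union>i. B (Suc (k + i)) - B (k + i))"
        by (intro \<mu>.finite_measure_mono) auto
      also have "\<dots> < r k" by (rule tail[OF _ less_imp_le[OF step(1)]]) measurable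
      finally show "measure \<mu> (S - B k) < r k" .
      have "B k - S \<subseteq> (\<Union>i. B (k + i) - B (Suc (k + i)))"
      proof
        fix x assume x: "x \<in> B k - S"
        then obtain n where n: "\<And>j. j \<ge> n \<Longrightarrow> x \<notin> B j" by (auto simp: S_def)
        have "x \<in> B (max n k) \<union> (\<Union>i. B (k + i) - B (Suc (k + i)))"
          using sub_dn[of k "max n k"] x by auto
        then show "x \<in> (\<Union>i. B (k + i) - B (Suc (k + i)))" using n[of "max n k"] by auto
      qed
      then have "measure \<mu> (B k - S) \<le> measure \<mu> (\<Union>i. B (k + i) - B (Suc (k + i)))"
        by (intro \<mu>.finite_measure_mono) auto
      also have "\<dots> < r k" by (rule tail[OF _ less_imp_le[OF step(2)]]) measurable
      finally show "measure \<mu> (B k - S) < r k" .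
    qed
    obtain N where N: "\<And>n m. n \<ge> N \<Longrightarrow> m \<ge> N \<Longrightarrow> d n m S \<le> e3"
      using q_Cauchy[OF S e3] unfolding d_def by blast
    obtain n m where "n \<ge> N" "m \<ge> N" "d n m S > e3"
      using bad[OF S near(2)[of "Suc N"] near(1)[of "Suc N"]] by blast
    then show False using N[of n m] by simp
  qed
  then obtain k B0 r where B0 [measurable]: "B0 \<in> sets \<mu>" and r: "r > 0"
    and ball: "\<And>B n m. B \<in> sets \<mu> \<Longrightarrow> measure \<mu> (B - B0) < r \<Longrightarrow> measure \<mu> (B0 - B) < r \<Longrightarrow>
      n \<ge> k \<Longrightarrow> m \<ge> k \<Longrightarrow> d n m B \<le> e3" by blast
  obtain \<eta> where \<eta>: "\<eta> > 0" "\<And>B. B \<in> sets \<mu> \<Longrightarrow> measure \<mu> B < \<eta> \<Longrightarrow> prob_norm (q k B) \<le> e3"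
    using q_ac[OF e3] by blast
  \<comment> \<open>A small set \<open>C\<close> is the difference of \<open>B0 \<union> C\<close>
    and \<open>B0 - C\<close>, which both lie in the ball around \<open>B0\<close>. So the estimate
    on the ball compares \<open>q n C\<close> with the single function \<open>q k C\<close>.\<close>
  show ?thesis
  proof (intro exI[of _ "min r \<eta>"] conjI exI[of _ k] allI impI ballI)
    fix n C assume n: "n \<ge> k" and C [measurable]: "C \<in> sets \<mu>" and m: "measure \<mu> C < min r \<eta>"
    have le: "measure \<mu> (B0 \<union> C - B0) \<le> measure \<mu> C" "measure \<mu> (B0 - (B0 - C)) \<le> measure \<mu> C"
      by (auto intro!: \<mu>.finite_measure_mono)
    have e0: "B0 - (B0 \<union> C) = {}" "B0 - C - B0 = {}" by auto
    have 1: "d n k (B0 \<union> C) \<le> e3"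
      using le m n r by (intro ball) (auto simp: e0)
    have 2: "d n k (B0 - C) \<le> e3"
      using le m n r by (intro ball) (auto simp: e0)
    have sp: "AE w in M. q i (B0 \<union> C) w = q i (B0 - C) w + q i C w" for i
      using q_add[of "B0 - C" C i] by (simp add: Diff_disjoint Un_commute Int_commute)
    have "prob_norm (q n C) = prob_norm (\<lambda>w. ((q n (B0 \<union> C) w - q k (B0 \<union> C) w) + (q k (B0 - C) w - q n (B0 - C) w)) + q k C w)"
      by (rule prob_norm_cong) (use sp[of n] sp[of k] in \<open>measurable, auto\<close>)
    also have "\<dots> \<le> (d n k (B0 \<union> C) + d k n (B0 - C)) + prob_norm (q k C)"
      unfolding d_def
      by (rule order_trans[OF prob_norm_triangle]) (auto intro!: add_right_mono prob_norm_triangle)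
    also have "d k n (B0 - C) = d n k (B0 - C)" unfolding d_def by (rule prob_norm_minus)
    finally show "prob_norm (q n C) \<le> e"
      using 1 2 \<eta>(2)[OF C] m by (simp add: e3_def)
  qed (use r \<eta> in auto)
qed

end

text \<open>The standard normal law stands in for Lebesgue measure, since the category argument
  needs a finite measure. On \<open>{-R..R}\<close> its density is at least its value at
  \<open>R\<close>, which translates smallness back.\<close>

lemma std_normal_measure_ge:
  assumes B: "B \<in> sets borel" "B \<subseteq> {-R..R}"
  shows "measure lborel B \<le> measure std_normal_distribution B / std_normal_density R"
proof -
  interpret prob_space std_normal_distribution by (rule prob_space_normal_density) simp
  have R: "std_normal_density R \<le> std_normal_density x" if "x \<in> {-R..R}" for x
  proof -
    have "x\<^sup>2 \<le> R\<^sup>2" using that by (intro abs_le_square_iff[THEN iffD1]) auto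
    then show ?thesis by (simp add: std_normal_density_def divide_right_mono)
  qed
  have "bounded B" using B(2) bounded_subset[OF bounded_closed_interval] by blast
  then have fin: "emeasure lborel B < \<infinity>" by (rule emeasure_bounded_finite)
  have "ennreal (std_normal_density R) * emeasure lborel B = (\<integral>\<^sup>+x. ennreal (std_normal_density R) * indicator B x \<partial>lborel)"
    using B by (simp add: nn_integral_cmult_indicator)
  also have "\<dots> \<le> (\<integral>\<^sup>+x. ennreal (std_normal_density x) * indicator B x \<partial>lborel)"
    using B(2) R by (intro nn_integral_mono) (auto split: split_indicator intro!: ennreal_leI)
  also have "\<dots> = emeasure std_normal_distribution B"
    using B by (subst emeasure_density) auto
  finally have "ennreal (std_normal_density R * measure lborel B) \<le> ennreal (measure std_normal_distribution B)"
    using fin by (simp add: emeasure_eq_ennreal_measure emeasure_eq_measure ennreal_mult less_top)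
  then have "std_normal_density R * measure lborel B \<le> measure std_normal_distribution B"
    by (simp add: ennreal_le_iff)
  moreover have "std_normal_density R > 0" by (rule normal_density_pos) simp
  ultimately show ?thesis by (simp add: field_simps)
qed

section \<open>Integrals of simple functions as random set functions\<close>

lemma simple_integrandD:
  assumes "simple_integrand g"
  shows "finite (range g)" "C \<noteq> 0 \<Longrightarrow> g -` {C} \<in> bounded_borel"
  using assms by (auto simp: simple_integrand_def)

text \<open>The level set of the value zero is unbounded; it is the complement of the finitely many
  other level sets.\<close>

lemma simple_integrand_vimage_borel:
  assumes "simple_integrand g" shows "g -` {C} \<in> sets borel"
proof (cases "C = 0")
  case True
  have "g -` {C} = UNIV - (\<Union>D\<in>range g - {0}. g -` {D})" using True by auto
  moreover have "(\<Union>D\<in>range g - {0}. g -` {D}) \<in> sets borel"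
    using assms by (intro sets.finite_UN) (auto simp: simple_integrand_def bounded_borel_def)
  ultimately show ?thesis by auto
next
  case False
  then show ?thesis using assms by (auto simp: simple_integrand_def bounded_borel_def)
qed

lemma (in prob_space) prob_norm_tendstoD:
  assumes "(\<lambda>n. prob_norm (X n)) \<longlonglongrightarrow> 0" "e > 0"
  shows "\<exists>N::nat. \<forall>n\<ge>N. prob_norm (X n) < e"
  using LIMSEQ_D[OF assms] by (simp add: prob_norm_nonneg)

context levy_noise begin

lemma Z_add:
  assumes "A \<in> bounded_borel" "B \<in> bounded_borel" "A \<inter> B = {}"
  shows "AE w in M. Z (A \<union> B) w = Z A w + Z B w"
proof -
  have "AE w in M. Z (\<Union>i<2. if i = (0::nat) then A else B) w = (\<Sum>i<2. Z (if i = (0::nat) then A else B) w)"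
    using assms by (intro Z_finite_additive_nat) (auto simp: disjoint_family_on_def)
  moreover have "(\<Union>i<2. if i = (0::nat) then A else B) = A \<union> B"
    by (auto simp: numeral_2_eq_2 lessThan_Suc)
  ultimately show ?thesis by (simp add: numeral_2_eq_2)
qed

lemma measurable_mult_Z:
  "B \<in> bounded_borel \<Longrightarrow> (\<lambda>w. (C :: real^'d^'d) *v Z B w) \<in> borel_measurable M"
  using measurable_compose[OF Z_measurable borel_measurable_continuous_onI[OF linear_continuous_on[OF matrix_vector_mul_bounded_linear]]] .

lemma simple_integral_measurable:
  assumes "simple_integrand g" "B \<in> sets borel"
  shows "simple_stoch_integral Z B g \<in> borel_measurable M"
proof -
  have "(\<lambda>w. \<Sum>C\<in>range g - {0}. C *v Z (B \<inter> g -` {C}) w) \<in> borel_measurable M"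
    using assms by (intro borel_measurable_sum measurable_mult_Z bounded_borel_Int2) (auto simp: simple_integrand_def)
  then show ?thesis by (simp add: simple_stoch_integral_def[abs_def])
qed

lemma simple_integral_Un:
  assumes g: "simple_integrand g" and AB: "A \<in> sets borel" "B \<in> sets borel" "A \<inter> B = {}"
  shows "AE w in M. simple_stoch_integral Z (A \<union> B) g w = simple_stoch_integral Z A g w + simple_stoch_integral Z B g w"
proof -
  have "AE w in M. \<forall>C\<in>range g - {0}. Z ((A \<union> B) \<inter> g -` {C}) w = Z (A \<inter> g -` {C}) w + Z (B \<inter> g -` {C}) w"
  proof (rule AE_finite_allI)
    fix C assume "C \<in> range g - {0}"
    then have "g -` {C} \<in> bounded_borel" using simple_integrandD[OF g] by auto
    then have "AE w in M. Z ((A \<inter> g -` {C}) \<union> (B \<inter> g -` {C})) w = Z (A \<inter> g -` {C}) w + Z (B \<inter> g -` {C}) w"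
      using AB by (intro Z_add bounded_borel_Int2) auto
    then show "AE w in M. Z ((A \<union> B) \<inter> g -` {C}) w = Z (A \<inter> g -` {C}) w + Z (B \<inter> g -` {C}) w"
      by (simp add: Int_Un_distrib2)
  qed (use simple_integrandD[OF g] in simp)
  then show ?thesis
    by eventually_elim (simp add: simple_stoch_integral_def matrix_vector_right_distrib sum.distrib)
qed

text \<open>The condition makes the probability of exceeding \<open>e\<close> at most
  \<open>e\<close>; truncation adds the two.\<close>

lemma Z_sum_prob_norm:
  assumes I: "finite I" and E: "\<And>i. i \<in> I \<Longrightarrow> E i \<in> bounded_borel" "disjoint_family_on E I" and e: "e > 0"
    and s: "(\<Sum>i\<in>I. measure lborel (E i) * Psi (c i)) \<le> e * (1 - exp (- e\<^sup>2 / 2))"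
  shows "prob_norm (\<lambda>w. \<Sum>i\<in>I. (c i :: real^'d^'d) *v Z (E i) w) \<le> 2 * e"
proof -
  have c: "1 - exp (- e\<^sup>2 / 2) > 0" using e by simp
  have "prob {w\<in>space M. norm (\<Sum>i\<in>I. c i *v Z (E i) w) > e} \<le>
    (\<Sum>i\<in>I. measure lborel (E i) * Psi (c i)) / (1 - exp (- e\<^sup>2 / 2))"
    by (rule Z_sum_tail[OF I E e])
  also have "\<dots> \<le> e" using s c by (simp add: divide_le_eq)
  finally show ?thesis
    using prob_norm_le[of "\<lambda>w. \<Sum>i\<in>I. c i *v Z (E i) w" e] e E
    by (force intro!: borel_measurable_sum measurable_mult_Z)
qed

lemma measure_le_measure: "A \<subseteq> B \<Longrightarrow> A \<in> sets borel \<Longrightarrow> B \<in> bounded_borel \<Longrightarrow> measure lborel A \<le> measure lborel B"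
  using emeasure_bounded_borel[of B] bounded_borelD(1)[of B] by (intro measure_mono_fmeasurable) (auto simp: fmeasurable_def)

text \<open>A single simple integrand takes finitely many values and has bounded support, so the
  normal measure of \<open>B\<close> controls the Lebesgue measures in
  \<open>Z_sum_prob_norm\<close>. This is the absolute continuity that
  \<open>vitali_hahn_saks_prob\<close> makes uniform.\<close>

lemma simple_integral_abs_continuous:
  assumes g: "simple_integrand g" and e: "e > 0"
  shows "\<exists>\<eta>>0. \<forall>B\<in>sets borel. measure std_normal_distribution B < \<eta> \<longrightarrow>
    prob_norm (simple_stoch_integral Z B g) \<le> e"
proof -
  define e2 where "e2 = e / 2"
  define c where "c = e2 * (1 - exp (- e2\<^sup>2 / 2))"
  have e2: "e2 > 0" using e by (simp add: e2_def)
  have c: "c > 0" using e2 by (simp add: c_def)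
  define P where "P = (\<Sum>C\<in>range g - {0}. Psi C) + 1"
  have P: "P > 0" by (simp add: P_def add_nonneg_pos sum_nonneg Psi_nonneg)
  have S: "bounded (\<Union>C\<in>range g - {0}. g -` {C})"
    using simple_integrandD[OF g] by (intro bounded_UN) (auto simp: bounded_borel_def)
  then obtain R where R: "\<And>x. x \<in> (\<Union>C\<in>range g - {0}. g -` {C}) \<Longrightarrow> \<bar>x\<bar> \<le> R"
    unfolding bounded_iff by (metis real_norm_def)
  have D: "std_normal_density R > 0" by (rule normal_density_pos) simp
  show ?thesis
  proof (intro exI[of _ "c * std_normal_density R / P"] conjI ballI impI)
    fix B assume B: "B \<in> sets borel" and m: "measure std_normal_distribution B < c * std_normal_density R / P"
    have le: "measure lborel (B \<inter> g -` {C}) \<le> c / P" if "C \<in> range g - {0}" for C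
    proof -
      have "measure lborel (B \<inter> g -` {C}) \<le> measure std_normal_distribution (B \<inter> g -` {C}) / std_normal_density R"
      proof (rule std_normal_measure_ge)
        show "B \<inter> g -` {C} \<subseteq> {-R..R}"
        proof
          fix x assume "x \<in> B \<inter> g -` {C}"
          then have "\<bar>x\<bar> \<le> R" using that by (intro R) blast
          then show "x \<in> {-R..R}" by auto
        qed
      qed (use B simple_integrand_vimage_borel[OF g] in auto)
      also have "\<dots> \<le> measure std_normal_distribution B / std_normal_density R"
        using D B simple_integrand_vimage_borel[OF g]
        by (intro divide_right_mono finite_measure.finite_measure_mono prob_space.finite_measure prob_space_normal_density) auto
      also have "\<dots> \<le> c / P" using m D P by (simp add: field_simps)
      finally show ?thesis .
    qed
    have "(\<Sum>C\<in>range g - {0}. measure lborel (B \<inter> g -` {C}) * Psi C) \<le> (\<Sum>C\<in>range g - {0}. c / P * Psi C)"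
      by (intro sum_mono mult_right_mono le Psi_nonneg)
    also have "\<dots> = c / P * (P - 1)" by (simp add: P_def sum_distrib_left)
    also have "\<dots> \<le> c" using c P by (simp add: field_simps)
    finally have "prob_norm (\<lambda>w. \<Sum>C\<in>range g - {0}. C *v Z (B \<inter> g -` {C}) w) \<le> 2 * e2"
      unfolding c_def using simple_integrandD[OF g] B e2
      by (intro Z_sum_prob_norm) (auto simp: disjoint_family_on_def intro: bounded_borel_Int2)
    then show "prob_norm (simple_stoch_integral Z B g) \<le> e"
      by (simp add: e2_def simple_stoch_integral_def[abs_def])
  qed (use c D P in auto)
qed

end

text \<open>The data behind \<open>has_stoch_integral\<close>: approximating integrands whose
  integrals converge over every Borel set. The limits form a random set function, determined up to
  null sets.\<close>

locale convergent_integrands = levy_noise M L Z \<psi>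
  for M :: "'w measure" and L :: "real \<Rightarrow> 'w \<Rightarrow> real^'d" and Z \<psi> +
  fixes g :: "nat \<Rightarrow> real \<Rightarrow> real^'d^'d" and f :: "real \<Rightarrow> real^'d^'d"
  assumes simple: "\<And>n. simple_integrand (g n)"
    and f_measurable [measurable]: "f \<in> borel_measurable borel"
    and g_lim: "AE s in lborel. (\<lambda>n. g n s) \<longlonglongrightarrow> f s"
    and integrals_converge: "\<And>B. B \<in> sets borel \<Longrightarrow> \<exists>W\<in>borel_measurable M.
      tendsto_in_prob M (\<lambda>n. simple_stoch_integral Z B (g n)) W"
begin

definition W :: "real set \<Rightarrow> 'w \<Rightarrow> real^'d" where
  "W B = (SOME V. V \<in> borel_measurable M \<and> tendsto_in_prob M (\<lambda>n. simple_stoch_integral Z B (g n)) V)"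

lemma W:
  assumes "B \<in> sets borel"
  shows "W B \<in> borel_measurable M" "tendsto_in_prob M (\<lambda>n. simple_stoch_integral Z B (g n)) (W B)"
  using someI_ex[of "\<lambda>V. V \<in> borel_measurable M \<and> tendsto_in_prob M (\<lambda>n. simple_stoch_integral Z B (g n)) V"]
    integrals_converge[OF assms] unfolding W_def by blast+

abbreviation q :: "nat \<Rightarrow> real set \<Rightarrow> 'w \<Rightarrow> real^'d" where "q n B \<equiv> simple_stoch_integral Z B (g n)"

lemma q_measurable: "B \<in> sets borel \<Longrightarrow> q n B \<in> borel_measurable M"
  by (rule simple_integral_measurable[OF simple])

lemma q_tendsto: "B \<in> sets borel \<Longrightarrow> (\<lambda>n. prob_norm (\<lambda>w. q n B w - W B w)) \<longlonglongrightarrow> 0"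
  using W tendsto_in_prob_iff_prob_norm[of "\<lambda>n. q n B" "W B"] q_measurable by blast

lemma g_measurable [measurable]: "g n \<in> borel_measurable borel"
proof -
  have "simple_function borel (g n)"
    using simple_integrandD(1)[OF simple] simple_integrand_vimage_borel[OF simple]
    by (auto simp: simple_function_def)
  then show ?thesis by (rule borel_measurable_simple_function)
qed

text \<open>Here the convergence over all Borel sets is spent: it rules out that the integrals
  concentrate on sets of small measure, although the integrands \<open>g n\<close> have no common
  bound.\<close>

lemma q_uniformly_small:
  assumes "e > 0"
  shows "\<exists>\<eta>>0. \<exists>N. \<forall>n\<ge>N. \<forall>B\<in>sets borel. measure std_normal_distribution B < \<eta> \<longrightarrow> prob_norm (q n B) \<le> e"
proof -
  have "\<exists>\<eta>>0. \<exists>N. \<forall>n\<ge>N. \<forall>B\<in>sets std_normal_distribution. measure std_normal_distribution B < \<eta> \<longrightarrow> prob_norm (q n B) \<le> e"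
  proof (rule vitali_hahn_saks_prob)
    show "finite_measure std_normal_distribution"
      by (intro prob_space.finite_measure prob_space_normal_density) simp
    show "q n B \<in> borel_measurable M" if "B \<in> sets std_normal_distribution" for n B
      using that by (intro q_measurable) simp
    show "AE w in M. q n (A \<union> B) w = q n A w + q n B w"
      if "A \<in> sets std_normal_distribution" "B \<in> sets std_normal_distribution" "A \<inter> B = {}" for n A B
      using that by (intro simple_integral_Un simple) auto
    show "\<exists>\<eta>>0. \<forall>B\<in>sets std_normal_distribution. measure std_normal_distribution B < \<eta> \<longrightarrow> prob_norm (q n B) \<le> e"
      if "e > 0" for n e
      using simple_integral_abs_continuous[OF simple that, of n] by simp
    show "\<exists>N. \<forall>n\<ge>N. \<forall>m\<ge>N. prob_norm (\<lambda>w. q n B w - q m B w) \<le> e"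
      if "B \<in> sets std_normal_distribution" "e > 0" for B e
    proof -
      have B: "B \<in> sets borel" using that by simp
      obtain N where N: "\<And>n. n \<ge> N \<Longrightarrow> prob_norm (\<lambda>w. q n B w - W B w) < e / 2"
        using prob_norm_tendstoD[OF q_tendsto[OF B], of "e / 2"] \<open>e > 0\<close> by auto
      have "prob_norm (\<lambda>w. q n B w - q m B w) \<le> e" if "n \<ge> N" "m \<ge> N" for n m
        using prob_norm_diff[OF q_measurable[OF B] q_measurable[OF B] W(1)[OF B], of n m]
          N[OF that(1)] N[OF that(2)] prob_norm_minus[of "W B" "q m B"] by simp
      then show ?thesis by blast
    qed
  qed fact
  then show ?thesis by simp
qed

text \<open>A bound that holds for all late approximations survives in the limit.\<close>

lemma W_diff_le:
  assumes B: "B \<in> sets borel" and V [measurable]: "V \<in> borel_measurable M"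
    and le: "\<And>n. n \<ge> N \<Longrightarrow> prob_norm (\<lambda>w. q n B w - V w) \<le> e"
  shows "prob_norm (\<lambda>w. W B w - V w) \<le> e"
proof (rule field_le_epsilon)
  fix d :: real assume d: "d > 0"
  obtain N' where N': "\<And>n. n \<ge> N' \<Longrightarrow> prob_norm (\<lambda>w. q n B w - W B w) < d"
    using prob_norm_tendstoD[OF q_tendsto[OF B] d] by auto
  have "prob_norm (\<lambda>w. W B w - V w) \<le> prob_norm (\<lambda>w. W B w - q (max N N') B w) + prob_norm (\<lambda>w. q (max N N') B w - V w)"
    by (rule prob_norm_diff[OF W(1)[OF B] V q_measurable[OF B]])
  then show "prob_norm (\<lambda>w. W B w - V w) \<le> e + d"
    using N'[of "max N N'"] le[of "max N N'"] prob_norm_minus[of "W B" "q (max N N') B"] by simp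
qed

lemma W_cong:
  assumes B: "B \<in> sets borel" and V: "V \<in> borel_measurable M" and t: "tendsto_in_prob M (\<lambda>n. q n B) V"
  shows "AE w in M. W B w = V w"
proof -
  have t': "(\<lambda>n. prob_norm (\<lambda>w. q n B w - V w)) \<longlonglongrightarrow> 0"
    using t tendsto_in_prob_iff_prob_norm[of "\<lambda>n. q n B" V] q_measurable[OF B] V by blast
  have "prob_norm (\<lambda>w. W B w - V w) \<le> 0"
  proof (rule field_le_epsilon)
    fix d :: real assume d: "d > 0"
    obtain N where "\<And>n. n \<ge> N \<Longrightarrow> prob_norm (\<lambda>w. q n B w - V w) < d"
      using prob_norm_tendstoD[OF t' d] by auto
    then show "prob_norm (\<lambda>w. W B w - V w) \<le> 0 + d"
      by (intro W_diff_le[OF B V, of N]) (auto intro: less_imp_le)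
  qed
  then have "AE w in M. W B w - V w = 0"
    using W(1)[OF B] V by (intro prob_norm_eq_0) measurable
  then show ?thesis by eventually_elim simp
qed

lemma W_Un:
  assumes AB: "A \<in> sets borel" "B \<in> sets borel" "A \<inter> B = {}"
  shows "AE w in M. W (A \<union> B) w = W A w + W B w"
proof (rule W_cong)
  note [measurable] = q_measurable[OF AB(1)] q_measurable[OF AB(2)] W(1)[OF AB(1)] W(1)[OF AB(2)] q_measurable[OF sets.Un[OF AB(1,2)]]
  show "(\<lambda>w. W A w + W B w) \<in> borel_measurable M" by measurable
  have "(\<lambda>n. prob_norm (\<lambda>w. q n (A \<union> B) w - (W A w + W B w))) \<longlonglongrightarrow> 0"
  proof (rule Lim_null_comparison[OF always_eventually])
    show "\<forall>n. norm (prob_norm (\<lambda>w. q n (A \<union> B) w - (W A w + W B w))) \<le>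
      prob_norm (\<lambda>w. q n A w - W A w) + prob_norm (\<lambda>w. q n B w - W B w)"
    proof
      fix n
      have "prob_norm (\<lambda>w. q n (A \<union> B) w - (W A w + W B w)) =
        prob_norm (\<lambda>w. (q n A w - W A w) + (q n B w - W B w))"
      proof (rule prob_norm_cong)
        show "AE w in M. q n (A \<union> B) w - (W A w + W B w) = (q n A w - W A w) + (q n B w - W B w)"
          using simple_integral_Un[OF simple AB, of n] by eventually_elim simp
      qed measurable
      also have "\<dots> \<le> prob_norm (\<lambda>w. q n A w - W A w) + prob_norm (\<lambda>w. q n B w - W B w)"
        by (rule prob_norm_triangle) measurable
      finally show "norm (prob_norm (\<lambda>w. q n (A \<union> B) w - (W A w + W B w))) \<le>
        prob_norm (\<lambda>w. q n A w - W A w) + prob_norm (\<lambda>w. q n B w - W B w)"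
        by (simp add: prob_norm_nonneg)
    qed
    show "(\<lambda>n. prob_norm (\<lambda>w. q n A w - W A w) + prob_norm (\<lambda>w. q n B w - W B w)) \<longlonglongrightarrow> 0"
      using tendsto_add[OF q_tendsto[OF AB(1)] q_tendsto[OF AB(2)]] by simp
  qed
  then show "tendsto_in_prob M (\<lambda>n. q n (A \<union> B)) (\<lambda>w. W A w + W B w)"
    by (subst tendsto_in_prob_iff_prob_norm) measurable
qed (use AB in auto)

text \<open>The complement of a long interval has small normal measure, hence uniformly small
  integrals. This reduces an integral over the line to bounded intervals.\<close>

lemma W_exhaust: "(\<lambda>k. prob_norm (\<lambda>w. W {-real k<..real k} w - W UNIV w)) \<longlonglongrightarrow> 0"
proof (rule LIMSEQ_I)
  fix e :: real assume "e > 0"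
  then obtain \<eta> N where \<eta>: "\<eta> > 0" and
    N: "\<And>n B. n \<ge> N \<Longrightarrow> B \<in> sets borel \<Longrightarrow> measure std_normal_distribution B < \<eta> \<Longrightarrow> prob_norm (q n B) \<le> e / 4"
    using q_uniformly_small[of "e / 4"] by auto
  interpret N: prob_space std_normal_distribution by (rule prob_space_normal_density) simp
  have "(\<lambda>k. measure std_normal_distribution {-real k<..real k}) \<longlonglongrightarrow> measure std_normal_distribution (\<Union>k. {-real k<..real k})"
    by (intro N.finite_Lim_measure_incseq) (auto simp: incseq_def)
  moreover have "(\<Union>k. {-real k<..real k}) = UNIV"
  proof -
    have "\<exists>k. x \<in> {-real k<..real k}" for x
    proof -
      obtain k where "\<bar>x\<bar> < real k" using reals_Archimedean2 by blast
      then show ?thesis by (intro exI[of _ k]) auto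
    qed
    then show ?thesis by blast
  qed
  ultimately have "(\<lambda>k. measure std_normal_distribution {-real k<..real k}) \<longlonglongrightarrow> 1"
    using N.prob_space by simp
  from LIMSEQ_D[OF this \<eta>] obtain k0 where
    k0: "\<And>k. k \<ge> k0 \<Longrightarrow> \<bar>measure std_normal_distribution {-real k<..real k} - 1\<bar> < \<eta>" by auto
  have "norm (prob_norm (\<lambda>w. W {-real k<..real k} w - W UNIV w) - 0) < e" if k: "k \<ge> k0" for k
  proof -
    let ?B = "{-real k<..real k}"
    have "measure std_normal_distribution (UNIV - ?B) < \<eta>"
      using N.prob_compl[of ?B] k0[OF k] by simp
    then have small: "prob_norm (q n (UNIV - ?B)) \<le> e / 4" if "n \<ge> N" for n
      using N that by auto
    have "prob_norm (\<lambda>w. W ?B w - W UNIV w) \<le> e / 2"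
    proof (rule W_diff_le)
      fix n
      obtain N' where N': "\<And>n. n \<ge> N' \<Longrightarrow> prob_norm (\<lambda>w. q n UNIV w - W UNIV w) < e / 4"
        using prob_norm_tendstoD[OF q_tendsto[of UNIV], of "e / 4"] \<open>e > 0\<close> by auto
      \<comment> \<open>The threshold of \<open>W_diff_le\<close> has to be a term that exists
        before \<open>N'\<close> is obtained, so it is named by a choice operator.\<close>
      assume "max N (SOME N'. \<forall>n\<ge>N'. prob_norm (\<lambda>w. q n UNIV w - W UNIV w) < e / 4) \<le> n"
      then have n: "n \<ge> N" "prob_norm (\<lambda>w. q n UNIV w - W UNIV w) < e / 4"
        using someI_ex[of "\<lambda>N'. \<forall>n\<ge>N'. prob_norm (\<lambda>w. q n UNIV w - W UNIV w) < e / 4"] N' by auto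
      note [measurable] = q_measurable[of UNIV n] q_measurable[of ?B n] q_measurable[of "UNIV - ?B" n] W(1)[of UNIV]
      have "prob_norm (\<lambda>w. q n ?B w - q n UNIV w) = prob_norm (\<lambda>w. 0 - q n (UNIV - ?B) w)"
      proof (rule prob_norm_cong)
        show "AE w in M. q n ?B w - q n UNIV w = 0 - q n (UNIV - ?B) w"
        proof -
          have "AE w in M. q n UNIV w = q n ?B w + q n (UNIV - ?B) w"
            using simple_integral_Un[OF simple, of ?B "UNIV - ?B" n] by simp
          then show ?thesis by eventually_elim simp
        qed
      qed auto
      then have "prob_norm (\<lambda>w. q n ?B w - q n UNIV w) \<le> e / 4"
        using small[OF n(1)] prob_norm_minus[of "\<lambda>_. 0" "q n (UNIV - ?B)"] by simp
      then show "prob_norm (\<lambda>w. q n ?B w - W UNIV w) \<le> e / 2"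
        using prob_norm_diff[of "q n ?B" "W UNIV" "q n UNIV"] n(2) by simp
    qed (auto intro: W)
    then show ?thesis using \<open>e > 0\<close> by (simp add: prob_norm_nonneg)
  qed
  then show "\<exists>k0. \<forall>k\<ge>k0. norm (prob_norm (\<lambda>w. W {-real k<..real k} w - W UNIV w) - 0) < e" by blast
qed

lemma sum_measure_le:
  assumes I: "finite I" and E: "\<And>i. i \<in> I \<Longrightarrow> E i \<in> sets borel" "\<And>i. i \<in> I \<Longrightarrow> E i \<subseteq> B" "disjoint_family_on E I"
    and B: "B \<in> bounded_borel"
  shows "(\<Sum>i\<in>I. measure lborel (E i)) \<le> measure lborel B"
proof -
  have "emeasure lborel (E i) \<noteq> \<infinity>" if "i \<in> I" for i
    using emeasure_bounded_borel[OF bounded_borel_subset[OF B E(1,2)[OF that]]] by simp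
  then have "(\<Sum>i\<in>I. measure lborel (E i)) = measure lborel (\<Union>i\<in>I. E i)"
    using I E by (intro measure_finite_Union[symmetric]) auto
  also have "\<dots> \<le> measure lborel B"
    using I E B by (intro measure_le_measure) auto
  finally show ?thesis .
qed

text \<open>Outside a set \<open>C0\<close> of small measure the integrands are uniformly close to
  \<open>F\<close>, and \<open>F\<close> is close to its grid values, so there the difference of the
  simple integral and the Riemann sum has coefficients of norm at most \<open>r\<close>. On
  \<open>C0\<close> the Riemann part is small since its coefficients are bounded; the simple
  integral is small by \<open>q_uniformly_small\<close>, as nothing bounds \<open>g n\<close>
  there.\<close>

lemma riem_sum_tendsto_W:
  assumes ab: "a < b" and F: "continuous_on {a..b} F" and fF: "\<And>s. s \<in> {a<..b} \<Longrightarrow> f s = F s"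
  shows "(\<lambda>k. prob_norm (\<lambda>w. riem_sum F (\<lambda>t. L t w) a b k - W {a<..b} w)) \<longlonglongrightarrow> 0"
proof (rule LIMSEQ_I)
  fix e :: real assume e: "e > 0"
  interpret N: prob_space std_normal_distribution by (rule prob_space_normal_density) simp
  \<comment> \<open>\<open>2 * e1\<close> for \<open>H\<close>, \<open>2 * e1\<close> for
    \<open>G\<close> and \<open>e1\<close> for the simple integral over the exceptional set stay
    below \<open>e\<close>.\<close>
  define e1 where "e1 = e / 8"
  define c where "c = e1 * (1 - exp (- e1\<^sup>2 / 2))"
  have e1: "e1 > 0" using e by (simp add: e1_def)
  have c: "c > 0" using e1 by (simp add: c_def)
  obtain \<eta>0 N0 where \<eta>0: "\<eta>0 > 0" and
    N0: "\<And>n B. n \<ge> N0 \<Longrightarrow> B \<in> sets borel \<Longrightarrow> measure std_normal_distribution B < \<eta>0 \<Longrightarrow> prob_norm (q n B) \<le> e1"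
    using q_uniformly_small[OF e1] by auto
  obtain M0 where "\<forall>x\<in>F ` {a..b}. norm x \<le> M0"
    using compact_imp_bounded[OF compact_continuous_image[OF F compact_Icc]] unfolding bounded_iff by blast
  then have M0: "\<And>s. s \<in> {a..b} \<Longrightarrow> norm (F s) \<le> M0" by blast
  obtain K where K: "K \<ge> 0" "\<And>C. Psi C \<le> K * (1 + (norm C)\<^sup>2)" using Psi_bounded by blast
  define PM where "PM = K * (1 + M0\<^sup>2) + 1"
  have PM: "PM > 0" unfolding PM_def using K(1) by (intro add_nonneg_pos mult_nonneg_nonneg) auto
  have PsiF: "Psi (F s) \<le> PM" if "s \<in> {a..b}" for s
  proof -
    have "Psi (F s) \<le> K * (1 + M0\<^sup>2)"
      using K(1) M0[OF that] by (intro order_trans[OF K(2)] mult_left_mono add_left_mono power_mono) auto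
    then show ?thesis by (simp add: PM_def)
  qed
  define R0 where "R0 = max \<bar>a\<bar> \<bar>b\<bar>"
  have R0: "{a<..b} \<subseteq> {-R0..R0}" by (auto simp: R0_def)
  have D: "std_normal_density R0 > 0" by (rule normal_density_pos) simp
  define \<eta> where "\<eta> = min \<eta>0 (c * std_normal_density R0 / PM)"
  have \<eta>: "\<eta> > 0" using \<eta>0 c D PM by (simp add: \<eta>_def)
  have cab: "c / (b - a) > 0" using c ab by simp
  obtain r where r: "r > 0" "\<And>C. norm C \<le> r \<Longrightarrow> Psi C \<le> c / (b - a)"
    using Psi_small[OF cab] by blast
  \<comment> \<open>As in Egorov's theorem: these sets decrease to a Lebesgue null set, which is
    also null for the normal law, so some \<open>A N1\<close> is small.\<close>
  define A where "A N = {s. \<exists>n\<ge>N. norm (g n s - f s) > r / 2}" for N :: nat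
  have A [measurable]: "A N \<in> sets borel" for N
  proof -
    have "A N = (\<Union>n\<in>{N..}. {s \<in> space borel. norm (g n s - f s) > r / 2})" by (auto simp: A_def)
    also have "\<dots> \<in> sets borel" by measurable
    finally show ?thesis .
  qed
  have "AE s in lborel. s \<notin> (\<Inter>N. A N)"
    using g_lim
  proof eventually_elim
    case (elim s)
    obtain N where "\<And>n. n \<ge> N \<Longrightarrow> norm (g n s - f s) < r / 2"
      using LIMSEQ_D[OF elim, of "r / 2"] r(1) by auto
    then have "s \<notin> A N" by (auto simp: A_def not_less intro: less_imp_le)
    then show ?case by blast
  qed
  then have "AE s in std_normal_distribution. s \<notin> (\<Inter>N. A N)"
    by (subst AE_density) auto
  then have "measure std_normal_distribution (\<Inter>N. A N) = 0"
    by (subst N.prob_eq_0) auto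
  moreover have "(\<lambda>N. measure std_normal_distribution (A N)) \<longlonglongrightarrow> measure std_normal_distribution (\<Inter>N. A N)"
    by (intro N.finite_Lim_measure_decseq) (auto simp: decseq_def A_def intro: order_trans)
  ultimately have "(\<lambda>N. measure std_normal_distribution (A N)) \<longlonglongrightarrow> 0" by simp
  from LIMSEQ_D[OF this \<eta>] obtain N1 where N1: "measure std_normal_distribution (A N1) < \<eta>" by auto
  define C0 where "C0 = A N1"
  have C0 [measurable]: "C0 \<in> sets borel" by (simp add: C0_def)
  have gf: "norm (g n s - f s) \<le> r / 2" if "n \<ge> N1" "s \<notin> C0" for n s
    using that by (auto simp: C0_def A_def not_less)
  obtain \<delta> where \<delta>: "\<delta> > 0" "\<And>s s'. s \<in> {a..b} \<Longrightarrow> s' \<in> {a..b} \<Longrightarrow> dist s' s < \<delta> \<Longrightarrow> dist (F s') (F s) < r / 2"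
    using compact_uniformly_continuous[OF F compact_Icc] r(1) unfolding uniformly_continuous_on_def
    by (metis half_gt_zero)
  obtain k0 where k0: "(b - a) / \<delta> < real k0" using reals_Archimedean2 by blast
  have k0pos: "k0 > 0" using k0 ab \<delta>(1) by (metis diff_gt_0_iff_gt divide_pos_pos less_trans of_nat_0_less_iff)
  have mC0: "measure lborel ({a<..b} \<inter> C0) \<le> c / PM"
  proof -
    have "measure lborel ({a<..b} \<inter> C0) \<le> measure std_normal_distribution ({a<..b} \<inter> C0) / std_normal_density R0"
      using R0 by (intro std_normal_measure_ge) auto
    also have "\<dots> \<le> measure std_normal_distribution C0 / std_normal_density R0"
      using D by (intro divide_right_mono N.finite_measure_mono) auto
    also have "\<dots> \<le> c / PM" using N1 D PM by (simp add: \<eta>_def C0_def field_simps)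
    finally show ?thesis .
  qed
  have L_vec: "(\<lambda>w. C *v (L t w - L s w)) \<in> borel_measurable M" for C :: "real^'d^'d" and t s
    using measurable_compose[OF borel_measurable_diff[OF L_measurable L_measurable]
      borel_measurable_continuous_onI[OF linear_continuous_on[OF matrix_vector_mul_bounded_linear]]] .
  have riem_meas: "(\<lambda>w. riem_sum F (\<lambda>t. L t w) a b k) \<in> borel_measurable M" for k
    unfolding riem_sum_def by (intro borel_measurable_sum L_vec)
  have "prob_norm (\<lambda>w. W {a<..b} w - riem_sum F (\<lambda>t. L t w) a b k) \<le> 5 * e1" if k: "k \<ge> k0" for k
  proof (rule W_diff_le[where N = "max N0 N1"])
    fix n assume "max N0 N1 \<le> n"
    then have n: "n \<ge> N0" "n \<ge> N1" by auto
    have kpos: "k > 0" using k k0pos by simp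
    let ?g = "grid a b k"
    define cell where "cell i = {?g i<..?g (Suc i)}" for i
    have mesh: "(b - a) / real k < \<delta>"
    proof -
      have "(b - a) / \<delta> < real k" using k0 k by linarith
      then show ?thesis using \<delta>(1) kpos by (simp add: field_simps)
    qed
    have cell_sub: "cell i \<subseteq> {a<..b}" if "i < k" for i
      using grid_mem[of a b i k] grid_mem[of a b "Suc i" k] ab that by (auto simp: cell_def)
    have cell_bb: "cell i \<in> bounded_borel" for i by (simp add: cell_def)
    have cell_F: "norm (F s - F (?g i)) < r / 2" if "i < k" "s \<in> cell i" for i s
    proof -
      have "?g (Suc i) = ?g i + (b - a) / real k" by (simp add: grid_def algebra_simps add_divide_distrib diff_divide_distrib)
      then have "dist s (?g i) < \<delta>" using that mesh by (auto simp: cell_def dist_real_def)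
      moreover have "s \<in> {a..b}" "?g i \<in> {a..b}" using cell_sub[OF that(1)] that grid_mem[of a b i k] ab by auto
      ultimately show ?thesis using \<delta>(2) by (simp add: dist_norm)
    qed
    have cell_dis: "disjoint_family_on cell {..<k}"
    proof -
      have "cell i \<inter> cell j = {}" if "i < j" for i j
        using grid_mono[of a b "Suc i" j k] ab that by (auto simp: cell_def)
      then show ?thesis unfolding disjoint_family_on_def by (metis Int_commute linorder_neqE_nat)
    qed
    have cell_UN: "(\<Union>i<k. cell i) = {a<..b}"
    proof -
      have "(\<Union>i<j. cell i) = {a<..?g j}" for j
      proof (induction j)
        case (Suc j)
        have "{a<..?g j} \<union> {?g j<..?g (Suc j)} = {a<..?g (Suc j)}"
          using grid_mono[of a b 0 j k] grid_mono[of a b j "Suc j" k] ab by (intro ivl_disj_un_two) auto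
        then show ?case using Suc by (simp add: lessThan_Suc cell_def Un_commute)
      qed simp
      then show ?thesis using kpos by simp
    qed
    \<comment> \<open>The cells are split along the level sets of \<open>g n\<close>, so that the
      simple integral and the Riemann sum run over the same disjoint pieces.\<close>
    define E where "E p = (cell (snd p) - C0) \<inter> g n -` {fst p}" for p
    define I where "I = range (g n) \<times> {..<k}"
    have I: "finite I" using simple_integrandD(1)[OF simple] by (simp add: I_def)
    have gv: "g n -` {C} \<in> sets borel" for C by (rule simple_integrand_vimage_borel[OF simple])
    have E_bb: "E p \<in> bounded_borel" for p
      unfolding E_def using cell_bb gv by (intro bounded_borel_Int1 bounded_borel_Diff) auto
    have E_dis: "disjoint_family_on E I"
      using cell_dis by (fastforce simp: disjoint_family_on_def E_def I_def)
    define H where "H w = (\<Sum>p\<in>I. (fst p - F (?g (snd p))) *v Z (E p) w)" for w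
    define G where "G w = (\<Sum>i<k. F (?g i) *v Z (cell i \<inter> C0) w)" for w
    have H_meas [measurable]: "H \<in> borel_measurable M"
      unfolding H_def[abs_def] by (intro borel_measurable_sum measurable_mult_Z E_bb)
    have G_meas [measurable]: "G \<in> borel_measurable M"
      unfolding G_def[abs_def] by (intro borel_measurable_sum measurable_mult_Z bounded_borel_Int1 cell_bb C0)
    have H_small: "prob_norm H \<le> 2 * e1"
      unfolding H_def[abs_def]
    proof (rule Z_sum_prob_norm[OF I E_bb E_dis e1])
      have "(\<Sum>p\<in>I. measure lborel (E p) * Psi (fst p - F (?g (snd p)))) \<le> (\<Sum>p\<in>I. measure lborel (E p) * (c / (b - a)))"
      proof (rule sum_mono)
        fix p assume p: "p \<in> I"
        show "measure lborel (E p) * Psi (fst p - F (?g (snd p))) \<le> measure lborel (E p) * (c / (b - a))"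
        \<comment> \<open>The bound on the coefficient is read off at a point of the piece; an empty
          piece has measure zero.\<close>
        proof (cases "E p = {}")
          case False
          then obtain s where s: "s \<in> cell (snd p)" "s \<notin> C0" "g n s = fst p" by (auto simp: E_def)
          have i: "snd p < k" using p by (auto simp: I_def)
          have "f s = F s" using cell_sub[OF i] s by (intro fF) auto
          then have "fst p - F (?g (snd p)) = (g n s - f s) + (F s - F (?g (snd p)))" using s by simp
          then have "norm (fst p - F (?g (snd p))) \<le> norm (g n s - f s) + norm (F s - F (?g (snd p)))"
            using norm_triangle_ineq by metis
          also have "\<dots> \<le> r" using gf[OF n(2) s(2)] cell_F[OF i s(1)] by linarith
          finally show ?thesis by (intro mult_left_mono r) auto
        qed simp
      qed
      also have "\<dots> = (\<Sum>p\<in>I. measure lborel (E p)) * (c / (b - a))" by (simp only: sum_distrib_right)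
      also have "\<dots> \<le> measure lborel {a<..b} * (c / (b - a))"
      proof (intro mult_right_mono sum_measure_le)
        show "E p \<subseteq> {a<..b}" if "p \<in> I" for p
        proof -
          have "snd p < k" using that by (auto simp: I_def)
          then show ?thesis using cell_sub[of "snd p"] unfolding E_def by blast
        qed
      qed (use I E_dis bounded_borelD(1)[OF E_bb] cab in auto)
      also have "\<dots> = c" using ab by simp
      finally show "(\<Sum>p\<in>I. measure lborel (E p) * Psi (fst p - F (?g (snd p)))) \<le> e1 * (1 - exp (- e1\<^sup>2 / 2))"
        by (simp add: c_def)
    qed
    have G_small: "prob_norm G \<le> 2 * e1"
      unfolding G_def[abs_def]
    proof (rule Z_sum_prob_norm[OF _ _ _ e1])
      have "(\<Sum>i<k. measure lborel (cell i \<inter> C0) * Psi (F (?g i))) \<le> (\<Sum>i<k. measure lborel (cell i \<inter> C0) * PM)"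
        using grid_mem ab by (intro sum_mono mult_left_mono PsiF) auto
      also have "\<dots> = (\<Sum>i<k. measure lborel (cell i \<inter> C0)) * PM" by (simp only: sum_distrib_right)
      also have "\<dots> \<le> measure lborel ({a<..b} \<inter> C0) * PM"
      proof (intro mult_right_mono sum_measure_le)
        show "cell i \<inter> C0 \<subseteq> {a<..b} \<inter> C0" if "i \<in> {..<k}" for i
          using cell_sub[of i] that by auto
      qed (use cell_dis PM bounded_borelD(1)[OF cell_bb] in \<open>auto simp: disjoint_family_on_def intro: bounded_borel_Int1\<close>)
      also have "\<dots> \<le> c / PM * PM" using PM by (intro mult_right_mono mC0) auto
      also have "\<dots> = c" using PM by simp
      finally show "(\<Sum>i<k. measure lborel (cell i \<inter> C0) * Psi (F (?g i))) \<le> e1 * (1 - exp (- e1\<^sup>2 / 2))"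
        by (simp add: c_def)
    qed (use cell_dis in \<open>auto simp: disjoint_family_on_def intro: bounded_borel_Int1 cell_bb\<close>)
    have J_small: "prob_norm (q n ({a<..b} \<inter> C0)) \<le> e1"
    proof (rule N0[OF n(1)])
      have "measure std_normal_distribution ({a<..b} \<inter> C0) \<le> measure std_normal_distribution C0"
        by (intro N.finite_measure_mono) auto
      then show "measure std_normal_distribution ({a<..b} \<inter> C0) < \<eta>0" using N1 by (simp add: C0_def \<eta>_def)
    qed simp
    have 1: "AE w in M. \<forall>i\<in>{..<k}. Z (cell i) w = L (?g (Suc i)) w - L (?g i) w"
      unfolding cell_def using ab kpos by (intro AE_finite_allI Z_incr grid_strict_mono) auto
    have 2: "AE w in M. \<forall>i\<in>{..<k}. Z (cell i) w = Z (cell i \<inter> C0) w + Z (cell i - C0) w"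
    proof (rule AE_finite_allI)
      fix i assume "i \<in> {..<k}"
      have "AE w in M. Z ((cell i \<inter> C0) \<union> (cell i - C0)) w = Z (cell i \<inter> C0) w + Z (cell i - C0) w"
        by (intro Z_add bounded_borel_Int1 bounded_borel_Diff cell_bb C0) auto
      then show "AE w in M. Z (cell i) w = Z (cell i \<inter> C0) w + Z (cell i - C0) w"
        by (simp add: Int_Diff_Un)
    qed simp
    have 3: "AE w in M. \<forall>i\<in>{..<k}. Z (cell i - C0) w = (\<Sum>C\<in>range (g n). Z (E (C, i)) w)"
    proof (rule AE_finite_allI)
      fix i assume "i \<in> {..<k}"
      have "AE w in M. Z (\<Union>C\<in>range (g n). E (C, i)) w = (\<Sum>C\<in>range (g n). Z (E (C, i)) w)"
        by (rule Z_finite_additive[OF simple_integrandD(1)[OF simple] E_bb]) (auto simp: disjoint_family_on_def E_def)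
      moreover have "(\<Union>C\<in>range (g n). E (C, i)) = cell i - C0" by (auto simp: E_def)
      ultimately show "AE w in M. Z (cell i - C0) w = (\<Sum>C\<in>range (g n). Z (E (C, i)) w)" by simp
    qed simp
    have 4: "AE w in M. \<forall>C\<in>range (g n). Z (({a<..b} - C0) \<inter> g n -` {C}) w = (\<Sum>i<k. Z (E (C, i)) w)"
    proof (rule AE_finite_allI[OF simple_integrandD(1)[OF simple]])
      fix C assume "C \<in> range (g n)"
      have "AE w in M. Z (\<Union>i<k. E (C, i)) w = (\<Sum>i<k. Z (E (C, i)) w)"
        using cell_dis by (intro Z_finite_additive E_bb) (auto simp: disjoint_family_on_def E_def)
      moreover have "(\<Union>i<k. E (C, i)) = ({a<..b} - C0) \<inter> g n -` {C}" unfolding cell_UN[symmetric] by (auto simp: E_def)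
      ultimately show "AE w in M. Z (({a<..b} - C0) \<inter> g n -` {C}) w = (\<Sum>i<k. Z (E (C, i)) w)" by simp
    qed
    have 5: "AE w in M. q n {a<..b} w = q n ({a<..b} \<inter> C0) w + q n ({a<..b} - C0) w"
      using simple_integral_Un[OF simple, of "{a<..b} \<inter> C0" "{a<..b} - C0" n] by (simp add: Int_Diff_Un Int_Diff_disjoint)
    have main: "AE w in M. q n {a<..b} w - riem_sum F (\<lambda>t. L t w) a b k = (q n ({a<..b} \<inter> C0) w + H w) + (0 - G w)"
      using 1 2 3 4 5
    proof eventually_elim
      case (elim w)
      have "q n ({a<..b} - C0) w = (\<Sum>C\<in>range (g n). C *v Z (({a<..b} - C0) \<inter> g n -` {C}) w)"
        unfolding simple_stoch_integral_def using simple_integrandD(1)[OF simple]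
        by (intro sum.mono_neutral_left) auto
      also have "\<dots> = (\<Sum>C\<in>range (g n). \<Sum>i<k. C *v Z (E (C, i)) w)"
        using elim(4) by (intro sum.cong) (auto simp: vec.sum)
      also have "\<dots> = (\<Sum>p\<in>I. fst p *v Z (E p) w)"
        unfolding I_def by (simp add: sum.cartesian_product split_beta)
      finally have a: "q n ({a<..b} - C0) w = (\<Sum>p\<in>I. fst p *v Z (E p) w)" .
      have "(\<Sum>i<k. F (?g i) *v Z (cell i - C0) w) = (\<Sum>i<k. \<Sum>C\<in>range (g n). F (?g i) *v Z (E (C, i)) w)"
        using elim(3) by (intro sum.cong) (auto simp: vec.sum)
      also have "\<dots> = (\<Sum>p\<in>I. F (?g (snd p)) *v Z (E p) w)"
        unfolding I_def by (subst sum.swap) (simp add: sum.cartesian_product split_beta)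
      finally have b: "(\<Sum>i<k. F (?g i) *v Z (cell i - C0) w) = (\<Sum>p\<in>I. F (?g (snd p)) *v Z (E p) w)" .
      have "riem_sum F (\<lambda>t. L t w) a b k = (\<Sum>i<k. F (?g i) *v Z (cell i) w)"
        unfolding riem_sum_def using elim(1) by (intro sum.cong) auto
      also have "\<dots> = (\<Sum>i<k. F (?g i) *v (Z (cell i \<inter> C0) w + Z (cell i - C0) w))"
        using elim(2) by (intro sum.cong) auto
      also have "\<dots> = G w + (\<Sum>p\<in>I. F (?g (snd p)) *v Z (E p) w)"
        by (simp add: G_def matrix_vector_right_distrib sum.distrib b)
      finally show ?case
        unfolding elim(5) a H_def by (simp add: matrix_vector_mult_diff_rdistrib sum_subtractf)
    qed
    note [measurable] = q_measurable[of "{a<..b}" n] q_measurable[of "{a<..b} \<inter> C0" n] riem_meas[of k]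
    have "prob_norm (\<lambda>w. q n {a<..b} w - riem_sum F (\<lambda>t. L t w) a b k) =
      prob_norm (\<lambda>w. (q n ({a<..b} \<inter> C0) w + H w) + (0 - G w))"
      by (rule prob_norm_cong[OF _ _ main]) measurable
    also have "\<dots> \<le> prob_norm (\<lambda>w. q n ({a<..b} \<inter> C0) w + H w) + prob_norm (\<lambda>w. 0 - G w)"
      by (rule prob_norm_triangle) measurable
    also have "prob_norm (\<lambda>w. q n ({a<..b} \<inter> C0) w + H w) \<le> prob_norm (q n ({a<..b} \<inter> C0)) + prob_norm H"
      by (rule prob_norm_triangle) measurable
    also have "prob_norm (\<lambda>w. 0 - G w) = prob_norm G" using prob_norm_minus[of "\<lambda>_. 0" G] by simp
    finally show "prob_norm (\<lambda>w. q n {a<..b} w - riem_sum F (\<lambda>t. L t w) a b k) \<le> 5 * e1"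
      using H_small G_small J_small by linarith
  qed (use riem_meas in auto)
  then have "norm (prob_norm (\<lambda>w. riem_sum F (\<lambda>t. L t w) a b k - W {a<..b} w) - 0) < e" if "k \<ge> k0" for k
    using that e prob_norm_minus[of "W {a<..b}" "\<lambda>w. riem_sum F (\<lambda>t. L t w) a b k"]
    by (fastforce simp: prob_norm_nonneg e1_def)
  then show "\<exists>k0. \<forall>k\<ge>k0. norm (prob_norm (\<lambda>w. riem_sum F (\<lambda>t. L t w) a b k - W {a<..b} w) - 0) < e" by blast
qed

end

section \<open>The Ornstein--Uhlenbeck recursion\<close>

text \<open>The integral of \<open>e\<^sup>(\<^sup>t\<^sup>-\<^sup>s\<^sup>)\<^sup>A \<Sigma>\<close> against a path \<open>l\<close> with \<open>l a = 0\<close>, after integration by parts.\<close>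

definition ou_path :: "real^'d^'d \<Rightarrow> real^'d^'d \<Rightarrow> real \<Rightarrow> (real \<Rightarrow> real^'d) \<Rightarrow> real \<Rightarrow> real^'d" where
  "ou_path A \<Sigma> a l t = \<Sigma> *v l t + integral {a..t} (\<lambda>s. (A ** mexp A (t - s) ** \<Sigma>) *v l s)"

lemma mexp_diff_has_vector_derivative:
  "((\<lambda>s. mexp A (t - s) ** \<Sigma>) has_vector_derivative - (A ** mexp A (t - s) ** \<Sigma>)) (at s within S)"
proof -
  have 1: "((\<lambda>s. mexp A (t - s)) has_vector_derivative (- 1) *\<^sub>R (A ** mexp A (t - s))) (at s within S)"
    by (rule derivative_eq_intros refl | simp)+
  have "bounded_linear (\<lambda>B. B ** \<Sigma>)"
    by (rule bounded_bilinear.bounded_linear_left[OF bounded_bilinear_matrix_matrix_mult])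
  from bounded_linear.has_vector_derivative[OF this 1] show ?thesis
    by (simp add: bounded_bilinear.minus_left[OF bounded_bilinear_matrix_matrix_mult])
qed

lemma continuous_on_matrix_mult:
  "continuous_on S f \<Longrightarrow> continuous_on S g \<Longrightarrow> continuous_on S (\<lambda>x. f x ** g x)"
  for f :: "_ \<Rightarrow> real^'n^'m" and g :: "_ \<Rightarrow> real^'p^'n"
  by (rule bounded_bilinear.continuous_on[OF bounded_bilinear_matrix_matrix_mult])

lemma continuous_on_matrix_vector_mult:
  "continuous_on S f \<Longrightarrow> continuous_on S g \<Longrightarrow> continuous_on S (\<lambda>x. f x *v g x)"
  for f :: "_ \<Rightarrow> real^'n^'m" and g :: "_ \<Rightarrow> real^'n"
  by (rule bounded_bilinear.continuous_on[OF bounded_bilinear_matrix_vector_mult])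

lemma continuous_on_ou_kernel: "continuous_on S (\<lambda>s. A ** mexp A (t - s) ** \<Sigma>)"
  by (intro continuous_on_matrix_mult continuous_intros)

lemma ou_kernel_integrable:
  assumes l: "cadlag_on {a..t} l"
  shows "(\<lambda>s. (A ** mexp A (u - s) ** \<Sigma>) *v l s) integrable_on {a..t}"
proof (cases "a < t")
  case True
  have "(\<lambda>s. - (A ** mexp A (u - s) ** \<Sigma>) *v l s) integrable_on {a..t}"
    by (rule riem_sum_tendsto(1)[OF True l mexp_diff_has_vector_derivative])
       (intro continuous_on_minus continuous_on_ou_kernel)
  then have "(\<lambda>s. - ((A ** mexp A (u - s) ** \<Sigma>) *v l s)) integrable_on {a..t}"
    by (simp add: bounded_bilinear.minus_left[OF bounded_bilinear_matrix_vector_mult])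
  then show ?thesis by (simp add: integrable_neg_iff)
next
  case False
  then show ?thesis by (cases "a = t") (auto intro: has_integral_integrable[OF has_integral_refl(2)])
qed

lemma riem_sum_tendsto_ou_path:
  assumes at: "a < t" and l: "cadlag_on {a..t} l" and l0: "l a = 0"
  shows "riem_sum (\<lambda>s. mexp A (t - s) ** \<Sigma>) l a t \<longlonglongrightarrow> ou_path A \<Sigma> a l t"
proof -
  have "riem_sum (\<lambda>s. mexp A (t - s) ** \<Sigma>) l a t \<longlonglongrightarrow> (mexp A (t - t) ** \<Sigma>) *v l t - (mexp A (t - a) ** \<Sigma>) *v l a
      - integral {a..t} (\<lambda>s. - (A ** mexp A (t - s) ** \<Sigma>) *v l s)"
    by (rule riem_sum_tendsto(2)[OF at l mexp_diff_has_vector_derivative])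
       (intro continuous_on_minus continuous_on_ou_kernel)
  also have "(\<lambda>s. - (A ** mexp A (t - s) ** \<Sigma>) *v l s) = (\<lambda>s. - ((A ** mexp A (t - s) ** \<Sigma>) *v l s))"
    by (simp add: bounded_bilinear.minus_left[OF bounded_bilinear_matrix_vector_mult])
  finally show ?thesis by (simp add: ou_path_def l0)
qed

lemma ou_path_initial: "l a = 0 \<Longrightarrow> ou_path A \<Sigma> a l a = 0"
  by (simp add: ou_path_def)

text \<open>By the group property the factor \<open>mexp A t\<close> leaves the integral, and the
  remaining integrand does not depend on \<open>t\<close>.\<close>

lemma ou_path_eq:
  assumes l: "cadlag_on {a..t} l"
  shows "ou_path A \<Sigma> a l t = \<Sigma> *v l t + (A ** mexp A t) *v integral {a..t} (\<lambda>s. (mexp A (- s) ** \<Sigma>) *v l s)"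
    and "(\<lambda>s. (mexp A (- s) ** \<Sigma>) *v l s) integrable_on {a..t}"
proof -
  have k: "A ** mexp A (t - s) ** \<Sigma> = (A ** mexp A t) ** (mexp A (- s) ** \<Sigma>)" for s t
    using mexp_add[of A t "- s"] by (simp add: matrix_mul_assoc)
  have inv: "mexp A (- t) ** mexp A t = mat 1" for t using mexp_add[of A "- t" t] by simp
  show int: "(\<lambda>s. (mexp A (- s) ** \<Sigma>) *v l s) integrable_on {a..t}"
  proof (cases "a < t")
    case True
    \<comment> \<open>\<open>A\<close> may be singular, so a primitive of the kernel comes from the fundamental theorem of calculus.\<close>
    define G where "G x = integral {a..x} (\<lambda>s. mexp A (- s) ** \<Sigma>)" for x
    have c: "continuous_on {a..t} (\<lambda>s. mexp A (- s) ** \<Sigma>)"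
      by (intro continuous_on_matrix_mult continuous_intros)
    have "(G has_vector_derivative mexp A (- s) ** \<Sigma>) (at s within {a..t})" if "s \<in> {a..t}" for s
      unfolding G_def using integral_has_vector_derivative[OF c that] .
    from riem_sum_tendsto(1)[OF True l this c] show ?thesis .
  next
    case False
    then show ?thesis by (cases "a = t") (auto intro: has_integral_integrable[OF has_integral_refl(2)])
  qed
  have "integral {a..t} (\<lambda>s. (A ** mexp A t) *v ((mexp A (- s) ** \<Sigma>) *v l s)) =
     (A ** mexp A t) *v integral {a..t} (\<lambda>s. (mexp A (- s) ** \<Sigma>) *v l s)"
    using integral_linear[OF int matrix_vector_mul_bounded_linear[of "A ** mexp A t"]] by (simp add: comp_def)
  then show "ou_path A \<Sigma> a l t = \<Sigma> *v l t + (A ** mexp A t) *v integral {a..t} (\<lambda>s. (mexp A (- s) ** \<Sigma>) *v l s)"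
    unfolding ou_path_def k by (simp add: matrix_vector_mul_assoc matrix_mul_assoc)
qed

text \<open>The integral part is continuous in \<open>t\<close>, so \<open>ou_path\<close> inherits
  from \<open>l\<close> that it is cadlag or continuous.\<close>

lemma ou_path_continuous_part:
  assumes l: "cadlag_on {a..} l"
  obtains c where "continuous_on {a..} c" "\<And>t. t \<in> {a..} \<Longrightarrow> ou_path A \<Sigma> a l t = \<Sigma> *v l t + c t"
proof
  let ?J = "\<lambda>t. integral {a..t} (\<lambda>s. (mexp A (- s) ** \<Sigma>) *v l s)"
  have l': "cadlag_on {a..t} l" for t by (rule cadlag_on_subset[OF l]) auto
  show "ou_path A \<Sigma> a l t = \<Sigma> *v l t + (A ** mexp A t) *v ?J t" for t
    by (rule ou_path_eq(1)[OF l'])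
  have "continuous_on {a..t} ?J" for t
    by (rule indefinite_integral_continuous_1[OF ou_path_eq(2)[OF l']])
  then have "continuous_on {a..} ?J"
  proof (intro continuous_on_eq_continuous_within[THEN iffD2] ballI)
    fix t assume "t \<in> {a..}"
    then have "continuous (at t within {a..t + 1}) ?J"
      using \<open>\<And>t. continuous_on {a..t} ?J\<close>[of "t + 1"] by (auto simp: continuous_on_eq_continuous_within)
    moreover have "at t within {a..t + 1} = at t within {a..}"
      by (rule at_within_nhd[of t "{..<t + 1}"]) auto
    ultimately show "continuous (at t within {a..}) ?J" by simp
  qed
  then show "continuous_on {a..} (\<lambda>t. (A ** mexp A t) *v ?J t)"
    by (intro continuous_on_matrix_vector_mult continuous_on_matrix_mult continuous_intros)
qed

lemma cadlag_on_linear_add: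
  fixes l :: "real \<Rightarrow> real^'d"
  assumes l: "cadlag_on S l" and c: "continuous_on S c"
  shows "cadlag_on S (\<lambda>t. (\<Sigma> :: real^'d^'d) *v l t + c t)"
  unfolding cadlag_on_def
proof (intro ballI conjI)
  fix t assume t: "t \<in> S"
  have c': "(c \<longlongrightarrow> c t) (at t within (S \<inter> U))" for U
    using c t by (auto simp: continuous_on_def intro: tendsto_within_subset)
  note lim = bounded_linear.tendsto[OF matrix_vector_mul_bounded_linear[of \<Sigma>]]
  show "((\<lambda>t. \<Sigma> *v l t + c t) \<longlongrightarrow> \<Sigma> *v l t + c t) (at t within (S \<inter> {t<..}))"
    using l t by (intro tendsto_add c' lim) (auto simp: cadlag_on_def)
  obtain x where "(l \<longlongrightarrow> x) (at t within (S \<inter> {..<t}))"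
    using l t unfolding cadlag_on_def by blast
  then show "\<exists>x. ((\<lambda>t. \<Sigma> *v l t + c t) \<longlongrightarrow> x) (at t within (S \<inter> {..<t}))"
    using tendsto_add[OF lim c'] by blast
qed

lemma ou_path_cadlag: "cadlag_on {a..} l \<Longrightarrow> cadlag_on {a..} (ou_path A \<Sigma> a l)"
proof -
  assume l: "cadlag_on {a..} l"
  then obtain c where c: "continuous_on {a..} c" "\<And>t. t \<in> {a..} \<Longrightarrow> ou_path A \<Sigma> a l t = \<Sigma> *v l t + c t"
    using ou_path_continuous_part by blast
  have "cadlag_on {a..} (\<lambda>t. \<Sigma> *v l t + c t)" by (rule cadlag_on_linear_add[OF l c(1)])
  moreover have "cadlag_on {a..} (ou_path A \<Sigma> a l) = cadlag_on {a..} (\<lambda>t. \<Sigma> *v l t + c t)"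
    unfolding cadlag_on_def
  proof (intro ball_cong refl arg_cong2[where f = "(\<and>)"] ex_cong1)
    fix t x assume t: "t \<in> {a..}"
    have ev: "eventually (\<lambda>s. ou_path A \<Sigma> a l s = \<Sigma> *v l s + c s) (at t within ({a..} \<inter> U))" for U
      by (rule eventually_at_topological[THEN iffD2]) (use c(2) in auto)
    show "((ou_path A \<Sigma> a l) \<longlongrightarrow> ou_path A \<Sigma> a l t) (at t within {a..} \<inter> {t<..}) =
      ((\<lambda>t. \<Sigma> *v l t + c t) \<longlongrightarrow> \<Sigma> *v l t + c t) (at t within {a..} \<inter> {t<..})"
      unfolding c(2)[OF t] by (rule tendsto_cong[OF ev])
    show "((ou_path A \<Sigma> a l) \<longlongrightarrow> x) (at t within {a..} \<inter> {..<t}) =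
      ((\<lambda>t. \<Sigma> *v l t + c t) \<longlongrightarrow> x) (at t within {a..} \<inter> {..<t})"
      by (rule tendsto_cong[OF ev])
  qed
  ultimately show ?thesis by simp
qed

lemma ou_path_continuous:
  assumes "continuous_on {a..} l" shows "continuous_on {a..} (ou_path A \<Sigma> a l)"
proof -
  obtain c where c: "continuous_on {a..} c" "\<And>t. t \<in> {a..} \<Longrightarrow> ou_path A \<Sigma> a l t = \<Sigma> *v l t + c t"
    using ou_path_continuous_part continuous_on_imp_cadlag_on[OF assms] by blast
  have "continuous_on {a..} (\<lambda>t. \<Sigma> *v l t + c t)"
    using assms c(1) by (intro continuous_on_add continuous_on_matrix_vector_mult continuous_on_const)
  then show ?thesis using c(2) by (metis (no_types, lifting) continuous_on_cong)
qed

lemma ou_path_diff: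
  assumes "cadlag_on {a..t} l" "cadlag_on {a..t} g"
  shows "ou_path A \<Sigma> a (\<lambda>s. l s - g s) t = ou_path A \<Sigma> a l t - ou_path A \<Sigma> a g t"
  unfolding ou_path_def
  using Henstock_Kurzweil_Integration.integral_diff[OF ou_kernel_integrable[OF assms(1), of A t \<Sigma>] ou_kernel_integrable[OF assms(2), of A t \<Sigma>]]
  by (simp add: matrix_vector_mult_diff_distrib)

text \<open>With linearity this is Lipschitz continuity in the supremum norm: uniformly close
  driving paths give uniformly close processes on \<open>{a..T}\<close>.\<close>

lemma ou_path_bound:
  fixes A \<Sigma> :: "real^'d^'d"
  assumes "a \<le> T"
  obtains C where "C > 0" "\<And>l t \<delta>. t \<in> {a..T} \<Longrightarrow> cadlag_on {a..t} l \<Longrightarrow> (\<And>s. s \<in> {a..t} \<Longrightarrow> norm (l s) \<le> \<delta>) \<Longrightarrow>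
    norm (ou_path A \<Sigma> a l t) \<le> C * \<delta>"
proof -
  have cont: "continuous_on {0..T - a} (\<lambda>u. A ** mexp A u ** \<Sigma>)"
    by (intro continuous_on_matrix_mult continuous_intros)
  obtain B where "\<forall>x\<in>(\<lambda>u. A ** mexp A u ** \<Sigma>) ` {0..T - a}. norm x \<le> B"
    using compact_imp_bounded[OF compact_continuous_image[OF cont compact_Icc]] unfolding bounded_iff by blast
  then have B: "\<And>u. u \<in> {0..T - a} \<Longrightarrow> norm (A ** mexp A u ** \<Sigma>) \<le> B" by blast
  have B0: "B \<ge> 0" using B[of 0] assms by (auto intro: order_trans[OF norm_ge_zero])
  show thesis
  proof (rule that[of "norm \<Sigma> + B * (T - a) + 1"])
    show "norm \<Sigma> + B * (T - a) + 1 > 0" using B0 assms by (intro add_nonneg_pos add_nonneg_nonneg mult_nonneg_nonneg) auto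
    fix l :: "real \<Rightarrow> real^'d" and t \<delta> assume t: "t \<in> {a..T}" and l: "cadlag_on {a..t} l" and \<delta>: "\<And>s. s \<in> {a..t} \<Longrightarrow> norm (l s) \<le> \<delta>"
    have \<delta>0: "\<delta> \<ge> 0" using \<delta>[of a] t by (auto intro: order_trans[OF norm_ge_zero])
    have 1: "norm (\<Sigma> *v l t) \<le> norm \<Sigma> * \<delta>"
      using t by (intro order_trans[OF norm_matrix_vector_mult_le] mult_left_mono \<delta>) auto
    have "norm (integral {a..t} (\<lambda>s. (A ** mexp A (t - s) ** \<Sigma>) *v l s)) \<le> B * \<delta> * (t - a)"
    proof -
      have "norm ((A ** mexp A (t - s) ** \<Sigma>) *v l s) \<le> B * \<delta>" if "s \<in> {a..t}" for s
        using that t B0 by (intro order_trans[OF norm_matrix_vector_mult_le] mult_mono \<delta> B) auto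
      then have "norm (integral (cbox a t) (\<lambda>s. (A ** mexp A (t - s) ** \<Sigma>) *v l s)) \<le> B * \<delta> * Henstock_Kurzweil_Integration.content (cbox a t)"
        using ou_kernel_integrable[OF l] B0 \<delta>0 by (intro integrable_bound) auto
      then show ?thesis using t by simp
    qed
    also have "\<dots> \<le> B * \<delta> * (T - a)" using t B0 \<delta>0 by (intro mult_left_mono) auto
    finally have "norm (ou_path A \<Sigma> a l t) \<le> norm \<Sigma> * \<delta> + B * \<delta> * (T - a)"
      unfolding ou_path_def using 1 by (intro order_trans[OF norm_triangle_ineq] add_mono)
    also have "\<dots> \<le> (norm \<Sigma> + B * (T - a) + 1) * \<delta>" using \<delta>0 by (simp add: algebra_simps)
    finally show "norm (ou_path A \<Sigma> a l t) \<le> (norm \<Sigma> + B * (T - a) + 1) * \<delta>" .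
  qed
qed

text \<open>The flow property: the process restarts at \<open>t0\<close>, driven by the increments
  from \<open>t0\<close> on. Recentring \<open>l\<close> at \<open>t0\<close> costs a boundary term,
  since the kernel applied to the constant vector \<open>l t0\<close> integrates explicitly.\<close>

lemma ou_path_cocycle:
  assumes at: "a \<le> t0" "t0 \<le> t" and l: "cadlag_on {a..t} l"
  shows "ou_path A \<Sigma> a l t = mexp A (t - t0) *v ou_path A \<Sigma> a l t0 + ou_path A \<Sigma> t0 (\<lambda>s. l s - l t0) t"
proof -
  let ?k = "\<lambda>u s. A ** mexp A (u - s) ** \<Sigma>"
  have l1: "cadlag_on {a..t0} l" and l2: "cadlag_on {t0..t} l"
    using at by (auto intro: cadlag_on_subset[OF l])
  have I1: "(\<lambda>s. ?k t s *v l s) integrable_on {a..t}" by (rule ou_kernel_integrable[OF l])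
  have c: "integral {a..t} (\<lambda>s. ?k t s *v l s) = integral {a..t0} (\<lambda>s. ?k t s *v l s) + integral {t0..t} (\<lambda>s. ?k t s *v l s)"
    by (rule Henstock_Kurzweil_Integration.integral_combine[symmetric, OF at I1])
  have k: "?k t s = mexp A (t - t0) ** ?k t0 s" for s
    using mexp_add[of A "t - t0" "t0 - s"] by (simp add: matrix_mul_assoc mexp_commute)
  have e: "integral {a..t0} (\<lambda>s. ?k t s *v l s) = mexp A (t - t0) *v integral {a..t0} (\<lambda>s. ?k t0 s *v l s)"
    using integral_linear[OF ou_kernel_integrable[OF l1, of A t0 \<Sigma>] matrix_vector_mul_bounded_linear[of "mexp A (t - t0)"]]
    unfolding k by (simp add: comp_def matrix_vector_mul_assoc)
  have bl: "bounded_linear (\<lambda>B. B *v l t0)"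
    by (rule bounded_bilinear.bounded_linear_left[OF bounded_bilinear_matrix_vector_mult])
  have "((\<lambda>s. - ?k t s *v l t0) has_integral (mexp A (t - t) ** \<Sigma>) *v l t0 - (mexp A (t - t0) ** \<Sigma>) *v l t0) {t0..t}"
    by (intro fundamental_theorem_of_calculus at bounded_linear.has_vector_derivative[OF bl mexp_diff_has_vector_derivative])
  then have "((\<lambda>s. - (- ?k t s *v l t0)) has_integral - (\<Sigma> *v l t0 - (mexp A (t - t0) ** \<Sigma>) *v l t0)) {t0..t}"
    by (intro has_integral_neg) simp
  then have h: "((\<lambda>s. ?k t s *v l t0) has_integral (mexp A (t - t0) ** \<Sigma>) *v l t0 - \<Sigma> *v l t0) {t0..t}"
    by (simp add: bounded_bilinear.minus_left[OF bounded_bilinear_matrix_vector_mult])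
  have "integral {t0..t} (\<lambda>s. ?k t s *v (l s - l t0)) = integral {t0..t} (\<lambda>s. ?k t s *v l s) - ((mexp A (t - t0) ** \<Sigma>) *v l t0 - \<Sigma> *v l t0)"
    unfolding matrix_vector_mult_diff_distrib
    using Henstock_Kurzweil_Integration.integral_diff[OF ou_kernel_integrable[OF l2, of A t \<Sigma>] has_integral_integrable[OF h]] integral_unique[OF h] by simp
  then show ?thesis
    unfolding ou_path_def c e by (simp add: matrix_vector_right_distrib matrix_vector_mult_diff_distrib matrix_vector_mul_assoc)
qed

text \<open>If \<open>y + f\<close> is to solve the equation driven by \<open>g\<close>, its
  integrated form is \<open>f t = p t + \<Sigma> *v g t\<close>, where \<open>p\<close> is the
  integral of the drift \<open>A *v (y + f s)\<close>. As \<Sigma> is invertible, this determines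
  \<open>g\<close>.\<close>

lemma ou_path_target:
  fixes A \<Sigma> :: "real^'d^'d" and f :: "real \<Rightarrow> real^'d"
  assumes det: "det \<Sigma> \<noteq> 0" and tT: "t0 \<le> T" and f: "continuous_on {t0..T} f" and f0: "f t0 = 0"
  obtains g where "continuous_on {t0..T} g" "g t0 = 0"
    "\<And>t. t \<in> {t0..T} \<Longrightarrow> mexp A (t - t0) *v y - y + ou_path A \<Sigma> t0 g t = f t"
proof -
  define p where "p t = integral {t0..t} (\<lambda>s. A *v (y + f s))" for t
  obtain \<Sigma>' where inv: "\<Sigma> ** \<Sigma>' = mat 1"
    using det unfolding invertible_det_nz[symmetric] invertible_def by blast
  define g where "g t = \<Sigma>' *v (f t - p t)" for t
  have \<Sigma>g: "\<Sigma> *v g t = f t - p t" for t by (simp add: g_def matrix_vector_mul_assoc inv)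
  have ca: "continuous_on {t0..T} (\<lambda>s. A *v (y + f s))"
    by (intro continuous_on_matrix_vector_mult continuous_intros f)
  have p': "(p has_vector_derivative A *v (y + f s)) (at s within {t0..T})" if "s \<in> {t0..T}" for s
    unfolding p_def by (rule integral_has_vector_derivative[OF ca that])
  have pc: "continuous_on {t0..T} p"
    unfolding continuous_on_eq_continuous_within using has_vector_derivative_continuous[OF p'] by blast
  have p0: "p t0 = 0" by (simp add: p_def)
  show thesis
  proof (rule that[of g])
    show gc: "continuous_on {t0..T} g"
      unfolding g_def by (intro continuous_on_matrix_vector_mult continuous_intros f pc)
    show "g t0 = 0" by (simp add: g_def f0 p0)
    fix t assume t: "t \<in> {t0..T}"
    \<comment> \<open>A primitive of the kernel applied to \<open>g\<close>: the two terms of the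
      product rule combine to \<open>f - p\<close>, which is \<open>\<Sigma> *v g\<close>.\<close>
    let ?h = "\<lambda>s. mexp A (t - s) *v (y + p s)"
    have hd: "(?h has_vector_derivative (A ** mexp A (t - s) ** \<Sigma>) *v g s) (at s within {t0..t})" if s: "s \<in> {t0..t}" for s
    proof -
      have 1: "((\<lambda>s. mexp A (t - s)) has_vector_derivative (- 1) *\<^sub>R (A ** mexp A (t - s))) (at s within {t0..t})"
        by (rule derivative_eq_intros refl | simp)+
      have "(p has_vector_derivative A *v (y + f s)) (at s within {t0..t})"
        using s t by (intro has_vector_derivative_within_subset[OF p']) auto
      then have 2: "((\<lambda>s. y + p s) has_vector_derivative 0 + A *v (y + f s)) (at s within {t0..t})"
        by (intro has_vector_derivative_add has_vector_derivative_const)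
      have "(?h has_vector_derivative mexp A (t - s) *v (0 + A *v (y + f s)) + ((- 1) *\<^sub>R (A ** mexp A (t - s))) *v (y + p s)) (at s within {t0..t})"
        by (rule bounded_bilinear.has_vector_derivative[OF bounded_bilinear_matrix_vector_mult 1 2])
      also have "mexp A (t - s) *v (0 + A *v (y + f s)) + ((- 1) *\<^sub>R (A ** mexp A (t - s))) *v (y + p s) =
         (A ** mexp A (t - s) ** \<Sigma>) *v g s"
        by (simp add: matrix_vector_mul_assoc mexp_commute bounded_bilinear.minus_left[OF bounded_bilinear_matrix_vector_mult]
             \<Sigma>g matrix_vector_mult_diff_distrib matrix_vector_right_distrib flip: matrix_vector_mul_assoc[of "A ** mexp A (t - s)" \<Sigma>])
      finally show ?thesis .
    qed
    have "((\<lambda>s. (A ** mexp A (t - s) ** \<Sigma>) *v g s) has_integral ?h t - ?h t0) {t0..t}"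
      using t by (intro fundamental_theorem_of_calculus hd) auto
    from integral_unique[OF this]
    have "ou_path A \<Sigma> t0 g t = (f t - p t) + (?h t - ?h t0)" unfolding ou_path_def \<Sigma>g by simp
    then show "mexp A (t - t0) *v y - y + ou_path A \<Sigma> t0 g t = f t" by (simp add: p0)
  qed
qed

section \<open>Comparing limits in probability with pathwise limits\<close>

context prob_space begin

lemma prob_norm_limit_unique:
  fixes X :: "nat \<Rightarrow> 'a \<Rightarrow> 'b::{second_countable_topology, real_normed_vector}"
  assumes X [measurable]: "\<And>k. X k \<in> borel_measurable M" and U [measurable]: "U \<in> borel_measurable M" and V [measurable]: "V \<in> borel_measurable M"
    and lim: "(\<lambda>k. prob_norm (\<lambda>w. X k w - U w)) \<longlonglongrightarrow> 0" "(\<lambda>k. prob_norm (\<lambda>w. X k w - V w)) \<longlonglongrightarrow> 0"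
  shows "AE w in M. U w = V w"
proof -
  have "(\<lambda>k. prob_norm (\<lambda>w. X k w - U w) + prob_norm (\<lambda>w. X k w - V w)) \<longlonglongrightarrow> 0"
    using tendsto_add[OF lim] by simp
  moreover have "prob_norm (\<lambda>w. U w - V w) \<le> prob_norm (\<lambda>w. X k w - U w) + prob_norm (\<lambda>w. X k w - V w)" for k
    using prob_norm_diff[OF U V X[of k]] prob_norm_minus[of U "X k"] by simp
  ultimately have "prob_norm (\<lambda>w. U w - V w) \<le> 0"
    by (intro LIMSEQ_le_const) auto
  then have "AE w in M. U w - V w = 0" by (intro prob_norm_eq_0) measurable
  then show ?thesis by eventually_elim simp
qed

lemma prob_norm_pointwise:
  fixes X :: "nat \<Rightarrow> 'a \<Rightarrow> 'b::{second_countable_topology, real_normed_vector}"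
  assumes X [measurable]: "\<And>k. X k \<in> borel_measurable M" and U [measurable]: "U \<in> borel_measurable M"
    and lim: "\<And>w. w \<in> space M \<Longrightarrow> (\<lambda>k. X k w) \<longlonglongrightarrow> U w"
  shows "(\<lambda>k. prob_norm (\<lambda>w. X k w - U w)) \<longlonglongrightarrow> 0"
proof -
  have "(\<lambda>k. LINT w|M. min 1 (norm (X k w - U w))) \<longlonglongrightarrow> (LINT w|M. 0)"
  proof (rule integral_dominated_convergence[where w = "\<lambda>_. 1"])
    show "AE w in M. (\<lambda>k. min 1 (norm (X k w - U w))) \<longlonglongrightarrow> 0"
    proof (rule AE_I2)
      fix w assume "w \<in> space M"
      from tendsto_min[OF tendsto_const[of 1] tendsto_norm[OF tendsto_diff[OF lim[OF this] tendsto_const[of "U w"]]]]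
      show "(\<lambda>k. min 1 (norm (X k w - U w))) \<longlonglongrightarrow> 0" by simp
    qed
  qed auto
  then show ?thesis by (simp add: prob_norm_def)
qed

text \<open>Where \<open>norm (X w)\<close> exceeds \<open>1\<close> the truncated left-hand side is
  at most \<open>1\<close>, which accounts for the summand \<open>1\<close> in the factor.\<close>

lemma prob_norm_matrix:
  fixes X :: "'a \<Rightarrow> real^'n" and B :: "real^'n^'m"
  assumes [measurable]: "X \<in> borel_measurable M"
  shows "prob_norm (\<lambda>w. B *v X w) \<le> (1 + norm B) * prob_norm X"
proof -
  have [measurable]: "(\<lambda>w. B *v X w) \<in> borel_measurable M"
    using measurable_compose[OF assms borel_measurable_continuous_onI[OF linear_continuous_on[OF matrix_vector_mul_bounded_linear]]] .
  have "prob_norm (\<lambda>w. B *v X w) \<le> (LINT w|M. (1 + norm B) * min 1 (norm (X w)))"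
    unfolding prob_norm_def
  proof (intro integral_mono integrable_min_norm integrable_mult_right)
    fix w
    show "min 1 (norm (B *v X w)) \<le> (1 + norm B) * min 1 (norm (X w))"
    proof (cases "norm (X w) \<le> 1")
      case True
      then have "(1 + norm B) * min 1 (norm (X w)) = norm (X w) + norm B * norm (X w)"
        by (simp add: min_absorb2 distrib_right)
      then show ?thesis using norm_matrix_vector_mult_le[of B "X w"] norm_ge_zero[of "X w"] by linarith
    next
      case False
      then have "(1 + norm B) * min 1 (norm (X w)) = 1 + norm B" by (simp add: min_absorb1)
      moreover have "min 1 (norm (B *v X w)) \<le> 1 + norm B"
        by (rule order_trans[OF min.cobounded1]) simp
      ultimately show ?thesis by (simp only:)
    qed
  qed measurable
  then show ?thesis by (simp add: prob_norm_def)
qed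

text \<open>Summable expectations make the truncated distances almost surely summable, hence
  convergent to zero; below \<open>1\<close> the truncation is not felt.\<close>

lemma AE_tendsto_of_prob_norm:
  fixes X :: "nat \<Rightarrow> 'a \<Rightarrow> 'b::{second_countable_topology, real_normed_vector}"
  assumes X [measurable]: "\<And>k. X k \<in> borel_measurable M" and U [measurable]: "U \<in> borel_measurable M"
    and le: "\<And>k. prob_norm (\<lambda>w. X k w - U w) \<le> (1/2) ^ k"
  shows "AE w in M. (\<lambda>k. X k w) \<longlonglongrightarrow> U w"
proof -
  have "(\<integral>\<^sup>+w. (\<Sum>k. ennreal (min 1 (norm (X k w - U w)))) \<partial>M) = (\<Sum>k. \<integral>\<^sup>+w. ennreal (min 1 (norm (X k w - U w))) \<partial>M)"
    by (intro nn_integral_suminf) measurable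
  also have "\<dots> = (\<Sum>k. ennreal (prob_norm (\<lambda>w. X k w - U w)))"
    unfolding prob_norm_def by (intro suminf_cong nn_integral_eq_integral integrable_min_norm) auto
  also have "\<dots> \<le> (\<Sum>k. ennreal ((1/2) ^ k))"
    by (intro suminf_le ennreal_leI le) auto
  also have "\<dots> = ennreal (\<Sum>k. (1/2) ^ k)"
    by (intro suminf_ennreal2) (auto simp: summable_geometric)
  also have "\<dots> < \<infinity>" by simp
  finally have "(\<integral>\<^sup>+w. (\<Sum>k. ennreal (min 1 (norm (X k w - U w)))) \<partial>M) \<noteq> \<infinity>" by simp
  then have "AE w in M. (\<Sum>k. ennreal (min 1 (norm (X k w - U w)))) \<noteq> \<infinity>"
    by (intro nn_integral_PInf_AE) measurable
  then show ?thesis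
  proof eventually_elim
    case (elim w)
    then have "summable (\<lambda>k. min 1 (norm (X k w - U w)))"
      by (intro summable_suminf_not_top) auto
    then have l: "(\<lambda>k. min 1 (norm (X k w - U w))) \<longlonglongrightarrow> 0" by (rule summable_LIMSEQ_zero)
    show ?case
    proof (rule LIMSEQ_I)
      fix r :: real assume r: "r > 0"
      obtain N where N: "\<And>k. k \<ge> N \<Longrightarrow> norm (min 1 (norm (X k w - U w)) - 0) < min r 1"
        using LIMSEQ_D[OF l, of "min r 1"] r by auto
      have "norm (X k w - U w) < r" if "k \<ge> N" for k
        using N[OF that] by (auto simp: min_def split: if_splits)
      then show "\<exists>N. \<forall>k\<ge>N. norm (X k w - U w) < r" by blast
    qed
  qed
qed

end

lemma space_incr_filtration [simp]: "space (incr_filtration M L t) = space M"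
  by (simp add: incr_filtration_def space_measure_of_conv)

lemma sets_incr_filtration: "sets (incr_filtration M L t) = sigma_sets (space M)
     {(\<lambda>w. L u w - L v w) -` B \<inter> space M | u v B. v < u \<and> u \<le> t \<and> B \<in> sets borel}"
  unfolding incr_filtration_def by (rule sets_measure_of) auto

lemma incr_measurable_filtration:
  assumes "v \<le> u" "u \<le> t"
  shows "(\<lambda>w. L u w - L v w :: real^'d) \<in> borel_measurable (incr_filtration M L t)"
proof (cases "v = u")
  case False
  show ?thesis
  proof (rule measurableI)
    fix B :: "(real^'d) set" assume "B \<in> sets borel"
    then show "(\<lambda>w. L u w - L v w) -` B \<inter> space (incr_filtration M L t) \<in> sets (incr_filtration M L t)"
      unfolding sets_incr_filtration space_incr_filtration using assms False
      by (intro sigma_sets.Basic CollectI exI[of _ u] exI[of _ v] exI[of _ B] conjI refl) auto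
  qed simp
qed simp

lemma measurable_matrix_vector:
  "X \<in> borel_measurable N \<Longrightarrow> (\<lambda>w. (B :: real^'n^'m) *v X w) \<in> borel_measurable N"
  using measurable_compose[OF _ borel_measurable_continuous_onI[OF linear_continuous_on[OF matrix_vector_mul_bounded_linear]]] .

text \<open>The path is a pointwise limit of Riemann sums, each of which uses finitely many values
  of \<open>l\<close> up to time \<open>t\<close>. \<open>N\<close> is arbitrary so that the lemma
  also yields adaptedness.\<close>

lemma ou_path_measurable:
  fixes l :: "real \<Rightarrow> 'w \<Rightarrow> real^'d"
  assumes cad: "\<And>w. w \<in> space N \<Longrightarrow> cadlag_on {0..t} (\<lambda>s. l s w)" and l0: "\<And>w. w \<in> space N \<Longrightarrow> l 0 w = 0" and t: "0 \<le> t"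
    and m: "\<And>s. 0 \<le> s \<Longrightarrow> s \<le> t \<Longrightarrow> l s \<in> borel_measurable N"
  shows "(\<lambda>w. ou_path A \<Sigma> 0 (\<lambda>s. l s w) t) \<in> borel_measurable N"
proof (cases "t = 0")
  case True
  have "(\<lambda>w. 0) \<in> borel_measurable N" by simp
  then show ?thesis
    by (rule measurable_cong[THEN iffD1, rotated]) (simp add: True ou_path_initial l0)
next
  case False
  then have t: "t > 0" using t by simp
  show ?thesis
  proof (rule borel_measurable_LIMSEQ_metric)
    show "(\<lambda>w. riem_sum (\<lambda>s. mexp A (t - s) ** \<Sigma>) (\<lambda>s. l s w) 0 t k) \<in> borel_measurable N" for k
      unfolding riem_sum_def
    proof (intro borel_measurable_sum measurable_matrix_vector borel_measurable_diff m)
      fix i assume "i \<in> {..<k}"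
      then show "0 \<le> grid 0 t k (Suc i)" "grid 0 t k (Suc i) \<le> t" "0 \<le> grid 0 t k i" "grid 0 t k i \<le> t"
        using grid_mem[of 0 t "Suc i" k] grid_mem[of 0 t i k] t by auto
    qed
    show "(\<lambda>k. riem_sum (\<lambda>s. mexp A (t - s) ** \<Sigma>) (\<lambda>s. l s w) 0 t k) \<longlonglongrightarrow> ou_path A \<Sigma> 0 (\<lambda>s. l s w) t" if "w \<in> space N" for w
      using riem_sum_tendsto_ou_path[OF t cad[OF that], where A = A and \<Sigma> = \<Sigma>] l0[OF that] by simp
  qed
qed

lemma riem_sum_measurable_filtration:
  assumes "a \<le> b" "b \<le> t"
  shows "(\<lambda>w. riem_sum F (\<lambda>u. L u w :: real^'d) a b k :: real^'d) \<in> borel_measurable (incr_filtration M L t)"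
  unfolding riem_sum_def
proof (intro borel_measurable_sum measurable_matrix_vector incr_measurable_filtration)
  fix i assume "i \<in> {..<k}"
  then show "grid a b k i \<le> grid a b k (Suc i)" "grid a b k (Suc i) \<le> t"
    using assms grid_mono[of a b i "Suc i" k] grid_mem[of a b "Suc i" k] by auto
qed

context levy_noise begin

lemma riem_sum_measurable: "(\<lambda>w. riem_sum F (\<lambda>u. L u w) a b k :: real^'d) \<in> borel_measurable M"
  unfolding riem_sum_def by (intro borel_measurable_sum measurable_matrix_vector) measurable

text \<open>The time line is split at zero and truncated at \<open>- n\<close>. The past part
  \<open>V n\<close> and the part \<open>U\<close> over \<open>{0<..t}\<close> are both limits of
  Riemann sums: from the former a matrix factor can be extracted, and for the latter a pathwise
  limit is available.\<close>

lemma ou_integral_limit: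
  assumes hs: "has_stoch_integral M L (\<lambda>s. indicator {..t} s *\<^sub>R (mexp A (t - s) ** \<Sigma>)) Y" and t: "0 \<le> t"
  shows "\<exists>V U. (\<forall>n::nat. V n \<in> borel_measurable M) \<and> U \<in> borel_measurable M \<and>
    (\<forall>n>0. (\<lambda>k. prob_norm (\<lambda>w. riem_sum (\<lambda>s. mexp A (t - s) ** \<Sigma>) (\<lambda>u. L u w) (- real n) 0 k - V n w)) \<longlonglongrightarrow> 0) \<and>
    (t > 0 \<longrightarrow> (\<lambda>k. prob_norm (\<lambda>w. riem_sum (\<lambda>s. mexp A (t - s) ** \<Sigma>) (\<lambda>u. L u w) 0 t k - U w)) \<longlonglongrightarrow> 0) \<and>
    (t = 0 \<longrightarrow> U = (\<lambda>_. 0)) \<and>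
    (\<lambda>n. prob_norm (\<lambda>w. (V n w + U w) - Y w)) \<longlonglongrightarrow> 0 \<and> Y \<in> borel_measurable M"
proof -
  define f where "f = (\<lambda>s. indicator {..t} s *\<^sub>R (mexp A (t - s) ** \<Sigma>))"
  define F where "F = (\<lambda>s. mexp A (t - s) ** \<Sigma>)"
  obtain Z' g where Z': "levy_random_measure M L Z'" and g: "\<And>n. simple_integrand (g n)"
    "AE s in lborel. (\<lambda>n. g n s) \<longlonglongrightarrow> f s"
    "\<And>B. B \<in> sets borel \<Longrightarrow> \<exists>W\<in>borel_measurable M. tendsto_in_prob M (\<lambda>n. simple_stoch_integral Z' B (g n)) W"
    "tendsto_in_prob M (\<lambda>n. simple_stoch_integral Z' UNIV (g n)) Y"
    and f: "f \<in> borel_measurable borel" and Y [measurable]: "Y \<in> borel_measurable M"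
    using hs unfolding has_stoch_integral_def f_def[symmetric] by blast
  \<comment> \<open>The integral brings its own random measure \<open>Z'\<close>, possibly different
    from \<open>Z\<close>; it extends the same increments, so the same \<psi> serves.\<close>
  interpret C: convergent_integrands M L Z' \<psi> g f
    by unfold_locales (use Z' g f incr_char psi_continuous psi_0 psi_bound in auto)
  have F: "continuous_on S F" for S
    unfolding F_def by (intro continuous_on_matrix_mult continuous_intros)
  have fF: "f s = F s" if "s \<le> t" for s using that by (simp add: f_def F_def)
  have f0: "f s = 0" if "s > t" for s using that by (simp add: f_def)
  define V where "V n = C.W {- real n<..0}" for n
  \<comment> \<open>Riemann sums need a nondegenerate interval, so \<open>t = 0\<close> is treated
    apart.\<close>
  define U where "U = (if t = 0 then (\<lambda>_. 0) else C.W {0<..t})"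
  have V [measurable]: "V n \<in> borel_measurable M" for n by (simp add: V_def C.W)
  have U [measurable]: "U \<in> borel_measurable M" by (simp add: U_def C.W)
  have WY: "AE w in M. C.W UNIV w = Y w" using g(4) by (intro C.W_cong) auto
  have U_eq: "AE w in M. C.W {0<..real n} w = U w" if n: "real n > t" for n
  proof -
    have z: "AE w in M. C.W {t<..real n} w = 0"
    proof -
      have "(\<lambda>k. prob_norm (\<lambda>w. riem_sum (\<lambda>_. 0) (\<lambda>u. L u w) t (real n) k - C.W {t<..real n} w)) \<longlonglongrightarrow> 0"
        using n f0 by (intro C.riem_sum_tendsto_W) auto
      then have "(\<lambda>k::nat. prob_norm (\<lambda>w. 0 - C.W {t<..real n} w)) \<longlonglongrightarrow> 0"
        by (simp add: riem_sum_def)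
      then have "prob_norm (C.W {t<..real n}) \<le> 0"
        using prob_norm_minus[of "\<lambda>_. 0" "C.W {t<..real n}"] by (simp add: LIMSEQ_const_iff)
      then show ?thesis by (intro prob_norm_eq_0) (simp_all add: C.W)
    qed
    show ?thesis
    proof (cases "t = 0")
      case True then show ?thesis using z by (simp add: U_def)
    next
      case False
      have "{0<..t} \<union> {t<..real n} = {0<..real n}" using t n by auto
      then have "AE w in M. C.W {0<..real n} w = C.W {0<..t} w + C.W {t<..real n} w"
        using C.W_Un[of "{0<..t}" "{t<..real n}"] by simp
      with z show ?thesis by eventually_elim (simp add: U_def False)
    qed
  qed
  have VU: "prob_norm (\<lambda>w. C.W {- real n<..real n} w - C.W UNIV w) = prob_norm (\<lambda>w. (V n w + U w) - Y w)" if n: "real n > t" for n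
  proof (rule prob_norm_cong)
    have "{- real n<..0} \<union> {0<..real n} = {- real n<..real n}" using t n by auto
    then have "AE w in M. C.W {- real n<..real n} w = V n w + C.W {0<..real n} w"
      using C.W_Un[of "{- real n<..0}" "{0<..real n}"] by (simp add: V_def)
    with U_eq[OF n] WY show "AE w in M. C.W {- real n<..real n} w - C.W UNIV w = (V n w + U w) - Y w"
      by eventually_elim simp
    show "(\<lambda>w. C.W {- real n<..real n} w - C.W UNIV w) \<in> borel_measurable M"
      by (intro borel_measurable_diff C.W) auto
  qed measurable
  obtain n0 where n0: "t < real n0" using reals_Archimedean2 by blast
  have l1: "(\<lambda>n. prob_norm (\<lambda>w. (V n w + U w) - Y w)) \<longlonglongrightarrow> 0"
  proof (rule Lim_transform_eventually[OF C.W_exhaust])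
    show "\<forall>\<^sub>F n in sequentially. prob_norm (\<lambda>w. C.W {- real n<..real n} w - C.W UNIV w) = prob_norm (\<lambda>w. (V n w + U w) - Y w)"
      using n0 VU unfolding eventually_sequentially by (meson less_le_trans of_nat_le_iff)
  qed
  have l2: "(\<lambda>k. prob_norm (\<lambda>w. riem_sum F (\<lambda>u. L u w) (- real n) 0 k - V n w)) \<longlonglongrightarrow> 0" if "n > 0" for n
    unfolding V_def using that t by (intro C.riem_sum_tendsto_W F fF) auto
  have l3: "(\<lambda>k. prob_norm (\<lambda>w. riem_sum F (\<lambda>u. L u w) 0 t k - U w)) \<longlonglongrightarrow> 0" if "t > 0"
  proof -
    have "U = C.W {0<..t}" using that by (simp add: U_def)
    then show ?thesis using that by (auto intro!: C.riem_sum_tendsto_W F fF)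
  qed
  have u0: "t = 0 \<longrightarrow> U = (\<lambda>_. 0)" by (simp add: U_def)
  show ?thesis
  proof (rule exI[of _ V], rule exI[of _ U], intro conjI allI impI)
    show "t = 0 \<Longrightarrow> U = (\<lambda>_. 0)" using u0 by blast
  qed (fact V U Y l1 l2[unfolded F_def] l3[unfolded F_def])+
qed

text \<open>Riemann sums over bounded intervals before zero are measurable for the past increments.
  A sequence of them with summable errors converges almost surely, and its \<open>lim\<close> is
  measurable even where the sequence diverges; this avoids completing the filtration.\<close>

lemma ou_initial_version:
  assumes hs: "has_stoch_integral M L (\<lambda>s. indicator {..0} s *\<^sub>R (mexp A (0 - s) ** \<Sigma>)) Y"
  obtains Y' where "Y' \<in> borel_measurable (incr_filtration M L 0)" "AE w in M. Y w = Y' w"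
proof -
  obtain V U where V [measurable]: "\<And>n::nat. V n \<in> borel_measurable M"
    and riem: "\<And>n. n > 0 \<Longrightarrow> (\<lambda>k. prob_norm (\<lambda>w. riem_sum (\<lambda>s. mexp A (0 - s) ** \<Sigma>) (\<lambda>u. L u w) (- real n) 0 k - V n w)) \<longlonglongrightarrow> 0"
    and U: "U = (\<lambda>_. 0)" and VY: "(\<lambda>n. prob_norm (\<lambda>w. (V n w + U w) - Y w)) \<longlonglongrightarrow> 0"
    and Y [measurable]: "Y \<in> borel_measurable M"
    using ou_integral_limit[OF hs order_refl] by blast
  define RS where "RS n k w = riem_sum (\<lambda>s. mexp A (0 - s) ** \<Sigma>) (\<lambda>u. L u w) (- real n) 0 k" for n k w
  have RS [measurable]: "RS n k \<in> borel_measurable M" for n k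
    unfolding RS_def[abs_def] by (rule riem_sum_measurable)
  have RSF: "RS n k \<in> borel_measurable (incr_filtration M L 0)" for n k
    unfolding RS_def[abs_def] by (rule riem_sum_measurable_filtration) auto
  have "\<exists>n k. prob_norm (\<lambda>w. RS n k w - Y w) \<le> (1/2) ^ j" for j
  proof -
    define d where "d = (1/2 :: real) ^ j / 2"
    have d: "d > 0" by (simp add: d_def)
    obtain N where N: "\<And>n. n \<ge> N \<Longrightarrow> prob_norm (\<lambda>w. V n w - Y w) < d"
      using prob_norm_tendstoD[OF VY d] by (auto simp: U)
    obtain K where K: "\<And>k. k \<ge> K \<Longrightarrow> prob_norm (\<lambda>w. RS (Suc N) k w - V (Suc N) w) < d"
      using prob_norm_tendstoD[OF riem[of "Suc N"] d] by (auto simp: RS_def)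
    have "prob_norm (\<lambda>w. RS (Suc N) K w - Y w) \<le> d + d"
      using prob_norm_diff[OF RS Y V[of "Suc N"], of "Suc N" K] N[of "Suc N"] K[of K] by simp
    then show ?thesis by (auto simp: d_def)
  qed
  then obtain n k where nk: "\<And>j. prob_norm (\<lambda>w. RS (n j) (k j) w - Y w) \<le> (1/2) ^ j" by metis
  have ae: "AE w in M. (\<lambda>j. RS (n j) (k j) w) \<longlonglongrightarrow> Y w"
    by (rule AE_tendsto_of_prob_norm[OF RS Y nk])
  show thesis
  proof (rule that[of "\<lambda>w. lim (\<lambda>j. RS (n j) (k j) w)"])
    show "(\<lambda>w. lim (\<lambda>j. RS (n j) (k j) w)) \<in> borel_measurable (incr_filtration M L 0)"
      by (rule borel_measurable_lim_metric) (rule RSF)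
    show "AE w in M. Y w = lim (\<lambda>j. RS (n j) (k j) w)"
      using ae by eventually_elim (simp add: limI)
  qed
qed

lemma riem_sum_shift: "riem_sum F (\<lambda>u. l u - c) a b k = riem_sum F l a b k"
  by (simp add: riem_sum_def)

text \<open>Over the past the factor \<open>mexp A t\<close> can be pulled out of every Riemann sum,
  which relates \<open>V n\<close> to \<open>V0 n\<close>. Over \<open>{0<..t}\<close> the same
  Riemann sums converge in probability to \<open>U\<close> and pathwise to \<open>ou_path\<close>,
  so these limits agree.\<close>

lemma ou_recursion:
  assumes hs: "has_stoch_integral M L (\<lambda>s. indicator {..t} s *\<^sub>R (mexp A (t - s) ** \<Sigma>)) Y" and t: "0 < t"
    and hs0: "has_stoch_integral M L (\<lambda>s. indicator {..0} s *\<^sub>R (mexp A (0 - s) ** \<Sigma>)) Y0"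
    and cad: "\<And>w. w \<in> space M \<Longrightarrow> cadlag_on {0..} (\<lambda>t. L t w)"
  shows "AE w in M. Y w = mexp A t *v Y0 w + ou_path A \<Sigma> 0 (\<lambda>s. L s w - L 0 w) t"
proof -
  obtain V U where V [measurable]: "\<And>n::nat. V n \<in> borel_measurable M" and U [measurable]: "U \<in> borel_measurable M"
    and riem: "\<And>n. n > 0 \<Longrightarrow> (\<lambda>k. prob_norm (\<lambda>w. riem_sum (\<lambda>s. mexp A (t - s) ** \<Sigma>) (\<lambda>u. L u w) (- real n) 0 k - V n w)) \<longlonglongrightarrow> 0"
    and riemU: "(\<lambda>k. prob_norm (\<lambda>w. riem_sum (\<lambda>s. mexp A (t - s) ** \<Sigma>) (\<lambda>u. L u w) 0 t k - U w)) \<longlonglongrightarrow> 0"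
    and VY: "(\<lambda>n. prob_norm (\<lambda>w. (V n w + U w) - Y w)) \<longlonglongrightarrow> 0"
    and Y [measurable]: "Y \<in> borel_measurable M"
    using ou_integral_limit[OF hs less_imp_le[OF t]] t by blast
  obtain V0 U0 where V0 [measurable]: "\<And>n::nat. V0 n \<in> borel_measurable M"
    and riem0: "\<And>n. n > 0 \<Longrightarrow> (\<lambda>k. prob_norm (\<lambda>w. riem_sum (\<lambda>s. mexp A (0 - s) ** \<Sigma>) (\<lambda>u. L u w) (- real n) 0 k - V0 n w)) \<longlonglongrightarrow> 0"
    and U0: "U0 = (\<lambda>_. 0)" and VY0: "(\<lambda>n. prob_norm (\<lambda>w. (V0 n w + U0 w) - Y0 w)) \<longlonglongrightarrow> 0"
    and Y0 [measurable]: "Y0 \<in> borel_measurable M"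
    using ou_integral_limit[OF hs0 order_refl] by blast
  let ?P = "\<lambda>w. ou_path A \<Sigma> 0 (\<lambda>s. L s w - L 0 w) t"
  have P [measurable]: "?P \<in> borel_measurable M"
    using t by (intro ou_path_measurable cadlag_on_diff_continuous cadlag_on_subset[OF cad] borel_measurable_diff) auto
  have UP: "AE w in M. U w = ?P w"
  proof (rule prob_norm_limit_unique[OF riem_sum_measurable U P riemU])
    show "(\<lambda>k. prob_norm (\<lambda>w. riem_sum (\<lambda>s. mexp A (t - s) ** \<Sigma>) (\<lambda>u. L u w) 0 t k - ?P w)) \<longlonglongrightarrow> 0"
    proof (rule prob_norm_pointwise[OF riem_sum_measurable P])
      fix w assume "w \<in> space M"
      then have "cadlag_on {0..t} (\<lambda>s. L s w)" by (intro cadlag_on_subset[OF cad]) auto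
      then have "cadlag_on {0..t} (\<lambda>s. L s w - L 0 w)" by (rule cadlag_on_diff_continuous) simp
      then show "(\<lambda>k. riem_sum (\<lambda>s. mexp A (t - s) ** \<Sigma>) (\<lambda>u. L u w) 0 t k) \<longlonglongrightarrow> ?P w"
        using riem_sum_tendsto_ou_path[OF t, of "\<lambda>s. L s w - L 0 w" A \<Sigma>] unfolding riem_sum_shift by simp
    qed
  qed
  have eq: "riem_sum (\<lambda>s. mexp A (t - s) ** \<Sigma>) l a b k = mexp A t *v riem_sum (\<lambda>s. mexp A (0 - s) ** \<Sigma>) l a b k" for l a b k
  proof -
    have "mexp A (t - s) = mexp A t ** mexp A (0 - s)" for s using mexp_add[of A t "0 - s"] by simp
    then show ?thesis by (simp add: riem_sum_def vec.sum matrix_vector_mul_assoc matrix_mul_assoc)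
  qed
  have VV0: "AE w in M. V n w = mexp A t *v V0 n w" if n: "n > 0" for n
  proof (rule prob_norm_limit_unique[OF riem_sum_measurable V _ riem[OF n]])
    show "(\<lambda>w. mexp A t *v V0 n w) \<in> borel_measurable M" by (intro measurable_matrix_vector V0)
    let ?R = "\<lambda>k w. riem_sum (\<lambda>s. mexp A (0 - s) ** \<Sigma>) (\<lambda>u. L u w) (- real n) 0 k - V0 n w"
    have lim: "(\<lambda>k. (1 + norm (mexp A t)) * prob_norm (?R k)) \<longlonglongrightarrow> 0"
      using tendsto_mult_left[OF riem0[OF n], of "1 + norm (mexp A t)"] by simp
    have R: "?R k \<in> borel_measurable M" for k by (intro borel_measurable_diff riem_sum_measurable V0)
    show "(\<lambda>k. prob_norm (\<lambda>w. riem_sum (\<lambda>s. mexp A (t - s) ** \<Sigma>) (\<lambda>u. L u w) (- real n) 0 k - mexp A t *v V0 n w)) \<longlonglongrightarrow> 0"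
    proof (rule Lim_null_comparison[OF always_eventually lim], rule allI)
      fix k
      show "norm (prob_norm (\<lambda>w. riem_sum (\<lambda>s. mexp A (t - s) ** \<Sigma>) (\<lambda>u. L u w) (- real n) 0 k - mexp A t *v V0 n w)) \<le>
         (1 + norm (mexp A t)) * prob_norm (?R k)"
        unfolding eq matrix_vector_mult_diff_distrib[symmetric] using prob_norm_matrix[OF R[of k]]
        by (simp add: prob_norm_nonneg)
    qed
  qed
  have "AE w in M. Y w = mexp A t *v Y0 w + U w"
  proof (rule prob_norm_limit_unique[where X = "\<lambda>n w. V n w + U w"])
    show "(\<lambda>w. mexp A t *v Y0 w + U w) \<in> borel_measurable M"
      by (intro borel_measurable_add measurable_matrix_vector Y0 U)
    have lim: "(\<lambda>n. (1 + norm (mexp A t)) * prob_norm (\<lambda>w. V0 n w - Y0 w)) \<longlonglongrightarrow> 0"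
      using tendsto_mult_left[OF VY0, of "1 + norm (mexp A t)"] by (simp add: U0)
    show "(\<lambda>n. prob_norm (\<lambda>w. (V n w + U w) - (mexp A t *v Y0 w + U w))) \<longlonglongrightarrow> 0"
    proof (rule Lim_null_comparison[OF _ lim], rule eventually_sequentiallyI[of 1])
      fix n :: nat assume n: "1 \<le> n"
      have "prob_norm (\<lambda>w. (V n w + U w) - (mexp A t *v Y0 w + U w)) = prob_norm (\<lambda>w. mexp A t *v (V0 n w - Y0 w))"
      proof (rule prob_norm_cong)
        show "AE w in M. (V n w + U w) - (mexp A t *v Y0 w + U w) = mexp A t *v (V0 n w - Y0 w)"
          using VV0[of n] n by (auto simp: matrix_vector_mult_diff_distrib elim!: eventually_mono)
        show "(\<lambda>w. V n w + U w - (mexp A t *v Y0 w + U w)) \<in> borel_measurable M"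
          by (intro borel_measurable_diff borel_measurable_add measurable_matrix_vector V U Y0)
      qed (intro measurable_matrix_vector borel_measurable_diff V0 Y0)
      also have "\<dots> \<le> (1 + norm (mexp A t)) * prob_norm (\<lambda>w. V0 n w - Y0 w)"
        by (intro prob_norm_matrix borel_measurable_diff V0 Y0)
      finally show "norm (prob_norm (\<lambda>w. (V n w + U w) - (mexp A t *v Y0 w + U w))) \<le>
        (1 + norm (mexp A t)) * prob_norm (\<lambda>w. V0 n w - Y0 w)" by (simp add: prob_norm_nonneg)
    qed
  qed (use VY in \<open>auto\<close>)
  with UP show ?thesis by eventually_elim simp
qed

end

section \<open>The two-sided Levy process: increments on the whole time line\<close>

lemma cadlag_left_sequence:
  fixes f :: "real \<Rightarrow> 'a::t2_space"
  assumes f: "cadlag_on {0..} f" and s: "0 < s" and h: "\<And>n. 0 < h n" "h \<longlonglongrightarrow> 0"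
  shows "(\<lambda>n::nat. f (s - h n)) \<longlonglongrightarrow> Lim (at_left s) f"
proof -
  have "filterlim (\<lambda>n. s - h n) (at_left s) sequentially"
    unfolding filterlim_at
  proof
    show "\<forall>\<^sub>F n in sequentially. s - h n \<in> {..<s} \<and> s - h n \<noteq> s"
      using h(1) by (intro always_eventually) (auto simp: less_imp_neq[symmetric])
    show "(\<lambda>n. s - h n) \<longlonglongrightarrow> s"
      using tendsto_diff[OF tendsto_const[of s] h(2)] by simp
  qed
  with cadlag_left_limit[OF f s] show ?thesis by (rule filterlim_compose)
qed

lemma levy_process_measurable: "levy_process M K \<Longrightarrow> 0 \<le> t \<Longrightarrow> K t \<in> borel_measurable M"
  by (simp add: levy_process_def)

lemma levy_process_stationary:
  "levy_process M K \<Longrightarrow> 0 \<le> s \<Longrightarrow> s \<le> t \<Longrightarrow> distr M borel (\<lambda>w. K t w - K s w) = distr M borel (K (t - s))"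
  by (simp add: levy_process_def)

lemma levy_process_0: "levy_process M K \<Longrightarrow> AE w in M. K 0 w = 0"
  by (simp add: levy_process_def)

lemma levy_process_cadlag: "levy_process M K \<Longrightarrow> w \<in> space M \<Longrightarrow> cadlag_on {0..} (\<lambda>t. K t w)"
  by (simp add: levy_process_def)

lemma levy_process_increment_char:
  assumes K: "levy_process M K" and "0 \<le> s" "s \<le> t"
  shows "(LINT w|M. iexp (\<xi> \<bullet> (K t w - K s w))) = (LINT w|M. iexp (\<xi> \<bullet> K (t - s) w))"
proof -
  have [measurable]: "K t \<in> borel_measurable M" "K s \<in> borel_measurable M" "K (t - s) \<in> borel_measurable M"
    using assms by (auto intro: levy_process_measurable)
  have "(LINT w|M. iexp (\<xi> \<bullet> (K t w - K s w))) = (LINT x|distr M borel (\<lambda>w. K t w - K s w). iexp (\<xi> \<bullet> x))"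
    by (subst integral_distr) auto
  also have "\<dots> = (LINT x|distr M borel (K (t - s)). iexp (\<xi> \<bullet> x))"
    using levy_process_stationary[OF assms] by simp
  also have "\<dots> = (LINT w|M. iexp (\<xi> \<bullet> K (t - s) w))"
    by (subst integral_distr) auto
  finally show ?thesis .
qed

text \<open>Carries the one-dimensional laws from \<open>L\<close> to its copy, for which only
  equality of the path laws is given.\<close>

lemma path_map_distr:
  assumes K: "levy_process M K" and t: "0 \<le> t"
  shows "distr (distr M path_space (path_map K)) borel (\<lambda>f. f t) = distr M borel (K t)"
proof -
  have 1: "path_map K \<in> measurable M path_space"
    unfolding path_map_def by (intro measurable_restrict levy_process_measurable[OF K]) auto
  have 2: "(\<lambda>f. f t) \<in> measurable path_space borel"
    using t by (intro measurable_component_singleton) auto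
  have "(\<lambda>f. f t) \<circ> path_map K = K t" using t by (auto simp: path_map_def fun_eq_iff)
  then show ?thesis by (subst distr_distr[OF 2 1]) simp
qed

text \<open>At negative times \<open>L\<close> is minus a left limit of the copy, so measurability
  and characteristic functions are obtained by approximating the time of the copy from the left. For
  an increment across zero, the independence of its two parts is taken from the random
  measure.\<close>

lemma two_sided_levy_noise:
  fixes L :: "real \<Rightarrow> 'w \<Rightarrow> real^'d"
  assumes M: "prob_space M" and two: "two_sided_levy_process M L" and trip: "has_triplet M L b S \<Lambda>"
    and Z: "levy_random_measure M L Z"
  shows "levy_noise M L Z (levy_khintchine_exponent b S \<Lambda>)"
proof -
  interpret prob_space M by fact
  define \<psi> where "\<psi> = levy_khintchine_exponent b S \<Lambda>"
  have Lp: "levy_process M L" and "levy_measure \<Lambda>" using two trip by (auto simp: two_sided_levy_process_def has_triplet_def)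
  have Lchar: "(LINT w|M. iexp (\<xi> \<bullet> L t w)) = exp (complex_of_real t * \<psi> \<xi>)" if "0 \<le> t" for t \<xi>
    using trip that by (simp add: has_triplet_def \<psi>_def)
  obtain L' where L': "levy_process M L'" and eq: "distr M path_space (path_map L') = distr M path_space (path_map L)"
    and neg: "\<And>t w. t < 0 \<Longrightarrow> w \<in> space M \<Longrightarrow> L t w = - Lim (at_left (- t)) (\<lambda>s. L' s w)"
    using two unfolding two_sided_levy_process_def by blast
  have L'm: "L' t \<in> borel_measurable M" if "0 \<le> t" for t using levy_process_measurable[OF L' that] .
  have L'char: "(LINT w|M. iexp (\<xi> \<bullet> L' t w)) = exp (complex_of_real t * \<psi> \<xi>)" if t: "0 \<le> t" for t \<xi>
  proof -
    have "distr M borel (L' t) = distr M borel (L t)"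
      using path_map_distr[OF L' t] path_map_distr[OF Lp t] eq by simp
    moreover have "(LINT w|M. iexp (\<xi> \<bullet> K w)) = (LINT x|distr M borel K. iexp (\<xi> \<bullet> x))" if "K \<in> borel_measurable M" for K
      using that by (subst integral_distr) auto
    ultimately show ?thesis using L'm[OF t] levy_process_measurable[OF Lp t] Lchar[OF t] by metis
  qed
  have neg_lim: "(\<lambda>n. - L' (- t - h n) w) \<longlonglongrightarrow> L t w"
    if "t < 0" "w \<in> space M" "\<And>n. 0 < h n" "h \<longlonglongrightarrow> 0" for t w and h :: "nat \<Rightarrow> real"
    unfolding neg[OF that(1,2)] using that
    by (intro tendsto_minus cadlag_left_sequence levy_process_cadlag[OF L']) auto
  \<comment> \<open>The denominators \<open>n + 2\<close> exceed \<open>1\<close>, so that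
    subtracting the shift leaves the times of the copy nonnegative.\<close>
  have hseq: "(\<lambda>n. c / real (n + 2)) \<longlonglongrightarrow> 0" for c
    using LIMSEQ_ignore_initial_segment[OF lim_const_over_n[of c], of 2] by simp
  have hpos: "0 < - c / real (n + 2)" if "c < 0" for c n using that by (intro divide_pos_pos) auto
  have Lm [measurable]: "L t \<in> borel_measurable M" for t
  proof (cases "0 \<le> t")
    case True then show ?thesis by (rule levy_process_measurable[OF Lp])
  next
    case False
    then have t: "t < 0" by simp
    let ?h = "\<lambda>n. - t / real (n + 2)"
    show ?thesis
    proof (rule borel_measurable_LIMSEQ_metric)
      show "(\<lambda>n. - L' (- t - ?h n) w) \<longlonglongrightarrow> L t w" if "w \<in> space M" for w
        by (rule neg_lim[OF t that hpos[OF t] hseq])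
      have "- t / real (n + 2) \<le> - t / 1" for n using t by (intro divide_left_mono) auto
      then have "- t - ?h n \<ge> 0" for n by (simp add: le_diff_eq)
      then show "(\<lambda>w. - L' (- t - ?h n) w) \<in> borel_measurable M" for n
        by (intro borel_measurable_uminus L'm)
    qed
  qed
  have DCT: "(LINT w|M. iexp (\<xi> \<bullet> X w)) = c"
    if "\<And>n. f n \<in> borel_measurable M" "X \<in> borel_measurable M" "AE w in M. (\<lambda>n. f n w) \<longlonglongrightarrow> X w"
      "(\<lambda>n. LINT w|M. iexp (\<xi> \<bullet> f n w)) \<longlonglongrightarrow> c"
    for f :: "nat \<Rightarrow> 'w \<Rightarrow> real^'d" and X \<xi> c
  proof -
    note [measurable] = that(1,2)
    have "(\<lambda>n. LINT w|M. iexp (\<xi> \<bullet> f n w)) \<longlonglongrightarrow> (LINT w|M. iexp (\<xi> \<bullet> X w))"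
    proof (rule integral_dominated_convergence[where w = "\<lambda>_. 1"])
      show "AE w in M. (\<lambda>n. iexp (\<xi> \<bullet> f n w)) \<longlonglongrightarrow> iexp (\<xi> \<bullet> X w)"
        using that(3) by eventually_elim (auto intro!: tendsto_intros)
    qed auto
    then show ?thesis using that(4) LIMSEQ_unique by blast
  qed
  have neg_char: "(LINT w|M. iexp (\<xi> \<bullet> (L c w - L a w))) = exp (complex_of_real (c - a) * \<psi> \<xi>)"
    if ac: "a < c" "c < 0" for a c \<xi>
  \<comment> \<open>Both ends use the same shift, so that the increment of \<open>L'\<close> has
    length exactly \<open>c - a\<close>.\<close>
  proof (rule DCT[of "\<lambda>n w. L' (- a - - c / real (n + 2)) w - L' (- c - - c / real (n + 2)) w"])
    let ?h = "\<lambda>n. - c / real (n + 2)"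
    have h: "- c - ?h n \<ge> 0" for n
    proof -
      have "- c / real (n + 2) \<le> - c / 1" using ac by (intro divide_left_mono) auto
      then show ?thesis by simp
    qed
    then have h': "- a - ?h n \<ge> 0" for n using ac by (smt (verit))
    show "(\<lambda>w. L' (- a - ?h n) w - L' (- c - ?h n) w) \<in> borel_measurable M" for n
      by (intro borel_measurable_diff L'm h h')
    show "AE w in M. (\<lambda>n. L' (- a - ?h n) w - L' (- c - ?h n) w) \<longlonglongrightarrow> L c w - L a w"
    proof (rule AE_I2)
      fix w assume "w \<in> space M"
      then have "(\<lambda>n. - L' (- c - ?h n) w - (- L' (- a - ?h n) w)) \<longlonglongrightarrow> L c w - L a w"
        using ac by (intro tendsto_diff neg_lim hpos hseq) auto
      then show "(\<lambda>n. L' (- a - ?h n) w - L' (- c - ?h n) w) \<longlonglongrightarrow> L c w - L a w"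
        by (simp add: algebra_simps)
    qed
    have "(LINT w|M. iexp (\<xi> \<bullet> (L' (- a - ?h n) w - L' (- c - ?h n) w))) = exp (complex_of_real (c - a) * \<psi> \<xi>)" for n
      using levy_process_increment_char[OF L' h[of n], of "- a - ?h n" \<xi>] L'char[of "c - a" \<xi>] ac by simp
    then show "(\<lambda>n. LINT w|M. iexp (\<xi> \<bullet> (L' (- a - ?h n) w - L' (- c - ?h n) w))) \<longlonglongrightarrow> exp (complex_of_real (c - a) * \<psi> \<xi>)"
      by simp
  qed measurable
  have neg0_char: "(LINT w|M. iexp (\<xi> \<bullet> (L 0 w - L a w))) = exp (complex_of_real (0 - a) * \<psi> \<xi>)"
    if a: "a < 0" for a \<xi>
  proof (rule DCT[of "\<lambda>n. L' (- a - - a / real (n + 2))"])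
    let ?h = "\<lambda>n. - a / real (n + 2)"
    have h: "- a - ?h n \<ge> 0" for n
    proof -
      have "- a / real (n + 2) \<le> - a / 1" using a by (intro divide_left_mono) auto
      then show ?thesis by simp
    qed
    show "L' (- a - ?h n) \<in> borel_measurable M" for n by (rule L'm[OF h])
    show "AE w in M. (\<lambda>n. L' (- a - ?h n) w) \<longlonglongrightarrow> L 0 w - L a w"
      using levy_process_0[OF Lp] AE_space
    proof eventually_elim
      case (elim w)
      have "(\<lambda>n. - L' (- a - ?h n) w) \<longlonglongrightarrow> L a w"
        using a elim by (intro neg_lim hpos hseq) auto
      from tendsto_minus[OF this] show ?case using elim by simp
    qed
    have "(\<lambda>n. exp (complex_of_real (- a - ?h n) * \<psi> \<xi>)) \<longlonglongrightarrow> exp (complex_of_real (- a - 0) * \<psi> \<xi>)"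
      by (intro tendsto_intros hseq)
    then show "(\<lambda>n. LINT w|M. iexp (\<xi> \<bullet> L' (- a - ?h n) w)) \<longlonglongrightarrow> exp (complex_of_real (0 - a) * \<psi> \<xi>)"
      unfolding L'char[OF h] by simp
  qed measurable
  have Zp: "Z B \<in> borel_measurable M" if "B \<in> bounded_borel" for B
    using Z that by (simp add: levy_random_measure_def)
  have Zincr: "AE w in M. Z {a<..c} w = L c w - L a w" if "a < c" for a c
    using Z that by (simp add: levy_random_measure_def)
  have cross_char: "(LINT w|M. iexp (\<xi> \<bullet> (L c w - L a w))) = exp (complex_of_real (c - a) * \<psi> \<xi>)"
    if a: "a < 0" and c: "0 < c" for a c \<xi>
  proof -
    define B where "B n = (if n = 0 then {a<..0} else if n = 1 then {0<..c} else {})" for n :: nat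
    have "range B \<subseteq> bounded_borel" "disjoint_family B" by (auto simp: B_def disjoint_family_on_def)
    then have "indep_vars (\<lambda>_. borel) (\<lambda>n. Z (B n)) UNIV"
      using Z unfolding levy_random_measure_def by blast
    then have "indep_vars (\<lambda>_. borel) (\<lambda>n. Z (B n)) {0, 1}" by (rule indep_vars_subset) simp
    then have ind: "indep_vars (\<lambda>_. borel) (\<lambda>n w. iexp (\<xi> \<bullet> Z (B n) w)) {0, 1}"
      by (rule indep_vars_compose2) measurable
    have [measurable]: "Z {a<..0} \<in> borel_measurable M" "Z {0<..c} \<in> borel_measurable M" by (auto intro: Zp)
    have "(LINT w|M. iexp (\<xi> \<bullet> (L c w - L a w))) = (LINT w|M. (\<Prod>n\<in>{0, 1}. iexp (\<xi> \<bullet> Z (B n) w)))"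
    proof (rule integral_cong_AE)
      show "AE w in M. iexp (\<xi> \<bullet> (L c w - L a w)) = (\<Prod>n\<in>{0, 1}. iexp (\<xi> \<bullet> Z (B n) w))"
        using Zincr[OF a] Zincr[OF c]
      proof eventually_elim
        case (elim w)
        have "L c w - L a w = (L 0 w - L a w) + (L c w - L 0 w)" by simp
        then show ?case unfolding elim[symmetric]
          by (simp add: B_def inner_add_right distrib_left exp_add)
      qed
    qed (auto simp: B_def)
    also have "\<dots> = (\<Prod>n\<in>{0, 1}. (LINT w|M. iexp (\<xi> \<bullet> Z (B n) w)))"
      by (rule indep_vars_lebesgue_integral[OF _ ind]) (auto simp: B_def intro!: integrable_const_bound[of _ 1])
    also have "\<dots> = (LINT w|M. iexp (\<xi> \<bullet> Z {a<..0} w)) * (LINT w|M. iexp (\<xi> \<bullet> Z {0<..c} w))" by (simp add: B_def)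
    also have "(LINT w|M. iexp (\<xi> \<bullet> Z {a<..0} w)) = (LINT w|M. iexp (\<xi> \<bullet> (L 0 w - L a w)))"
      by (rule integral_cong_AE) (use Zincr[OF a] in \<open>auto elim!: eventually_mono\<close>)
    also have "\<dots> = exp (complex_of_real (0 - a) * \<psi> \<xi>)" by (rule neg0_char[OF a])
    also have "(LINT w|M. iexp (\<xi> \<bullet> Z {0<..c} w)) = (LINT w|M. iexp (\<xi> \<bullet> (L c w - L 0 w)))"
      by (rule integral_cong_AE) (use Zincr[OF c] in \<open>auto elim!: eventually_mono\<close>)
    also have "\<dots> = exp (complex_of_real c * \<psi> \<xi>)"
      using levy_process_increment_char[OF Lp, of 0 c \<xi>] Lchar[of c \<xi>] c by simp
    finally show ?thesis by (simp add: exp_add[symmetric] algebra_simps)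
  qed
  have "(LINT w|M. iexp (\<xi> \<bullet> (L c w - L a w))) = exp (complex_of_real (c - a) * \<psi> \<xi>)" if ac: "a < c" for a c \<xi>
  proof -
    consider "0 \<le> a" | "a < 0" "c < 0" | "a < 0" "c = 0" | "a < 0" "0 < c" by linarith
    then show ?thesis
    proof cases
      case 1
      then show ?thesis using levy_process_increment_char[OF Lp, of a c \<xi>] Lchar[of "c - a" \<xi>] ac by simp
    qed (use neg_char neg0_char cross_char ac in auto)
  qed
  moreover have "\<psi> 0 = 0" by (simp add: \<psi>_def levy_khintchine_exponent_def)
  moreover have "\<exists>K\<ge>0. \<forall>\<xi>. cmod (\<psi> \<xi>) \<le> K * (1 + (norm \<xi>)\<^sup>2)"
    using lk_exponent_bound[OF \<open>levy_measure \<Lambda>\<close>] unfolding \<psi>_def by metis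
  ultimately show ?thesis
    unfolding \<psi>_def[symmetric] using Z continuous_lk_exponent[OF \<open>levy_measure \<Lambda>\<close>, of b S, folded \<psi>_def] Lm
    by (intro levy_noise.intro levy_noise_axioms.intro M) auto
qed

section \<open>Independence of past and future, feedback\<close>

text \<open>Increments of \<open>L\<close> agree with values of \<open>Z\<close> only almost surely;
  this transfers the independence.\<close>

lemma (in prob_space) indep_vars_cong_AE:
  assumes X: "indep_vars N X I" and Y: "\<And>i. i \<in> I \<Longrightarrow> Y i \<in> measurable M (N i)"
    and eq: "\<And>i. i \<in> I \<Longrightarrow> AE w in M. X i w = Y i w"
  shows "indep_vars N Y I"
  unfolding indep_vars_def2
proof (intro conjI ballI Y indep_setsI)
  fix i assume "i \<in> I"
  then show "{Y i -` A \<inter> space M |A. A \<in> sets (N i)} \<subseteq> events"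
    using measurable_sets[OF Y] by auto
next
  fix A J assume J: "J \<noteq> {}" "J \<subseteq> I" "finite J"
    and A: "\<forall>j\<in>J. A j \<in> {Y j -` A \<inter> space M |A. A \<in> sets (N j)}"
  then have "\<forall>j\<in>J. \<exists>E. A j = Y j -` E \<inter> space M \<and> E \<in> sets (N j)" by blast
  then obtain E where E: "\<And>j. j \<in> J \<Longrightarrow> A j = Y j -` E j \<inter> space M" "\<And>j. j \<in> J \<Longrightarrow> E j \<in> sets (N j)"
    by metis
  have Xm: "\<And>i. i \<in> I \<Longrightarrow> X i \<in> measurable M (N i)" using X by (auto simp: indep_vars_def2)
  have ae: "AE w in M. \<forall>j\<in>J. X j w = Y j w"
    using J eq by (intro AE_finite_allI) auto
  have ev: "X j -` E j \<inter> space M \<in> events" "A j \<in> events" if "j \<in> J" for j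
    using E that J measurable_sets[OF Xm] measurable_sets[OF Y] by auto
  have evI: "(\<Inter>j\<in>J. X j -` E j \<inter> space M) \<in> events" "(\<Inter>j\<in>J. A j) \<in> events"
    by (rule sets.finite_INT; use J ev in blast)+
  have "prob (\<Inter>j\<in>J. A j) = prob (\<Inter>j\<in>J. X j -` E j \<inter> space M)"
  proof (rule finite_measure_eq_AE)
    show "AE w in M. (w \<in> (\<Inter>j\<in>J. A j)) = (w \<in> (\<Inter>j\<in>J. X j -` E j \<inter> space M))"
      using ae by eventually_elim (auto simp: E(1))
  qed (use evI in blast)+
  also have "\<dots> = (\<Prod>j\<in>J. prob (X j -` E j \<inter> space M))"
    using X J E(2) by (intro indep_varsD) auto
  also have "\<dots> = (\<Prod>j\<in>J. prob (A j))"
  proof (intro prod.cong refl finite_measure_eq_AE)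
    fix j assume j: "j \<in> J"
    show "AE w in M. (w \<in> X j -` E j \<inter> space M) = (w \<in> A j)"
      using ae by eventually_elim (use j in \<open>auto simp: E(1)\<close>)
  qed (use ev in auto)
  finally show "prob (\<Inter>j\<in>J. A j) = (\<Prod>j\<in>J. prob (A j))" .
qed

definition future_incr :: "'w measure \<Rightarrow> (real \<Rightarrow> 'w \<Rightarrow> real ^ 'd) \<Rightarrow> real \<Rightarrow> 'w measure" where
  "future_incr M L t = sigma (space M)
     {(\<lambda>w. L u w - L v w) -` B \<inter> space M | u v B. t \<le> v \<and> v < u \<and> B \<in> sets borel}"

lemma space_future_incr [simp]: "space (future_incr M L t) = space M"
  by (simp add: future_incr_def space_measure_of_conv)

lemma sets_future_incr: "sets (future_incr M L t) = sigma_sets (space M)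
     {(\<lambda>w. L u w - L v w) -` B \<inter> space M | u v B. t \<le> v \<and> v < u \<and> B \<in> sets borel}"
  unfolding future_incr_def by (rule sets_measure_of) auto

lemma incr_measurable_future:
  assumes "t \<le> v" "v \<le> u"
  shows "(\<lambda>w. L u w - L v w :: real^'d) \<in> borel_measurable (future_incr M L t)"
proof (cases "v = u")
  case False
  show ?thesis
  proof (rule measurableI)
    fix B :: "(real^'d) set" assume "B \<in> sets borel"
    then show "(\<lambda>w. L u w - L v w) -` B \<inter> space (future_incr M L t) \<in> sets (future_incr M L t)"
      unfolding sets_future_incr space_future_incr using assms False
      by (intro sigma_sets.Basic CollectI exI[of _ u] exI[of _ v] exI[of _ B] conjI refl) auto
  qed simp
qed simp

section \<open>Independence of the increments before and after a fixed time\<close>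

context levy_noise begin

text \<open>Used with finite \<open>P\<close>, where all increments are sums of consecutive ones;
  general past and future events are generated by these.\<close>

definition incr_sets :: "real set \<Rightarrow> 'w set set" where
  "incr_sets P = sigma_sets (space M) {(\<lambda>w. L u w - L v w) -` B \<inter> space M | u v B. u \<in> P \<and> v \<in> P \<and> v < u \<and> B \<in> sets borel}"

lemma incr_sets_mono: "P \<subseteq> Q \<Longrightarrow> incr_sets P \<subseteq> incr_sets Q"
  unfolding incr_sets_def by (intro sigma_sets_mono') blast

text \<open>Read off from \<open>Z\<close> on disjoint intervals, hence valid across negative times
  as well.\<close>

lemma indep_increments:
  assumes xs: "\<And>i. i < m \<Longrightarrow> x i < x (Suc i)"
  shows "indep_vars (\<lambda>_. borel) (\<lambda>i w. L (x (Suc i)) w - L (x i) w) {..<m::nat}"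
proof -
  define B where "B i = (if i < m then {x i<..x (Suc i)} else {})" for i
  have le: "x i \<le> x j" if "i \<le> j" "j \<le> m" for i j
    using that
  proof (induction j rule: dec_induct)
    case (step j) then show ?case using xs[of j] by simp
  qed simp
  have dis: "B i \<inter> B j = {}" if "i < j" for i j
    using le[of "Suc i" j] that by (auto simp: B_def)
  then have "disjoint_family B" unfolding disjoint_family_on_def by (metis Int_commute linorder_neqE_nat)
  moreover have "B i \<in> bounded_borel" for i by (simp add: B_def)
  ultimately have "indep_vars (\<lambda>_. borel) (\<lambda>i. Z (B i)) UNIV" by (intro Z_indep)
  then have "indep_vars (\<lambda>_. borel) (\<lambda>i. Z (B i)) {..<m}" by (rule indep_vars_subset) simp
  then show ?thesis
  proof (rule indep_vars_cong_AE)
    fix i assume i: "i \<in> {..<m}"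
    then show "AE w in M. Z (B i) w = L (x (Suc i)) w - L (x i) w"
      using Z_incr[OF xs[of i]] by (simp add: B_def)
  qed measurable
qed

text \<open>On the sorted union of the time points the consecutive increments are independent, and
  every increment within \<open>P\<close> or \<open>Q\<close> telescopes into them. As
  \<open>t\<close> is one of the points, no consecutive increment straddles it.\<close>

lemma incr_sets_indep:
  assumes P: "finite P" "P \<subseteq> {..t}" "t \<in> P" and Q: "finite Q" "Q \<subseteq> {t..}" "t \<in> Q"
  shows "indep_set (incr_sets P) (incr_sets Q)"
proof -
  define xs where "xs = sorted_list_of_set (P \<union> Q)"
  have xs: "set xs = P \<union> Q" "sorted xs" "distinct xs" using P Q by (auto simp: xs_def)
  obtain k where k: "k < length xs" "xs ! k = t" using xs(1) P(3) by (metis UnCI in_set_conv_nth)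
  have lt: "xs ! i < xs ! j" if "i < j" "j < length xs" for i j
    using xs that sorted_nth_mono[of xs i j] nth_eq_iff_index_eq[of xs i j] by (simp add: order_less_le)
  define m where "m = length xs - 1"
  define X where "X i w = L (xs ! Suc i) w - L (xs ! i) w" for i w
  have ind: "indep_vars (\<lambda>_. borel) X {..<m}"
    unfolding X_def[abs_def] using lt by (intro indep_increments) (auto simp: m_def)
  let ?VA = "\<lambda>w. restrict (\<lambda>i. X i w) {..<k}" and ?VB = "\<lambda>w. restrict (\<lambda>i. X i w) {k..<m}"
  have iv: "indep_var (PiM {..<k} (\<lambda>_. borel)) ?VA (PiM {k..<m} (\<lambda>_. borel)) ?VB"
    by (rule indep_var_restrict[OF ind]) (use k in \<open>auto simp: m_def\<close>)
  have tel: "L (xs ! i) w - L (xs ! j) w = (\<Sum>l\<in>{j..<i}. X l w)" if "j \<le> i" for i j w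
    unfolding X_def using sum_Suc_diff'[OF that, of "\<lambda>i. L (xs ! i) w"] by simp
  have sub: "incr_sets R \<subseteq> sigma_sets (space M) {(\<lambda>w. restrict (\<lambda>i. X i w) I) -` A \<inter> space M |A. A \<in> sets (PiM I (\<lambda>_. borel))}"
    if R: "\<And>u v. u \<in> R \<Longrightarrow> v \<in> R \<Longrightarrow> v < u \<Longrightarrow> \<exists>i j. u = xs ! i \<and> v = xs ! j \<and> j \<le> i \<and> {j..<i} \<subseteq> I"
    for R and I :: "nat set"
    unfolding incr_sets_def
  proof (rule sigma_sets_mono, rule subsetI)
    fix D assume "D \<in> {(\<lambda>w. L u w - L v w) -` B \<inter> space M | u v B. u \<in> R \<and> v \<in> R \<and> v < u \<and> B \<in> sets borel}"
    then obtain u v B where D: "D = (\<lambda>w. L u w - L v w) -` B \<inter> space M" "u \<in> R" "v \<in> R" "v < u" "B \<in> sets borel" by blast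
    then obtain i j where ij: "u = xs ! i" "v = xs ! j" "j \<le> i" "{j..<i} \<subseteq> I" using R by blast
    have m: "(\<lambda>x. \<Sum>l\<in>{j..<i}. x l) \<in> borel_measurable (PiM I (\<lambda>_. borel :: (real^'d) measure))"
      using ij(4) by (intro borel_measurable_sum measurable_component_singleton) auto
    have "D = (\<lambda>w. restrict (\<lambda>i. X i w) I) -` ((\<lambda>x. \<Sum>l\<in>{j..<i}. x l) -` B \<inter> space (PiM I (\<lambda>_. borel))) \<inter> space M"
    proof -
      have "L u w - L v w = (\<Sum>l\<in>{j..<i}. restrict (\<lambda>i. X i w) I l)" for w
        unfolding ij tel[OF ij(3)] using ij(4) by (intro sum.cong) auto
      then show ?thesis unfolding D(1) by (auto simp: space_PiM)
    qed
    moreover have "(\<lambda>x. \<Sum>l\<in>{j..<i}. x l) -` B \<inter> space (PiM I (\<lambda>_. borel)) \<in> sets (PiM I (\<lambda>_. borel :: (real^'d) measure))"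
      by (rule measurable_sets[OF m D(5)])
    ultimately show "D \<in> sigma_sets (space M) {(\<lambda>w. restrict (\<lambda>i. X i w) I) -` A \<inter> space M |A. A \<in> sets (PiM I (\<lambda>_. borel))}"
      by (intro sigma_sets.Basic) blast
  qed
  have idx: "\<exists>i<length xs. u = xs ! i" if "u \<in> P \<union> Q" for u
    using that xs(1) by (metis in_set_conv_nth)
  have ord: "j \<le> i" if "xs ! j < xs ! i" "i < length xs" "j < length xs" for i j
    using lt[of i j] that by (metis linorder_not_le order_less_asym)
  have subP: "incr_sets P \<subseteq> sigma_sets (space M) {?VA -` A \<inter> space M |A. A \<in> sets (PiM {..<k} (\<lambda>_. borel))}"
  proof (rule sub)
    fix u v assume "u \<in> P" "v \<in> P" "v < u"
    obtain i where i: "i < length xs" "u = xs ! i" using idx \<open>u \<in> P\<close> by auto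
    obtain j where j: "j < length xs" "v = xs ! j" using idx \<open>v \<in> P\<close> by auto
    have "i \<le> k" using lt[of k i] i P(2) \<open>u \<in> P\<close> k by (metis atMost_iff linorder_not_le subsetD)
    then show "\<exists>i j. u = xs ! i \<and> v = xs ! j \<and> j \<le> i \<and> {j..<i} \<subseteq> {..<k}"
      using i j ord \<open>v < u\<close> by (intro exI[of _ i] exI[of _ j]) auto
  qed
  have subQ: "incr_sets Q \<subseteq> sigma_sets (space M) {?VB -` A \<inter> space M |A. A \<in> sets (PiM {k..<m} (\<lambda>_. borel))}"
  proof (rule sub)
    fix u v assume "u \<in> Q" "v \<in> Q" "v < u"
    obtain i where i: "i < length xs" "u = xs ! i" using idx \<open>u \<in> Q\<close> by auto
    obtain j where j: "j < length xs" "v = xs ! j" using idx \<open>v \<in> Q\<close> by auto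
    have "k \<le> j" using lt[of j k] j Q(2) \<open>v \<in> Q\<close> k by (metis atLeast_iff linorder_not_le subsetD)
    then show "\<exists>i j. u = xs ! i \<and> v = xs ! j \<and> j \<le> i \<and> {j..<i} \<subseteq> {k..<m}"
      using i j ord \<open>v < u\<close> by (intro exI[of _ i] exI[of _ j]) (auto simp: m_def)
  qed
  have isec: "indep_set (sigma_sets (space M) {?VA -` A \<inter> space M |A. A \<in> sets (PiM {..<k} (\<lambda>_. borel))})
     (sigma_sets (space M) {?VB -` A \<inter> space M |A. A \<in> sets (PiM {k..<m} (\<lambda>_. borel))})"
    using iv unfolding indep_var_eq by blast
  show ?thesis
    using subP subQ indep_setD[OF isec] indep_setD_ev1[OF isec] indep_setD_ev2[OF isec]
    by (intro indep_setI) blast+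
qed

text \<open>The events determined by finitely many times form a directed union of sigma-algebras,
  hence an intersection-stable generator of the past or the future.\<close>

lemma past_future_indep:
  assumes A: "A \<in> sets (incr_filtration M L t)" and B: "B \<in> sets (future_incr M L t)"
  shows "prob (A \<inter> B) = prob A * prob B"
proof -
  define PP where "PP = (\<Union>P\<in>{P. finite P \<and> P \<subseteq> {..t} \<and> t \<in> P}. incr_sets P)"
  define QQ where "QQ = (\<Union>P\<in>{P. finite P \<and> P \<subseteq> {t..} \<and> t \<in> P}. incr_sets P)"
  have stable: "Int_stable (\<Union>P\<in>{P. finite P \<and> P \<subseteq> S \<and> t \<in> P}. incr_sets P)" for S
  proof (rule Int_stableI)
    fix a b assume "a \<in> (\<Union>P\<in>{P. finite P \<and> P \<subseteq> S \<and> t \<in> P}. incr_sets P)" "b \<in> (\<Union>P\<in>{P. finite P \<and> P \<subseteq> S \<and> t \<in> P}. incr_sets P)"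
    then obtain P1 P2 where P: "finite P1" "P1 \<subseteq> S" "t \<in> P1" "a \<in> incr_sets P1" "finite P2" "P2 \<subseteq> S" "b \<in> incr_sets P2" by blast
    interpret sigma_algebra "space M" "incr_sets (P1 \<union> P2)"
      unfolding incr_sets_def by (rule sigma_algebra_sigma_sets) auto
    have "a \<inter> b \<in> incr_sets (P1 \<union> P2)"
      using P incr_sets_mono[of P1 "P1 \<union> P2"] incr_sets_mono[of P2 "P1 \<union> P2"] by (intro Int) auto
    then show "a \<inter> b \<in> (\<Union>P\<in>{P. finite P \<and> P \<subseteq> S \<and> t \<in> P}. incr_sets P)" using P by blast
  qed
  have "indep_set PP QQ"
  proof (rule indep_setI)
    have ev: "incr_sets P \<subseteq> events" for P
      unfolding incr_sets_def by (intro sets.sigma_sets_subset) (auto intro!: measurable_sets[OF borel_measurable_diff[OF L_measurable L_measurable]])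
    show "PP \<subseteq> events" "QQ \<subseteq> events" using ev by (auto simp: PP_def QQ_def)
    fix a b assume "a \<in> PP" "b \<in> QQ"
    then obtain P Q where "finite P" "P \<subseteq> {..t}" "t \<in> P" "a \<in> incr_sets P" "finite Q" "Q \<subseteq> {t..}" "t \<in> Q" "b \<in> incr_sets Q"
      unfolding PP_def QQ_def by blast
    then show "prob (a \<inter> b) = prob a * prob b" using indep_setD[OF incr_sets_indep[of P t Q]] by blast
  qed
  then have ind: "indep_set (sigma_sets (space M) PP) (sigma_sets (space M) QQ)"
    by (rule indep_set_sigma_sets) (auto simp: PP_def QQ_def intro: stable)
  have "sets (incr_filtration M L t) \<subseteq> sigma_sets (space M) PP"
    unfolding sets_incr_filtration
  proof (rule sigma_sets_mono', rule subsetI)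
    fix D assume "D \<in> {(\<lambda>w. L u w - L v w) -` B \<inter> space M | u v B. v < u \<and> u \<le> t \<and> B \<in> sets borel}"
    then obtain u v B where D: "D = (\<lambda>w. L u w - L v w) -` B \<inter> space M" "v < u" "u \<le> t" "B \<in> sets borel" by blast
    then have "D \<in> incr_sets {u, v, t}" unfolding incr_sets_def by (intro sigma_sets.Basic) blast
    moreover have "finite {u, v, t} \<and> {u, v, t} \<subseteq> {..t} \<and> t \<in> {u, v, t}" using D by auto
    ultimately show "D \<in> PP" unfolding PP_def by blast
  qed
  moreover have "sets (future_incr M L t) \<subseteq> sigma_sets (space M) QQ"
    unfolding sets_future_incr
  proof (rule sigma_sets_mono', rule subsetI)
    fix D assume "D \<in> {(\<lambda>w. L u w - L v w) -` B \<inter> space M | u v B. t \<le> v \<and> v < u \<and> B \<in> sets borel}"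
    then obtain u v B where D: "D = (\<lambda>w. L u w - L v w) -` B \<inter> space M" "t \<le> v" "v < u" "B \<in> sets borel" by blast
    then have "D \<in> incr_sets {u, v, t}" unfolding incr_sets_def by (intro sigma_sets.Basic) blast
    moreover have "finite {u, v, t} \<and> {u, v, t} \<subseteq> {t..} \<and> t \<in> {u, v, t}" using D by auto
    ultimately show "D \<in> QQ" unfolding QQ_def by blast
  qed
  ultimately show ?thesis using indep_setD[OF ind] A B by blast
qed

lemma sets_incr_filtration_events: "sets (incr_filtration M L t) \<subseteq> events"
  using subalgebra_incr_filtration[of L M t] L_measurable by (auto simp: subalgebra_def)

lemma sets_future_incr_events: "sets (future_incr M L t) \<subseteq> events"
  unfolding sets_future_incr
  by (intro sets.sigma_sets_subset) (auto intro!: measurable_sets[OF borel_measurable_diff[OF L_measurable L_measurable]])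

lemma incr_filtration_mono: "s \<le> t \<Longrightarrow> sets (incr_filtration M L s) \<subseteq> sets (incr_filtration M L t)"
  unfolding sets_incr_filtration by (intro sigma_sets_mono') (blast intro: order_trans)

lemma future_incr_mono: "s \<le> t \<Longrightarrow> sets (future_incr M L t) \<subseteq> sets (future_incr M L s)"
  unfolding sets_future_incr by (intro sigma_sets_mono') (blast intro: order_trans)

end

text \<open>By independence the joint law is a product. If the inner probability is positive for
  every outcome in \<open>A\<close>, its integral over \<open>A\<close> is positive, and Fubini
  identifies this integral with the probability in question.\<close>

lemma (in prob_space) prob_pos_indep:
  fixes V W :: "'a \<Rightarrow> 'b::{second_countable_topology, t2_space}"
  assumes ind: "\<And>A B. A \<in> sets F \<Longrightarrow> B \<in> sets G \<Longrightarrow> prob (A \<inter> B) = prob A * prob B"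
    and F: "sets F \<subseteq> events" "space F = space M" and G: "sets G \<subseteq> events" "space G = space M"
    and V: "V \<in> borel_measurable F" and W: "W \<in> borel_measurable G"
    and A: "A \<in> sets F" "prob A > 0" and B: "B \<in> sets G"
    and S [measurable]: "S \<in> sets (borel \<Otimes>\<^sub>M borel)"
    and pos: "\<And>w. w \<in> A \<Longrightarrow> prob ({w'\<in>space M. (V w, W w') \<in> S} \<inter> B) > 0"
  shows "prob (A \<inter> ({w\<in>space M. (V w, W w) \<in> S} \<inter> B)) > 0"
proof -
  let ?N = "borel \<Otimes>\<^sub>M borel :: ('b \<times> real) measure"
  \<comment> \<open>The indicators are carried along as coordinates, so that membership in
    \<open>A\<close> and \<open>B\<close> becomes a condition on the product space.\<close>
  define X where "X w = (V w, indicator A w :: real)" for w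
  define Y where "Y w = (W w, indicator B w :: real)" for w
  have XF: "X \<in> measurable F ?N" unfolding X_def[abs_def] using V A(1) by (intro measurable_Pair) auto
  have YG: "Y \<in> measurable G ?N" unfolding Y_def[abs_def] using W B by (intro measurable_Pair) auto
  have X [measurable]: "X \<in> measurable M ?N"
    using XF F by (auto simp: measurable_def)
  have Y [measurable]: "Y \<in> measurable M ?N"
    using YG G by (auto simp: measurable_def)
  have V' [measurable]: "V \<in> borel_measurable M" using V F by (auto simp: measurable_def)
  have W' [measurable]: "W \<in> borel_measurable M" using W G by (auto simp: measurable_def)
  have Ae [measurable]: "A \<in> events" and Be [measurable]: "B \<in> events" using A B F G by auto
  have "indep_var ?N X ?N Y"
    unfolding indep_var_eq
  proof (intro conjI X Y indep_setI)
    have sX: "sigma_sets (space M) {X -` A \<inter> space M |A. A \<in> sets ?N} \<subseteq> sets F"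
      unfolding F(2)[symmetric] using measurable_sets[OF XF] by (intro sets.sigma_sets_subset) auto
    have sY: "sigma_sets (space M) {Y -` A \<inter> space M |A. A \<in> sets ?N} \<subseteq> sets G"
      unfolding G(2)[symmetric] using measurable_sets[OF YG] by (intro sets.sigma_sets_subset) auto
    show "sigma_sets (space M) {X -` A \<inter> space M |A. A \<in> sets ?N} \<subseteq> events"
      "sigma_sets (space M) {Y -` A \<inter> space M |A. A \<in> sets ?N} \<subseteq> events"
      using sX sY F(1) G(1) by blast+
    fix a b assume "a \<in> sigma_sets (space M) {X -` A \<inter> space M |A. A \<in> sets ?N}"
      "b \<in> sigma_sets (space M) {Y -` A \<inter> space M |A. A \<in> sets ?N}"
    then show "prob (a \<inter> b) = prob a * prob b" using sX sY by (intro ind) blast+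
  qed
  then have prod: "distr M ?N X \<Otimes>\<^sub>M distr M ?N Y = distr M (?N \<Otimes>\<^sub>M ?N) (\<lambda>x. (X x, Y x))"
    unfolding indep_var_distribution_eq by blast
  interpret DY: prob_space "distr M ?N Y" by (rule prob_space_distr) measurable
  define S' where "S' = {p \<in> space (?N \<Otimes>\<^sub>M ?N). snd (fst p) = 1 \<and> snd (snd p) = 1 \<and> (fst (fst p), fst (snd p)) \<in> S}"
  have S' [measurable]: "S' \<in> sets (?N \<Otimes>\<^sub>M ?N)"
    unfolding S'_def by measurable
  let ?T = "A \<inter> ({w\<in>space M. (V w, W w) \<in> S} \<inter> B)"
  have sub: "w \<in> space M" if "w \<in> A \<or> w \<in> B" for w using that sets.sets_into_space[OF Ae] sets.sets_into_space[OF Be] by blast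
  have T: "?T = (\<lambda>w. (X w, Y w)) -` S' \<inter> space M"
    using sub by (auto simp: S'_def X_def Y_def space_pair_measure split: split_indicator_asm)
  have Te: "?T \<in> events" unfolding T by measurable
  have "emeasure M ?T = emeasure (distr M ?N X \<Otimes>\<^sub>M distr M ?N Y) S'"
    unfolding prod T by (subst emeasure_distr) measurable
  also have "\<dots> = (\<integral>\<^sup>+x. emeasure (distr M ?N Y) (Pair x -` S') \<partial>distr M ?N X)"
    by (rule DY.emeasure_pair_measure_alt) simp
  also have "\<dots> = (\<integral>\<^sup>+w. emeasure (distr M ?N Y) (Pair (X w) -` S') \<partial>M)"
  proof (rule nn_integral_distr)
    have "(\<lambda>x. emeasure (distr M ?N Y) (Pair x -` S')) \<in> borel_measurable (distr M ?N X)"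
      by (rule DY.measurable_emeasure_Pair) simp
    then show "(\<lambda>x. emeasure (distr M ?N Y) (Pair x -` S')) \<in> borel_measurable (distr M ?N X)" .
  qed measurable
  finally have eq: "emeasure M ?T = (\<integral>\<^sup>+w. emeasure (distr M ?N Y) (Pair (X w) -` S') \<partial>M)" .
  have m: "(\<lambda>w. emeasure (distr M ?N Y) (Pair (X w) -` S')) \<in> borel_measurable M"
  proof -
    have "(\<lambda>x. emeasure (distr M ?N Y) (Pair x -` S')) \<in> borel_measurable ?N"
      using DY.measurable_emeasure_Pair[of S' ?N] by simp
    then show ?thesis by (rule measurable_compose[OF X])
  qed
  show ?thesis
  proof (rule ccontr)
    assume "\<not> ?thesis"
    then have "prob ?T = 0" using measure_nonneg[of M ?T] by linarith
    then have "emeasure M ?T = 0" by (simp add: emeasure_eq_measure)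
    then have ae: "AE w in M. emeasure (distr M ?N Y) (Pair (X w) -` S') = 0"
      using eq m by (simp add: nn_integral_0_iff_AE)
    have "AE w in M. w \<notin> A"
      using ae
    proof eventually_elim
      case (elim w)
      show ?case
      proof
        assume w: "w \<in> A"
        have "Pair (X w) -` S' \<in> sets ?N" by (rule sets_Pair1[OF S'])
        then have "emeasure (distr M ?N Y) (Pair (X w) -` S') = emeasure M (Y -` (Pair (X w) -` S') \<inter> space M)"
          by (rule emeasure_distr[OF Y])
        also have "Y -` (Pair (X w) -` S') \<inter> space M = {w'\<in>space M. (V w, W w') \<in> S} \<inter> B"
          using sub w by (auto simp: S'_def X_def Y_def space_pair_measure split: split_indicator_asm)
        finally show False using elim pos[OF w] by (simp add: emeasure_eq_measure)
      qed
    qed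
    then have "prob A = 0" by (subst prob_eq_0) auto
    then show False using A by simp
  qed
qed

text \<open>Adds what the feedback argument needs at nonnegative times: regular paths and stationary
  increments.\<close>

locale stationary_noise = levy_noise M L Z \<psi>
  for M :: "'w measure" and L :: "real \<Rightarrow> 'w \<Rightarrow> real^'d" and Z \<psi> +
  assumes cadlag: "\<And>w. w \<in> space M \<Longrightarrow> cadlag_on {0..} (\<lambda>t. L t w)"
    and stationary: "\<And>s t. 0 \<le> s \<Longrightarrow> s \<le> t \<Longrightarrow> distr M borel (\<lambda>w. L t w - L s w) = distr M borel (L (t - s))"
begin

section \<open>Suprema of increments over short intervals, and feedback along a grid\<close>

definition grid_event :: "real \<Rightarrow> real \<Rightarrow> nat \<Rightarrow> real \<Rightarrow> 'w set" where
  "grid_event t h n \<eta> = {w\<in>space M. \<forall>j\<le>n. norm (L (grid t (t + h) n j) w - L t w) \<le> \<eta>}"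

text \<open>The uncountably many conditions reduce to dyadic times by right-continuity, see
  \<open>sup_event_eq\<close>; this gives measurability and a limit along refining grids.\<close>

definition sup_event :: "real \<Rightarrow> real \<Rightarrow> real \<Rightarrow> 'w set" where
  "sup_event t h \<eta> = {w\<in>space M. \<forall>s\<in>{t..t + h}. norm (L s w - L t w) \<le> \<eta>}"

lemma grid_event_sets:
  assumes h: "0 \<le> h"
  shows "grid_event t h n \<eta> \<in> sets (future_incr M L t)" "grid_event t h n \<eta> \<in> sets (incr_filtration M L (t + h))"
proof -
  have *: "grid_event t h n \<eta> \<in> sets N" if N: "space N = space M"
    and m: "\<And>j. j \<le> n \<Longrightarrow> (\<lambda>w. L (grid t (t + h) n j) w - L t w) \<in> borel_measurable N" for N
  proof -
    have "grid_event t h n \<eta> = {w\<in>space N. \<forall>j\<in>{..n}. norm (L (grid t (t + h) n j) w - L t w) \<le> \<eta>}"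
      by (auto simp: grid_event_def N)
    also have "\<dots> \<in> sets N"
    proof (rule sets.sets_Collect_finite_All)
      fix j assume "j \<in> {..n}"
      then have [measurable]: "(\<lambda>w. L (grid t (t + h) n j) w - L t w) \<in> borel_measurable N" by (intro m) simp
      show "{w \<in> space N. norm (L (grid t (t + h) n j) w - L t w) \<le> \<eta>} \<in> sets N" by measurable
    qed simp
    finally show ?thesis .
  qed
  have g: "t \<le> grid t (t + h) n j" "grid t (t + h) n j \<le> t + h" if "j \<le> n" for j
    using grid_mem[of t "t + h" j n] that h by auto
  show "grid_event t h n \<eta> \<in> sets (future_incr M L t)"
    by (rule *) (auto intro!: incr_measurable_future g)
  show "grid_event t h n \<eta> \<in> sets (incr_filtration M L (t + h))"
    by (rule *) (auto intro!: incr_measurable_filtration g)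
qed

text \<open>The event is determined by the \<open>n\<close> increments over the cells, which are
  independent with a law depending on \<open>h / real n\<close> only.\<close>

lemma prob_grid_event:
  assumes t: "0 \<le> t" and h: "0 < h" and n: "0 < n"
  shows "prob (grid_event t h n \<eta>) = prob (grid_event 0 h n \<eta>)"
proof -
  define D where "D = distr M borel (L (h / real n))"
  define S where "S = {x \<in> space (PiM {..<n} (\<lambda>_. borel :: (real^'d) measure)). \<forall>j\<in>{..n}. norm (\<Sum>i<j. x i) \<le> \<eta>}"
  have S: "S \<in> sets (PiM {..<n} (\<lambda>_. borel))"
    unfolding S_def
  proof (rule sets.sets_Collect_finite_All)
    fix j assume "j \<in> {..n}"
    then have [measurable]: "(\<lambda>x. \<Sum>i<j. x i) \<in> borel_measurable (PiM {..<n} (\<lambda>_. borel :: (real^'d) measure))"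
      by (intro borel_measurable_sum measurable_component_singleton) auto
    show "{x \<in> space (PiM {..<n} (\<lambda>_. borel :: (real^'d) measure)). norm (\<Sum>i<j. x i) \<le> \<eta>} \<in> sets (PiM {..<n} (\<lambda>_. borel))"
      by measurable
  qed simp
  have "prob (grid_event t h n \<eta>) = measure (PiM {..<n} (\<lambda>_. D)) S" if t: "0 \<le> t" for t
  proof -
    let ?g = "grid t (t + h) n"
    define X where "X i w = L (?g (Suc i)) w - L (?g i) w" for i w
    have X [measurable]: "X i \<in> borel_measurable M" for i by (simp add: X_def[abs_def])
    have ind: "indep_vars (\<lambda>_. borel) X {..<n}"
      unfolding X_def[abs_def] using h n by (intro indep_increments grid_strict_mono) auto
    have XD: "distr M borel (X i) = D" if "i < n" for i
    proof -
      have "?g (Suc i) - ?g i = h / real n" by (simp add: grid_def algebra_simps add_divide_distrib)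
      moreover have "0 \<le> ?g i" "?g i \<le> ?g (Suc i)"
        using grid_mem[of t "t + h" i n] grid_mono[of t "t + h" i "Suc i" n] that t h by auto
      ultimately show ?thesis unfolding X_def[abs_def] D_def using stationary by metis
    qed
    have "distr M (PiM {..<n} (\<lambda>_. borel)) (\<lambda>w. \<lambda>i\<in>{..<n}. X i w) = PiM {..<n} (\<lambda>i. distr M borel (X i))"
      using n ind by (subst (asm) indep_vars_iff_distr_eq_PiM') auto
    also have "\<dots> = PiM {..<n} (\<lambda>_. D)" by (intro PiM_cong) (auto simp: XD)
    finally have eq: "distr M (PiM {..<n} (\<lambda>_. borel)) (\<lambda>w. \<lambda>i\<in>{..<n}. X i w) = PiM {..<n} (\<lambda>_. D)" .
    have "L (?g j) w - L t w = (\<Sum>i<j. (\<lambda>i\<in>{..<n}. X i w) i)" if "j \<le> n" for j w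
    proof -
      have "(\<Sum>i<j. (\<lambda>i\<in>{..<n}. X i w) i) = (\<Sum>i<j. X i w)" using that by (intro sum.cong) auto
      also have "\<dots> = L (?g j) w - L (?g 0) w"
        unfolding X_def using sum_lessThan_telescope[of "\<lambda>i. L (?g i) w" j] by simp
      finally show ?thesis by simp
    qed
    then have "grid_event t h n \<eta> = (\<lambda>w. \<lambda>i\<in>{..<n}. X i w) -` S \<inter> space M"
      by (auto simp: grid_event_def S_def space_PiM)
    then show ?thesis
      unfolding eq[symmetric] using S by (subst measure_distr) (auto intro!: measurable_restrict)
  qed
  from this[OF t] this[of 0] show ?thesis by simp
qed

lemma sup_event_eq:
  assumes t: "0 \<le> t" and h: "0 < h"
  shows "sup_event t h \<eta> = (\<Inter>m. grid_event t h (2 ^ m) \<eta>)"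
proof
  show "sup_event t h \<eta> \<subseteq> (\<Inter>m. grid_event t h (2 ^ m) \<eta>)"
    using grid_mem[of t "t + h"] h by (auto simp: sup_event_def grid_event_def)
  show "(\<Inter>m. grid_event t h (2 ^ m) \<eta>) \<subseteq> sup_event t h \<eta>"
  proof
    fix w assume w: "w \<in> (\<Inter>m. grid_event t h (2 ^ m) \<eta>)"
    then have sp: "w \<in> space M" by (auto simp: grid_event_def)
    define D where "D = {grid t (t + h) (2 ^ m) j | m j :: nat. j \<le> 2 ^ m}"
    have "L s w - L t w \<in> cball 0 \<eta>" if s: "s \<in> {t..t + h}" for s
    proof (rule cadlag_on_dense_closed[where D = D and a = t and b = "t + h" and f = "\<lambda>s. L s w - L t w"])
      show "cadlag_on {t..t + h} (\<lambda>s. L s w - L t w)"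
        using t by (intro cadlag_on_diff_continuous cadlag_on_subset[OF cadlag[OF sp]]) auto
      show "D \<subseteq> {t..t + h}" using grid_mem[of t "t + h"] h by (auto simp: D_def)
      have "grid t (t + h) (2 ^ 0) 1 = t + h" by (simp add: grid_def)
      then show "t + h \<in> D" unfolding D_def by (intro CollectI exI[of _ 0] exI[of _ 1]) auto
      show "L d w - L t w \<in> cball 0 \<eta>" if "d \<in> D" for d
        using that w by (auto simp: D_def grid_event_def)
      show "\<exists>d\<in>D. u < d \<and> d < v" if uv: "t \<le> u" "u < v" "v \<le> t + h" for u v
      proof -
        obtain m where m: "h / (v - u) < 2 ^ m" using real_arch_pow[of 2 "h / (v - u)"] by auto
        \<comment> \<open>The first grid point strictly beyond \<open>u\<close>; as the mesh is
          smaller than \<open>v - u\<close>, it lies before \<open>v\<close>.\<close>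
        define j where "j = nat (\<lfloor>(u - t) * 2 ^ m / h\<rfloor> + 1)"
        have "(u - t) * 2 ^ m / h \<ge> 0" using uv h by simp
        then have "real j = real_of_int \<lfloor>(u - t) * 2 ^ m / h\<rfloor> + 1" by (simp add: j_def)
        then have j: "(u - t) * 2 ^ m / h < real j" "real j \<le> (u - t) * 2 ^ m / h + 1" by linarith+
        have "u < t + real j * (h / 2 ^ m)" using j(1) h by (simp add: field_simps)
        moreover have lt: "t + real j * (h / 2 ^ m) < v"
        proof -
          have "real j * (h / 2 ^ m) \<le> ((u - t) * 2 ^ m / h + 1) * (h / 2 ^ m)" using j(2) h by (intro mult_right_mono) auto
          also have "\<dots> = (u - t) + h / 2 ^ m" using h by (simp add: field_simps)
          also have "h / 2 ^ m < v - u" using m uv by (simp add: field_simps)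
          finally show ?thesis by simp
        qed
        moreover have "j \<le> 2 ^ m"
        proof -
          have "real j * (h / 2 ^ m) < h" using lt uv by linarith
          then have "real j < 2 ^ m" using h by (simp add: field_simps)
          then show ?thesis by (metis less_imp_le of_nat_less_iff of_nat_numeral of_nat_power)
        qed
        ultimately show ?thesis unfolding D_def
          by (intro bexI[of _ "grid t (t + h) (2 ^ m) j"]) (auto simp: grid_def)
      qed
    qed (use s in auto)
    then show "w \<in> sup_event t h \<eta>" using sp by (auto simp: sup_event_def)
  qed
qed

lemma grid_event_decseq: "decseq (\<lambda>m. grid_event t h (2 ^ m) \<eta>)"
proof (rule decseq_SucI, rule subsetI)
  fix m w assume w: "w \<in> grid_event t h (2 ^ Suc m) \<eta>"
  have "norm (L (grid t (t + h) (2 ^ m) j) w - L t w) \<le> \<eta>" if "j \<le> 2 ^ m" for j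
  proof -
    have "grid t (t + h) (2 ^ m) j = grid t (t + h) (2 ^ Suc m) (2 * j)" by (simp add: grid_def)
    then show ?thesis using w that by (auto simp: grid_event_def)
  qed
  then show "w \<in> grid_event t h (2 ^ m) \<eta>" using w by (auto simp: grid_event_def)
qed

lemma sup_event_sets:
  assumes t: "0 \<le> t" and h: "0 < h"
  shows "sup_event t h \<eta> \<in> sets (future_incr M L t)" "sup_event t h \<eta> \<in> sets (incr_filtration M L (t + h))"
  unfolding sup_event_eq[OF assms] using grid_event_sets h by auto

lemma sup_event_events: "0 \<le> t \<Longrightarrow> 0 < h \<Longrightarrow> sup_event t h \<eta> \<in> events"
  using sup_event_sets sets_future_incr_events by blast

lemma grid_event_events: "0 < h \<Longrightarrow> grid_event t h n \<eta> \<in> events"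
  using grid_event_sets(1)[of h t n \<eta>] sets_future_incr_events[of t] by auto

lemma grid_event_tendsto:
  assumes "0 \<le> t" "0 < h"
  shows "(\<lambda>m. prob (grid_event t h (2 ^ m) \<eta>)) \<longlonglongrightarrow> prob (sup_event t h \<eta>)"
  unfolding sup_event_eq[OF assms] using grid_event_events assms
  by (intro finite_Lim_measure_decseq grid_event_decseq) auto

lemma prob_sup_event:
  assumes "0 \<le> t" "0 < h" shows "prob (sup_event t h \<eta>) = prob (sup_event 0 h \<eta>)"
proof (rule LIMSEQ_unique[OF grid_event_tendsto[OF assms]])
  show "(\<lambda>m. prob (grid_event t h (2 ^ m) \<eta>)) \<longlonglongrightarrow> prob (sup_event 0 h \<eta>)"
    using grid_event_tendsto[of 0 h \<eta>] assms prob_grid_event[OF assms] by simp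
qed

text \<open>At time zero these events increase to the whole space by right-continuity of the paths;
  stationarity carries the bound to all \<open>t\<close> with the same \<open>h0\<close>.\<close>

lemma sup_event_likely:
  assumes \<eta>: "\<eta> > 0" and p: "p < 1"
  obtains h0 where "h0 > 0" "\<And>t h. 0 \<le> t \<Longrightarrow> 0 < h \<Longrightarrow> h \<le> h0 \<Longrightarrow> prob (sup_event t h \<eta>) > p"
proof -
  have inc: "incseq (\<lambda>n. sup_event 0 (1 / real (Suc n)) \<eta>)"
  proof (rule incseq_SucI, rule subsetI)
    fix n w assume "w \<in> sup_event 0 (1 / real (Suc n)) \<eta>"
    moreover have "1 / real (Suc (Suc n)) \<le> 1 / real (Suc n)" by (intro divide_left_mono) auto
    ultimately show "w \<in> sup_event 0 (1 / real (Suc (Suc n))) \<eta>"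
      unfolding sup_event_def by (auto simp del: of_nat_Suc)
  qed
  have "(\<Union>n. sup_event 0 (1 / real (Suc n)) \<eta>) = space M"
  proof
    show "space M \<subseteq> (\<Union>n. sup_event 0 (1 / real (Suc n)) \<eta>)"
    proof
      fix w assume sp: "w \<in> space M"
      have "((\<lambda>s. L s w) \<longlongrightarrow> L 0 w) (at 0 within ({0..} \<inter> {0<..}))"
        using cadlag[OF sp] unfolding cadlag_on_def by (metis atLeast_iff order_refl)
      from tendstoD[OF this \<eta>] obtain d where d: "d > 0"
        "\<forall>s\<in>{0..} \<inter> {0<..}. s \<noteq> 0 \<and> dist s 0 < d \<longrightarrow> dist (L s w) (L 0 w) < \<eta>"
        unfolding eventually_at by blast
      obtain n where n: "1 / real (Suc n) < d" using d(1) reals_Archimedean[of d] by (auto simp: inverse_eq_divide)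
      have "norm (L s w - L 0 w) \<le> \<eta>" if "s \<in> {0..0 + 1 / real (Suc n)}" for s
      proof (cases "s = 0")
        case False
        then have "dist s 0 < d" using that n by (auto simp del: of_nat_Suc)
        then have "dist (L s w) (L 0 w) < \<eta>" using d(2) that False by auto
        then show ?thesis by (simp add: dist_norm)
      qed (use \<eta> in simp)
      then have "w \<in> sup_event 0 (1 / real (Suc n)) \<eta>" using sp unfolding sup_event_def by blast
      then show "w \<in> (\<Union>n. sup_event 0 (1 / real (Suc n)) \<eta>)" by blast
    qed
  qed (auto simp: sup_event_def)
  moreover have "range (\<lambda>n. sup_event 0 (1 / real (Suc n)) \<eta>) \<subseteq> events"
    by (intro image_subsetI sup_event_events) auto
  ultimately have "(\<lambda>n. prob (sup_event 0 (1 / real (Suc n)) \<eta>)) \<longlonglongrightarrow> 1"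
    using finite_Lim_measure_incseq[OF _ inc] by (simp only: prob_space)
  from order_tendstoD(1)[OF this p] obtain n where n: "p < prob (sup_event 0 (1 / real (Suc n)) \<eta>)"
    by (auto simp: eventually_sequentially)
  show thesis
  proof (rule that[of "1 / real (Suc n)"])
    fix t h :: real assume "0 \<le> t" "0 < h" "h \<le> 1 / real (Suc n)"
    then have "prob (sup_event 0 (1 / real (Suc n)) \<eta>) \<le> prob (sup_event 0 h \<eta>)"
      by (intro finite_measure_mono sup_event_events) (auto simp: sup_event_def simp del: of_nat_Suc)
    then show "p < prob (sup_event t h \<eta>)" using n prob_sup_event[of t h \<eta>] \<open>0 \<le> t\<close> \<open>0 < h\<close> by simp
  qed simp
qed

text \<open>Only positivity is propagated, without lower bounds, which is enough for finitely many
  steps. The event built so far belongs to the past of the current grid time, so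
  \<open>prob_pos_indep\<close> applies with the current deviation as \<open>V\<close> and the next
  increment as \<open>W\<close>.\<close>

lemma feedback:
  fixes g :: "real \<Rightarrow> real^'d"
  assumes K: "K \<in> sets borel" "0 \<in> K" and h: "h > 0" and t0: "t0 \<ge> 0"
    and step: "\<And>k v. k < N \<Longrightarrow> v \<in> K \<Longrightarrow>
      prob ({w\<in>space M. v + (L (t0 + real (Suc k) * h) w - L (t0 + real k * h) w) -
          (g (t0 + real (Suc k) * h) - g (t0 + real k * h)) \<in> K} \<inter> sup_event (t0 + real k * h) h \<eta>) > 0"
    and A: "A \<in> sets (incr_filtration M L t0)" "prob A > 0"
  shows "\<exists>A'\<in>sets (incr_filtration M L (t0 + real N * h)). prob A' > 0 \<and> A' \<subseteq> A \<and>
    (\<forall>w\<in>A'. \<forall>k\<le>N. L (t0 + real k * h) w - L t0 w - (g (t0 + real k * h) - g t0) \<in> K) \<and>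
    (\<forall>w\<in>A'. \<forall>k<N. w \<in> sup_event (t0 + real k * h) h \<eta>)"
  using step
proof (induction N)
  case 0
  then show ?case using A K by (intro bexI[of _ A]) auto
next
  case (Suc N)
  define t where "t = t0 + real N * h"
  have t: "t \<ge> 0" "t \<ge> t0" using t0 h by (auto simp: t_def)
  have th: "t0 + real (Suc N) * h = t + h" by (simp add: t_def algebra_simps)
  obtain A' where A': "A' \<in> sets (incr_filtration M L t)" "prob A' > 0" "A' \<subseteq> A"
    "\<And>w k. w \<in> A' \<Longrightarrow> k \<le> N \<Longrightarrow> L (t0 + real k * h) w - L t0 w - (g (t0 + real k * h) - g t0) \<in> K"
    "\<And>w k. w \<in> A' \<Longrightarrow> k < N \<Longrightarrow> w \<in> sup_event (t0 + real k * h) h \<eta>"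
    using Suc.IH[OF Suc.prems] unfolding t_def by (metis less_SucI)
  define V where "V w = L t w - L t0 w - (g t - g t0)" for w
  define W where "W w = L (t + h) w - L t w" for w
  define \<Delta> where "\<Delta> = g (t + h) - g t"
  define S where "S = {p :: (real^'d) \<times> (real^'d). fst p + snd p - \<Delta> \<in> K}"
  have S: "S \<in> sets (borel \<Otimes>\<^sub>M borel)"
  proof -
    have [measurable]: "K \<in> sets borel" by (rule K)
    have "{p \<in> space (borel \<Otimes>\<^sub>M borel). fst p + snd p - \<Delta> \<in> K} \<in> sets (borel \<Otimes>\<^sub>M borel)" by measurable
    then show ?thesis by (simp add: S_def space_pair_measure)
  qed
  have VF: "V \<in> borel_measurable (incr_filtration M L t)"
    unfolding V_def[abs_def] using t by (intro borel_measurable_diff incr_measurable_filtration) auto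
  have WG: "W \<in> borel_measurable (future_incr M L t)"
    unfolding W_def[abs_def] using h by (intro incr_measurable_future) auto
  let ?A = "A' \<inter> ({w\<in>space M. (V w, W w) \<in> S} \<inter> sup_event t h \<eta>)"
  have pos: "prob ?A > 0"
  proof (rule prob_pos_indep[OF past_future_indep[of _ t] sets_incr_filtration_events _ sets_future_incr_events _ VF WG A'(1,2) _ S])
    show "sup_event t h \<eta> \<in> sets (future_incr M L t)" by (rule sup_event_sets[OF t(1) h])
    fix w assume "w \<in> A'"
    then have "V w \<in> K" using A'(4)[of w N] by (simp add: V_def t_def)
    from Suc.prems[OF _ this, of N]
    show "prob ({w' \<in> space M. (V w, W w') \<in> S} \<inter> sup_event t h \<eta>) > 0"
      by (simp only: th t_def[symmetric] S_def W_def \<Delta>_def mem_Collect_eq fst_conv snd_conv lessI)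
  qed auto
  have in_F: "?A \<in> sets (incr_filtration M L (t + h))"
  proof -
    have 1: "A' \<in> sets (incr_filtration M L (t + h))" using A'(1) incr_filtration_mono[of t "t + h"] h by auto
    have "(\<lambda>w. (V w, W w)) \<in> measurable (incr_filtration M L (t + h)) (borel \<Otimes>\<^sub>M borel)"
      unfolding V_def[abs_def] W_def[abs_def] using h t
      by (intro measurable_Pair borel_measurable_diff incr_measurable_filtration) auto
    from measurable_sets[OF this S] have "{w\<in>space M. (V w, W w) \<in> S} \<in> sets (incr_filtration M L (t + h))"
      by (simp add: vimage_def Int_def conj_commute)
    then show ?thesis using 1 sup_event_sets(2)[OF t(1) h] by blast
  qed
  show ?case
    unfolding th
  proof (intro bexI[OF _ in_F] conjI pos ballI allI impI)
    show "?A \<subseteq> A" using A' by blast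
    fix w k assume w: "w \<in> ?A"
    { assume "k < Suc N"
      then show "w \<in> sup_event (t0 + real k * h) h \<eta>"
        using w A'(5)[of w k] by (auto simp: less_Suc_eq t_def) }
    { assume "k \<le> Suc N"
      then show "L (t0 + real k * h) w - L t0 w - (g (t0 + real k * h) - g t0) \<in> K"
      proof (cases "k = Suc N")
        case True
        have "V w + W w - \<Delta> \<in> K" using w by (simp add: S_def)
        moreover have "V w + W w - \<Delta> = L (t + h) w - L t0 w - (g (t + h) - g t0)"
          by (simp add: V_def W_def \<Delta>_def)
        ultimately show ?thesis unfolding True th by simp
      next
        case False
        then show ?thesis using w A'(4)[of w k] \<open>k \<le> Suc N\<close> by auto
      qed }
  qed
qed

text \<open>Between grid times three errors add up: the deviation at the last grid time, the
  fluctuation of \<open>L\<close> within the step, and that of \<open>g\<close>.\<close>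

lemma feedback_path:
  fixes g :: "real \<Rightarrow> real^'d"
  assumes K: "K \<in> sets borel" "0 \<in> K" "\<And>v. v \<in> K \<Longrightarrow> norm v \<le> \<rho>" and t0: "0 \<le> t0" "t0 < T" and N: "N > 0"
    and h: "h = (T - t0) / real N"
    and step: "\<And>k v. k < N \<Longrightarrow> v \<in> K \<Longrightarrow>
      prob ({w\<in>space M. v + (L (t0 + real (Suc k) * h) w - L (t0 + real k * h) w) -
          (g (t0 + real (Suc k) * h) - g (t0 + real k * h)) \<in> K} \<inter> sup_event (t0 + real k * h) h \<eta>) > 0"
    and osc: "\<And>s t. s \<in> {t0..T} \<Longrightarrow> t \<in> {t0..T} \<Longrightarrow> \<bar>s - t\<bar> \<le> h \<Longrightarrow> norm (g s - g t) \<le> \<epsilon>"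
    and g0: "g t0 = 0"
    and A: "A \<in> sets (incr_filtration M L t0)" "prob A > 0"
  shows "\<exists>A'\<in>events. A' \<subseteq> A \<and> prob A' > 0 \<and>
    (\<forall>w\<in>A'. \<forall>t\<in>{t0..T}. norm (L t w - L t0 w - g t) \<le> \<rho> + \<eta> + \<epsilon>)"
proof -
  have hpos: "h > 0" using t0 N h by simp
  obtain A' where A': "A' \<in> sets (incr_filtration M L (t0 + real N * h))" "prob A' > 0" "A' \<subseteq> A"
    and V: "\<And>w k. w \<in> A' \<Longrightarrow> k \<le> N \<Longrightarrow> L (t0 + real k * h) w - L t0 w - (g (t0 + real k * h) - g t0) \<in> K"
    and sup: "\<And>w k. w \<in> A' \<Longrightarrow> k < N \<Longrightarrow> w \<in> sup_event (t0 + real k * h) h \<eta>"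
    using feedback[OF K(1,2) hpos t0(1) step A] by metis
  have "norm (L t w - L t0 w - g t) \<le> \<rho> + \<eta> + \<epsilon>" if w: "w \<in> A'" and t: "t \<in> {t0..T}" for w t
  proof -
    \<comment> \<open>The cell containing \<open>t\<close>; the cap at \<open>N - 1\<close> puts
      \<open>t = T\<close> into the last cell.\<close>
    define k where "k = min (nat \<lfloor>(t - t0) / h\<rfloor>) (N - 1)"
    have k: "k < N" using N by (auto simp: k_def min_def)
    have nn: "(t - t0) / h \<ge> 0" using t hpos by simp
    have NT: "real N * h = T - t0" using h N by simp
    have "real k * h \<le> t - t0"
    proof -
      have "real k \<le> (t - t0) / h" using nn by (auto simp: k_def min_def) linarith+
      then show ?thesis using hpos by (simp add: field_simps)
    qed
    moreover have "t - t0 \<le> real (Suc k) * h"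
    proof (cases "nat \<lfloor>(t - t0) / h\<rfloor> \<le> N - 1")
      case True
      then have "k = nat \<lfloor>(t - t0) / h\<rfloor>" by (simp add: k_def)
      then have "(t - t0) / h \<le> real (Suc k)" using nn by (simp add: ) linarith
      then show ?thesis using hpos by (simp add: field_simps)
    next
      case False
      then have "Suc k = N" using N by (simp add: k_def)
      then show ?thesis using NT t by simp
    qed
    ultimately have tk: "t \<in> {t0 + real k * h..t0 + real k * h + h}" by (auto simp: algebra_simps)
    have tkm: "t0 + real k * h \<in> {t0..T}"
    proof -
      have "real k * h \<le> real N * h" using k hpos by (intro mult_right_mono) auto
      then show ?thesis using NT hpos by simp
    qed
    have 1: "norm (L (t0 + real k * h) w - L t0 w - (g (t0 + real k * h) - g t0)) \<le> \<rho>"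
      using V[OF w, of k] k by (intro K(3)) auto
    have 2: "norm (L t w - L (t0 + real k * h) w) \<le> \<eta>" using sup[OF w k] tk by (auto simp: sup_event_def)
    have 3: "norm (g (t0 + real k * h) - g t) \<le> \<epsilon>" using tk tkm t by (intro osc) auto
    have "L t w - L t0 w - g t = (L (t0 + real k * h) w - L t0 w - (g (t0 + real k * h) - g t0)) +
       (L t w - L (t0 + real k * h) w) + (g (t0 + real k * h) - g t)" using g0 by simp
    also have "norm \<dots> \<le> \<rho> + \<eta> + \<epsilon>"
      by (rule order_trans[OF norm_triangle_ineq] order_trans[OF add_mono[OF norm_triangle_ineq order_refl]])+
         (intro add_mono 1 2 3)
    finally show ?thesis .
  qed
  then show ?thesis using A' sets_incr_filtration_events by blast
qed

end

section \<open>Small ball property for jumps\<close>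

lemma tendsto_exp_quotient:
  fixes z :: complex
  assumes s: "s \<longlonglongrightarrow> 0" "\<And>m. 0 < s m"
  shows "(\<lambda>m. (exp (complex_of_real (s m) * z) - 1) / complex_of_real (s m)) \<longlonglongrightarrow> z"
proof -
  have "((\<lambda>w. exp (w * z)) has_field_derivative exp (0 * z) * (1 * z)) (at 0)"
    by (auto intro!: derivative_eq_intros)
  then have "((\<lambda>w. (exp (w * z) - 1) / w) \<longlongrightarrow> z) (at 0)"
    by (simp add: has_field_derivative_iff)
  moreover have "filterlim (\<lambda>m. complex_of_real (s m)) (at 0) sequentially"
    unfolding filterlim_at using tendsto_of_real[OF s(1), where ?'a = complex] s(2)
    by (auto simp: less_imp_neq[symmetric])
  ultimately show ?thesis by (rule filterlim_compose)
qed

lemma one_minus_cos_le: "1 - cos v \<le> v\<^sup>2 / 2" for v :: real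
proof -
  have "cos v = 1 - 2 * (sin (v / 2))\<^sup>2" using cos_double_sin[of "v / 2"] by simp
  moreover have "(sin (v / 2))\<^sup>2 \<le> (v / 2)\<^sup>2"
    using abs_sin_x_le_abs_x[of "v / 2"] by (intro abs_le_square_iff[THEN iffD1])
  ultimately show ?thesis by (simp add: power_divide)
qed

lemma one_minus_cos_bound: "1 - cos (u \<bullet> y) \<le> (2 + (norm u)\<^sup>2) * min 1 ((norm y)\<^sup>2)" for u y :: "'a::real_inner"
proof (cases "norm y \<le> 1")
  case True
  have "(u \<bullet> y)\<^sup>2 \<le> (norm u)\<^sup>2 * (norm y)\<^sup>2"
    using power_mono[OF Cauchy_Schwarz_ineq2[of u y] abs_ge_zero, of 2] by (simp add: power_mult_distrib)
  then have "1 - cos (u \<bullet> y) \<le> (norm u)\<^sup>2 * (norm y)\<^sup>2"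
    using one_minus_cos_le[of "u \<bullet> y"] zero_le_power2[of "u \<bullet> y"] by linarith
  also have "\<dots> \<le> (2 + (norm u)\<^sup>2) * (norm y)\<^sup>2" by (intro mult_right_mono) auto
  also have "(norm y)\<^sup>2 = min 1 ((norm y)\<^sup>2)" using True by (simp add: min_absorb2 power_le_one)
  finally show ?thesis .
next
  case False
  then have "min 1 ((norm y)\<^sup>2) = 1" by (simp add: min_def)
  moreover have "1 - cos (u \<bullet> y) \<le> 2" using cos_ge_minus_one[of "u \<bullet> y"] by linarith
  moreover have "2 \<le> 2 + (norm u)\<^sup>2" by simp
  ultimately show ?thesis by (simp only: mult_1_right)
qed

lemma iexp_second_difference:
  "iexp a - iexp (a + v) / 2 - iexp (a - v) / 2 = iexp a * complex_of_real (1 - cos v)"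
proof -
  have "iexp (a - v) = exp (\<i> * complex_of_real a + - (\<i> * complex_of_real v))"
    unfolding of_real_diff by (simp only: distrib_left mult_minus_right diff_conv_add_uminus)
  also have "\<dots> = iexp a * exp (- (\<i> * complex_of_real v))" by (rule exp_add)
  finally have e1: "iexp (a - v) = iexp a * exp (- (\<i> * complex_of_real v))" .
  have "iexp (a + v) = exp (\<i> * complex_of_real a + \<i> * complex_of_real v)"
    by (simp add: distrib_left)
  also have "\<dots> = iexp a * iexp v" by (rule exp_add)
  finally have e2: "iexp (a + v) = iexp a * iexp v" .
  have e3: "complex_of_real (cos v) = (iexp v + exp (- (\<i> * complex_of_real v))) / 2"
    using cos_exp_eq[of "complex_of_real v"] by (simp add: cos_of_real)
  show ?thesis unfolding e1 e2 unfolding of_real_diff e3 by (simp add: field_simps)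
qed

text \<open>A symmetric second difference in \<xi> cancels the drift and the compensator. What
  remains is the Fourier transform of a finite measure, because
  \<open>1 - cos (u \<bullet> y)\<close> vanishes to second order at the origin.\<close>

lemma lk_second_difference:
  fixes \<Lambda> :: "(real^'d) measure" and b \<xi> u :: "real^'d"
  assumes \<Lambda>: "levy_measure \<Lambda>"
  defines "\<psi> \<equiv> levy_khintchine_exponent b 0 \<Lambda>"
  shows "\<psi> \<xi> - \<psi> (\<xi> + u) / 2 - \<psi> (\<xi> - u) / 2 = (LINT y|\<Lambda>. iexp (\<xi> \<bullet> y) * complex_of_real (1 - cos (u \<bullet> y)))"
proof -
  have \<psi>: "\<psi> x = \<i> * complex_of_real (b \<bullet> x) + (LINT y|\<Lambda>. lk_kernel x y)" for x
    by (simp add: \<psi>_def levy_khintchine_exponent_def lk_kernel_def matrix_vector_mult_0)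
  have "\<psi> \<xi> - \<psi> (\<xi> + u) / 2 - \<psi> (\<xi> - u) / 2 =
     (LINT y|\<Lambda>. lk_kernel \<xi> y) - (LINT y|\<Lambda>. lk_kernel (\<xi> + u) y) / 2 - (LINT y|\<Lambda>. lk_kernel (\<xi> - u) y) / 2"
    unfolding \<psi> by (simp add: inner_add_right inner_diff_right field_simps)
  also have "\<dots> = (LINT y|\<Lambda>. lk_kernel \<xi> y - lk_kernel (\<xi> + u) y / 2 - lk_kernel (\<xi> - u) y / 2)"
    using integrable_lk_kernel[OF \<Lambda>] by (simp add: Bochner_Integration.integral_diff)
  also have "\<dots> = (LINT y|\<Lambda>. iexp (\<xi> \<bullet> y) * complex_of_real (1 - cos (u \<bullet> y)))"
  proof (intro Bochner_Integration.integral_cong refl)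
    fix y
    have "lk_kernel \<xi> y - lk_kernel (\<xi> + u) y / 2 - lk_kernel (\<xi> - u) y / 2 =
      iexp (\<xi> \<bullet> y) - iexp (\<xi> \<bullet> y + u \<bullet> y) / 2 - iexp (\<xi> \<bullet> y - u \<bullet> y) / 2"
      unfolding lk_kernel_def inner_add_left inner_diff_left
      by (simp add: field_simps)
    then show "lk_kernel \<xi> y - lk_kernel (\<xi> + u) y / 2 - lk_kernel (\<xi> - u) y / 2 =
      iexp (\<xi> \<bullet> y) * complex_of_real (1 - cos (u \<bullet> y))" by (simp only: iexp_second_difference)
  qed
  finally show ?thesis .
qed

text \<open>\<open>c\<close> is the inverse width of a Gaussian weight: for large \<open>c\<close> a
  mass \<open>p\<close> within distance \<open>r'\<close> outweighs a mass \<open>B\<close> beyond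
  distance \<open>r\<close>.\<close>

lemma exists_gaussian_scale:
  fixes r r' p B :: real
  assumes "0 < r'" "r' < r" "0 < p" "0 \<le> B"
  obtains c where "c > 0" "exp (- (c * r')\<^sup>2 / 2) * p > exp (- (c * r)\<^sup>2 / 2) * B"
proof -
  define D where "D = (r\<^sup>2 - r'\<^sup>2) / 2"
  have D: "D > 0" using assms by (simp add: D_def power_strict_mono)
  define c where "c = sqrt (ln ((B + 1) / p + 1) / D)"
  have "ln ((B + 1) / p + 1) > 0" using assms by (intro ln_gt_zero) (simp add: add_pos_pos)
  then have c: "c > 0" "c\<^sup>2 = ln ((B + 1) / p + 1) / D" using D by (auto simp: c_def)
  have "exp (c\<^sup>2 * D) = (B + 1) / p + 1" using D assms c by (simp add: add_pos_pos)
  then have "exp (c\<^sup>2 * D) * p = B + 1 + p" using assms by (simp add: field_simps)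
  then have "exp (c\<^sup>2 * D) * p > B" using assms by linarith
  then have "exp (- (c * r)\<^sup>2 / 2) * (exp (c\<^sup>2 * D) * p) > exp (- (c * r)\<^sup>2 / 2) * B" by simp
  moreover have "exp (- (c * r)\<^sup>2 / 2) * exp (c\<^sup>2 * D) = exp (- (c * r')\<^sup>2 / 2)"
    by (simp add: exp_add[symmetric] D_def power_mult_distrib field_simps)
  ultimately have "exp (- (c * r')\<^sup>2 / 2) * p > exp (- (c * r)\<^sup>2 / 2) * B"
    by (metis mult.assoc)
  with c(1) show thesis by (rule that)
qed

text \<open>\<open>F m\<close>, the expectation of \<kappa> times a Gaussian centred at
  \<open>x\<close>, is expressed through characteristic functions, so \<open>F m / s m\<close>
  converges to the corresponding integral against \<Lambda>, which is at least \<open>a\<close>.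
  Outside the ball of radius \<open>r\<close> the Gaussian is tiny and the expectation of \<kappa>
  is at most \<open>s m * B\<close>, so at most \<open>b' * s m\<close> comes from there. The rest,
  still of order \<open>s m\<close>, requires the increment to lie in the ball.\<close>

lemma small_time_lower_bound:
  fixes \<Lambda> :: "(real^'d) measure" and L :: "real \<Rightarrow> 'w \<Rightarrow> real^'d" and b x :: "real^'d"
  assumes noise: "levy_noise M L Z (levy_khintchine_exponent b 0 \<Lambda>)" and \<Lambda>: "levy_measure \<Lambda>"
    and x: "x \<noteq> 0" "\<And>r. r > 0 \<Longrightarrow> emeasure \<Lambda> (ball x r) > 0" and r: "r > 0"
  shows "\<exists>c>0. \<forall>s. s \<longlonglongrightarrow> 0 \<longrightarrow> (\<forall>m. 0 < s m) \<longrightarrow> (\<forall>\<^sub>F m in sequentially. measure M {w\<in>space M. norm (L (s m) w - L 0 w - x) < r} \<ge> c * s m)"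
proof -
  define \<psi> where "\<psi> = levy_khintchine_exponent b 0 \<Lambda>"
  interpret levy_noise M L Z \<psi> using noise by (simp add: \<psi>_def)
  interpret G: prob_space "std_gauss :: (real^'d) measure" by (rule prob_space_std_gauss)
  have [measurable_cong]: "sets \<Lambda> = sets borel" using \<Lambda> by (simp add: levy_measure_def)
  \<comment> \<open>Normalised such that \<open>u \<bullet> x = 1\<close>, so that the weight
    \<kappa>, which vanishes at the origin, takes the positive value \<open>1 - cos 1\<close> at
    \<open>x\<close>.\<close>
  define u where "u = (1 / (norm x)\<^sup>2) *\<^sub>R x"
  define \<kappa> where "\<kappa> y = 1 - cos (u \<bullet> y)" for y
  have \<kappa>: "0 \<le> \<kappa> y" "\<kappa> y \<le> 2" for y using cos_ge_minus_one[of "u \<bullet> y"] by (auto simp: \<kappa>_def)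
  have \<kappa>m [measurable]: "\<kappa> \<in> borel_measurable borel" unfolding \<kappa>_def[abs_def] by measurable
  have ux: "u \<bullet> x = 1" using x(1) by (simp add: u_def power2_norm_eq_inner[symmetric])
  have c1: "cos (1::real) < 1" using cos_monotone_0_pi[of 0 1] pi_gt3 by simp
  define \<kappa>0 where "\<kappa>0 = (1 - cos (1::real)) / 2"
  have \<kappa>0: "\<kappa>0 > 0" using c1 by (simp add: \<kappa>0_def)
  have "isCont \<kappa> x" unfolding \<kappa>_def[abs_def] by (intro continuous_intros)
  moreover have "\<kappa> x = 2 * \<kappa>0" by (simp add: \<kappa>_def \<kappa>0_def ux)
  ultimately have "\<exists>d>0. \<forall>y. dist y x < d \<longrightarrow> dist (\<kappa> y) (2 * \<kappa>0) < \<kappa>0"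
    using \<kappa>0 by (simp add: continuous_at_eps_delta)
  then obtain r1 where r1: "r1 > 0" "\<And>y. dist y x < r1 \<Longrightarrow> dist (\<kappa> y) (2 * \<kappa>0) < \<kappa>0" by blast
  define r' where "r' = min (r / 2) r1"
  have r': "0 < r'" "r' < r" using r r1 by (auto simp: r'_def)
  have \<kappa>ball: "\<kappa> y \<ge> \<kappa>0" if "y \<in> ball x r'" for y
    using r1(2)[of y] that by (auto simp: r'_def dist_commute dist_real_def abs_less_iff)
  have int\<kappa>: "integrable \<Lambda> \<kappa>"
  proof (rule Bochner_Integration.integrable_bound[OF integrable_mult_right[OF integrable_levy_measure_min[OF \<Lambda>]]])
    show "AE y in \<Lambda>. norm (\<kappa> y) \<le> norm ((2 + (norm u)\<^sup>2) * min 1 ((norm y)\<^sup>2))"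
      using one_minus_cos_bound[of u] \<kappa>(1) by (intro AE_I2) (simp add: \<kappa>_def abs_mult)
  qed measurable
  define \<nu> where "\<nu> = density \<Lambda> (\<lambda>y. ennreal (\<kappa> y))"
  have [simp, measurable_cong]: "sets \<nu> = sets borel" by (simp add: \<nu>_def \<open>sets \<Lambda> = sets borel\<close>)
  have sp\<nu>: "space \<nu> = UNIV" using sets_eq_imp_space_eq[of \<nu> borel] by simp
  have \<nu>fin: "finite_measure \<nu>"
  proof
    have "emeasure \<nu> (space \<nu>) = (\<integral>\<^sup>+y. ennreal (\<kappa> y) \<partial>\<Lambda>)"
      unfolding \<nu>_def by (subst emeasure_density) (auto intro!: nn_integral_cong)
    also have "\<dots> = ennreal (LINT y|\<Lambda>. \<kappa> y)" using int\<kappa> \<kappa> by (intro nn_integral_eq_integral) auto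
    finally show "emeasure \<nu> (space \<nu>) \<noteq> \<infinity>" by simp
  qed
  interpret \<nu>: finite_measure \<nu> by fact
  define p where "p = measure \<nu> (ball x r')"
  have p: "p > 0"
  proof -
    have "0 < ennreal \<kappa>0 * emeasure \<Lambda> (ball x r')"
      using x(2)[OF r'(1)] \<kappa>0 by (simp add: ennreal_zero_less_mult_iff)
    also have "\<dots> = (\<integral>\<^sup>+y. ennreal \<kappa>0 * indicator (ball x r') y \<partial>\<Lambda>)" by (subst nn_integral_cmult_indicator) auto
    also have "\<dots> \<le> (\<integral>\<^sup>+y. ennreal (\<kappa> y) * indicator (ball x r') y \<partial>\<Lambda>)"
      using \<kappa>ball by (intro nn_integral_mono) (auto split: split_indicator intro!: ennreal_leI)
    also have "\<dots> = emeasure \<nu> (ball x r')" unfolding \<nu>_def by (subst emeasure_density) auto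
    finally show ?thesis by (simp add: p_def \<nu>.emeasure_eq_measure)
  qed
  define B where "B = cmod (\<psi> u)"
  have B0: "0 \<le> B" by (simp add: B_def)
  obtain c where c: "c > 0" "exp (- (c * r')\<^sup>2 / 2) * p > exp (- (c * r)\<^sup>2 / 2) * B"
    by (rule exists_gaussian_scale[OF r' p B0])
  define a b' where "a = exp (- (c * r')\<^sup>2 / 2) * p" and "b' = exp (- (c * r)\<^sup>2 / 2) * B"
  have ab: "a > b'" using c by (simp add: a_def b'_def)
  show ?thesis
  \<comment> \<open>Eventually \<open>F m / s m\<close> exceeds the midpoint of \<open>b'\<close>
    and \<open>a\<close>; subtracting \<open>b'\<close> and dividing by the bound \<open>2\<close>
    of \<kappa> leaves a quarter of the gap.\<close>
  proof (rule exI[of _ "(a - b') / 4"], intro conjI allI impI)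
    show "(a - b') / 4 > 0" using ab by simp
    fix s :: "nat \<Rightarrow> real" assume s: "s \<longlonglongrightarrow> 0" and "\<forall>m. 0 < s m"
    then have s: "s \<longlonglongrightarrow> 0" "\<And>m. 0 < s m" by auto
    define X where "X m w = L (s m) w - L 0 w" for m w
    have X [measurable]: "X m \<in> borel_measurable M" for m by (simp add: X_def[abs_def])
    have Xchar: "(LINT w|M. iexp (\<xi> \<bullet> X m w)) = exp (complex_of_real (s m) * \<psi> \<xi>)" for m \<xi>
      using incr_char[OF s(2)[of m], of \<xi>] by (simp add: X_def)
    have iint: "integrable M (\<lambda>w. iexp (\<xi> \<bullet> X m w))" for m \<xi> by (intro integrable_const_bound[of _ 1]) auto
    define F where "F m = (LINT w|M. \<kappa> (X m w) * exp (- (norm (c *\<^sub>R (X m w - x)))\<^sup>2 / 2))" for m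
    \<comment> \<open>The Fourier side of \<open>F m\<close>: multiplication by \<kappa> acts on the
      characteristic function of the increment as a second difference.\<close>
    define H where "H m \<xi> = iexp (- c * (\<xi> \<bullet> x)) * (exp (complex_of_real (s m) * \<psi> (c *\<^sub>R \<xi>))
       - exp (complex_of_real (s m) * \<psi> (c *\<^sub>R \<xi> + u)) / 2 - exp (complex_of_real (s m) * \<psi> (c *\<^sub>R \<xi> - u)) / 2)" for m \<xi>
    have FH: "complex_of_real (F m) = (LINT \<xi>|std_gauss. H m \<xi>)" for m
    proof -
      \<comment> \<open>The law weighted by \<kappa> is a finite measure, so the Gaussian averaging
        applies to it.\<close>
      define Mm where "Mm = density M (\<lambda>w. ennreal (\<kappa> (X m w)))"
      have [simp, measurable_cong]: "sets Mm = sets M" by (simp add: Mm_def)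
      have "finite_measure Mm"
      proof
        have "emeasure Mm (space Mm) = (\<integral>\<^sup>+w. ennreal (\<kappa> (X m w)) \<partial>M)"
          unfolding Mm_def by (subst emeasure_density) (auto intro!: nn_integral_cong)
        also have "\<dots> \<le> (\<integral>\<^sup>+w. ennreal 2 \<partial>M)" using \<kappa> by (intro nn_integral_mono ennreal_leI) auto
        also have "\<dots> < \<infinity>" by (simp add: emeasure_space_1)
        finally show "emeasure Mm (space Mm) \<noteq> \<infinity>" by simp
      qed
      moreover have "(\<lambda>w. c *\<^sub>R (X m w - x)) \<in> borel_measurable Mm" by measurable
      ultimately have "(LINT \<xi>|std_gauss. LINT w|Mm. iexp (\<xi> \<bullet> (c *\<^sub>R (X m w - x)))) =
          complex_of_real (LINT w|Mm. exp (- (norm (c *\<^sub>R (X m w - x)))\<^sup>2 / 2))"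
        by (rule std_gauss_Fubini(1))
      moreover have "(LINT w|Mm. exp (- (norm (c *\<^sub>R (X m w - x)))\<^sup>2 / 2)) = F m"
        unfolding Mm_def F_def using \<kappa> by (subst integral_density) auto
      moreover have "(LINT w|Mm. iexp (\<xi> \<bullet> (c *\<^sub>R (X m w - x)))) = H m \<xi>" for \<xi> :: "real^'d"
      proof -
        have "(LINT w|Mm. iexp (\<xi> \<bullet> (c *\<^sub>R (X m w - x)))) = (LINT w|M. \<kappa> (X m w) *\<^sub>R iexp (\<xi> \<bullet> (c *\<^sub>R (X m w - x))))"
          unfolding Mm_def using \<kappa> by (subst integral_density) auto
        also have "\<dots> = (LINT w|M. iexp (- c * (\<xi> \<bullet> x)) * (iexp ((c *\<^sub>R \<xi>) \<bullet> X m w)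
            - iexp ((c *\<^sub>R \<xi> + u) \<bullet> X m w) / 2 - iexp ((c *\<^sub>R \<xi> - u) \<bullet> X m w) / 2))"
        proof (intro Bochner_Integration.integral_cong refl)
          fix w
          have "iexp (\<xi> \<bullet> (c *\<^sub>R (X m w - x))) = iexp (- c * (\<xi> \<bullet> x)) * iexp ((c *\<^sub>R \<xi>) \<bullet> X m w)"
            by (simp add: exp_add[symmetric] inner_diff_right algebra_simps)
          then show "\<kappa> (X m w) *\<^sub>R iexp (\<xi> \<bullet> (c *\<^sub>R (X m w - x))) = iexp (- c * (\<xi> \<bullet> x)) * (iexp ((c *\<^sub>R \<xi>) \<bullet> X m w)
            - iexp ((c *\<^sub>R \<xi> + u) \<bullet> X m w) / 2 - iexp ((c *\<^sub>R \<xi> - u) \<bullet> X m w) / 2)"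
            unfolding inner_add_left inner_diff_left iexp_second_difference \<kappa>_def
            by (simp add: scaleR_conv_of_real mult_ac)
        qed
        also have "\<dots> = H m \<xi>"
        proof -
          have lin: "(LINT w|M. k * (f w - g w / 2 - h w / 2)) = k * ((LINT w|M. f w) - (LINT w|M. g w) / 2 - (LINT w|M. h w) / 2)"
            if "integrable M f" "integrable M g" "integrable M h" for k and f g h :: "'w \<Rightarrow> complex"
            using that by (simp add: Bochner_Integration.integral_diff)
          show ?thesis unfolding H_def Xchar[symmetric] by (rule lin[OF iint iint iint])
        qed
        finally show ?thesis .
      qed
      ultimately show ?thesis by simp
    qed
    define Hlim where "Hlim \<xi> = (LINT y|\<nu>. iexp (\<xi> \<bullet> (c *\<^sub>R (y - x))))" for \<xi> :: "real^'d"
    have Hlim_eq: "Hlim \<xi> = iexp (- c * (\<xi> \<bullet> x)) * (\<psi> (c *\<^sub>R \<xi>) - \<psi> (c *\<^sub>R \<xi> + u) / 2 - \<psi> (c *\<^sub>R \<xi> - u) / 2)" for \<xi>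
    proof -
      have "Hlim \<xi> = (LINT y|\<Lambda>. \<kappa> y *\<^sub>R iexp (\<xi> \<bullet> (c *\<^sub>R (y - x))))"
        unfolding Hlim_def \<nu>_def using \<kappa> by (subst integral_density) auto
      also have "\<dots> = (LINT y|\<Lambda>. iexp (- c * (\<xi> \<bullet> x)) * (iexp ((c *\<^sub>R \<xi>) \<bullet> y) * complex_of_real (1 - cos (u \<bullet> y))))"
      proof (intro Bochner_Integration.integral_cong refl)
        fix y
        have "iexp (\<xi> \<bullet> (c *\<^sub>R (y - x))) = iexp (- c * (\<xi> \<bullet> x)) * iexp ((c *\<^sub>R \<xi>) \<bullet> y)"
          by (simp add: exp_add[symmetric] inner_diff_right algebra_simps)
        then show "\<kappa> y *\<^sub>R iexp (\<xi> \<bullet> (c *\<^sub>R (y - x))) =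
          iexp (- c * (\<xi> \<bullet> x)) * (iexp ((c *\<^sub>R \<xi>) \<bullet> y) * complex_of_real (1 - cos (u \<bullet> y)))"
          by (simp add: scaleR_conv_of_real mult_ac \<kappa>_def)
      qed
      finally show ?thesis
        using lk_second_difference[OF \<Lambda>, of b "c *\<^sub>R \<xi>" u] by (simp add: \<psi>_def)
    qed
    have Fubini\<nu>: "(LINT \<xi>|std_gauss. Hlim \<xi>) = complex_of_real (LINT y|\<nu>. exp (- (norm (c *\<^sub>R (y - x)))\<^sup>2 / 2))"
      unfolding Hlim_def by (rule std_gauss_Fubini(1)[OF \<nu>fin]) measurable
    have limit_ge: "(LINT y|\<nu>. exp (- (norm (c *\<^sub>R (y - x)))\<^sup>2 / 2)) \<ge> a"
    proof -
      have "a = (LINT y|\<nu>. exp (- (c * r')\<^sup>2 / 2) * indicator (ball x r') y)" by (simp add: a_def p_def sp\<nu>)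
      also have "\<dots> \<le> (LINT y|\<nu>. exp (- (norm (c *\<^sub>R (y - x)))\<^sup>2 / 2))"
      proof (rule integral_mono)
        show "integrable \<nu> (\<lambda>y. exp (- (c * r')\<^sup>2 / 2) * indicator (ball x r') y)"
          by (intro integrable_mult_right integrable_real_indicator) (auto simp: \<nu>.emeasure_eq_measure)
        show "integrable \<nu> (\<lambda>y. exp (- (norm (c *\<^sub>R (y - x)))\<^sup>2 / 2))"
          by (intro \<nu>.integrable_const_bound[of _ 1]) auto
        fix y
        have "(c * norm (y - x))\<^sup>2 \<le> (c * r')\<^sup>2" if "y \<in> ball x r'"
          using that c(1) by (intro power_mono mult_left_mono) (auto simp: dist_norm norm_minus_commute)
        then show "exp (- (c * r')\<^sup>2 / 2) * indicator (ball x r') y \<le> exp (- (norm (c *\<^sub>R (y - x)))\<^sup>2 / 2)"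
          using c(1) by (auto split: split_indicator simp: abs_of_pos)
      qed
      finally show ?thesis .
    qed
    obtain K where K: "K \<ge> 0" "\<And>\<xi>. cmod (\<psi> \<xi>) \<le> K * (1 + (norm \<xi>)\<^sup>2)" using psi_bound by blast
    have quot: "cmod ((exp (complex_of_real (s m) * z) - 1) / complex_of_real (s m)) \<le> cmod z" if "Re z \<le> 0" for m z
    proof -
      have "cmod (exp (complex_of_real (s m) * z) - 1) \<le> cmod (complex_of_real (s m) * z)"
        using that s(2)[of m] by (intro norm_exp_minus_1_le) (simp add: mult_nonneg_nonpos)
      then show ?thesis using s(2)[of m] by (simp add: norm_divide norm_mult field_simps)
    qed
    \<comment> \<open>The second difference annihilates constants, so \<open>1\<close> may be
      subtracted from each exponential; the quotients then converge to values of \<psi>.\<close>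
    have Hs: "H m \<xi> / complex_of_real (s m) = iexp (- c * (\<xi> \<bullet> x)) *
       ((exp (complex_of_real (s m) * \<psi> (c *\<^sub>R \<xi>)) - 1) / complex_of_real (s m)
       - (exp (complex_of_real (s m) * \<psi> (c *\<^sub>R \<xi> + u)) - 1) / complex_of_real (s m) / 2
       - (exp (complex_of_real (s m) * \<psi> (c *\<^sub>R \<xi> - u)) - 1) / complex_of_real (s m) / 2)" for m \<xi>
      unfolding H_def using s(2)[of m] by (simp add: field_simps)
    have "(\<lambda>m. LINT \<xi>|std_gauss. H m \<xi> / complex_of_real (s m)) \<longlonglongrightarrow> (LINT \<xi>|std_gauss. Hlim \<xi>)"
    proof (rule integral_dominated_convergence)
      let ?w = "\<lambda>\<xi>::real^'d. 2 * K * (1 + 2 * (c\<^sup>2 * (norm \<xi>)\<^sup>2 + (norm u)\<^sup>2))"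
      show "integrable std_gauss ?w"
        using integrable_std_gauss_norm2 by (intro integrable_mult_right Bochner_Integration.integrable_add) auto
      show "(\<lambda>\<xi>. H m \<xi> / complex_of_real (s m)) \<in> borel_measurable std_gauss" for m
        unfolding H_def by measurable
      show "Hlim \<in> borel_measurable std_gauss" unfolding Hlim_eq[abs_def] by measurable
      show "AE \<xi> in std_gauss. (\<lambda>m. H m \<xi> / complex_of_real (s m)) \<longlonglongrightarrow> Hlim \<xi>"
        unfolding Hs Hlim_eq by (intro AE_I2 tendsto_intros tendsto_exp_quotient s) auto
      show "AE \<xi> in std_gauss. norm (H m \<xi> / complex_of_real (s m)) \<le> ?w \<xi>" for m
      proof (rule AE_I2)
        fix \<xi> :: "real^'d"
        have n2: "(norm (y + z))\<^sup>2 \<le> 2 * ((norm y)\<^sup>2 + (norm z)\<^sup>2)" for y z :: "real^'d"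
        proof -
          have "(norm (y + z))\<^sup>2 \<le> (norm y + norm z)\<^sup>2" by (intro power_mono norm_triangle_ineq) auto
          also have "\<dots> \<le> 2 * ((norm y)\<^sup>2 + (norm z)\<^sup>2)"
            using zero_le_power2[of "norm y - norm z"] by (simp add: power2_eq_square algebra_simps)
          finally show ?thesis .
        qed
        have bd: "cmod ((exp (complex_of_real (s m) * \<psi> v) - 1) / complex_of_real (s m)) \<le> K * (1 + 2 * (c\<^sup>2 * (norm \<xi>)\<^sup>2 + (norm u)\<^sup>2))"
          if "(norm v)\<^sup>2 \<le> 2 * (c\<^sup>2 * (norm \<xi>)\<^sup>2 + (norm u)\<^sup>2)" for v
          using K(1) that by (intro order_trans[OF quot[OF Re_psi]] order_trans[OF K(2)] mult_left_mono add_left_mono) auto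
        have e1: "(norm (c *\<^sub>R \<xi>))\<^sup>2 = c\<^sup>2 * (norm \<xi>)\<^sup>2" by (simp add: power_mult_distrib)
        have "(norm (c *\<^sub>R \<xi>))\<^sup>2 \<le> 2 * (c\<^sup>2 * (norm \<xi>)\<^sup>2 + (norm u)\<^sup>2)" unfolding e1 by simp
        note b1 = bd[OF this]
        have "(norm (c *\<^sub>R \<xi> + u))\<^sup>2 \<le> 2 * (c\<^sup>2 * (norm \<xi>)\<^sup>2 + (norm u)\<^sup>2)" using n2[of "c *\<^sub>R \<xi>" u] e1 by simp
        note b2 = bd[OF this]
        have "(norm (c *\<^sub>R \<xi> - u))\<^sup>2 \<le> 2 * (c\<^sup>2 * (norm \<xi>)\<^sup>2 + (norm u)\<^sup>2)" using n2[of "c *\<^sub>R \<xi>" "- u"] e1 by simp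
        note b3 = bd[OF this]
        have tri: "cmod (p1 - p2 / 2 - p3 / 2) \<le> 2 * W" if "cmod p1 \<le> W" "cmod p2 \<le> W" "cmod p3 \<le> W" for p1 p2 p3 W
        proof -
          have "cmod (p1 - p2 / 2 - p3 / 2) \<le> cmod p1 + cmod (p2 / 2) + cmod (p3 / 2)"
            using norm_triangle_ineq4[of "p1 - p2 / 2" "p3 / 2"] norm_triangle_ineq4[of p1 "p2 / 2"] by linarith
          then show ?thesis using that by (simp add: norm_divide)
        qed
        show "norm (H m \<xi> / complex_of_real (s m)) \<le> ?w \<xi>"
          unfolding Hs norm_mult norm_exp_i_times using tri[OF b1 b2 b3] by simp
      qed
    qed
    moreover have "(LINT \<xi>|std_gauss. H m \<xi> / complex_of_real (s m)) = complex_of_real (F m / s m)" for m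
      using FH[of m] by simp
    ultimately have "(\<lambda>m. complex_of_real (F m / s m)) \<longlonglongrightarrow> (LINT \<xi>|std_gauss. Hlim \<xi>)"
      by (simp only:)
    then have "(\<lambda>m. complex_of_real (F m / s m)) \<longlonglongrightarrow> complex_of_real (LINT y|\<nu>. exp (- (norm (c *\<^sub>R (y - x)))\<^sup>2 / 2))"
      by (simp only: Fubini\<nu>)
    then have Flim: "(\<lambda>m. F m / s m) \<longlonglongrightarrow> (LINT y|\<nu>. exp (- (norm (c *\<^sub>R (y - x)))\<^sup>2 / 2))"
      by (simp only: tendsto_of_real_iff)
    have "(a + b') / 2 < (LINT y|\<nu>. exp (- (norm (c *\<^sub>R (y - x)))\<^sup>2 / 2))"
      by (rule less_le_trans[OF _ limit_ge]) (use ab in simp)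
    from order_tendstoD(1)[OF Flim this]
    have ev: "\<forall>\<^sub>F m in sequentially. (a + b') / 2 < F m / s m" .
    have Fle: "F m \<le> 2 * measure M {w\<in>space M. norm (X m w - x) < r} + b' * s m" for m
    proof -
      \<comment> \<open>\<kappa> is the real part of \<open>1 - iexp (u \<bullet> y)\<close>, so its
        expectation is bounded through the exponent at \<open>u\<close>.\<close>
      have E\<kappa>: "(LINT w|M. \<kappa> (X m w)) \<le> s m * B"
      proof -
        have "(LINT w|M. \<kappa> (X m w)) = (LINT w|M. Re (1 - iexp (u \<bullet> X m w)))"
          by (intro Bochner_Integration.integral_cong refl) (simp add: \<kappa>_def Re_exp)
        also have "\<dots> = Re (LINT w|M. 1 - iexp (u \<bullet> X m w))"
          using iint[of u m] by (intro integral_Re Bochner_Integration.integrable_diff) auto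
        also have "\<dots> = Re (1 - exp (complex_of_real (s m) * \<psi> u))"
          using iint[of u m] Xchar[of u m] by (subst Bochner_Integration.integral_diff) (auto simp: prob_space)
        also have "\<dots> \<le> cmod (1 - exp (complex_of_real (s m) * \<psi> u))" by (rule complex_Re_le_cmod)
        also have "\<dots> = cmod (exp (complex_of_real (s m) * \<psi> u) - 1)" by (rule norm_minus_commute)
        also have "\<dots> \<le> cmod (complex_of_real (s m) * \<psi> u)"
          using Re_psi[of u] s(2)[of m] by (intro norm_exp_minus_1_le) (simp add: mult_nonneg_nonpos)
        also have "\<dots> = s m * B" using s(2)[of m] by (simp add: norm_mult B_def)
        finally show ?thesis .
      qed
      let ?D = "{w\<in>space M. norm (X m w - x) < r}"
      have ik: "integrable M (\<lambda>w. \<kappa> (X m w))" using \<kappa> by (intro integrable_const_bound[of _ 2]) auto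
      have "F m \<le> (LINT w|M. 2 * indicator ?D w + exp (- (c * r)\<^sup>2 / 2) * \<kappa> (X m w))"
        unfolding F_def
      proof (rule integral_mono)
        show "integrable M (\<lambda>w. \<kappa> (X m w) * exp (- (norm (c *\<^sub>R (X m w - x)))\<^sup>2 / 2))"
        proof (rule integrable_const_bound[of _ 2])
          show "AE w in M. norm (\<kappa> (X m w) * exp (- (norm (c *\<^sub>R (X m w - x)))\<^sup>2 / 2)) \<le> 2"
          proof (rule AE_I2)
            fix w
            have "\<kappa> (X m w) * exp (- (norm (c *\<^sub>R (X m w - x)))\<^sup>2 / 2) \<le> 2 * 1" using \<kappa> by (intro mult_mono) auto
            then show "norm (\<kappa> (X m w) * exp (- (norm (c *\<^sub>R (X m w - x)))\<^sup>2 / 2)) \<le> 2" using \<kappa> by (simp add: abs_mult)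
          qed
        qed measurable
        show "integrable M (\<lambda>w. 2 * indicator ?D w + exp (- (c * r)\<^sup>2 / 2) * \<kappa> (X m w))"
          using ik by (intro Bochner_Integration.integrable_add integrable_mult_right integrable_real_indicator) (auto simp: less_top[symmetric])
        fix w assume w: "w \<in> space M"
        show "\<kappa> (X m w) * exp (- (norm (c *\<^sub>R (X m w - x)))\<^sup>2 / 2) \<le> 2 * indicator ?D w + exp (- (c * r)\<^sup>2 / 2) * \<kappa> (X m w)"
        proof (cases "norm (X m w - x) < r")
          case True
          have "\<kappa> (X m w) * exp (- (norm (c *\<^sub>R (X m w - x)))\<^sup>2 / 2) \<le> 2 * 1" using \<kappa> by (intro mult_mono) auto
          then show ?thesis using True w \<kappa>(1)[of "X m w"] by (simp add: add_increasing2)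
        next
          case False
          then have "(c * r)\<^sup>2 \<le> (c * norm (X m w - x))\<^sup>2" using c(1) r by (intro power_mono mult_left_mono) auto
          then have "exp (- (norm (c *\<^sub>R (X m w - x)))\<^sup>2 / 2) \<le> exp (- (c * r)\<^sup>2 / 2)" using c(1) by simp
          then have "\<kappa> (X m w) * exp (- (norm (c *\<^sub>R (X m w - x)))\<^sup>2 / 2) \<le> \<kappa> (X m w) * exp (- (c * r)\<^sup>2 / 2)"
            by (intro mult_left_mono \<kappa>(1))
          then show ?thesis using False by (simp add: mult.commute)
        qed
      qed
      also have "\<dots> = 2 * measure M ?D + exp (- (c * r)\<^sup>2 / 2) * (LINT w|M. \<kappa> (X m w))"
        using ik by (subst Bochner_Integration.integral_add) (auto intro!: integrable_real_indicator simp: less_top[symmetric])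
      also have "\<dots> \<le> 2 * measure M ?D + exp (- (c * r)\<^sup>2 / 2) * (s m * B)"
        by (intro add_left_mono mult_left_mono E\<kappa>) auto
      finally show ?thesis by (simp add: b'_def mult_ac)
    qed
      show "\<forall>\<^sub>F m in sequentially. (a - b') / 4 * s m \<le> measure M {w\<in>space M. norm (L (s m) w - L 0 w - x) < r}"
        using ev
      proof eventually_elim
        case (elim m)
        then have "(a + b') / 2 * s m < F m" using s(2)[of m] by (simp add: field_simps)
        then have "(a + b') / 2 * s m - b' * s m < 2 * measure M {w\<in>space M. norm (X m w - x) < r}"
          using Fle[of m] by linarith
        then show ?case by (simp add: X_def field_simps)
      qed
  qed
qed

section \<open>Following a prescribed jump in a short time\<close>

context stationary_noise begin

lemma prob_increment:
  assumes "0 \<le> s" "0 \<le> h"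
  shows "prob {w\<in>space M. norm (L (s + h) w - L s w - x) < e} = prob {w\<in>space M. norm (L h w - L 0 w - x) < e}"
proof -
  have S: "{y. norm (y - x) < e} \<in> sets (borel :: (real^'d) measure)"
  proof -
    have "{y \<in> space borel. norm (y - x) < e} \<in> sets (borel :: (real^'d) measure)" by measurable
    then show ?thesis by simp
  qed
  have eq: "prob {w\<in>space M. norm (L (s + h) w - L s w - x) < e} = measure (distr M borel (L h)) {y. norm (y - x) < e}"
    if "0 \<le> s" for s
  proof -
    have "prob {w\<in>space M. norm (L (s + h) w - L s w - x) < e} = measure (distr M borel (\<lambda>w. L (s + h) w - L s w)) {y. norm (y - x) < e}"
      by (subst measure_distr[OF _ S]) (auto simp: vimage_def Int_def conj_commute)
    also have "distr M borel (\<lambda>w. L (s + h) w - L s w) = distr M borel (L h)"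
      using stationary[of s "s + h"] that assms by simp
    finally show ?thesis .
  qed
  show ?thesis using eq[OF assms(1)] eq[of 0] by simp
qed

text \<open>The interval is cut into \<open>n\<close> cells. The events that a given cell makes a
  jump close to \<open>x\<close> while the path is calm before and after it are disjoint, and along
  dyadic \<open>n\<close> each eventually has a probability of at least a constant times
  \<open>h / n\<close>. So their union is bounded from below independently of \<open>n\<close>, and
  refining the grid passes to the whole interval.\<close>

lemma jump_step:
  assumes small: "\<And>r. x \<noteq> 0 \<Longrightarrow> r > 0 \<Longrightarrow> \<exists>c>0. \<forall>s. s \<longlonglongrightarrow> 0 \<longrightarrow> (\<forall>m. 0 < s m) \<longrightarrow>
        (\<forall>\<^sub>F m in sequentially. prob {w\<in>space M. norm (L (s m) w - L 0 w - x) < r} \<ge> c * s m)"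
    and \<eta>: "\<eta> > 0"
  shows "\<exists>h0>0. \<forall>t h. 0 \<le> t \<longrightarrow> 0 < h \<longrightarrow> h \<le> h0 \<longrightarrow>
    prob ({w\<in>space M. norm (L (t + h) w - L t w - x) \<le> \<eta>} \<inter> sup_event t h (norm x + \<eta>)) > 0"
proof (cases "norm x \<le> \<eta> / 2")
  case True
  \<comment> \<open>For a short \<open>x\<close>, hardly moving at all is close enough to the
    jump.\<close>
  obtain h0 where h0: "h0 > 0" "\<And>t h. 0 \<le> t \<Longrightarrow> 0 < h \<Longrightarrow> h \<le> h0 \<Longrightarrow> prob (sup_event t h (\<eta> / 2)) > 0"
    using sup_event_likely[of "\<eta> / 2" 0] \<eta> by (metis half_gt_zero zero_less_one)
  show ?thesis
  proof (intro exI[of _ h0] conjI allI impI h0(1))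
    fix t h :: real assume th: "0 \<le> t" "0 < h" "h \<le> h0"
    have "sup_event t h (\<eta> / 2) \<subseteq> {w\<in>space M. norm (L (t + h) w - L t w - x) \<le> \<eta>} \<inter> sup_event t h (norm x + \<eta>)"
    proof
      fix w assume w: "w \<in> sup_event t h (\<eta> / 2)"
      then have sp: "w \<in> space M" and le: "\<And>s. s \<in> {t..t + h} \<Longrightarrow> norm (L s w - L t w) \<le> \<eta> / 2"
        by (auto simp: sup_event_def)
      have "norm (L (t + h) w - L t w - x) \<le> norm (L (t + h) w - L t w) + norm x" by (rule norm_triangle_ineq4)
      also have "\<dots> \<le> \<eta> / 2 + \<eta> / 2" using le[of "t + h"] th True by (intro add_mono) auto
      finally have "norm (L (t + h) w - L t w - x) \<le> \<eta>" by simp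
      moreover have "norm (L s w - L t w) \<le> norm x + \<eta>" if "s \<in> {t..t + h}" for s
        using le[OF that] \<eta> norm_ge_zero[of x] by linarith
      ultimately show "w \<in> {w\<in>space M. norm (L (t + h) w - L t w - x) \<le> \<eta>} \<inter> sup_event t h (norm x + \<eta>)"
        using sp by (auto simp: sup_event_def)
    qed
    moreover have "{w\<in>space M. norm (L (t + h) w - L t w - x) \<le> \<eta>} \<inter> sup_event t h (norm x + \<eta>) \<in> events"
      using sup_event_events[OF th(1,2)] by (intro sets.Int) measurable
    ultimately show "0 < prob ({w\<in>space M. norm (L (t + h) w - L t w - x) \<le> \<eta>} \<inter> sup_event t h (norm x + \<eta>))"
      using h0(2)[OF th] finite_measure_mono by (meson less_le_trans)
  qed
next
  case False
  then have x0: "x \<noteq> 0" using \<eta> by auto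
  \<comment> \<open>Here \<open>norm x\<close> exceeds \<open>8 * e\<close>, whereas two jump cells
    would force it below \<open>3 * e\<close>; the total error \<open>4 * e\<close> is below
    \<eta>.\<close>
  define e where "e = \<eta> / 16"
  have e: "e > 0" using \<eta> by (simp add: e_def)
  obtain c where c: "c > 0" "\<And>s. s \<longlonglongrightarrow> 0 \<Longrightarrow> (\<forall>m. 0 < s m) \<Longrightarrow>
        (\<forall>\<^sub>F m in sequentially. prob {w\<in>space M. norm (L (s m) w - L 0 w - x) < e} \<ge> c * s m)"
    using small[OF x0 e] by blast
  obtain h0 where h0: "h0 > 0" "\<And>t h. 0 \<le> t \<Longrightarrow> 0 < h \<Longrightarrow> h \<le> h0 \<Longrightarrow> prob (sup_event t h e) > 3/4"
    using sup_event_likely[of e "3/4"] e by auto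
  show ?thesis
  proof (intro exI[of _ h0] conjI allI impI h0(1))
    fix t h :: real assume th: "0 \<le> t" "0 < h" "h \<le> h0"
    define D where "D = {w\<in>space M. norm (L (t + h) w - L t w - x) \<le> \<eta>}"
    have D: "D \<in> events" unfolding D_def by measurable
    have likely: "prob (sup_event t h e) > 3/4" by (rule h0(2)[OF th])
    have main: "9/16 * (real n * prob {w\<in>space M. norm (L (h / real n) w - L 0 w - x) < e}) \<le> prob (grid_event t h n (norm x + \<eta>) \<inter> D)"
      if n: "n > 0" for n :: nat
    proof -
      let ?g = "grid t (t + h) n"
      \<comment> \<open>Calm up to cell \<open>k\<close>, a jump in cell \<open>k\<close>, calm
        afterwards: three events that depend on disjoint time intervals. Calm on the whole interval
        has probability above \<open>3/4\<close> and implies the first and the third.\<close>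
      define P where "P k = {w\<in>space M. \<forall>j\<in>{..k}. norm (L (?g j) w - L t w) \<le> e}" for k
      define I where "I k = {w\<in>space M. norm (L (?g (Suc k)) w - L (?g k) w - x) < e}" for k
      define R where "R k = {w\<in>space M. \<forall>j\<in>{Suc k..n}. norm (L (?g j) w - L (?g (Suc k)) w) \<le> 2 * e}" for k
      have gm: "?g i \<le> ?g j" if "i \<le> j" for i j using grid_mono[of t "t + h" i j n] that th by auto
      have gt: "t \<le> ?g j" for j using gm[of 0 j] by simp
      have gin: "?g j \<in> {t..t + h}" if "j \<le> n" for j using grid_mem[of t "t + h" j n] that th by auto
      have PF: "P k \<in> sets (incr_filtration M L (?g k))" for k
      proof -
        have "{w\<in>space (incr_filtration M L (?g k)). \<forall>j\<in>{..k}. norm (L (?g j) w - L t w) \<le> e} \<in> sets (incr_filtration M L (?g k))"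
        proof (rule sets.sets_Collect_finite_All)
          fix j assume "j \<in> {..k}"
          then have [measurable]: "(\<lambda>w. L (?g j) w - L t w) \<in> borel_measurable (incr_filtration M L (?g k))"
            by (intro incr_measurable_filtration gt gm) auto
          show "{w \<in> space (incr_filtration M L (?g k)). norm (L (?g j) w - L t w) \<le> e} \<in> sets (incr_filtration M L (?g k))" by measurable
        qed simp
        then show ?thesis by (simp add: P_def)
      qed
      have IF: "I k \<in> sets (incr_filtration M L (?g (Suc k)))" "I k \<in> sets (future_incr M L (?g k))" for k
      proof -
        have *: "I k \<in> sets N" if N: "space N = space M" and m [measurable]: "(\<lambda>w. L (?g (Suc k)) w - L (?g k) w) \<in> borel_measurable N" for N
        proof -
          have "{w\<in>space N. norm (L (?g (Suc k)) w - L (?g k) w - x) < e} \<in> sets N" by measurable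
          then show ?thesis by (simp add: I_def N)
        qed
        show "I k \<in> sets (incr_filtration M L (?g (Suc k)))" "I k \<in> sets (future_incr M L (?g k))"
          by (rule *; auto intro!: incr_measurable_filtration incr_measurable_future gm)+
      qed
      have RF: "R k \<in> sets (future_incr M L (?g (Suc k)))" for k
      proof -
        have "{w\<in>space (future_incr M L (?g (Suc k))). \<forall>j\<in>{Suc k..n}. norm (L (?g j) w - L (?g (Suc k)) w) \<le> 2 * e} \<in> sets (future_incr M L (?g (Suc k)))"
        proof (rule sets.sets_Collect_finite_All)
          fix j assume "j \<in> {Suc k..n}"
          then have [measurable]: "(\<lambda>w. L (?g j) w - L (?g (Suc k)) w) \<in> borel_measurable (future_incr M L (?g (Suc k)))"
            by (intro incr_measurable_future gm) auto
          show "{w \<in> space (future_incr M L (?g (Suc k))). norm (L (?g j) w - L (?g (Suc k)) w) \<le> 2 * e} \<in> sets (future_incr M L (?g (Suc k)))" by measurable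
        qed simp
        then show ?thesis by (simp add: R_def)
      qed
      define E where "E k = P k \<inter> (I k \<inter> R k)" for k
      have ev: "P k \<in> events" "I k \<in> events" "R k \<in> events" for k
        using PF IF RF sets_incr_filtration_events sets_future_incr_events by blast+
      have Eev: "E k \<in> events" for k unfolding E_def using ev by auto
      have probE: "prob (E k) \<ge> 9/16 * prob {w\<in>space M. norm (L (h / real n) w - L 0 w - x) < e}" if k: "k < n" for k
      proof -
        have IR: "I k \<inter> R k \<in> sets (future_incr M L (?g k))"
        proof (rule sets.Int[OF IF(2)])
          show "R k \<in> sets (future_incr M L (?g k))"
            using subsetD[OF future_incr_mono[OF gm[OF le_SucI[OF order_refl]]] RF] .
        qed
        have "prob (E k) = prob (P k) * (prob (I k) * prob (R k))"
          unfolding E_def using past_future_indep[OF PF IR] past_future_indep[OF IF(1) RF] by simp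
        moreover have "prob (P k) \<ge> 3/4"
        proof -
          have "sup_event t h e \<subseteq> P k" using gin k by (auto simp: sup_event_def P_def)
          then have "prob (sup_event t h e) \<le> prob (P k)" using ev by (intro finite_measure_mono)
          then show ?thesis using likely by simp
        qed
        moreover have "prob (R k) \<ge> 3/4"
        proof -
          have "sup_event t h e \<subseteq> R k"
          proof
            fix w assume w: "w \<in> sup_event t h e"
            have "norm (L (?g j) w - L (?g (Suc k)) w) \<le> 2 * e" if "j \<in> {Suc k..n}" for j
            proof -
              have "norm (L (?g j) w - L t w) \<le> e" "norm (L (?g (Suc k)) w - L t w) \<le> e"
                using w gin[of j] gin[of "Suc k"] that k by (auto simp: sup_event_def)
              then show ?thesis
                using norm_triangle_ineq4[of "L (?g j) w - L t w" "L (?g (Suc k)) w - L t w"] by simp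
            qed
            then show "w \<in> R k" using w by (auto simp: R_def sup_event_def)
          qed
          then have "prob (sup_event t h e) \<le> prob (R k)" using ev by (intro finite_measure_mono)
          then show ?thesis using likely by simp
        qed
        moreover have "prob (I k) = prob {w\<in>space M. norm (L (h / real n) w - L 0 w - x) < e}"
        proof -
          have "?g (Suc k) = ?g k + h / real n" by (simp add: grid_def algebra_simps add_divide_distrib)
          then show ?thesis unfolding I_def using prob_increment[of "?g k" "h / real n" x e] gt[of k] th by simp
        qed
        moreover have "3/4 * (prob (I k) * (3/4)) \<le> prob (P k) * (prob (I k) * prob (R k))"
          using \<open>prob (P k) \<ge> 3/4\<close> \<open>prob (R k) \<ge> 3/4\<close> by (intro mult_mono mult_nonneg_nonneg) auto
        ultimately show ?thesis by simp
      qed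
      \<comment> \<open>Calmness up to the later cell bounds the increment over the earlier one by
        \<open>2 * e\<close>, too little for a jump close to \<open>x\<close>.\<close>
      have dis: "E k \<inter> E k' = {}" if kk: "k < k'" "k' < n" for k k'
      proof (rule equals0I)
        fix w assume "w \<in> E k \<inter> E k'"
        then have i: "norm (L (?g (Suc k)) w - L (?g k) w - x) < e"
          and p: "norm (L (?g (Suc k)) w - L t w) \<le> e" "norm (L (?g k) w - L t w) \<le> e"
          using kk by (auto simp: E_def I_def P_def)
        have "norm x \<le> norm (L (?g (Suc k)) w - L (?g k) w - x) + norm (L (?g (Suc k)) w - L (?g k) w)"
          using norm_triangle_ineq4[of "L (?g (Suc k)) w - L (?g k) w" "L (?g (Suc k)) w - L (?g k) w - x"] by simp
        also have "norm (L (?g (Suc k)) w - L (?g k) w) \<le> 2 * e"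
          using norm_triangle_ineq4[of "L (?g (Suc k)) w - L t w" "L (?g k) w - L t w"] p by simp
        finally have "norm x < 3 * e" using i by simp
        then show False using False \<eta> by (simp add: e_def)
      qed
      have disf: "disjoint_family_on E {..<n}"
        unfolding disjoint_family_on_def using dis by (metis Int_commute lessThan_iff linorder_neqE_nat)
      have "9/16 * (real n * prob {w\<in>space M. norm (L (h / real n) w - L 0 w - x) < e}) =
          (\<Sum>k<n. 9/16 * prob {w\<in>space M. norm (L (h / real n) w - L 0 w - x) < e})" by simp
      also have "\<dots> \<le> (\<Sum>k<n. prob (E k))" by (intro sum_mono probE) simp
      also have "\<dots> = prob (\<Union>k<n. E k)" using Eev disf by (intro finite_measure_finite_Union[symmetric]) auto
      also have "\<dots> \<le> prob (grid_event t h n (norm x + \<eta>) \<inter> D)"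
      proof (intro finite_measure_mono sets.Int D grid_event_events th subsetI)
        fix w assume "w \<in> (\<Union>k<n. E k)"
        then obtain k where k: "k < n" and w: "w \<in> E k" by auto
        then have sp: "w \<in> space M" by (auto simp: E_def P_def)
        have p: "norm (L (?g j) w - L t w) \<le> e" if "j \<le> k" for j using w that by (auto simp: E_def P_def)
        have i: "norm (L (?g (Suc k)) w - L (?g k) w - x) < e" using w by (auto simp: E_def I_def)
        have f: "norm (L (?g j) w - L (?g (Suc k)) w) \<le> 2 * e" if "j \<in> {Suc k..n}" for j using w that by (auto simp: E_def R_def)
        have late: "norm (L (?g j) w - L t w - x) \<le> 4 * e" if "j \<in> {Suc k..n}" for j
        proof -
          have "L (?g j) w - L t w - x = (L (?g j) w - L (?g (Suc k)) w) + (L (?g (Suc k)) w - L (?g k) w - x) + (L (?g k) w - L t w)" by simp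
          also have "norm \<dots> \<le> 2 * e + e + e"
            using f[OF that] i p[of k]
            by (intro order_trans[OF norm_triangle_ineq] add_mono order_trans[OF norm_triangle_ineq] add_mono) auto
          finally show ?thesis by simp
        qed
        have "norm (L (?g j) w - L t w) \<le> norm x + \<eta>" if "j \<le> n" for j
        proof (cases "j \<le> k")
          case True
          then show ?thesis using p[OF True] \<eta> norm_ge_zero[of x] unfolding e_def by linarith
        next
          case False
          then have "norm (L (?g j) w - L t w - x) \<le> 4 * e" using that by (intro late) auto
          then show ?thesis using norm_triangle_ineq[of "L (?g j) w - L t w - x" x] \<eta> by (simp add: e_def)
        qed
        moreover have "norm (L (t + h) w - L t w - x) \<le> \<eta>"
          using late[of n] k n \<eta> by (simp add: e_def)
        ultimately show "w \<in> grid_event t h n (norm x + \<eta>) \<inter> D" using sp by (auto simp: grid_event_def D_def)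
      qed
      finally show ?thesis .
    qed
    have s0: "(\<lambda>m. h / 2 ^ m) \<longlonglongrightarrow> 0"
      using tendsto_mult_left[OF LIMSEQ_realpow_zero[of "1/2"], of h] by (simp add: power_divide)
    have "\<forall>\<^sub>F m in sequentially. prob {w\<in>space M. norm (L (h / 2 ^ m) w - L 0 w - x) < e} \<ge> c * (h / 2 ^ m)"
      using th by (intro c(2)[OF s0]) auto
    then have ev: "\<forall>\<^sub>F m in sequentially. 9/16 * (c * h) \<le> prob (grid_event t h (2 ^ m) (norm x + \<eta>) \<inter> D)"
    proof eventually_elim
      case (elim m)
      have "9/16 * (c * h) = 9/16 * (2 ^ m * (c * (h / 2 ^ m)))" by simp
      also have "\<dots> \<le> 9/16 * (2 ^ m * prob {w\<in>space M. norm (L (h / 2 ^ m) w - L 0 w - x) < e})"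
        using elim by (intro mult_left_mono) auto
      also have "\<dots> \<le> prob (grid_event t h (2 ^ m) (norm x + \<eta>) \<inter> D)" using main[of "2 ^ m"] by simp
      finally show ?case .
    qed
    have "decseq (\<lambda>m. grid_event t h (2 ^ m) (norm x + \<eta>) \<inter> D)"
      using grid_event_decseq[of t h "norm x + \<eta>"] unfolding decseq_def by blast
    then have "(\<lambda>m. prob (grid_event t h (2 ^ m) (norm x + \<eta>) \<inter> D)) \<longlonglongrightarrow> prob (\<Inter>m. grid_event t h (2 ^ m) (norm x + \<eta>) \<inter> D)"
      using grid_event_events[OF th(2)] D by (intro finite_Lim_measure_decseq) auto
    moreover have "(\<Inter>m. grid_event t h (2 ^ m) (norm x + \<eta>) \<inter> D) = D \<inter> sup_event t h (norm x + \<eta>)"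
      unfolding sup_event_eq[OF th(1,2)] by auto
    ultimately have "9/16 * (c * h) \<le> prob (D \<inter> sup_event t h (norm x + \<eta>))"
      using ev by (intro tendsto_lowerbound[of "\<lambda>m. prob (grid_event t h (2 ^ m) (norm x + \<eta>) \<inter> D)"]) auto
    moreover have "0 < 9/16 * (c * h)" using c th by simp
    ultimately show "0 < prob ({w\<in>space M. norm (L (t + h) w - L t w - x) \<le> \<eta>} \<inter> sup_event t h (norm x + \<eta>))"
      unfolding D_def[symmetric] by linarith
  qed
qed

end

text \<open>One of the at most \<open>R\<close> Caratheodory weights of \<open>y\<close> is at least
  \<open>1 / R\<close>. Its point \<open>x\<close> can be subtracted once from
  \<open>R *\<^sub>R y\<close>, which leaves nonnegative weights of total mass
  \<open>R - 1\<close>.\<close>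

lemma convex_hull_scaled_step:
  fixes S :: "'a::euclidean_space set"
  assumes y: "y \<in> convex hull S"
  defines "R \<equiv> real (DIM('a) + 1)"
  shows "\<exists>x\<in>S. \<exists>z\<in>convex hull S. R *\<^sub>R y - x = (R - 1) *\<^sub>R z"
proof -
  obtain T where T: "finite T" "T \<subseteq> S" "card T \<le> DIM('a) + 1" "y \<in> convex hull T"
    using y unfolding caratheodory[of S] by blast
  obtain u where u: "\<forall>x\<in>T. 0 \<le> u x" "sum u T = 1" "(\<Sum>x\<in>T. u x *\<^sub>R x) = y"
    using T(4) unfolding convex_hull_finite[OF T(1)] by blast
  have R: "R \<ge> 2" using DIM_positive[where 'a = 'a] by (simp add: R_def)
  have "\<exists>x\<in>T. u x \<ge> 1 / R"
  proof (rule ccontr)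
    assume "\<not> ?thesis"
    then have lt: "\<And>x. x \<in> T \<Longrightarrow> u x < 1 / R" by (simp add: not_le)
    have "T \<noteq> {}" using u(2) by auto
    then have "sum u T < (\<Sum>x\<in>T. 1 / R)" using T(1) lt by (intro sum_strict_mono) auto
    also have "\<dots> = real (card T) / R" by simp
    also have "\<dots> \<le> 1" using T(3) by (simp add: R_def)
    finally show False using u(2) by simp
  qed
  then obtain x where x: "x \<in> T" "u x \<ge> 1 / R" by blast
  define v where "v t = (R * u t - (if t = x then 1 else 0)) / (R - 1)" for t
  have sv: "sum v T = 1"
  proof -
    have "sum v T = (R * sum u T - (\<Sum>t\<in>T. if t = x then 1 else 0)) / (R - 1)"
      by (simp add: v_def sum_divide_distrib[symmetric] sum_subtractf sum_distrib_left)
    then show ?thesis using u(2) T(1) x(1) R by simp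
  qed
  have v0: "0 \<le> v t" if "t \<in> T" for t
    using u(1) that x(2) R by (auto simp: v_def field_simps)
  have "(\<Sum>t\<in>T. v t *\<^sub>R t) \<in> convex hull T"
    unfolding convex_hull_finite[OF T(1)] using v0 sv by blast
  then have z: "(\<Sum>t\<in>T. v t *\<^sub>R t) \<in> convex hull S" using hull_mono[OF T(2)] by blast
  have "(R - 1) *\<^sub>R (\<Sum>t\<in>T. v t *\<^sub>R t) = (\<Sum>t\<in>T. (R * u t - (if t = x then 1 else 0)) *\<^sub>R t)"
    using R by (simp add: v_def scaleR_sum_right)
  also have "\<dots> = (\<Sum>t\<in>T. R *\<^sub>R (u t *\<^sub>R t)) - (\<Sum>t\<in>T. if t = x then t else 0)"
    unfolding sum_subtractf[symmetric] by (intro sum.cong) (auto simp: algebra_simps)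
  also have "\<dots> = R *\<^sub>R y - x" using T(1) x(1) by (simp add: u(3)[symmetric] scaleR_sum_right)
  finally show ?thesis using x(1) T(2) z by (metis subsetD)
qed

section \<open>Steering the noise by jumps\<close>

context stationary_noise begin

text \<open>The conditional small ball property of the driving noise, phrased with past events of
  positive probability in place of conditional probabilities.\<close>

definition small_ball :: bool where
  "small_ball \<longleftrightarrow> (\<forall>t0 T g \<delta> A. 0 \<le> t0 \<longrightarrow> t0 < T \<longrightarrow> continuous_on {t0..T} g \<longrightarrow> g t0 = 0 \<longrightarrow> 0 < \<delta> \<longrightarrow>
     A \<in> sets (incr_filtration M L t0) \<longrightarrow> 0 < prob A \<longrightarrow>
     (\<exists>A'\<in>events. A' \<subseteq> A \<and> 0 < prob A' \<and> (\<forall>w\<in>A'. \<forall>t\<in>{t0..T}. norm (L t w - L t0 w - g t) \<le> \<delta>)))"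

lemma small_ball_jumps:
  assumes supp: "\<And>\<epsilon>. \<epsilon> > 0 \<Longrightarrow> \<exists>S. compact S \<and> (\<forall>x\<in>S. norm x \<le> \<epsilon>) \<and> 0 \<in> interior (convex hull S) \<and>
      (\<forall>x\<in>S. \<forall>r. x \<noteq> 0 \<longrightarrow> r > 0 \<longrightarrow> (\<exists>c>0. \<forall>s. s \<longlonglongrightarrow> 0 \<longrightarrow> (\<forall>m. 0 < s m) \<longrightarrow>
        (\<forall>\<^sub>F m in sequentially. prob {w\<in>space M. norm (L (s m) w - L 0 w - x) < r} \<ge> c * s m)))"
  shows small_ball
  unfolding small_ball_def
proof (intro allI impI)
  fix t0 T :: real and g :: "real \<Rightarrow> real^'d" and \<delta> :: real and A
  assume t0: "0 \<le> t0" "t0 < T" and g: "continuous_on {t0..T} g" "g t0 = 0" and \<delta>: "0 < \<delta>"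
    and A: "A \<in> sets (incr_filtration M L t0)" "0 < prob A"
  define R where "R = real (DIM(real^'d) + 1)"
  have R: "R \<ge> 2" using DIM_positive[where 'a = "real^'d"] unfolding R_def by linarith
  \<comment> \<open>\<open>R * \<epsilon>\<close> bounds the elements of \<open>K\<close>,
    \<open>2 * \<epsilon>\<close> the motion within a step, and the oscillation of \<open>g\<close>
    takes at most another \<epsilon>.\<close>
  define \<epsilon> where "\<epsilon> = \<delta> / (R + 3)"
  have \<epsilon>: "\<epsilon> > 0" using \<delta> R by (simp add: \<epsilon>_def)
  from supp[OF \<epsilon>] obtain S where SS: "compact S \<and> (\<forall>x\<in>S. norm x \<le> \<epsilon>) \<and> 0 \<in> interior (convex hull S) \<and>
      (\<forall>x\<in>S. \<forall>r. x \<noteq> 0 \<longrightarrow> r > 0 \<longrightarrow> (\<exists>c>0. \<forall>s. s \<longlonglongrightarrow> 0 \<longrightarrow> (\<forall>m. 0 < s m) \<longrightarrow>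
        (\<forall>\<^sub>F m in sequentially. prob {w\<in>space M. norm (L (s m) w - L 0 w - x) < r} \<ge> c * s m)))" ..
  have S: "compact S" "\<And>x. x \<in> S \<Longrightarrow> norm x \<le> \<epsilon>" "0 \<in> interior (convex hull S)"
    using conjunct1[OF SS] conjunct1[OF conjunct2[OF SS]] conjunct1[OF conjunct2[OF conjunct2[OF SS]]] by simp_all
  note small = conjunct2[OF conjunct2[OF conjunct2[OF SS]], rule_format]
  have "S \<noteq> {}" using S(3) by auto
  define C where "C = convex hull S"
  have C: "compact C" "convex C" using S(1) by (auto simp: C_def compact_convex_hull)
  have C0: "0 \<in> C" using S(3) interior_subset by (auto simp: C_def)
  have Cn: "norm y \<le> \<epsilon>" if "y \<in> C" for y
  proof -
    have "convex hull S \<subseteq> cball 0 \<epsilon>" by (rule hull_minimal) (use S(2) in auto)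
    then show ?thesis using that by (auto simp: C_def)
  qed
  obtain \<rho> where \<rho>: "\<rho> > 0" "ball 0 \<rho> \<subseteq> C" using S(3) by (auto simp: mem_interior C_def)
  \<comment> \<open>The oscillation of \<open>g\<close>, the error of the jump and the replacement
    of \<open>x\<close> by \<open>x'\<close> together stay below \<open>3 * \<eta>\<close>, so their
    sum lies in the ball contained in \<open>C\<close>.\<close>
  define \<eta> where "\<eta> = min \<epsilon> (\<rho> / 3)"
  have \<eta>: "\<eta> > 0" "\<eta> \<le> \<epsilon>" "3 * \<eta> \<le> \<rho>" using \<epsilon> \<rho> by (auto simp: \<eta>_def)
  have "S \<subseteq> (\<Union>x\<in>S. ball x (\<eta> / 2))" using \<eta>(1) by force
  \<comment> \<open>The admissible time step in \<open>jump_step\<close> depends on the jump; a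
    finite net of \<open>S\<close> gives a common one.\<close>
  then obtain F where F: "F \<subseteq> S" "finite F" "S \<subseteq> (\<Union>x\<in>F. ball x (\<eta> / 2))"
    using compactE_image[OF S(1), of S "\<lambda>x. ball x (\<eta> / 2)"] by (metis open_ball)
  have "F \<noteq> {}" using F(3) \<open>S \<noteq> {}\<close> by auto
  have "\<forall>x\<in>F. \<exists>h0>0. \<forall>t h. 0 \<le> t \<longrightarrow> 0 < h \<longrightarrow> h \<le> h0 \<longrightarrow>
    prob ({w\<in>space M. norm (L (t + h) w - L t w - x) \<le> \<eta> / 2} \<inter> sup_event t h (norm x + \<eta> / 2)) > 0"
    using F(1) \<eta>(1) by (intro ballI jump_step small) auto
  from bchoice[OF this] obtain h0 where "\<forall>x\<in>F. h0 x > 0 \<and> (\<forall>t h. 0 \<le> t \<longrightarrow> 0 < h \<longrightarrow> h \<le> h0 x \<longrightarrow>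
    prob ({w\<in>space M. norm (L (t + h) w - L t w - x) \<le> \<eta> / 2} \<inter> sup_event t h (norm x + \<eta> / 2)) > 0)" ..
  then have h0: "\<And>x. x \<in> F \<Longrightarrow> h0 x > 0" "\<And>x t h. x \<in> F \<Longrightarrow> 0 \<le> t \<Longrightarrow> 0 < h \<Longrightarrow> h \<le> h0 x \<Longrightarrow>
    prob ({w\<in>space M. norm (L (t + h) w - L t w - x) \<le> \<eta> / 2} \<inter> sup_event t h (norm x + \<eta> / 2)) > 0"
    by blast+
  define hm where "hm = Min (h0 ` F)"
  have hm: "hm > 0" "\<And>x. x \<in> F \<Longrightarrow> hm \<le> h0 x"
    using F(2) \<open>F \<noteq> {}\<close> h0(1) by (auto simp: hm_def)
  obtain d where d: "d > 0" "\<And>s t. s \<in> {t0..T} \<Longrightarrow> t \<in> {t0..T} \<Longrightarrow> dist t s < d \<Longrightarrow> dist (g t) (g s) < \<eta>"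
    using compact_uniformly_continuous[OF g(1) compact_Icc] \<eta>(1) unfolding uniformly_continuous_on_def by metis
  obtain N where N: "(T - t0) / min hm (d / 2) < real N" using reals_Archimedean2 by blast
  have mp: "min hm (d / 2) > 0" using hm d by simp
  have Npos: "real N > 0"
  proof -
    have "(T - t0) / min hm (d / 2) > 0" using mp t0 by simp
    then show ?thesis using N by linarith
  qed
  define h where "h = (T - t0) / real N"
  have h: "h > 0" using t0 Npos by (simp add: h_def)
  have hle: "h \<le> min hm (d / 2)"
  proof -
    have "T - t0 < real N * min hm (d / 2)" using N mp by (simp add: field_simps)
    then have "T - t0 \<le> min hm (d / 2) * real N" by (simp only: mult.commute less_imp_le)
    then show ?thesis unfolding h_def using Npos by (simp only: pos_divide_le_eq)
  qed
  define K where "K = (\<lambda>y. - (R *\<^sub>R y)) ` C"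
  have Kb: "K \<in> sets borel"
  proof -
    have "compact K" unfolding K_def using C(1) by (intro compact_continuous_image continuous_intros)
    then show ?thesis by (intro borel_closed compact_imp_closed)
  qed
  have osc: "norm (g s - g t) \<le> \<eta>" if "s \<in> {t0..T}" "t \<in> {t0..T}" "\<bar>s - t\<bar> \<le> h" for s t
    using d(2)[of t s] that hle d(1) by (auto simp: dist_norm intro: less_imp_le)
  have "\<exists>A'\<in>events. A' \<subseteq> A \<and> prob A' > 0 \<and>
    (\<forall>w\<in>A'. \<forall>t\<in>{t0..T}. norm (L t w - L t0 w - g t) \<le> R * \<epsilon> + 2 * \<epsilon> + \<eta>)"
  proof (rule feedback_path[where K = K and \<rho> = "R * \<epsilon>" and g = g and \<eta> = "2 * \<epsilon>" and \<epsilon> = \<eta>, OF Kb _ _ t0 _ h_def _ osc g(2) A])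
    show "0 \<in> K" using C0 by (force simp: K_def)
    show "norm v \<le> R * \<epsilon>" if "v \<in> K" for v
      using that Cn R by (auto simp: K_def intro!: mult_left_mono)
    show "N > 0" using Npos by simp
    fix k v assume k: "k < N" and v: "v \<in> K"
    define t where "t = t0 + real k * h"
    have tS: "t0 + real (Suc k) * h = t + h" by (simp add: t_def algebra_simps)
    have "real (Suc k) * h \<le> real N * h" using k h by (intro mult_right_mono) auto
    then have tT: "t + h \<le> T" using Npos tS by (simp add: h_def)
    have tt: "t0 \<le> t" "0 \<le> t" using h t0 by (auto simp: t_def)
    obtain y where y: "y \<in> C" "v = - (R *\<^sub>R y)" using v by (auto simp: K_def)
    obtain x z where x: "x \<in> S" and z: "z \<in> C" and xz: "R *\<^sub>R y - x = (R - 1) *\<^sub>R z"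
      using convex_hull_scaled_step[of y S] y(1) unfolding C_def R_def by blast
    obtain x' where x': "x' \<in> F" "dist x' x < \<eta> / 2" using F(3) x by auto
    define J where "J = {w\<in>space M. norm (L (t + h) w - L t w - x') \<le> \<eta> / 2} \<inter> sup_event t h (norm x' + \<eta> / 2)"
    have J: "prob J > 0" unfolding J_def using x'(1) tt h hle hm(2)[OF x'(1)] by (intro h0(2)) auto
    have "J \<subseteq> {w\<in>space M. v + (L (t + h) w - L t w) - (g (t + h) - g t) \<in> K} \<inter> sup_event t h (2 * \<epsilon>)"
    proof
      fix w assume w: "w \<in> J"
      then have sp: "w \<in> space M" and j: "norm (L (t + h) w - L t w - x') \<le> \<eta> / 2"
        and su: "\<And>s. s \<in> {t..t + h} \<Longrightarrow> norm (L s w - L t w) \<le> norm x' + \<eta> / 2"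
        by (auto simp: J_def sup_event_def)
      have "norm x' + \<eta> / 2 \<le> 2 * \<epsilon>" using S(2)[of x'] x'(1) F(1) \<eta> by auto
      then have 1: "w \<in> sup_event t h (2 * \<epsilon>)" using sp su by (force simp: sup_event_def)
      define e where "e = (g (t + h) - g t) - ((L (t + h) w - L t w - x') + (x' - x))"
      have "norm (g (t + h) - g t) \<le> \<eta>" using tt tT h by (intro osc) auto
      moreover have "norm ((L (t + h) w - L t w - x') + (x' - x)) \<le> \<eta> / 2 + norm (x' - x)"
        by (rule order_trans[OF norm_triangle_ineq]) (use j in simp)
      moreover have "norm (x' - x) < \<eta> / 2" using x'(2) by (simp add: dist_norm)
      ultimately have "norm e < 3 * \<eta>"
        using norm_triangle_ineq4[of "g (t + h) - g t" "(L (t + h) w - L t w - x') + (x' - x)"] \<eta>(1) unfolding e_def by linarith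
      then have eC: "e \<in> C" using \<rho>(2) \<eta>(3) by auto
      \<comment> \<open>The new deviation consists of a remainder in \<open>(R - 1)\<close> times
        \<open>C\<close> and an error in \<open>C\<close>, up to sign; by convexity both together
        fit into \<open>R\<close> times \<open>C\<close>.\<close>
      have "((R - 1) / R) *\<^sub>R z + (1 / R) *\<^sub>R e \<in> C"
        using R by (intro convexD[OF C(2) z eC]) (auto simp: field_simps)
      moreover have "v + (L (t + h) w - L t w) - (g (t + h) - g t) = - (R *\<^sub>R (((R - 1) / R) *\<^sub>R z + (1 / R) *\<^sub>R e))"
      proof -
        have "R *\<^sub>R (((R - 1) / R) *\<^sub>R z + (1 / R) *\<^sub>R e) = (R - 1) *\<^sub>R z + e" using R by (simp add: scaleR_add_right)
        then show ?thesis unfolding xz[symmetric] y(2) e_def by simp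
      qed
      ultimately have "v + (L (t + h) w - L t w) - (g (t + h) - g t) \<in> K" unfolding K_def by blast
      then show "w \<in> {w\<in>space M. v + (L (t + h) w - L t w) - (g (t + h) - g t) \<in> K} \<inter> sup_event t h (2 * \<epsilon>)"
        using 1 sp by blast
    qed
    moreover have "{w\<in>space M. v + (L (t + h) w - L t w) - (g (t + h) - g t) \<in> K} \<inter> sup_event t h (2 * \<epsilon>) \<in> events"
    proof (intro sets.Int sup_event_events tt h)
      have [measurable]: "K \<in> sets borel" by (rule Kb)
      show "{w\<in>space M. v + (L (t + h) w - L t w) - (g (t + h) - g t) \<in> K} \<in> events" by measurable
    qed
    ultimately have "prob J \<le> prob ({w\<in>space M. v + (L (t + h) w - L t w) - (g (t + h) - g t) \<in> K} \<inter> sup_event t h (2 * \<epsilon>))"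
      by (rule finite_measure_mono)
    then show "prob ({w\<in>space M. v + (L (t0 + real (Suc k) * h) w - L (t0 + real k * h) w) -
          (g (t0 + real (Suc k) * h) - g (t0 + real k * h)) \<in> K} \<inter> sup_event (t0 + real k * h) h (2 * \<epsilon>)) > 0"
      using J unfolding tS t_def[symmetric] by linarith
  qed
  moreover have "R * \<epsilon> + 2 * \<epsilon> + \<eta> \<le> \<delta>"
  proof -
    have "R * \<epsilon> + 2 * \<epsilon> + \<eta> \<le> (R + 3) * \<epsilon>" using \<eta>(2) by (simp add: algebra_simps)
    then show ?thesis using R by (simp add: \<epsilon>_def)
  qed
  ultimately show "\<exists>A'\<in>events. A' \<subseteq> A \<and> 0 < prob A' \<and> (\<forall>w\<in>A'. \<forall>t\<in>{t0..T}. norm (L t w - L t0 w - g t) \<le> \<delta>)"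
    by (meson order_trans)
qed

end

text \<open>The support stays in the closed ball only: mass inside the open ball may accumulate at
  the sphere.\<close>

lemma measure_support_restrict_ball:
  fixes \<Lambda> :: "(real^'d) measure" and x :: "real^'d" and \<epsilon> r :: real
  assumes \<Lambda>: "sets \<Lambda> = sets borel"
  defines "S \<equiv> measure_support (restrict_ball \<Lambda> \<epsilon>)"
  shows "compact S" "x \<in> S \<Longrightarrow> norm x \<le> \<epsilon>" "x \<in> S \<Longrightarrow> r > 0 \<Longrightarrow> emeasure \<Lambda> (ball x r) > 0"
proof -
  have bound: "norm x \<le> \<epsilon>" if "x \<in> S" for x
  proof (rule ccontr)
    assume "\<not> norm x \<le> \<epsilon>"
    then have "open (- cball 0 \<epsilon>) \<and> x \<in> - cball 0 \<epsilon>" by auto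
    then have "emeasure (restrict_ball \<Lambda> \<epsilon>) (- cball 0 \<epsilon>) > 0" using that unfolding S_def measure_support_def by blast
    moreover have "(- cball 0 \<epsilon>) \<inter> ball (0::real^'d) \<epsilon> = {}" by auto
    ultimately show False using emeasure_restrict_ball[OF \<Lambda>, of "- cball 0 \<epsilon>" \<epsilon>] by simp
  qed
  then show "x \<in> S \<Longrightarrow> norm x \<le> \<epsilon>" by blast
  have "open (- S)"
  proof (subst open_subopen, intro ballI)
    fix x assume "x \<in> - S"
    then obtain U where U: "open U" "x \<in> U" "\<not> emeasure (restrict_ball \<Lambda> \<epsilon>) U > 0" by (auto simp: S_def measure_support_def)
    then have "U \<subseteq> - S" by (auto simp: S_def measure_support_def)
    then show "\<exists>T. open T \<and> x \<in> T \<and> T \<subseteq> - S" using U by blast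
  qed
  then have "closed S" by (simp add: closed_def)
  moreover have "bounded S" using bound by (auto simp: bounded_iff)
  ultimately show "compact S" by (simp add: compact_eq_bounded_closed)
  assume x: "x \<in> S" and r: "r > 0"
  have "0 < emeasure (restrict_ball \<Lambda> \<epsilon>) (ball x r)" using x r by (auto simp: S_def measure_support_def)
  also have "\<dots> = emeasure \<Lambda> (ball x r \<inter> ball 0 \<epsilon>)" by (rule emeasure_restrict_ball[OF \<Lambda>]) simp
  also have "\<dots> \<le> emeasure \<Lambda> (ball x r)" by (intro emeasure_mono) (auto simp: \<Lambda>)
  finally show "emeasure \<Lambda> (ball x r) > 0" .
qed

section \<open>Small ball property for Gaussian increments\<close>

text \<open>If \<open>v = S *v u\<close> were nonzero, moving from \<open>u\<close> a little against
  \<open>v\<close> would make the form negative, because its linear term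
  \<open>2 * r * (v \<bullet> v)\<close> dominates the quadratic one.\<close>

lemma symmetric_psd_kernel:
  fixes S :: "real^'d^'d"
  assumes sym: "transpose S = S" and psd: "\<And>x. 0 \<le> x \<bullet> (S *v x)" and u: "u \<bullet> (S *v u) = 0"
  shows "S *v u = 0"
proof -
  define v where "v = S *v u"
  have e: "u \<bullet> (S *v v) = v \<bullet> v" using dot_lmul_matrix[of u S v] sym
    by (metis transpose_matrix_vector v_def)
  have "v \<bullet> v = 0"
  proof (rule ccontr)
    assume "v \<bullet> v \<noteq> 0"
    then have p: "v \<bullet> v > 0" using inner_ge_zero[of v] by linarith
    define q where "q = v \<bullet> (S *v v)"
    \<comment> \<open>A step against \<open>v\<close>, short enough for the quadratic term; the
      denominator is positive also for \<open>q = 0\<close>.\<close>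
    define r where "r = - (v \<bullet> v) / (q + 1)"
    have q: "q \<ge> 0" using psd by (simp add: q_def)
    have "0 \<le> (u + r *\<^sub>R v) \<bullet> (S *v (u + r *\<^sub>R v))" by (rule psd)
    also have "\<dots> = 2 * r * (v \<bullet> v) + r * r * q"
      using u e by (simp add: matrix_vector_right_distrib matrix_vector_mult_scaleR inner_add_left inner_add_right
          q_def v_def[symmetric] algebra_simps)
    also have "\<dots> = r * (2 * (v \<bullet> v) + r * q)" by (simp add: algebra_simps)
    also have "\<dots> < 0"
    proof (rule mult_neg_pos)
      show "r < 0" using p q by (simp add: r_def divide_neg_pos)
      have "q / (q + 1) \<le> 1" using q by (simp add: field_simps)
      then have "(v \<bullet> v) * (q / (q + 1)) \<le> (v \<bullet> v) * 1" using p by (intro mult_left_mono) auto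
      then have "- (r * q) \<le> v \<bullet> v" by (simp add: r_def)
      then show "0 < 2 * (v \<bullet> v) + r * q" using p by linarith
    qed
    finally show False by simp
  qed
  then show ?thesis by (simp add: v_def)
qed

text \<open>The minimum over the compact sphere is attained, and it is not zero since a null vector
  of the form lies in the kernel of \<open>S\<close>.\<close>

lemma nondegenerate_covariance_lower_bound:
  fixes S :: "real^'d^'d"
  assumes sym: "transpose S = S" and psd: "\<And>x. 0 \<le> x \<bullet> (S *v x)" and det: "det S \<noteq> 0"
  obtains \<kappa> where "\<kappa> > 0" "\<And>u. norm u = 1 \<Longrightarrow> \<kappa> \<le> u \<bullet> (S *v u)"
proof -
  have "continuous_on (sphere 0 1) (\<lambda>u. u \<bullet> (S *v u))"
    by (intro continuous_intros linear_continuous_on matrix_vector_mul_bounded_linear)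
  moreover have "sphere (0::real^'d) 1 \<noteq> {}" by simp
  ultimately obtain w where w: "w \<in> sphere 0 1" "\<And>u. u \<in> sphere 0 1 \<Longrightarrow> w \<bullet> (S *v w) \<le> u \<bullet> (S *v u)"
    using continuous_attains_inf[OF compact_sphere, of "0::real^'d" 1 "\<lambda>u. u \<bullet> (S *v u)"] by blast
  have "w \<bullet> (S *v w) \<noteq> 0"
  proof
    assume "w \<bullet> (S *v w) = 0"
    then have "S *v w = 0" by (rule symmetric_psd_kernel[OF sym psd])
    then have "w = 0" using det by (metis invertible_det_nz matrix_left_invertible_ker invertible_def)
    then show False using w(1) by simp
  qed
  then show thesis using psd[of w] w by (intro that[of "w \<bullet> (S *v w)"]) auto
qed

text \<open>Fourth moments are used because continuity of the paths needs a tail that beats the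
  number of cells: for \<open>n\<close> cells of length of order \<open>1 / n\<close>, second
  moments give only a bounded sum.\<close>

lemma std_normal_tail: "x > 0 \<Longrightarrow> measure std_normal_distribution {z. \<bar>z\<bar> \<ge> x} \<le> 3 / x ^ 4"
proof -
  assume x: "x > 0"
  interpret real_distribution std_normal_distribution by (rule real_dist_normal_dist)
  have "measure std_normal_distribution {z \<in> space std_normal_distribution. x ^ 4 \<le> z ^ 4} \<le>
    (LINT z|std_normal_distribution. z ^ 4) / x ^ 4"
    using x std_normal_distribution_even_moments(2)[of 2] by (intro integral_Markov_inequality_measure[of _ _ "{}"]) auto
  also have "(LINT z|std_normal_distribution. z ^ 4) = 3"
    using std_normal_distribution_even_moments(1)[of 2] by (simp add: fact_numeral)
  also have "{z \<in> space std_normal_distribution. x ^ 4 \<le> z ^ 4} = {z. \<bar>z\<bar> \<ge> x}"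
    using x power_mono_iff[of x "\<bar>z\<bar>" 4 for z] by auto
  finally show ?thesis .
qed

text \<open>The density is positive on \<open>{a - 1..a}\<close>, a set of positive Lebesgue
  measure.\<close>

lemma std_normal_lower_tail_pos: "measure std_normal_distribution {..a} > 0"
proof -
  interpret real_distribution std_normal_distribution by (rule real_dist_normal_dist)
  have "measure std_normal_distribution {..a} \<noteq> 0"
  proof
    assume "measure std_normal_distribution {..a} = 0"
    then have "emeasure std_normal_distribution {..a} = 0" by (simp add: emeasure_eq_measure)
    then have "(\<integral>\<^sup>+x. ennreal (std_normal_density x) * indicator {..a} x \<partial>lborel) = 0"
      by (subst (asm) emeasure_density) auto
    then have "AE x in lborel. ennreal (std_normal_density x) * indicator {..a} x = 0"
      by (subst (asm) nn_integral_0_iff_AE) auto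
    then have "AE x in lborel. x \<notin> {a - 1..a}"
    proof eventually_elim
      case (elim x)
      show ?case
      proof
        assume "x \<in> {a - 1..a}"
        then have "ennreal (std_normal_density x) = 0" using elim by (auto simp: indicator_def)
        then show False using normal_density_pos[of 1 0 x] by (simp add: ennreal_eq_0_iff)
      qed
    qed
    then have "emeasure lborel {a - 1..a} = 0"
      by (subst (asm) AE_iff_measurable[of "{a - 1..a}"]) auto
    then show False by simp
  qed
  then show ?thesis using measure_nonneg[of std_normal_distribution "{..a}"] by linarith
qed

text \<open>In the inner half of the ball no step of length \<open>C * q\<close> leads out. In the
  outer half an increment with inward component of at least \<open>a * q\<close> lowers the squared
  norm by the order \<open>a * R * q\<^sup>2\<close>, which pays for the length of the increment and
  for \<open>d\<close>, whose length is of the smaller order \<open>q\<^sup>2\<close>.\<close>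

lemma ball_feedback:
  fixes v l d :: "'a::real_inner"
  assumes v: "norm v \<le> R * q" and l: "norm l \<le> C * q" and d: "norm d \<le> G * q\<^sup>2" and q: "q > 0"
    and C: "C \<ge> 0" "4 * C \<le> R" "4 * C\<^sup>2 \<le> R * a" and G: "G \<ge> 0" "4 * (G * q) \<le> R" "8 * (G * q) \<le> a"
    and down: "norm v > R * q / 2 \<Longrightarrow> v \<bullet> l \<le> - (a * q * norm v)"
  shows "norm (v + l - d) \<le> R * q"
proof -
  have Gq: "G * q\<^sup>2 \<le> R * q / 4" using mult_right_mono[OF G(2), of q] q by (simp add: power2_eq_square mult_ac)
  have "norm (v + l) \<le> R * q - G * q\<^sup>2"
  proof (cases "norm v > R * q / 2")
    case False
    have "C * q \<le> R * q / 4" using mult_right_mono[OF C(2), of q] q by simp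
    then show ?thesis using False norm_triangle_ineq[of v l] l Gq by linarith
  next
    case True
    have R: "R \<ge> 0" using C by linarith
    have a: "a \<ge> 0" using G q by (meson mult_nonneg_nonneg order_trans less_imp_le zero_le_numeral)
    have "(norm (v + l))\<^sup>2 = (norm v)\<^sup>2 + 2 * (v \<bullet> l) + (norm l)\<^sup>2"
      by (simp add: power2_norm_eq_inner inner_add_left inner_add_right inner_commute)
    also have "\<dots> \<le> (R * q)\<^sup>2 + 2 * (- (a * q * (R * q / 2))) + (C * q)\<^sup>2"
    proof (intro add_mono power_mono v l mult_left_mono norm_ge_zero)
      have "a * q * (R * q / 2) \<le> a * q * norm v" using True a q by (intro mult_left_mono) auto
      then show "v \<bullet> l \<le> - (a * q * (R * q / 2))" using down[OF True] by linarith
    qed auto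
    also have "\<dots> = q\<^sup>2 * (R\<^sup>2 - a * R + C\<^sup>2)" by (simp add: power2_eq_square algebra_simps)
    \<comment> \<open>\<open>C\<^sup>2\<close> and \<open>2 * R * (G * q)\<close> are each at most a
      quarter of \<open>R * a\<close>; the right-hand side is completed to the square of
      \<open>R - G * q\<close>.\<close>
    also have "\<dots> \<le> q\<^sup>2 * (R\<^sup>2 - 2 * R * (G * q) + (G * q)\<^sup>2)"
    proof (rule mult_left_mono)
      have "8 * (R * (G * q)) \<le> R * a" using mult_left_mono[OF G(3) R] by (simp add: mult_ac)
      moreover have "0 \<le> R * a" using R a by simp
      ultimately show "R\<^sup>2 - a * R + C\<^sup>2 \<le> R\<^sup>2 - 2 * R * (G * q) + (G * q)\<^sup>2"
        unfolding mult.commute[of a R] mult.assoc using C(3) zero_le_power2[of "G * q"] by linarith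
    qed simp
    also have "\<dots> = (R * q - G * q\<^sup>2)\<^sup>2" by (simp add: power2_eq_square algebra_simps)
    finally show ?thesis
    proof (rule power2_le_imp_le)
      show "0 \<le> R * q - G * q\<^sup>2" using Gq mult_nonneg_nonneg[OF R less_imp_le[OF q]] by linarith
    qed
  qed
  then show ?thesis using norm_triangle_ineq4[of "v + l" d] d by linarith
qed

text \<open>Over a step of length \<open>h\<close> the target has to move much less than
  \<open>sqrt h\<close>, the scale of the noise, which a merely continuous \<open>g\<close> does not
  guarantee. Polynomials are uniformly dense and Lipschitz on bounded intervals; subtracting the
  value at \<open>a\<close> restores the initial value zero at the price of a second error.\<close>

lemma continuous_on_Lipschitz_approx:
  fixes g :: "real \<Rightarrow> 'a::euclidean_space"
  assumes g: "continuous_on {a..b} g" "g a = 0" and ab: "a < b" and e: "e > 0"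
  obtains G g' where "G \<ge> 0" "g' a = 0" "\<And>t. t \<in> {a..b} \<Longrightarrow> norm (g t - g' t) \<le> e"
    "\<And>s t. s \<in> {a..b} \<Longrightarrow> t \<in> {a..b} \<Longrightarrow> norm (g' s - g' t) \<le> G * \<bar>s - t\<bar>"
proof -
  obtain p where p: "polynomial_function p" "\<And>x. x \<in> {a..b} \<Longrightarrow> norm (g x - p x) < e / 2"
    using Stone_Weierstrass_polynomial_function[OF compact_Icc g(1), of "e / 2"] e by auto
  obtain p' where p': "polynomial_function p'" "\<And>x. (p has_vector_derivative p' x) (at x)"
    using has_vector_derivative_polynomial_function[OF p(1)] by blast
  have "bounded (p' ` {a..b})"
    by (intro compact_imp_bounded compact_continuous_image continuous_on_polymonial_function p' compact_Icc)
  then obtain G where G: "\<And>x. x \<in> {a..b} \<Longrightarrow> norm (p' x) \<le> G" unfolding bounded_iff by blast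
  have "norm (p s - p t) \<le> G * \<bar>s - t\<bar>" if "s \<in> {a..b}" "t \<in> {a..b}" for s t
  proof -
    have "norm (p s - p t) \<le> G * norm (s - t)"
    proof (rule differentiable_bound[where S = "{a..b}" and f' = "\<lambda>x h. h *\<^sub>R p' x"])
      show "(p has_derivative (\<lambda>h. h *\<^sub>R p' x)) (at x within {a..b})" for x
        using p'(2)[of x] by (simp add: has_vector_derivative_def has_derivative_at_withinI)
      show "onorm (\<lambda>h. h *\<^sub>R p' x) \<le> G" if "x \<in> {a..b}" for x
      proof (rule onorm_le)
        fix h :: real
        have "\<bar>h\<bar> * norm (p' x) \<le> \<bar>h\<bar> * G" by (intro mult_left_mono G[OF that]) auto
        then show "norm (h *\<^sub>R p' x) \<le> G * norm h" by (simp add: mult.commute)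
      qed
    qed (use that in auto)
    then show ?thesis by simp
  qed
  moreover have "norm (g t - (p t - p a)) \<le> e" if "t \<in> {a..b}" for t
  proof -
    have "norm (g t - (p t - p a)) \<le> norm (g t - p t) + norm (g a - p a)"
      using norm_triangle_ineq4[of "g t - p t" "g a - p a"] g(2) by (simp add: algebra_simps)
    then show ?thesis using p(2)[OF that] p(2)[of a] ab by simp
  qed
  moreover have "0 \<le> G" using G[of a] ab norm_ge_zero[of "p' a"] by (meson atLeastAtMost_iff less_imp_le order_refl order_trans)
  ultimately show thesis by (intro that[of G "\<lambda>t. p t - p a"]) auto
qed

text \<open>A jump at \<open>t\<close> shows up as an increment over the grid cell containing
  \<open>t\<close> on every sufficiently fine grid. So it suffices that arbitrarily fine grids
  without large increments exist.\<close>

lemma continuous_on_of_small_increments: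
  fixes l :: "real \<Rightarrow> 'a::real_normed_vector"
  assumes l: "cadlag_on {0..} l"
    and small: "\<And>m k N. \<exists>n\<ge>N. n > 0 \<and> (\<forall>j<n. norm (l (grid 0 (real (Suc m)) n (Suc j)) - l (grid 0 (real (Suc m)) n j)) \<le> 1 / real (Suc k))"
  shows "continuous_on {0..} l"
  unfolding continuous_on_def
proof
  fix t :: real assume t: "t \<in> {0..}"
  have right: "(l \<longlongrightarrow> l t) (at t within ({0..} \<inter> {t<..}))" using l t by (auto simp: cadlag_on_def)
  have "(l \<longlongrightarrow> l t) (at t within ({0..} \<inter> {..<t}))"
  proof (cases "t = 0")
    case True
    then have "{0..} \<inter> {..<t} = {}" by auto
    then show ?thesis by (simp add: tendsto_def)
  next
    case False
    then have t0: "t > 0" using t by simp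
    obtain x where x: "(l \<longlongrightarrow> x) (at t within ({0..} \<inter> {..<t}))" using l t by (auto simp: cadlag_on_def)
    have "x = l t"
    proof (rule ccontr)
      assume "x \<noteq> l t"
      define e where "e = norm (x - l t) / 4"
      have e: "e > 0" using \<open>x \<noteq> l t\<close> by (simp add: e_def)
      obtain d1 where d1: "d1 > 0" "\<And>s. s \<in> {0..} \<inter> {..<t} \<Longrightarrow> dist s t < d1 \<Longrightarrow> dist (l s) x < e"
        using x[unfolded tendsto_iff, rule_format, OF e] unfolding eventually_at by auto
      obtain d2 where d2: "d2 > 0" "\<And>s. s \<in> {0..} \<inter> {t<..} \<Longrightarrow> dist s t < d2 \<Longrightarrow> dist (l s) (l t) < e"
        using right[unfolded tendsto_iff, rule_format, OF e] unfolding eventually_at by auto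
      obtain m where "t < real m" using reals_Archimedean2 by blast
      then have m: "t < real (Suc m)" by simp
      obtain k where k: "1 / real (Suc k) < e" using reals_Archimedean[OF e] by (auto simp: inverse_eq_divide)
      obtain N where N: "real (Suc m) / min d1 d2 < real N" using reals_Archimedean2 by blast
      obtain n where n: "n \<ge> N" "n > 0"
        "\<And>j. j < n \<Longrightarrow> norm (l (grid 0 (real (Suc m)) n (Suc j)) - l (grid 0 (real (Suc m)) n j)) \<le> 1 / real (Suc k)"
        using small[of N m k] by blast
      define h where "h = real (Suc m) / real n"
      have h: "h > 0" using n(2) by (simp add: h_def)
      have "min d1 d2 > 0" using d1 d2 by simp
      then have "real (Suc m) < real N * min d1 d2" using N by (simp only: pos_divide_less_eq)
      also have "\<dots> \<le> real n * min d1 d2" using n(1) d1(1) d2(1) by (intro mult_right_mono) auto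
      finally have "h < min d1 d2" unfolding h_def using n(2) by (simp only: pos_divide_less_eq of_nat_0_less_iff mult.commute)
      then have hd: "h < d1" "h < d2" by auto
      \<comment> \<open>The cell is half-open on the left: its left end point lies strictly before
        \<open>t\<close>, its right one at \<open>t\<close> or after it, where right-continuity
        applies.\<close>
      define j where "j = nat (\<lceil>t / h\<rceil> - 1)"
      have c: "\<lceil>t / h\<rceil> \<ge> 1" using t0 h by (simp add: less_ceiling_iff)
      then have j: "real j = real_of_int \<lceil>t / h\<rceil> - 1" by (simp add: j_def)
      have "real j < t / h" "t / h \<le> real (Suc j)"
        using ceiling_correct[of "t / h"] unfolding of_nat_Suc j by linarith+
      then have jt: "real j * h < t" "t \<le> real (Suc j) * h" using h by (auto simp: field_simps)
      have "real n * h = real (Suc m)" using n(2) by (simp add: h_def)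
      then have "real j * h < real n * h" using jt m by linarith
      then have "real j < real n" using h by (simp only: mult_less_cancel_right_pos)
      then have jn: "j < n" by simp
      have gr: "grid 0 (real (Suc m)) n i = real i * h" for i by (simp add: grid_def h_def)
      have "dist (l (real j * h)) x < e"
        using jt h hd by (intro d1(2)) (auto simp: dist_real_def algebra_simps)
      moreover have "dist (l (real (Suc j) * h)) (l t) < e"
      proof (cases "real (Suc j) * h = t")
        case False
        then show ?thesis using jt h hd t0 by (intro d2(2)) (auto simp: dist_real_def algebra_simps)
      qed (use e in simp)
      moreover have "dist (l (real (Suc j) * h)) (l (real j * h)) < e"
        using n(3)[OF jn] k unfolding gr dist_norm by linarith
      moreover have "dist x (l t) = 4 * e" by (simp add: e_def dist_norm)
      ultimately show False using dist_triangle3[of x "l t" "l (real j * h)"]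
          dist_triangle3[of "l (real j * h)" "l t" "l (real (Suc j) * h)"] e by (simp add: dist_commute)
    qed
    then show ?thesis using x by simp
  qed
  then have "(l \<longlongrightarrow> l t) (at t within (({0..} \<inter> {..<t}) \<union> ({0..} \<inter> {t<..})))"
    using right by (rule Lim_Un)
  moreover have "(({0..} \<inter> {..<t}) \<union> ({0..} \<inter> {t<..})) = {0..} - {t}" by auto
  moreover have "at t within ({0..} - {t}) = at t within {0..}" by (simp add: at_within_def)
  ultimately show "(l \<longlongrightarrow> l t) (at t within {0..})" by (simp only:)
qed

lemma exists_large_coordinate:
  fixes x :: "real^'d"
  assumes "norm x > c"
  shows "\<exists>i. \<bar>axis i 1 \<bullet> x\<bar> > c / real CARD('d)"
proof (rule ccontr)
  assume "\<not> ?thesis"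
  then have "\<And>i. \<bar>x $ i\<bar> \<le> c / real CARD('d)" by (simp add: not_less inner_axis')
  then have "(\<Sum>i\<in>UNIV. \<bar>x $ i\<bar>) \<le> (\<Sum>i\<in>(UNIV::'d set). c / real CARD('d))" by (intro sum_mono)
  then show False using norm_le_l1_cart[of x] assms by simp
qed

section \<open>Brownian motion with drift: tails, continuity and steering\<close>

locale gaussian_noise = stationary_noise M L Z \<psi>
  for M :: "'w measure" and L :: "real \<Rightarrow> 'w \<Rightarrow> real^'d" and Z \<psi> +
  fixes b :: "real^'d" and S :: "real^'d^'d"
  assumes exponent: "\<And>\<xi>. \<psi> \<xi> = \<i> * complex_of_real (b \<bullet> \<xi>) - complex_of_real (\<xi> \<bullet> (S *v \<xi>) / 2)"
    and symmetric: "transpose S = S" and psd: "\<And>x. 0 \<le> x \<bullet> (S *v x)" and nondegenerate: "det S \<noteq> 0"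
begin

text \<open>Both laws have the same characteristic function. Writing the right-hand side as a scaled
  standard normal variable covers a vanishing variance as well.\<close>

lemma projection_distr:
  assumes h: "h > 0" and B: "B \<in> sets borel"
  shows "prob {w\<in>space M. u \<bullet> (L (t + h) w - L t w) \<in> B} =
    measure std_normal_distribution {z. h * (b \<bullet> u) + sqrt (h * (u \<bullet> (S *v u))) * z \<in> B}"
proof -
  interpret N: real_distribution std_normal_distribution by (rule real_dist_normal_dist)
  define X where "X w = u \<bullet> (L (t + h) w - L t w)" for w
  define Y where "Y z = h * (b \<bullet> u) + sqrt (h * (u \<bullet> (S *v u))) * z" for z
  have X [measurable]: "X \<in> borel_measurable M" by (simp add: X_def[abs_def])
  have Y [measurable]: "Y \<in> borel_measurable std_normal_distribution" by (simp add: Y_def[abs_def])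
  have "distr M borel X = distr std_normal_distribution borel Y"
  proof (rule Levy_uniqueness)
    show "real_distribution (distr M borel X)" by simp
    show "real_distribution (distr std_normal_distribution borel Y)" by simp
    show "char (distr M borel X) = char (distr std_normal_distribution borel Y)"
    proof
      fix v
      have "char (distr M borel X) v = (LINT w|M. iexp ((v *\<^sub>R u) \<bullet> (L (t + h) w - L t w)))"
        unfolding char_def by (subst integral_distr) (auto simp: X_def)
      also have "\<dots> = exp (complex_of_real h * \<psi> (v *\<^sub>R u))" using incr_char[of t "t + h" "v *\<^sub>R u"] h by simp
      also have "\<dots> = iexp (v * (h * (b \<bullet> u))) * complex_of_real (exp (- (v * sqrt (h * (u \<bullet> (S *v u))))\<^sup>2 / 2))"
        unfolding exponent using h psd[of u]
        by (simp add: exp_of_real[symmetric] exp_add[symmetric] matrix_vector_mult_scaleR power_mult_distrib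
            power2_eq_square[of v] algebra_simps)
      also have "\<dots> = iexp (v * (h * (b \<bullet> u))) * char std_normal_distribution (v * sqrt (h * (u \<bullet> (S *v u))))"
        by (simp add: char_std_normal_distribution)
      also have "\<dots> = (LINT z|std_normal_distribution. iexp (v * (h * (b \<bullet> u))) * iexp (v * sqrt (h * (u \<bullet> (S *v u))) * z))"
        unfolding char_def by (subst integral_mult_right_zero) simp
      also have "\<dots> = (LINT z|std_normal_distribution. iexp (v * Y z))"
        by (intro Bochner_Integration.integral_cong refl) (simp add: Y_def exp_add[symmetric] algebra_simps)
      also have "\<dots> = char (distr std_normal_distribution borel Y) v"
        unfolding char_def by (subst integral_distr) auto
      finally show "char (distr M borel X) v = char (distr std_normal_distribution borel Y) v" .
    qed
  qed
  then have "measure (distr M borel X) B = measure (distr std_normal_distribution borel Y) B" by simp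
  then show ?thesis using B by (simp add: measure_distr X_def Y_def vimage_def Int_def conj_commute)
qed

text \<open>A large increment has a large coordinate, and each coordinate is normal.
  \<open>K0\<close> is so large that the drift uses up at most half of the threshold of a
  coordinate.\<close>

lemma increment_tail:
  obtains D K0 where "D > 0" "K0 > 0" "\<And>t h K. 0 < h \<Longrightarrow> h \<le> 1 \<Longrightarrow> K \<ge> K0 \<Longrightarrow>
    prob {w\<in>space M. norm (L (t + h) w - L t w) > K * sqrt h} \<le> D / K ^ 4"
proof -
  interpret N: real_distribution std_normal_distribution by (rule real_dist_normal_dist)
  define d where "d = real CARD('d)"
  have d: "d \<ge> 1" by (simp add: d_def Suc_leI)
  define \<sigma> where "\<sigma> i = axis i 1 \<bullet> (S *v axis i 1)" for i :: 'd
  define s where "s = sqrt (Max (range \<sigma>)) + 1"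
  have \<sigma>: "0 \<le> \<sigma> i" "\<sigma> i \<le> Max (range \<sigma>)" for i using psd by (auto simp: \<sigma>_def)
  have s: "sqrt (\<sigma> i) \<le> s" "s > 0" for i
    using real_sqrt_le_mono[OF \<sigma>(2)[of i]] real_sqrt_ge_zero[OF \<sigma>(1)[of i]] unfolding s_def by linarith+
  define D where "D = d * (3 * (2 * d * s) ^ 4)"
  define K0 where "K0 = 2 * d * (norm b + 1)"
  have "prob {w\<in>space M. norm (L (t + h) w - L t w) > K * sqrt h} \<le> D / K ^ 4"
    if h: "0 < h" "h \<le> 1" and K: "K \<ge> K0" for t h K
  proof -
    have K0: "K0 > 0" using d by (simp add: K0_def add_nonneg_pos)
    then have Kp: "K > 0" using K by linarith
    define E where "E i = {w\<in>space M. \<bar>axis i 1 \<bullet> (L (t + h) w - L t w)\<bar> > K * sqrt h / d}" for i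
    have Em: "E i \<in> events" for i unfolding E_def by measurable
    have "prob {w\<in>space M. norm (L (t + h) w - L t w) > K * sqrt h} \<le> prob (\<Union>i\<in>UNIV. E i)"
    proof (rule finite_measure_mono)
      show "{w\<in>space M. norm (L (t + h) w - L t w) > K * sqrt h} \<subseteq> (\<Union>i\<in>UNIV. E i)"
      proof
        fix w assume "w \<in> {w\<in>space M. norm (L (t + h) w - L t w) > K * sqrt h}"
        then show "w \<in> (\<Union>i\<in>UNIV. E i)"
          using exists_large_coordinate[of "K * sqrt h" "L (t + h) w - L t w"] by (simp add: E_def d_def)
      qed
    qed (use Em in auto)
    also have "\<dots> \<le> (\<Sum>i\<in>UNIV. prob (E i))" using Em by (intro finite_measure_subadditive_finite) auto
    also have "\<dots> \<le> (\<Sum>i\<in>(UNIV::'d set). 3 * (2 * d * s) ^ 4 / K ^ 4)"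
    proof (rule sum_mono)
      fix i :: 'd
      define B where "B = {y. \<bar>y\<bar> > K * sqrt h / d}"
      have B: "B \<in> sets borel" by (simp add: B_def)
      have "E i = {w\<in>space M. axis i 1 \<bullet> (L (t + h) w - L t w) \<in> B}" by (auto simp: B_def E_def)
      then have "prob (E i) = measure std_normal_distribution {z. h * (b \<bullet> axis i 1) + sqrt (h * \<sigma> i) * z \<in> B}"
        using projection_distr[OF h(1) B, of "axis i 1" t] by (simp only: \<sigma>_def)
      also have "\<dots> \<le> measure std_normal_distribution {z. \<bar>z\<bar> \<ge> K / (2 * d * s)}"
      proof (rule N.finite_measure_mono)
        show "{z. h * (b \<bullet> axis i 1) + sqrt (h * \<sigma> i) * z \<in> B} \<subseteq> {z. \<bar>z\<bar> \<ge> K / (2 * d * s)}"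
        proof
          fix z assume "z \<in> {z. h * (b \<bullet> axis i 1) + sqrt (h * \<sigma> i) * z \<in> B}"
          then have "K * sqrt h / d < \<bar>h * (b \<bullet> axis i 1) + sqrt (h * \<sigma> i) * z\<bar>" by (simp add: B_def)
          also have "\<dots> \<le> h * norm b + sqrt h * (s * \<bar>z\<bar>)"
          proof -
            have "\<bar>b \<bullet> axis i 1\<bar> \<le> norm b" using Cauchy_Schwarz_ineq2[of b "axis i 1"] by simp
            then have "\<bar>h * (b \<bullet> axis i 1)\<bar> \<le> h * norm b" using h by (simp add: abs_mult)
            moreover have "\<bar>sqrt (h * \<sigma> i) * z\<bar> \<le> sqrt h * (s * \<bar>z\<bar>)"
              using h s \<sigma>(1)[of i] by (simp add: abs_mult real_sqrt_mult mult_right_mono mult.assoc)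
            ultimately show ?thesis using abs_triangle_ineq[of "h * (b \<bullet> axis i 1)" "sqrt (h * \<sigma> i) * z"] by linarith
          qed
          also have "h * norm b \<le> sqrt h * norm b"
          proof -
            have "sqrt h * sqrt h \<le> sqrt h * 1" using h by (intro mult_left_mono) auto
            then have "h \<le> sqrt h" using h by simp
            then show ?thesis by (intro mult_right_mono) auto
          qed
          finally have "sqrt h * (K / d) < sqrt h * (norm b + s * \<bar>z\<bar>)" by (simp add: algebra_simps)
          then have a: "K / d < norm b + s * \<bar>z\<bar>" by (rule mult_left_less_imp_less) (use h in simp)
          have "norm b \<le> K / (2 * d)"
          proof -
            have "norm b * (2 * d) \<le> K" using K d unfolding K0_def by (simp add: algebra_simps)
            then show ?thesis using d by (simp add: pos_le_divide_eq)
          qed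
          moreover have "K / d = K / (2 * d) + K / (2 * d)" using d by (simp add: field_simps)
          ultimately have "K / (2 * d) < s * \<bar>z\<bar>" using a by linarith
          then have "K / (2 * d) < \<bar>z\<bar> * s" by (simp only: mult.commute)
          then have "K / (2 * d) / s < \<bar>z\<bar>" using s(2) by (simp only: pos_divide_less_eq)
          then show "z \<in> {z. \<bar>z\<bar> \<ge> K / (2 * d * s)}" by (simp only: divide_divide_eq_left mem_Collect_eq less_imp_le)
        qed
      qed auto
      also have "\<dots> \<le> 3 / (K / (2 * d * s)) ^ 4" using Kp d s(2) by (intro std_normal_tail) simp
      finally show "prob (E i) \<le> 3 * (2 * d * s) ^ 4 / K ^ 4" by (simp add: power_divide)
    qed
    also have "\<dots> = D / K ^ 4" by (simp add: D_def d_def)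
    finally show ?thesis .
  qed
  moreover have "D > 0" "K0 > 0" using d s(2) by (auto simp: D_def K0_def add_nonneg_pos)
  ultimately show thesis using that by blast
qed

text \<open>Along a unit vector the increment is normal with standard deviation at least
  \<open>a * sqrt h\<close>. Where the standard normal variable is below \<open>-2\<close> the
  fluctuation is at most \<open>- 2 * a * sqrt h\<close>, and for \<open>h \<le> h0\<close> the
  drift takes back at most half of it.\<close>

lemma downward_step:
  obtains a p h0 where "a > 0" "p > 0" "h0 > 0" "\<And>t h u. 0 < h \<Longrightarrow> h \<le> h0 \<Longrightarrow> norm u = 1 \<Longrightarrow>
    prob {w\<in>space M. u \<bullet> (L (t + h) w - L t w) \<le> - (a * sqrt h)} \<ge> p"
proof -
  interpret N: real_distribution std_normal_distribution by (rule real_dist_normal_dist)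
  obtain \<kappa> where \<kappa>: "\<kappa> > 0" "\<And>u. norm u = 1 \<Longrightarrow> \<kappa> \<le> u \<bullet> (S *v u)"
    using nondegenerate_covariance_lower_bound[OF symmetric psd nondegenerate] by blast
  define a where "a = sqrt \<kappa>"
  define p where "p = measure std_normal_distribution {..-2}"
  define h0 where "h0 = (a / (norm b + 1))\<^sup>2"
  have a: "a > 0" using \<kappa> by (simp add: a_def)
  have h0: "h0 > 0" using a by (simp add: h0_def add_nonneg_eq_0_iff)
  have "p \<le> prob {w\<in>space M. u \<bullet> (L (t + h) w - L t w) \<le> - (a * sqrt h)}"
    if h: "0 < h" "h \<le> h0" and u: "norm u = 1" for t h u
  proof -
    define \<sigma> where "\<sigma> = u \<bullet> (S *v u)"
    have \<sigma>: "a \<le> sqrt \<sigma>" using \<kappa>(2)[OF u] by (simp add: a_def \<sigma>_def)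
    have "sqrt h \<le> a / (norm b + 1)"
      using real_sqrt_le_mono[OF h(2)] a by (simp add: h0_def)
    then have "sqrt h * (norm b + 1) \<le> a" by (simp add: pos_le_divide_eq add_nonneg_pos)
    then have hb: "sqrt h * norm b \<le> a" using real_sqrt_gt_zero[OF h(1)] unfolding distrib_left by linarith
    have "{..-2} \<subseteq> {z. h * (b \<bullet> u) + sqrt (h * \<sigma>) * z \<in> {..- (a * sqrt h)}}"
    proof
      fix z :: real assume z: "z \<in> {..-2}"
      have "b \<bullet> u \<le> norm b" using norm_cauchy_schwarz[of b u] u by simp
      then have "sqrt h * (b \<bullet> u) \<le> sqrt h * norm b" using h by (intro mult_left_mono) auto
      then have 1: "sqrt h * (b \<bullet> u) \<le> a" using hb by linarith
      have "0 \<le> sqrt \<sigma>" using \<sigma> a by linarith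
      then have "sqrt \<sigma> * z \<le> sqrt \<sigma> * (-2)" using z by (intro mult_left_mono) simp_all
      then have "sqrt \<sigma> * z \<le> - 2 * a" using \<sigma> by linarith
      then have "sqrt h * (b \<bullet> u) + sqrt \<sigma> * z \<le> - a" using 1 by linarith
      then have "sqrt h * (sqrt h * (b \<bullet> u) + sqrt \<sigma> * z) \<le> sqrt h * (- a)" using h by (intro mult_left_mono) auto
      then show "z \<in> {z. h * (b \<bullet> u) + sqrt (h * \<sigma>) * z \<in> {..- (a * sqrt h)}}"
      proof -
        assume le: "sqrt h * (sqrt h * (b \<bullet> u) + sqrt \<sigma> * z) \<le> sqrt h * (- a)"
        have "sqrt h * (sqrt h * (b \<bullet> u) + sqrt \<sigma> * z) = (sqrt h * sqrt h) * (b \<bullet> u) + sqrt (h * \<sigma>) * z"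
          by (simp only: distrib_left mult.assoc real_sqrt_mult)
        also have "sqrt h * sqrt h = h" using h by simp
        finally show ?thesis using le by (simp add: mult.commute)
      qed
    qed
    then have "p \<le> measure std_normal_distribution {z. h * (b \<bullet> u) + sqrt (h * \<sigma>) * z \<in> {..- (a * sqrt h)}}"
      unfolding p_def by (intro N.finite_measure_mono) auto
    then show ?thesis using projection_distr[OF h(1), of "{..- (a * sqrt h)}" u t] by (simp add: \<sigma>_def)
  qed
  moreover have "p > 0" unfolding p_def by (rule std_normal_lower_tail_pos)
  ultimately show thesis using that a h0 by blast
qed

text \<open>With \<open>K = e / sqrt h\<close> the tail bound is of order \<open>h\<^sup>2\<close>
  per cell and \<open>1 / n\<close> in total. Probabilities tending to zero already exclude, almost
  surely, that all fine grids have a large increment.\<close>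

lemma paths_continuous: "AE w in M. continuous_on {0..} (\<lambda>t. L t w)"
proof -
  obtain D K0 where DK: "D > 0" "K0 > 0" and tail: "\<And>t h K. 0 < h \<Longrightarrow> h \<le> 1 \<Longrightarrow> K \<ge> K0 \<Longrightarrow>
    prob {w\<in>space M. norm (L (t + h) w - L t w) > K * sqrt h} \<le> D / K ^ 4"
    by (rule increment_tail) blast
  define E where "E m k n = {w\<in>space M. \<exists>j\<in>{..<n}. norm (L (grid 0 (real (Suc m)) n (Suc j)) w - L (grid 0 (real (Suc m)) n j) w) > 1 / real (Suc k)}" for m k n
  have Em: "E m k n \<in> events" for m k n unfolding E_def by measurable
  have lim: "(\<lambda>n. prob (E m k n)) \<longlonglongrightarrow> 0" for m k
  proof (rule tendsto_sandwich[of "\<lambda>_. 0"])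
    define e where "e = 1 / real (Suc k)"
    define T where "T = real (Suc m)"
    have eT: "e > 0" "T > 0" by (auto simp: e_def T_def)
    show "\<forall>\<^sub>F n in sequentially. 0 \<le> prob (E m k n)" by simp
    show "(\<lambda>n. D * T\<^sup>2 / e ^ 4 / real n) \<longlonglongrightarrow> 0" by (rule real_tendsto_divide_at_top[OF tendsto_const filterlim_real_sequentially])
    have "\<forall>\<^sub>F n in sequentially. max T (K0\<^sup>2 * T / e\<^sup>2) \<le> real n"
      using filterlim_real_sequentially unfolding filterlim_at_top by blast
    then show "\<forall>\<^sub>F n in sequentially. prob (E m k n) \<le> D * T\<^sup>2 / e ^ 4 / real n"
    proof eventually_elim
      case (elim n)
      then have n: "T \<le> real n" "K0\<^sup>2 * T / e\<^sup>2 \<le> real n" by auto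
      then have np: "real n > 0" using eT by linarith
      define h where "h = T / real n"
      define K where "K = e / sqrt h"
      have h: "0 < h" "h \<le> 1" using n np eT by (auto simp: h_def)
      have "K0\<^sup>2 * h \<le> e\<^sup>2" using n(2) np eT by (simp add: h_def field_simps)
      then have "K0\<^sup>2 \<le> K\<^sup>2" using h by (simp add: K_def power_divide pos_le_divide_eq)
      then have K: "K0 \<le> K" using eT h by (intro power2_le_imp_le[of K0 K]) (auto simp: K_def)
      have gr: "grid 0 T n (Suc j) = grid 0 T n j + h" for j by (simp add: grid_def h_def distrib_left mult.commute[of _ T] add_divide_distrib)
      have "prob (E m k n) \<le> prob (\<Union>j\<in>{..<n}. {w\<in>space M. norm (L (grid 0 T n j + h) w - L (grid 0 T n j) w) > K * sqrt h})"
        using h by (intro finite_measure_mono) (auto simp: E_def K_def e_def T_def[symmetric] gr simp del: of_nat_Suc)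
      also have "\<dots> \<le> (\<Sum>j<n. prob {w\<in>space M. norm (L (grid 0 T n j + h) w - L (grid 0 T n j) w) > K * sqrt h})"
        by (intro finite_measure_subadditive_finite) auto
      also have "\<dots> \<le> (\<Sum>j<n. D / K ^ 4)" by (intro sum_mono tail h K)
      also have "K ^ 4 = e ^ 4 / h\<^sup>2"
      proof -
        have "sqrt h ^ 4 = (sqrt h ^ 2) ^ 2" by (simp flip: power_mult)
        then show ?thesis using h by (simp add: K_def power_divide)
      qed
      also have "(\<Sum>j<n. D / (e ^ 4 / h\<^sup>2)) = D * T\<^sup>2 / e ^ 4 / real n"
        using np by (simp add: h_def power_divide power2_eq_square)
      finally show ?case .
    qed
  qed simp
  have "AE w in M. \<not> (\<forall>n\<ge>N. n > 0 \<longrightarrow> w \<in> E m k n)" for m k N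
  proof -
    have N: "(\<Inter>n\<in>{Suc N..}. E m k n) \<in> events" using Em by (intro sets.countable_INT) auto
    have "prob (\<Inter>n\<in>{Suc N..}. E m k n) \<le> 0"
    proof (rule tendsto_lowerbound[OF lim])
      show "\<forall>\<^sub>F n in sequentially. prob (\<Inter>n\<in>{Suc N..}. E m k n) \<le> prob (E m k n)"
        unfolding eventually_sequentially using Em by (intro exI[of _ "Suc N"] allI impI finite_measure_mono) auto
    qed simp
    then have "prob (\<Inter>n\<in>{Suc N..}. E m k n) = 0" using measure_nonneg[of M "\<Inter>n\<in>{Suc N..}. E m k n"] by linarith
    then have "AE w in M. w \<notin> (\<Inter>n\<in>{Suc N..}. E m k n)" using N by (intro AE_not_in) (simp add: null_sets_def emeasure_eq_measure)
    then show ?thesis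
    proof eventually_elim
      case (elim w)
      then obtain n where "Suc N \<le> n" "w \<notin> E m k n" by auto
      then show ?case by (intro notI) (metis Suc_leD Suc_le_lessD le_less_trans zero_le)
    qed
  qed
  then have "AE w in M. \<forall>m k N. \<not> (\<forall>n\<ge>N. n > 0 \<longrightarrow> w \<in> E m k n)" by (simp add: AE_all_countable)
  then show ?thesis
  proof (rule AE_mp, intro AE_I2 impI)
    fix w assume w: "w \<in> space M" and io: "\<forall>m k N. \<not> (\<forall>n\<ge>N. n > 0 \<longrightarrow> w \<in> E m k n)"
    show "continuous_on {0..} (\<lambda>t. L t w)"
    proof (rule continuous_on_of_small_increments[OF cadlag[OF w]])
      fix m k N
      obtain n where "n \<ge> N" "n > 0" "w \<notin> E m k n" using io by blast
      then show "\<exists>n\<ge>N. n > 0 \<and> (\<forall>j<n. norm (L (grid 0 (real (Suc m)) n (Suc j)) w - L (grid 0 (real (Suc m)) n j) w) \<le> 1 / real (Suc k))"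
        using w by (intro exI[of _ n]) (auto simp: E_def not_less)
    qed
  qed
qed

text \<open>A move against the deviation has probability at least \<open>p\<close>. Removing the
  events that the increment exceeds \<open>C * sqrt h\<close>, at most \<open>p / 4\<close>, and
  that the path moves by more than \<eta> within the step, below \<open>p / 2\<close>, leaves a
  positive probability.\<close>

lemma gaussian_step:
  assumes G: "G \<ge> 0" and \<eta>: "\<eta> > 0"
  obtains R h0 where "R > 0" "h0 > 0" "\<And>t h v d. 0 \<le> t \<Longrightarrow> 0 < h \<Longrightarrow> h \<le> h0 \<Longrightarrow> norm v \<le> R * sqrt h \<Longrightarrow> norm d \<le> G * h \<Longrightarrow>
    prob ({w\<in>space M. v + (L (t + h) w - L t w) - d \<in> cball 0 (R * sqrt h)} \<inter> sup_event t h \<eta>) > 0"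
proof -
  obtain D K0 where DK: "D > 0" "K0 > 0" and tail: "\<And>t h K. 0 < h \<Longrightarrow> h \<le> 1 \<Longrightarrow> K \<ge> K0 \<Longrightarrow>
    prob {w\<in>space M. norm (L (t + h) w - L t w) > K * sqrt h} \<le> D / K ^ 4"
    by (rule increment_tail) blast
  obtain a p h1 where a: "a > 0" "p > 0" "h1 > 0" and down: "\<And>t h u. 0 < h \<Longrightarrow> h \<le> h1 \<Longrightarrow> norm u = 1 \<Longrightarrow>
    prob {w\<in>space M. u \<bullet> (L (t + h) w - L t w) \<le> - (a * sqrt h)} \<ge> p"
    by (rule downward_step) blast
  obtain h2 where h2: "h2 > 0" "\<And>t h. 0 \<le> t \<Longrightarrow> 0 < h \<Longrightarrow> h \<le> h2 \<Longrightarrow> prob (sup_event t h \<eta>) > 1 - p / 2"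
    using sup_event_likely[OF \<eta>, of "1 - p / 2"] a(2) by auto
  \<comment> \<open>\<open>K0\<close> admits the tail bound; since \<open>C \<ge> 1\<close> gives
    \<open>C \<le> C ^ 4\<close>, the last entry makes \<open>D / C ^ 4\<close> at most
    \<open>p / 4\<close>.\<close>
  define C where "C = max K0 (max 1 (4 * D / p))"
  have C: "C \<ge> K0" "C \<ge> 1" "C \<ge> 4 * D / p" by (auto simp: C_def)
  have DC: "D / C ^ 4 \<le> p / 4"
  proof -
    have "C \<le> C ^ 4" using C(2) self_le_power[of C 4] by simp
    then have "4 * D / p \<le> C ^ 4" using C(3) by linarith
    then have "4 * D \<le> C ^ 4 * p" using a(2) by (simp only: pos_divide_le_eq)
    then show ?thesis using C(2) by (simp add: pos_divide_le_eq mult.commute)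
  qed
  \<comment> \<open>The two entries are the conditions of \<open>ball_feedback\<close> that relate
    \<open>C\<close> to \<open>R\<close> and \<open>a\<close>; the bound \<open>c\<close> on
    \<open>sqrt h\<close> then provides those on \<open>G\<close>.\<close>
  define R where "R = max (4 * C) (4 * C\<^sup>2 / a)"
  have R: "R \<ge> 4 * C" "R \<ge> 4 * C\<^sup>2 / a" by (auto simp: R_def)
  then have Ra: "4 * C\<^sup>2 \<le> R * a" using a(1) by (simp only: pos_divide_le_eq)
  have Rp: "R > 0" using R(1) C(2) by linarith
  define c where "c = min (R / 4) (a / 8) / (G + 1)"
  have c: "c > 0" using Rp a G by (simp add: c_def)
  have cG: "G * q \<le> min (R / 4) (a / 8)" if "0 < q" "q \<le> c" for q
  proof -
    have "q * (G + 1) \<le> min (R / 4) (a / 8)" using that(2) G unfolding c_def by (subst (asm) pos_le_divide_eq) auto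
    then show ?thesis using that(1) by (simp only: distrib_left mult.commute[of q G] mult_1_right)
  qed
  define h0 where "h0 = min (min 1 (c\<^sup>2)) (min h1 h2)"
  have h0: "h0 > 0" using c a h2 by (simp add: h0_def)
  have "prob ({w\<in>space M. v + (L (t + h) w - L t w) - d \<in> cball 0 (R * sqrt h)} \<inter> sup_event t h \<eta>) > 0"
    if t: "0 \<le> t" and h: "0 < h" "h \<le> h0" and v: "norm v \<le> R * sqrt h" and d: "norm d \<le> G * h" for t h v d
  proof -
    define q where "q = sqrt h"
    have q: "q > 0" "h = q\<^sup>2" using h by (auto simp: q_def)
    have hh: "h \<le> 1" "h \<le> c\<^sup>2" "h \<le> h1" "h \<le> h2" using h by (auto simp: h0_def)
    have "q \<le> c" using real_sqrt_le_mono[OF hh(2)] c by (simp add: q_def)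
    then have Gq: "4 * (G * q) \<le> R" "8 * (G * q) \<le> a" using cG[OF q(1)] by auto
    \<comment> \<open>For \<open>v = 0\<close> any unit vector will do.\<close>
    define u where "u = (if v = 0 then axis undefined 1 else (1 / norm v) *\<^sub>R v)"
    have u: "norm u = 1" by (simp add: u_def)
    have vu: "v = norm v *\<^sub>R u" by (simp add: u_def)
    let ?D = "{w\<in>space M. u \<bullet> (L (t + h) w - L t w) \<le> - (a * sqrt h)}"
    let ?B = "{w\<in>space M. norm (L (t + h) w - L t w) > C * sqrt h}"
    let ?E = "{w\<in>space M. v + (L (t + h) w - L t w) - d \<in> cball 0 (R * sqrt h)}"
    have sub: "?D - ?B \<subseteq> ?E"
    proof
      fix w assume w: "w \<in> ?D - ?B"
      define l where "l = L (t + h) w - L t w"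
      have l: "norm l \<le> C * q" "u \<bullet> l \<le> - (a * q)" using w by (auto simp: l_def q_def)
      have "v \<bullet> l = norm v * (u \<bullet> l)" using arg_cong[OF vu, of "\<lambda>v. v \<bullet> l"] by simp
      also have "\<dots> \<le> norm v * (- (a * q))" by (intro mult_left_mono l) auto
      finally have "v \<bullet> l \<le> - (a * q * norm v)" by (simp add: mult_ac)
      then have "norm (v + l - d) \<le> R * q"
        using v d Gq q G C(2) R(1) Ra l by (intro ball_feedback[of v R q l C d G a]) (auto simp: q_def[symmetric])
      then show "w \<in> ?E" using w by (simp add: l_def q_def)
    qed
    have sup: "sup_event t h \<eta> \<in> events" using sup_event_events[OF t h(1)] .
    have "prob ?D \<le> prob ((?E \<inter> sup_event t h \<eta>) \<union> (?B \<union> (space M - sup_event t h \<eta>)))"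
      using sub sup by (intro finite_measure_mono) auto
    also have "\<dots> \<le> prob (?E \<inter> sup_event t h \<eta>) + prob (?B \<union> (space M - sup_event t h \<eta>))"
      using sup by (intro measure_Un_le) auto
    also have "prob (?B \<union> (space M - sup_event t h \<eta>)) \<le> prob ?B + prob (space M - sup_event t h \<eta>)"
      using sup by (intro measure_Un_le) auto
    finally have "prob ?D \<le> prob (?E \<inter> sup_event t h \<eta>) + (prob ?B + prob (space M - sup_event t h \<eta>))" by simp
    moreover have "prob ?D \<ge> p" by (rule down[OF h(1) hh(3) u])
    moreover have "prob ?B \<le> p / 4" using tail[OF h(1) hh(1) C(1), of t] DC by linarith
    moreover have "prob (space M - sup_event t h \<eta>) < p / 2"
      using prob_compl[OF sup] h2(2)[OF t h(1) hh(4)] by linarith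
    ultimately show ?thesis using a(2) by linarith
  qed
  then show thesis using that Rp h0 by blast
qed

lemma small_ball_gaussian: small_ball
  unfolding small_ball_def
proof (intro allI impI)
  fix t0 T :: real and g :: "real \<Rightarrow> real^'d" and \<delta> :: real and A
  assume t0: "0 \<le> t0" "t0 < T" and g: "continuous_on {t0..T} g" "g t0 = 0" and \<delta>: "0 < \<delta>"
    and A: "A \<in> sets (incr_filtration M L t0)" "0 < prob A"
  \<comment> \<open>One quarter each for the radius \<open>R * sqrt h\<close>, the fluctuation of
    \<open>L\<close>, that of \<open>g'\<close>, and the distance of \<open>g\<close> to
    \<open>g'\<close>.\<close>
  define \<eta> where "\<eta> = \<delta> / 4"
  have \<eta>: "\<eta> > 0" using \<delta> by (simp add: \<eta>_def)
  obtain G g' where g': "G \<ge> 0" "g' t0 = 0" "\<And>t. t \<in> {t0..T} \<Longrightarrow> norm (g t - g' t) \<le> \<eta>"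
    "\<And>s t. s \<in> {t0..T} \<Longrightarrow> t \<in> {t0..T} \<Longrightarrow> norm (g' s - g' t) \<le> G * \<bar>s - t\<bar>"
    by (rule continuous_on_Lipschitz_approx[OF g t0(2) \<eta>]) blast
  obtain R h0 where R: "R > 0" "h0 > 0" and step: "\<And>t h v d. 0 \<le> t \<Longrightarrow> 0 < h \<Longrightarrow> h \<le> h0 \<Longrightarrow> norm v \<le> R * sqrt h \<Longrightarrow> norm d \<le> G * h \<Longrightarrow>
    prob ({w\<in>space M. v + (L (t + h) w - L t w) - d \<in> cball 0 (R * sqrt h)} \<inter> sup_event t h \<eta>) > 0"
    by (rule gaussian_step[OF g'(1) \<eta>]) blast
  define hm where "hm = min h0 (min ((\<eta> / R)\<^sup>2) (\<eta> / (G + 1)))"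
  have hm: "hm > 0" using R \<eta> g'(1) by (simp add: hm_def)
  obtain N where N: "(T - t0) / hm < real N" using reals_Archimedean2 by blast
  have Npos: "real N > 0" using N divide_pos_pos[of "T - t0" hm] t0 hm by linarith
  define h where "h = (T - t0) / real N"
  have h: "h > 0" using t0 Npos by (simp add: h_def)
  have "T - t0 < real N * hm" using N hm by (simp only: pos_divide_less_eq)
  then have "h \<le> hm" unfolding h_def using Npos by (simp add: pos_divide_le_eq mult.commute)
  then have hh: "h \<le> h0" "h \<le> (\<eta> / R)\<^sup>2" "h \<le> \<eta> / (G + 1)" by (auto simp: hm_def)
  have "sqrt h \<le> \<eta> / R" using real_sqrt_le_mono[OF hh(2)] \<eta> R by simp
  then have Rh: "R * sqrt h \<le> \<eta>" using R by (simp add: pos_le_divide_eq mult.commute)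
  have "h * (G + 1) \<le> \<eta>" using hh(3) g'(1) by (simp add: pos_le_divide_eq)
  then have Gh: "G * h \<le> \<eta>" using h by (simp add: algebra_simps)
  have lip: "norm (g' s - g' t) \<le> G * h" if "s \<in> {t0..T}" "t \<in> {t0..T}" "\<bar>s - t\<bar> \<le> h" for s t
    using g'(4)[OF that(1,2)] mult_left_mono[OF that(3) g'(1)] by linarith
  have "\<exists>A'\<in>events. A' \<subseteq> A \<and> prob A' > 0 \<and>
    (\<forall>w\<in>A'. \<forall>t\<in>{t0..T}. norm (L t w - L t0 w - g' t) \<le> R * sqrt h + \<eta> + \<eta>)"
  proof (rule feedback_path[where K = "cball 0 (R * sqrt h)" and \<rho> = "R * sqrt h" and g = g' and \<eta> = \<eta> and \<epsilon> = \<eta>,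
        OF _ _ _ t0 _ h_def _ _ g'(2) A])
    show "N > 0" using Npos by simp
    fix k v assume k: "k < N" and v: "v \<in> cball (0::real^'d) (R * sqrt h)"
    define t where "t = t0 + real k * h"
    have tS: "t0 + real (Suc k) * h = t + h" by (simp add: t_def algebra_simps)
    have "real (Suc k) * h \<le> real N * h" using k h by (intro mult_right_mono) auto
    then have tT: "t + h \<le> T" using Npos tS by (simp add: h_def)
    have tt: "t0 \<le> t" "0 \<le> t" using h t0 by (auto simp: t_def)
    show "prob ({w\<in>space M. v + (L (t0 + real (Suc k) * h) w - L (t0 + real k * h) w) -
          (g' (t0 + real (Suc k) * h) - g' (t0 + real k * h)) \<in> cball 0 (R * sqrt h)} \<inter> sup_event (t0 + real k * h) h \<eta>) > 0"
      unfolding tS t_def[symmetric] using v tt tT h hh(1) by (intro step lip) auto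
  next
    fix s t assume "s \<in> {t0..T}" "t \<in> {t0..T}" "\<bar>s - t\<bar> \<le> h"
    then show "norm (g' s - g' t) \<le> \<eta>" using lip[of s t] Gh by linarith
  qed (use R h in auto)
  then obtain A' where A': "A' \<in> events" "A' \<subseteq> A" "prob A' > 0"
    and near: "\<And>w t. w \<in> A' \<Longrightarrow> t \<in> {t0..T} \<Longrightarrow> norm (L t w - L t0 w - g' t) \<le> R * sqrt h + \<eta> + \<eta>" by blast
  have "norm (L t w - L t0 w - g t) \<le> \<delta>" if "w \<in> A'" "t \<in> {t0..T}" for w t
  proof -
    have e: "L t w - L t0 w - g' t - (g t - g' t) = L t w - L t0 w - g t" by simp
    then show ?thesis
      using near[OF that] g'(3)[OF that(2)] Rh norm_triangle_ineq4[of "L t w - L t0 w - g' t" "g t - g' t"]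
      unfolding \<eta>_def e by linarith
  qed
  then show "\<exists>A'\<in>events. A' \<subseteq> A \<and> 0 < prob A' \<and> (\<forall>w\<in>A'. \<forall>t\<in>{t0..T}. norm (L t w - L t0 w - g t) \<le> \<delta>)"
    using A' by blast
qed

end

section \<open>Conditional small ball property\<close>

text \<open>The event where the conditional expectation is nonpositive belongs to \<open>F\<close>.
  If it had positive probability, so would its intersection with \<open>E\<close>, but that
  probability is the integral of the conditional expectation over it.\<close>

lemma (in prob_space) cond_exp_indicator_pos:
  assumes F: "subalgebra M F" and E: "E \<in> events"
    and pos: "\<And>G. G \<in> sets F \<Longrightarrow> prob G > 0 \<Longrightarrow> prob (G \<inter> E) > 0"
  shows "AE w in M. 0 < real_cond_exp M F (indicator E) w"
proof -
  interpret finite_measure_subalgebra M F using F by unfold_locales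
  define R where "R = real_cond_exp M F (indicator E)"
  have R [measurable]: "R \<in> borel_measurable F" by (simp add: R_def)
  have FM: "space F = space M" "sets F \<subseteq> events" using F by (auto simp: subalgebra_def)
  define G where "G = {w\<in>space F. R w \<le> 0}"
  have G: "G \<in> sets F" unfolding G_def by measurable
  then have GM: "G \<in> events" using FM by blast
  have iE: "integrable M (indicator E :: 'a \<Rightarrow> real)" using E by (auto intro!: integrable_real_indicator simp: less_top[symmetric])
  have "prob G = 0"
  proof (rule ccontr)
    assume "prob G \<noteq> 0"
    then have "prob (G \<inter> E) > 0" using measure_nonneg[of M G] by (intro pos G) linarith
    moreover have "prob (G \<inter> E) = (LINT w:G|M. indicator E w)"
      using GM E by (simp add: set_lebesgue_integral_def indicator_inter_arith[symmetric])
    moreover have "\<dots> = (LINT w:G|M. R w)" unfolding R_def by (rule real_cond_exp_intA[OF iE G])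
    moreover have "0 \<le> (LINT w|M. - (indicator G w *\<^sub>R R w))"
      by (rule Bochner_Integration.integral_nonneg) (auto simp: G_def indicator_def)
    then have "(LINT w:G|M. R w) \<le> 0" by (simp add: set_lebesgue_integral_def)
    ultimately show False by linarith
  qed
  then have "AE w in M. w \<notin> G" using GM by (intro AE_not_in) (simp add: null_sets_def emeasure_eq_measure)
  then show ?thesis unfolding R_def[symmetric] by (rule AE_mp) (intro AE_I2, auto simp: G_def FM)
qed

text \<open>Countably many balls cover the space. This confines the process at the conditioning time
  to a neighbourhood of a fixed \<open>y\<close>, so that a deterministic driving path can be aimed
  at.\<close>

lemma exists_likely_ball:
  fixes X :: "'w \<Rightarrow> 'b::{second_countable_topology, metric_space}"
  assumes M: "prob_space M" and X: "X \<in> borel_measurable F" and F: "space F = space M" "sets F \<subseteq> sets M"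
    and G: "G \<in> sets F" "measure M G > 0" and \<eta>: "\<eta> > 0"
  obtains y where "G \<inter> {w\<in>space M. dist (X w) y < \<eta>} \<in> sets F" "measure M (G \<inter> {w\<in>space M. dist (X w) y < \<eta>}) > 0"
proof -
  interpret prob_space M by fact
  have sF: "G \<inter> {w\<in>space M. dist (X w) y < \<eta>} \<in> sets F" for y
  proof -
    have "{w\<in>space F. dist (X w) y < \<eta>} \<in> sets F" using X by measurable
    then show ?thesis using G(1) by (auto simp: F(1))
  qed
  obtain D :: "'b set" where D: "countable D" "\<And>U. open U \<Longrightarrow> U \<noteq> {} \<Longrightarrow> \<exists>d\<in>D. d \<in> U"
    using countable_dense_exists by blast
  have "\<exists>y. measure M (G \<inter> {w\<in>space M. dist (X w) y < \<eta>}) > 0"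
  proof (rule ccontr)
    assume "\<not> ?thesis"
    then have "measure M (G \<inter> {w\<in>space M. dist (X w) y < \<eta>}) = 0" for y
      using measure_nonneg[of M] by (simp add: not_less order_antisym)
    then have "(\<Union>y\<in>D. G \<inter> {w\<in>space M. dist (X w) y < \<eta>}) \<in> null_sets M"
      using sF F(2) by (intro null_sets_UN' D(1)) (auto simp: null_sets_def emeasure_eq_measure)
    moreover have "G \<subseteq> (\<Union>y\<in>D. G \<inter> {w\<in>space M. dist (X w) y < \<eta>})"
    proof
      fix w assume w: "w \<in> G"
      obtain d where "d \<in> D" "d \<in> ball (X w) \<eta>" using D(2)[of "ball (X w) \<eta>"] \<eta> by auto
      then show "w \<in> (\<Union>y\<in>D. G \<inter> {w\<in>space M. dist (X w) y < \<eta>})"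
        using w sets.sets_into_space[OF G(1)] F(1) by auto
    qed
    ultimately have "G \<in> null_sets M" using G(1) F(2) by (blast intro: null_sets_subset)
    then show False using G(2) by (simp add: null_sets_def measure_def)
  qed
  then show thesis using that sF by blast
qed

lemma rational_right_sequence:
  obtains x :: "nat \<Rightarrow> real" where "\<And>n. x n \<in> \<rat>" "\<And>n. t < x n" "x \<longlonglongrightarrow> t"
proof -
  have "\<exists>x. \<forall>n. x n \<in> \<rat> \<and> t < x n \<and> x n < t + 1 / real (Suc n)"
    using Rats_dense_in_real[of t] by (intro choice allI) (metis less_add_same_cancel1 of_nat_0_less_iff zero_less_Suc zero_less_divide_1_iff)
  then obtain x where x: "\<And>n. x n \<in> \<rat>" "\<And>n. t < x n" "\<And>n. x n < t + 1 / real (Suc n)" by blast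
  have "(\<lambda>n. x n - t) \<longlonglongrightarrow> 0"
  proof (rule Lim_null_comparison[OF always_eventually LIMSEQ_Suc[OF lim_1_over_n]], intro allI)
    fix n show "norm (x n - t) \<le> 1 / real (Suc n)" using x(2,3)[of n] by simp
  qed
  then have "x \<longlonglongrightarrow> t" by (simp only: LIM_zero_iff)
  then show thesis using x that by blast
qed

section \<open>From the driving noise to the process\<close>

context stationary_noise begin

lemma ou_process_cadlag:
  assumes "cadlag_on {0..} l"
  shows "cadlag_on {0..} (\<lambda>t. mexp A t *v (y::real^'d) + ou_path A \<Sigma> 0 l t)"
proof -
  have "cadlag_on {0..} (\<lambda>t. ou_path A \<Sigma> 0 l t - (- (mexp A t *v y)))"
    by (intro cadlag_on_diff_continuous ou_path_cadlag assms continuous_intros continuous_on_matrix_vector_mult)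
  then show ?thesis by (simp add: add.commute)
qed

lemma cadlag_centred: "w \<in> space M \<Longrightarrow> cadlag_on {0..} (\<lambda>s. L s w - L 0 w)"
  by (intro cadlag_on_diff_continuous cadlag) (simp_all add: continuous_on_const)

text \<open>The relation holds almost surely at all rational times simultaneously, and both sides
  are cadlag in \<open>t\<close>; \<open>ou_path_cocycle\<close> then moves the starting point to
  \<open>t0\<close>.\<close>

lemma ou_indistinguishable:
  assumes Y: "\<And>w. w \<in> space M \<Longrightarrow> cadlag_on {0..} (\<lambda>t. Y t w)"
    and mod: "\<And>t. 0 \<le> t \<Longrightarrow> AE w in M. Y t w = mexp A t *v Y 0 w + ou_path A \<Sigma> 0 (\<lambda>s. L s w - L 0 w) t"
  shows "AE w in M. \<forall>t0\<ge>0. \<forall>t\<ge>t0. Y t w = mexp A (t - t0) *v Y t0 w + ou_path A \<Sigma> t0 (\<lambda>s. L s w - L t0 w) t"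
proof -
  have "AE w in M. \<forall>t\<in>\<rat>\<inter>{0..}. Y t w = mexp A t *v Y 0 w + ou_path A \<Sigma> 0 (\<lambda>s. L s w - L 0 w) t"
    using mod by (intro AE_ball_countable[THEN iffD2]) (auto intro: countable_subset[OF _ countable_rat])
  then show ?thesis
  proof (rule AE_mp, intro AE_I2 impI)
    fix w assume w: "w \<in> space M"
      and q: "\<forall>t\<in>\<rat>\<inter>{0..}. Y t w = mexp A t *v Y 0 w + ou_path A \<Sigma> 0 (\<lambda>s. L s w - L 0 w) t"
    let ?l = "\<lambda>s. L s w - L 0 w"
    have l: "cadlag_on {0..} ?l" by (rule cadlag_centred[OF w])
    have all: "Y t w = mexp A t *v Y 0 w + ou_path A \<Sigma> 0 ?l t" if t: "t \<ge> 0" for t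
    proof -
      obtain x where x: "\<And>n. x n \<in> \<rat>" "\<And>n. t < x n" "x \<longlonglongrightarrow> t" by (rule rational_right_sequence) blast
      have x0: "x n \<in> {0..}" "t \<le> x n" for n using x(2)[of n] t by auto
      have "(\<lambda>n. Y (x n) w) \<longlonglongrightarrow> Y t w"
        using t by (intro cadlag_on_right_sequence[OF Y[OF w] _ x0 x(3)]) simp
      moreover have "(\<lambda>n. mexp A (x n) *v Y 0 w + ou_path A \<Sigma> 0 ?l (x n)) \<longlonglongrightarrow> mexp A t *v Y 0 w + ou_path A \<Sigma> 0 ?l t"
        using t by (intro cadlag_on_right_sequence[OF ou_process_cadlag[OF l] _ x0 x(3)]) simp
      moreover have "Y (x n) w = mexp A (x n) *v Y 0 w + ou_path A \<Sigma> 0 ?l (x n)" for n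
        using q x(1)[of n] x0(1)[of n] by blast
      ultimately show ?thesis by (simp only: LIMSEQ_unique)
    qed
    show "\<forall>t0\<ge>0. \<forall>t\<ge>t0. Y t w = mexp A (t - t0) *v Y t0 w + ou_path A \<Sigma> t0 (\<lambda>s. L s w - L t0 w) t"
    proof (intro allI impI)
      fix t0 t :: real assume t: "0 \<le> t0" "t0 \<le> t"
      have "ou_path A \<Sigma> 0 ?l t = mexp A (t - t0) *v ou_path A \<Sigma> 0 ?l t0 + ou_path A \<Sigma> t0 (\<lambda>s. ?l s - ?l t0) t"
        by (rule ou_path_cocycle[OF t cadlag_on_subset[OF l]]) auto
      moreover have "mexp A t = mexp A (t - t0) ** mexp A t0" using mexp_add[of A "t - t0" t0] by simp
      moreover have "0 \<le> t" using t by linarith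
      ultimately show "Y t w = mexp A (t - t0) *v Y t0 w + ou_path A \<Sigma> t0 (\<lambda>s. L s w - L t0 w) t"
        using all[of t] all[OF t(1)] by (simp add: matrix_vector_mul_assoc matrix_vector_right_distrib)
    qed
  qed
qed

text \<open>On a past event where the process is near \<open>y\<close> at \<open>t0\<close>, the
  noise is steered along the path from \<open>ou_path_target\<close>. The error splits into the
  effect of the initial value and that of the deviation of the noise.\<close>

lemma CSBP_of_small_ball:
  fixes Y :: "real \<Rightarrow> 'w \<Rightarrow> real^'d" and A \<Sigma> :: "real^'d^'d"
  assumes sb: small_ball and det: "det \<Sigma> \<noteq> 0"
    and Y: "\<And>w. w \<in> space M \<Longrightarrow> cadlag_on {0..} (\<lambda>t. Y t w)"
    and adapted: "adapted_on {0..} (incr_filtration M L) Y"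
    and mod: "\<And>t. 0 \<le> t \<Longrightarrow> AE w in M. Y t w = mexp A t *v Y 0 w + ou_path A \<Sigma> 0 (\<lambda>s. L s w - L 0 w) t"
  shows "CSBP M (incr_filtration M L) T Y"
  unfolding CSBP_def
proof (intro conjI allI impI ballI)
  show "cadlag_on {0..T} (\<lambda>t. Y t w)" if "w \<in> space M" for w
    by (rule cadlag_on_subset[OF Y[OF that]]) auto
  show "adapted_on {0..T} (incr_filtration M L) Y" using adapted by (auto simp: adapted_on_def)
  fix t0 :: real and f :: "real \<Rightarrow> real^'d" and \<epsilon> :: real
  assume "0 \<le> t0 \<and> t0 < T \<and> continuous_on {t0..T} f \<and> f t0 = 0 \<and> 0 < \<epsilon>"
  then have t0: "0 \<le> t0" "t0 < T" and f: "continuous_on {t0..T} f" "f t0 = 0" and \<epsilon>: "0 < \<epsilon>" by auto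
  have Ym: "Y t \<in> borel_measurable (incr_filtration M L t)" if "0 \<le> t" for t
    using adapted that by (auto simp: adapted_on_def)
  have YM [measurable]: "Y t \<in> borel_measurable M" if "0 \<le> t" for t
    by (rule measurable_from_subalg[OF subalgebra_incr_filtration[OF L_measurable] Ym[OF that]])
  define p where "p t w = Y t w - Y t0 w - f t" for t w
  have pc: "cadlag_on {t0..T} (\<lambda>t. p t w)" if "w \<in> space M" for w
    unfolding p_def
    by (intro cadlag_on_diff_continuous f(1) cadlag_on_subset[OF Y[OF that]]) (use t0 in \<open>auto simp: continuous_on_const\<close>)
  define E where "E = {w\<in>space M. (SUP t\<in>{t0..T}. norm (p t w)) < \<epsilon>}"
  \<comment> \<open>Countably many times decide the supremum, which makes the event measurable;
    \<open>T\<close> is included since nothing lies to its right.\<close>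
  define D where "D = insert T (\<rat> \<inter> {t0..T})"
  have D: "countable D" "D \<subseteq> {t0..T}" "T \<in> D"
    using t0 by (auto simp: D_def intro: countable_subset[OF _ countable_rat])
  have Dd: "\<exists>d\<in>D. s < d \<and> d < t" if "t0 \<le> s" "s < t" "t \<le> T" for s t
    using Rats_dense_in_real[OF that(2)] that by (force simp: D_def)
  have sup_le: "(SUP t\<in>{t0..T}. norm (p t w)) \<le> c" if "\<And>t. t \<in> {t0..T} \<Longrightarrow> norm (p t w) \<le> c" for w c
    using t0 that by (intro cSUP_least) auto
  \<comment> \<open>The strict bound on the supremum is a union of closed conditions, each of which
    passes from \<open>D\<close> to all times.\<close>
  have "E = (\<Union>n. {w\<in>space M. \<forall>d\<in>D. norm (p d w) \<le> \<epsilon> - 1 / real (Suc n)})"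
  proof (intro equalityI subsetI)
    fix w assume "w \<in> E"
    then have w: "w \<in> space M" and lt: "(SUP t\<in>{t0..T}. norm (p t w)) < \<epsilon>" by (auto simp: E_def)
    obtain n where n: "1 / real (Suc n) < \<epsilon> - (SUP t\<in>{t0..T}. norm (p t w))"
      using reals_Archimedean[of "\<epsilon> - (SUP t\<in>{t0..T}. norm (p t w))"] lt by (auto simp: inverse_eq_divide)
    have "bdd_above ((\<lambda>t. norm (p t w)) ` {t0..T})"
      using cadlag_on_bounded[OF pc[OF w]] unfolding bounded_iff bdd_above_def by auto
    then have "norm (p d w) \<le> (SUP t\<in>{t0..T}. norm (p t w))" if "d \<in> D" for d
      using that D(2) by (intro cSUP_upper) auto
    then have "\<forall>d\<in>D. norm (p d w) \<le> \<epsilon> - 1 / real (Suc n)" using n by (fastforce simp del: of_nat_Suc)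
    then show "w \<in> (\<Union>n. {w\<in>space M. \<forall>d\<in>D. norm (p d w) \<le> \<epsilon> - 1 / real (Suc n)})" using w by blast
  next
    fix w assume "w \<in> (\<Union>n. {w\<in>space M. \<forall>d\<in>D. norm (p d w) \<le> \<epsilon> - 1 / real (Suc n)})"
    then obtain n where w: "w \<in> space M" and n: "\<And>d. d \<in> D \<Longrightarrow> p d w \<in> cball 0 (\<epsilon> - 1 / real (Suc n))" by auto
    have "p t w \<in> cball 0 (\<epsilon> - 1 / real (Suc n))" if "t \<in> {t0..T}" for t
      by (rule cadlag_on_dense_closed[OF pc[OF w] closed_cball D(2,3) Dd n that])
    then have "(SUP t\<in>{t0..T}. norm (p t w)) \<le> \<epsilon> - 1 / real (Suc n)" by (intro sup_le) auto
    moreover have "1 / real (Suc n) > 0" by simp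
    ultimately have "(SUP t\<in>{t0..T}. norm (p t w)) < \<epsilon>" by linarith
    then show "w \<in> E" using w by (simp add: E_def)
  qed
  also have "\<dots> \<in> events"
  proof (intro sets.countable_UN image_subsetI sets.sets_Collect_countable_All' D(1))
    fix n d assume "d \<in> D"
    then have "0 \<le> d" using D(2) t0 by auto
    then show "{w\<in>space M. norm (p d w) \<le> \<epsilon> - 1 / real (Suc n)} \<in> events"
      unfolding p_def using t0 by measurable
  qed
  finally have E: "E \<in> events" .
  have "AE w in M. 0 < real_cond_exp M (incr_filtration M L t0) (indicator E) w"
  proof (rule cond_exp_indicator_pos[OF subalgebra_incr_filtration[OF L_measurable] E])
    fix G assume G: "G \<in> sets (incr_filtration M L t0)" "prob G > 0"
    obtain C where C: "C > 0" "\<And>l t \<delta>. t \<in> {t0..T} \<Longrightarrow> cadlag_on {t0..t} l \<Longrightarrow> (\<And>s. s \<in> {t0..t} \<Longrightarrow> norm (l s) \<le> \<delta>) \<Longrightarrow>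
      norm (ou_path A \<Sigma> t0 l t) \<le> C * \<delta>" by (rule ou_path_bound[of t0 T A \<Sigma>]) (use t0 in \<open>simp, blast\<close>)
    have "bounded ((\<lambda>t. mexp A (t - t0) - mat 1) ` {t0..T})"
      by (intro compact_imp_bounded compact_continuous_image continuous_intros) auto
    then obtain K' where "\<forall>x\<in>(\<lambda>t. mexp A (t - t0) - mat 1) ` {t0..T}. norm x \<le> K'" unfolding bounded_iff by blast
    then have K': "norm (mexp A (t - t0) - mat 1) \<le> K'" if "t \<in> {t0..T}" for t using that by blast
    \<comment> \<open>The maximum with \<open>1\<close> allows division by \<open>K\<close>.\<close>
    define K where "K = max K' 1"
    have K: "K > 0" "\<And>t. t \<in> {t0..T} \<Longrightarrow> norm (mexp A (t - t0) - mat 1) \<le> K"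
      using K' by (auto simp: K_def le_max_iff_disj)
    \<comment> \<open>Each of the two errors contributes \<open>\<epsilon> / 4\<close>; the total
      \<open>\<epsilon> / 2\<close> leaves room for the strict inequality.\<close>
    define \<eta> \<delta> where "\<eta> = \<epsilon> / 4 / K" and "\<delta> = \<epsilon> / 4 / C"
    have \<eta>\<delta>: "\<eta> > 0" "\<delta> > 0" "K * \<eta> = \<epsilon> / 4" "C * \<delta> = \<epsilon> / 4" using \<epsilon> K C by (auto simp: \<eta>_def \<delta>_def)
    obtain y where y: "G \<inter> {w\<in>space M. dist (Y t0 w) y < \<eta>} \<in> sets (incr_filtration M L t0)"
      "prob (G \<inter> {w\<in>space M. dist (Y t0 w) y < \<eta>}) > 0"
      by (rule exists_likely_ball[OF prob_space_axioms Ym[OF t0(1)] _ sets_incr_filtration_events G \<eta>\<delta>(1)]) simp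
    obtain g where g: "continuous_on {t0..T} g" "g t0 = 0"
      "\<And>t. t \<in> {t0..T} \<Longrightarrow> mexp A (t - t0) *v y - y + ou_path A \<Sigma> t0 g t = f t"
      by (rule ou_path_target[OF det less_imp_le[OF t0(2)] f]) blast
    from sb[unfolded small_ball_def, rule_format, OF t0 g(1,2) \<eta>\<delta>(2) y]
    obtain A' where A': "A' \<in> events" "A' \<subseteq> G \<inter> {w\<in>space M. dist (Y t0 w) y < \<eta>}" "prob A' > 0"
      and near: "\<And>w t. w \<in> A' \<Longrightarrow> t \<in> {t0..T} \<Longrightarrow> norm (L t w - L t0 w - g t) \<le> \<delta>" by blast
    have "AE w in M. \<forall>t0\<ge>0. \<forall>t\<ge>t0. Y t w = mexp A (t - t0) *v Y t0 w + ou_path A \<Sigma> t0 (\<lambda>s. L s w - L t0 w) t"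
      by (rule ou_indistinguishable[OF Y mod])
    then have "AE w in M. w \<in> A' \<longrightarrow> w \<in> G \<inter> E"
    proof (rule AE_mp, intro AE_I2 impI)
      fix w assume w: "w \<in> space M" "w \<in> A'"
        and rec: "\<forall>t0\<ge>0. \<forall>t\<ge>t0. Y t w = mexp A (t - t0) *v Y t0 w + ou_path A \<Sigma> t0 (\<lambda>s. L s w - L t0 w) t"
      have yy: "norm (Y t0 w - y) \<le> \<eta>" using A'(2) w(2) by (auto simp: dist_norm)
      have "norm (p t w) \<le> \<epsilon> / 2" if t: "t \<in> {t0..T}" for t
      proof -
        have l: "cadlag_on {t0..t} (\<lambda>s. L s w - L t0 w)"
          by (intro cadlag_on_diff_continuous cadlag_on_subset[OF cadlag[OF w(1)]]) (use t0 in \<open>auto simp: continuous_on_const\<close>)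
        have gt: "continuous_on {t0..t} g" by (rule continuous_on_subset[OF g(1)]) (use t in auto)
        have "t0 \<le> t" using t by simp
        note r = rec[rule_format, OF t0(1) this]
        have "p t w = (mexp A (t - t0) *v Y t0 w + ou_path A \<Sigma> t0 (\<lambda>s. L s w - L t0 w) t) - Y t0 w
            - (mexp A (t - t0) *v y - y + ou_path A \<Sigma> t0 g t)"
          by (simp only: p_def g(3)[OF t] r)
        also have "\<dots> = (mexp A (t - t0) - mat 1) *v (Y t0 w - y) + ou_path A \<Sigma> t0 (\<lambda>s. L s w - L t0 w - g s) t"
          unfolding ou_path_diff[OF l continuous_on_imp_cadlag_on[OF gt]]
          by (simp add: matrix_vector_mult_diff_rdistrib matrix_vector_mult_diff_distrib)
        finally have "norm (p t w) \<le> norm ((mexp A (t - t0) - mat 1) *v (Y t0 w - y)) + norm (ou_path A \<Sigma> t0 (\<lambda>s. L s w - L t0 w - g s) t)"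
          by (simp only: norm_triangle_ineq)
        also have "norm (ou_path A \<Sigma> t0 (\<lambda>s. L s w - L t0 w - g s) t) \<le> C * \<delta>"
          using near[OF w(2)] t by (intro C(2) cadlag_on_diff_continuous l gt) auto
        also have "norm ((mexp A (t - t0) - mat 1) *v (Y t0 w - y)) \<le> K * \<eta>"
          by (rule order_trans[OF norm_matrix_vector_mult_le]) (intro mult_mono K(2) t yy, use K in auto)
        finally show ?thesis using \<eta>\<delta> by simp
      qed
      then have "(SUP t\<in>{t0..T}. norm (p t w)) \<le> \<epsilon> / 2" by (rule sup_le)
      then show "w \<in> G \<inter> E" using w A'(2) \<epsilon> by (auto simp: E_def)
    qed
    then have "prob A' \<le> prob (G \<inter> E)"
      using E G(1) sets_incr_filtration_events by (intro finite_measure_mono_AE) auto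
    then show "prob (G \<inter> E) > 0" using A'(3) by linarith
  qed
  then show "AE w in M. 0 < real_cond_exp M (incr_filtration M L t0)
      (indicator {w \<in> space M. (SUP t\<in>{t0..T}. norm (Y t w - Y t0 w - f t)) < \<epsilon>}) w"
    by (simp add: E_def p_def)
qed

end

section \<open>Adapted representatives\<close>

lemma continuous_on_atLeast_0:
  fixes f :: "real \<Rightarrow> 'a::topological_space"
  assumes "\<And>m. 0 \<le> m \<Longrightarrow> continuous_on {0..m} f"
  shows "continuous_on {0..} f"
  unfolding continuous_on_def
proof
  fix t :: real assume t: "t \<in> {0..}"
  then have "(f \<longlongrightarrow> f t) (at t within {0..t + 1})" using assms[of "t + 1"] by (simp add: continuous_on_def)
  moreover have "at t within {0..t + 1} = at t within {0..}" by (rule at_within_nhd[of _ "{..<t + 1}"]) auto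
  ultimately show "(f \<longlongrightarrow> f t) (at t within {0..})" by simp
qed

lemma right_dense_sequence:
  assumes u: "u \<in> {0..s}"
  obtains x :: "nat \<Rightarrow> real" where "\<And>n. x n \<in> insert s (\<rat> \<inter> {0..s})" "\<And>n. u \<le> x n" "x \<longlonglongrightarrow> u"
proof (cases "u = s")
  case True
  then show thesis using that[of "\<lambda>_. s"] by simp
next
  case False
  obtain x where x: "\<And>n::nat. x n \<in> \<rat>" "\<And>n. u < x n" "x \<longlonglongrightarrow> u" by (rule rational_right_sequence) blast
  have "\<forall>\<^sub>F n in sequentially. x n < s" using order_tendstoD(2)[OF x(3)] u False by auto
  then obtain N where N: "\<And>n. n \<ge> N \<Longrightarrow> x n < s" unfolding eventually_sequentially by blast
  show thesis
  proof (rule that)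
    fix n
    show "x (n + N) \<in> insert s (\<rat> \<inter> {0..s})" using x(1)[of "n + N"] x(2)[of "n + N"] N[of "n + N"] u by auto
    show "u \<le> x (n + N)" using x(2)[of "n + N"] by simp
    show "(\<lambda>n. x (n + N)) \<longlonglongrightarrow> u" using x(3) by (rule LIMSEQ_ignore_initial_segment)
  qed
qed

text \<open>On a compact interval continuity is uniform continuity, and for a cadlag path the latter
  can be tested at rational times and the right end point. Thus continuity becomes a countable
  condition on increments.\<close>

lemma cadlag_continuous_on_iff:
  fixes l :: "real \<Rightarrow> 'a::real_normed_vector"
  assumes l: "cadlag_on {0..s} l"
  defines "D \<equiv> insert s (\<rat> \<inter> {0..s})"
  assumes s: "0 \<le> s"
  shows "continuous_on {0..s} l \<longleftrightarrow>
    (\<forall>m. \<exists>k. \<forall>u\<in>D. \<forall>v\<in>D. \<bar>u - v\<bar> < 1 / real (Suc k) \<longrightarrow> norm (l u - l v) \<le> 1 / real (Suc m))"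
proof (intro iffI allI)
  fix m assume "continuous_on {0..s} l"
  then have "uniformly_continuous_on {0..s} l" by (rule compact_uniformly_continuous) simp
  moreover have "1 / real (Suc m) > 0" by simp
  ultimately obtain d where d: "d > 0" "\<forall>u\<in>{0..s}. \<forall>v\<in>{0..s}. dist v u < d \<longrightarrow> dist (l v) (l u) < 1 / real (Suc m)"
    unfolding uniformly_continuous_on_def by blast
  obtain k where k: "1 / real (Suc k) < d" using reals_Archimedean[OF d(1)] by (auto simp: inverse_eq_divide)
  have "norm (l u - l v) \<le> 1 / real (Suc m)" if "u \<in> D" "v \<in> D" "\<bar>u - v\<bar> < 1 / real (Suc k)" for u v
  proof -
    have "u \<in> {0..s}" "v \<in> {0..s}" using that s by (auto simp: D_def)
    moreover have "dist u v < d" using that(3) k by (simp only: dist_real_def less_trans)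
    ultimately show ?thesis using d(2) by (fastforce simp: dist_norm simp del: of_nat_Suc)
  qed
  then show "\<exists>k. \<forall>u\<in>D. \<forall>v\<in>D. \<bar>u - v\<bar> < 1 / real (Suc k) \<longrightarrow> norm (l u - l v) \<le> 1 / real (Suc m)" by blast
next
  assume unif: "\<forall>m. \<exists>k. \<forall>u\<in>D. \<forall>v\<in>D. \<bar>u - v\<bar> < 1 / real (Suc k) \<longrightarrow> norm (l u - l v) \<le> 1 / real (Suc m)"
  have "uniformly_continuous_on {0..s} l"
    unfolding uniformly_continuous_on_def
  proof (intro allI impI)
    fix e :: real assume e: "0 < e"
    obtain m where m: "1 / real (Suc m) < e" using reals_Archimedean[OF e] by (auto simp: inverse_eq_divide)
    obtain k where k: "\<And>u v. u \<in> D \<Longrightarrow> v \<in> D \<Longrightarrow> \<bar>u - v\<bar> < 1 / real (Suc k) \<Longrightarrow> norm (l u - l v) \<le> 1 / real (Suc m)"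
      using unif by meson
    show "\<exists>d>0. \<forall>u\<in>{0..s}. \<forall>v\<in>{0..s}. dist v u < d \<longrightarrow> dist (l v) (l u) < e"
    proof (intro exI[of _ "1 / real (Suc k)"] conjI ballI impI)
      fix u v assume uv: "u \<in> {0..s}" "v \<in> {0..s}" "dist v u < 1 / real (Suc k)"
      obtain x where x: "\<And>n::nat. x n \<in> D" "\<And>n. u \<le> x n" "x \<longlonglongrightarrow> u"
        unfolding D_def by (rule right_dense_sequence[OF uv(1)]) blast
      obtain y where y: "\<And>n::nat. y n \<in> D" "\<And>n. v \<le> y n" "y \<longlonglongrightarrow> v"
        unfolding D_def by (rule right_dense_sequence[OF uv(2)]) blast
      have D: "d \<in> {0..s}" if "d \<in> D" for d using that s by (auto simp: D_def)
      have "(\<lambda>n. norm (l (y n) - l (x n))) \<longlonglongrightarrow> norm (l v - l u)"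
        by (intro tendsto_intros cadlag_on_right_sequence[OF l uv(1) D x(2,3)] cadlag_on_right_sequence[OF l uv(2) D y(2,3)] x y)
      moreover have "(\<lambda>n. \<bar>y n - x n\<bar>) \<longlonglongrightarrow> \<bar>v - u\<bar>" by (intro tendsto_intros x y)
      then have "\<forall>\<^sub>F n in sequentially. \<bar>y n - x n\<bar> < 1 / real (Suc k)"
        using uv(3) unfolding dist_real_def by (rule order_tendstoD(2))
      then have "\<forall>\<^sub>F n in sequentially. norm (l (y n) - l (x n)) \<le> 1 / real (Suc m)"
        by eventually_elim (intro k x y)
      ultimately have "norm (l v - l u) \<le> 1 / real (Suc m)" by (rule tendsto_upperbound) simp
      then show "dist (l v) (l u) < e" using m unfolding dist_norm by linarith
    qed simp
  qed
  then show "continuous_on {0..s} l" by (rule uniformly_continuous_imp_continuous)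
qed

text \<open>The index of the last of the points \<open>k t / N\<close> up to which \<open>l\<close> is continuous. It depends on \<open>l\<close> on \<open>{0..t}\<close> only,
  so that stopping the path there keeps it adapted.\<close>

definition last_good :: "(real \<Rightarrow> 'a::topological_space) \<Rightarrow> real \<Rightarrow> nat \<Rightarrow> nat" where
  "last_good l t N = card {k \<in> {1..N}. continuous_on {0..real k * t / real N} l}"

text \<open>From the time at which continuity is lost, the value is frozen at the left limit there,
  or at the initial value if that time is zero; see \<open>stopped_path\<close>.\<close>

definition stop_path :: "(real \<Rightarrow> 'a::real_normed_vector) \<Rightarrow> real \<Rightarrow> 'a" where
  "stop_path l t = lim (\<lambda>n. l (real (last_good l t (Suc n)) * t / real (Suc n)))"

text \<open>Continuity up to a time is inherited by earlier times, so the indices counted form an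
  initial segment and their number is the largest of them.\<close>

lemma last_good:
  assumes t: "0 \<le> t"
  shows "last_good l t N \<le> N" "continuous_on {0..real (last_good l t N) * t / real N} l"
    "last_good l t N < N \<Longrightarrow> \<not> continuous_on {0..real (Suc (last_good l t N)) * t / real N} l"
proof -
  define S where "S = {k \<in> {1..N}. continuous_on {0..real k * t / real N} l}"
  have down: "j \<in> S" if "k \<in> S" "1 \<le> j" "j \<le> k" for j k
  proof -
    have "real j * t / real N \<le> real k * t / real N" using that t by (intro divide_right_mono mult_right_mono) auto
    then have "{0..real j * t / real N} \<subseteq> {0..real k * t / real N}" by auto
    then show ?thesis using that by (auto simp: S_def intro: continuous_on_subset)
  qed
  have "S = {1..card S}"
  proof (cases "S = {}")
    case False
    have fin: "finite S" by (simp add: S_def)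
    have "S = {1..Max S}"
    proof (intro equalityI subsetI)
      fix k assume "k \<in> S"
      then show "k \<in> {1..Max S}" using fin by (auto simp: S_def)
    next
      fix k assume "k \<in> {1..Max S}"
      then show "k \<in> S" using down[OF Max_in[OF fin False], of k] by auto
    qed
    then show ?thesis by (metis card_atLeastAtMost diff_Suc_1 Suc_eq_plus1)
  qed simp
  then have S: "k \<in> S \<longleftrightarrow> 1 \<le> k \<and> k \<le> last_good l t N" for k
    unfolding last_good_def S_def[symmetric] by (metis atLeastAtMost_iff)
  have "card S \<le> card {1..N}" by (intro card_mono) (auto simp: S_def)
  then show le: "last_good l t N \<le> N" by (simp add: last_good_def S_def)
  show "continuous_on {0..real (last_good l t N) * t / real N} l"
  proof (cases "last_good l t N = 0")
    case False
    then have "last_good l t N \<in> S" using S by simp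
    then show ?thesis by (simp add: S_def)
  qed simp
  show "\<not> continuous_on {0..real (Suc (last_good l t N)) * t / real N} l" if "last_good l t N < N"
    using S[of "Suc (last_good l t N)"] that by (auto simp: S_def simp del: of_nat_Suc)
qed

text \<open>\<tau> is the supremum of the times up to which \<open>l\<close> is continuous. The grid
  points stay where \<open>l\<close> is still continuous and are within one mesh of
  \<open>min t \<tau>\<close>, so the values of \<open>l\<close> there converge.\<close>

lemma stopped_path:
  fixes l :: "real \<Rightarrow> 'a::real_normed_vector"
  assumes l: "cadlag_on {0..} l"
  obtains c where "continuous_on {0..} c" "\<And>s. 0 \<le> s \<Longrightarrow> continuous_on {0..s} l \<Longrightarrow> c s = l s"
    "\<And>t. 0 \<le> t \<Longrightarrow> (\<lambda>n. l (real (last_good l t (Suc n)) * t / real (Suc n))) \<longlonglongrightarrow> c t"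
proof (cases "\<forall>s\<ge>0. continuous_on {0..s} l")
  case True
  show thesis
  proof (rule that[of l])
    show "continuous_on {0..} l" using True by (intro continuous_on_atLeast_0) auto
    fix t :: real assume t: "0 \<le> t"
    have "last_good l t (Suc n) = Suc n" for n
      using True t last_good(1)[OF t, of l "Suc n"] last_good(3)[OF t, of l "Suc n"]
      by (metis divide_nonneg_nonneg le_neq_implies_less mult_nonneg_nonneg of_nat_0_le_iff)
    then show "(\<lambda>n. l (real (last_good l t (Suc n)) * t / real (Suc n))) \<longlonglongrightarrow> l t" by simp
  qed auto
next
  case False
  define good where "good s \<longleftrightarrow> 0 \<le> s \<and> continuous_on {0..s} l" for s
  obtain b where b: "b \<ge> 0" "\<not> good b" using False by (auto simp: good_def)
  have down: "good r" if "good s" "0 \<le> r" "r \<le> s" for r s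
    using that by (auto simp: good_def intro: continuous_on_subset)
  have good0: "good 0" by (simp add: good_def)
  have bdd: "bdd_above {s. good s}" using b down by (intro bdd_aboveI[of _ b]) (metis linear mem_Collect_eq)
  define \<tau> where "\<tau> = Sup {s. good s}"
  have le\<tau>: "s \<le> \<tau>" if "good s" for s unfolding \<tau>_def using that bdd by (intro cSup_upper) auto
  have below: "good s" if "0 \<le> s" "s < \<tau>" for s
  proof -
    have "\<exists>r\<in>{s. good s}. s < r"
      using that(2) good0 bdd unfolding \<tau>_def by (subst less_cSup_iff[symmetric]) auto
    then show ?thesis using down that(1) by auto
  qed
  have \<tau>0: "0 \<le> \<tau>" by (rule le\<tau>[OF good0])
  \<comment> \<open>At \<tau> the left limit is taken in place of \<open>l \<tau>\<close>, where
    \<open>l\<close> may have jumped; for \<open>\<tau> = 0\<close> no left limit exists within the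
    time set.\<close>
  define e where "e s = (if s < \<tau> then l s else if \<tau> = 0 then l 0 else Lim (at_left \<tau>) l)" for s
  define c where "c s = e (min s \<tau>)" for s
  have left: "(l \<longlongrightarrow> Lim (at_left \<tau>) l) (at_left \<tau>)" if "\<tau> > 0" by (rule cadlag_left_limit[OF l that])
  have "continuous_on {0..\<tau>} e"
  proof (cases "\<tau> = 0")
    case False
    then have \<tau>: "0 < \<tau>" using \<tau>0 by simp
    show ?thesis
    proof (rule continuous_on_IccI[OF _ _ _ \<tau>])
      have "(l \<longlongrightarrow> l 0) (at 0 within ({0..} \<inter> {0<..}))" using l by (auto simp: cadlag_on_def)
      moreover have "{0..} \<inter> {0<..} = {0::real<..}" by auto
      ultimately have "(l \<longlongrightarrow> l 0) (at_right 0)" by simp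
      moreover have "\<forall>\<^sub>F s in at_right 0. l s = e s"
        unfolding eventually_at_right[OF \<tau>] using \<tau> by (intro exI[of _ \<tau>]) (auto simp: e_def)
      moreover have "e 0 = l 0" using \<tau> by (simp add: e_def)
      ultimately show "(e \<longlongrightarrow> e 0) (at_right 0)" by (simp only: Lim_transform_eventually)
      have "\<forall>\<^sub>F s in at_left \<tau>. l s = e s"
        unfolding eventually_at_left[OF \<tau>] using \<tau> by (intro exI[of _ 0]) (auto simp: e_def)
      moreover have "e \<tau> = Lim (at_left \<tau>) l" using \<tau> by (simp add: e_def)
      ultimately show "(e \<longlongrightarrow> e \<tau>) (at_left \<tau>)" using left[OF \<tau>] by (simp only: Lim_transform_eventually)
      fix x assume x: "0 < x" "x < \<tau>"
      define m where "m = (x + \<tau>) / 2"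
      have m: "x < m" "m < \<tau>" using x by (auto simp: m_def)
      have "continuous_on {0..m} l" using below[of m] m x by (simp add: good_def)
      then have "isCont l x" by (rule continuous_on_interior) (use m x in simp)
      then have "(l \<longlongrightarrow> l x) (at x)" by (simp add: isCont_def)
      moreover have "\<forall>\<^sub>F s in at x. l s = e s"
        using x(2) unfolding eventually_at by (intro exI[of _ "\<tau> - x"]) (auto simp: e_def dist_real_def)
      moreover have "e x = l x" using x by (simp add: e_def)
      ultimately show "(e \<longlongrightarrow> e x) (at x)" by (simp only: Lim_transform_eventually)
    qed
  qed simp
  then have c: "continuous_on {0..} c"
    unfolding c_def by (rule continuous_on_compose2) (use \<tau>0 in \<open>auto intro!: continuous_intros\<close>)
  have cl: "c s = l s" if "good s" for s
  proof (cases "s < \<tau>")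
    case True then show ?thesis by (simp add: c_def e_def)
  next
    case False
    then have s: "s = \<tau>" using le\<tau>[OF that] by simp
    show ?thesis
    proof (cases "\<tau> = 0")
      case False
      then have \<tau>: "0 < \<tau>" using \<tau>0 by simp
      have "(l \<longlongrightarrow> l \<tau>) (at \<tau> within {0..\<tau>})" using that s \<tau> by (simp add: good_def continuous_on_def)
      then have "(l \<longlongrightarrow> l \<tau>) (at_left \<tau>)" using \<tau> by (simp add: at_within_Icc_at_left)
      then have "Lim (at_left \<tau>) l = l \<tau>" by (intro tendsto_unique[OF _ left[OF \<tau>]]) simp_all
      then show ?thesis using False s by (simp add: c_def e_def)
    qed (simp add: c_def e_def s)
  qed
  show thesis
  proof (rule that[OF c])
    show "c s = l s" if "0 \<le> s" "continuous_on {0..s} l" for s using cl that by (simp add: good_def)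
    fix t :: real assume t: "0 \<le> t"
    define \<rho> where "\<rho> n = real (last_good l t (Suc n)) * t / real (Suc n)" for n
    have \<rho>0: "0 \<le> \<rho> n" for n using t by (simp add: \<rho>_def)
    have g: "good (\<rho> n)" for n using last_good(2)[OF t] \<rho>0[of n] by (simp add: good_def \<rho>_def del: of_nat_Suc)
    have "norm (\<rho> n - min t \<tau>) \<le> t / real (Suc n)" for n
    proof (cases "last_good l t (Suc n) = Suc n")
      case True
      then have "\<rho> n = t" by (simp add: \<rho>_def)
      then show ?thesis using le\<tau>[OF g[of n]] t by simp
    next
      case False
      then have lt: "last_good l t (Suc n) < Suc n" using last_good(1)[OF t, of l "Suc n"] by simp
      have e: "real (Suc (last_good l t (Suc n))) * t / real (Suc n) = \<rho> n + t / real (Suc n)"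
        by (simp add: \<rho>_def add_divide_distrib[symmetric] distrib_right add.commute)
      have "\<not> good (\<rho> n + t / real (Suc n))"
        using last_good(3)[OF t lt] unfolding e by (simp add: good_def)
      moreover have "0 \<le> \<rho> n + t / real (Suc n)" using \<rho>0[of n] t by simp
      ultimately have "\<tau> \<le> \<rho> n + t / real (Suc n)" using below by (meson not_le)
      moreover have "real (last_good l t (Suc n)) * t / real (Suc n) \<le> real (Suc n) * t / real (Suc n)"
        using lt t by (intro divide_right_mono mult_right_mono) auto
      then have "\<rho> n \<le> t" by (simp add: \<rho>_def)
      ultimately show ?thesis using le\<tau>[OF g[of n]] by (auto simp: min_def simp del: of_nat_Suc)
    qed
    then have "(\<lambda>n. \<rho> n - min t \<tau>) \<longlonglongrightarrow> 0"
      by (intro Lim_null_comparison[OF always_eventually LIMSEQ_Suc[OF lim_const_over_n]] allI)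
    then have "\<rho> \<longlonglongrightarrow> min t \<tau>" by (simp only: LIM_zero_iff)
    then have "(\<lambda>n. c (\<rho> n)) \<longlonglongrightarrow> c (min t \<tau>)"
      using t \<tau>0 \<rho>0 by (intro continuous_on_tendsto_compose[OF c]) auto
    then have "(\<lambda>n. l (\<rho> n)) \<longlonglongrightarrow> c t" using cl[OF g] by (simp add: c_def)
    then show "(\<lambda>n. l (real (last_good l t (Suc n)) * t / real (Suc n))) \<longlonglongrightarrow> c t" by (simp only: \<rho>_def)
  qed
qed

lemma stop_path:
  fixes l :: "real \<Rightarrow> 'a::real_normed_vector"
  assumes l: "cadlag_on {0..} l"
  shows "continuous_on {0..} (stop_path l)" "stop_path l 0 = l 0"
    "0 \<le> t \<Longrightarrow> (\<lambda>n. l (real (last_good l t (Suc n)) * t / real (Suc n))) \<longlonglongrightarrow> stop_path l t"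
    "continuous_on {0..} l \<Longrightarrow> 0 \<le> t \<Longrightarrow> stop_path l t = l t"
proof -
  obtain c where c: "continuous_on {0..} c" "\<And>s. 0 \<le> s \<Longrightarrow> continuous_on {0..s} l \<Longrightarrow> c s = l s"
    "\<And>t. 0 \<le> t \<Longrightarrow> (\<lambda>n. l (real (last_good l t (Suc n)) * t / real (Suc n))) \<longlonglongrightarrow> c t"
    by (rule stopped_path[OF l]) blast
  have eq: "stop_path l t = c t" if "0 \<le> t" for t unfolding stop_path_def by (rule limI[OF c(3)[OF that]])
  show "continuous_on {0..} (stop_path l)" using continuous_on_cong[of "{0..}" "{0..}" "stop_path l" c] c(1) eq by simp
  show "stop_path l 0 = l 0" using eq[of 0] c(2)[of 0] by simp
  show "0 \<le> t \<Longrightarrow> (\<lambda>n. l (real (last_good l t (Suc n)) * t / real (Suc n))) \<longlonglongrightarrow> stop_path l t"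
    using c(3)[of t] eq[of t] by simp
  show "continuous_on {0..} l \<Longrightarrow> 0 \<le> t \<Longrightarrow> stop_path l t = l t"
    using c(2)[of t] eq[of t] continuous_on_subset[of "{0..}" l "{0..t}"] by auto
qed

section \<open>Measurability of the stopped path\<close>

context stationary_noise begin

text \<open>For a cadlag path, continuity up to \<open>s\<close> is decided by increments between
  countably many times up to \<open>s\<close>.\<close>

lemma continuity_event:
  assumes s: "0 \<le> s" "s \<le> t"
  shows "{w\<in>space M. continuous_on {0..s} (\<lambda>u. L u w)} \<in> sets (incr_filtration M L t)"
proof -
  define D where "D = insert s (\<rat> \<inter> {0..s})"
  have D: "countable D" "D \<subseteq> {0..s}" using s by (auto simp: D_def intro: countable_subset[OF _ countable_rat])
  let ?F = "incr_filtration M L t"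
  have "{w\<in>space M. continuous_on {0..s} (\<lambda>u. L u w)} = {w\<in>space ?F. \<forall>m. \<exists>k. \<forall>u\<in>D. \<forall>v\<in>D.
      \<bar>u - v\<bar> < 1 / real (Suc k) \<longrightarrow> norm (L u w - L v w) \<le> 1 / real (Suc m)}"
  proof (intro Collect_cong conj_cong)
    fix w assume "w \<in> space ?F"
    then have "cadlag_on {0..s} (\<lambda>u. L u w)" by (intro cadlag_on_subset[OF cadlag]) auto
    then show "continuous_on {0..s} (\<lambda>u. L u w) \<longleftrightarrow> (\<forall>m. \<exists>k. \<forall>u\<in>D. \<forall>v\<in>D.
      \<bar>u - v\<bar> < 1 / real (Suc k) \<longrightarrow> norm (L u w - L v w) \<le> 1 / real (Suc m))"
      unfolding D_def using s(1) by (rule cadlag_continuous_on_iff)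
  qed simp
  also have "\<dots> \<in> sets ?F"
  proof (intro sets.sets_Collect_countable_All sets.sets_Collect_countable_Ex sets.sets_Collect_countable_All' D(1)
      sets.sets_Collect_imp sets.sets_Collect_const)
    fix m u v assume "u \<in> D" "v \<in> D"
    then have uv: "u \<le> t" "v \<le> t" using D(2) s by auto
    have "(\<lambda>w. L u w - L v w) \<in> borel_measurable ?F"
    proof (cases "v \<le> u")
      case False
      have "(\<lambda>w. - (L v w - L u w)) \<in> borel_measurable ?F"
        using False uv by (intro borel_measurable_uminus incr_measurable_filtration) auto
      then show ?thesis by simp
    qed (use uv in \<open>intro incr_measurable_filtration\<close>)
    then show "{w\<in>space ?F. norm (L u w - L v w) \<le> 1 / real (Suc m)} \<in> sets ?F" by measurable
  qed
  finally show ?thesis .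
qed

text \<open>\<open>last_good\<close> is a random index with finitely many values, so the path
  evaluated at the corresponding grid point is measurable. \<open>L 0\<close> is subtracted because
  the filtration is generated by increments.\<close>

lemma stop_path_measurable:
  assumes s: "0 \<le> s" "s \<le> t"
  shows "(\<lambda>w. stop_path (\<lambda>u. L u w) s - L 0 w) \<in> borel_measurable (incr_filtration M L t)"
proof (rule borel_measurable_LIMSEQ_metric)
  let ?F = "incr_filtration M L t"
  fix n
  show "(\<lambda>w. L (real (last_good (\<lambda>u. L u w) s (Suc n)) * s / real (Suc n)) w - L 0 w) \<in> borel_measurable ?F"
  proof (rule measurable_compose_countable'[where I = "{..Suc n}" and g = "\<lambda>w. last_good (\<lambda>u. L u w) s (Suc n)"
        and f = "\<lambda>k w. L (real k * s / real (Suc n)) w - L 0 w"])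
    show "(\<lambda>w. last_good (\<lambda>u. L u w) s (Suc n)) \<in> measurable ?F (count_space {..Suc n})"
    proof -
      have m: "(\<lambda>w. last_good (\<lambda>u. L u w) s (Suc n)) \<in> measurable ?F (count_space UNIV)"
        unfolding last_good_def
      proof (rule measurable_card)
        fix k
        have ev: "{w\<in>space M. continuous_on {0..real k * s / real (Suc n)} (\<lambda>u. L u w)} \<in> sets ?F" if "k \<in> {1..Suc n}"
        proof (rule continuity_event)
          have "real k * s / real (Suc n) \<le> real (Suc n) * s / real (Suc n)"
            using that s by (intro divide_right_mono mult_right_mono) auto
          then show "real k * s / real (Suc n) \<le> t" using s by simp
        qed (use s in simp)
        show "{w\<in>space ?F. k \<in> {k \<in> {1..Suc n}. continuous_on {0..real k * s / real (Suc n)} (\<lambda>u. L u w)}} \<in> sets ?F"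
        proof (cases "k \<in> {1..Suc n}")
          case True
          then show ?thesis using ev by (simp only: mem_Collect_eq space_incr_filtration simp_thms)
        next
          case False
          then show ?thesis by (simp only: mem_Collect_eq simp_thms Collect_const if_False HOL.conj_commute sets.empty_sets empty_def[symmetric])
        qed
      qed
      have "(\<lambda>w. last_good (\<lambda>u. L u w) s (Suc n)) -` {k} \<inter> space ?F \<in> sets ?F" for k
        by (rule measurable_sets[OF m]) simp
      then show ?thesis
        using last_good(1)[OF s(1)] by (subst measurable_count_space_eq2) auto
    qed
    fix k assume "k \<in> {..Suc n}"
    then have "real k * s / real (Suc n) \<le> real (Suc n) * s / real (Suc n)"
      using s by (intro divide_right_mono mult_right_mono) auto
    then have "real k * s / real (Suc n) \<le> t" using s by simp
    then show "(\<lambda>w. L (real k * s / real (Suc n)) w - L 0 w) \<in> borel_measurable ?F"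
      using s by (intro incr_measurable_filtration) auto
  qed simp
next
  fix w assume "w \<in> space (incr_filtration M L t)"
  then show "(\<lambda>n. L (real (last_good (\<lambda>u. L u w) s (Suc n)) * s / real (Suc n)) w - L 0 w) \<longlonglongrightarrow> stop_path (\<lambda>u. L u w) s - L 0 w"
    by (intro tendsto_diff tendsto_const stop_path(3)[OF cadlag s(1)]) simp
qed

end

lemma ou_path_cong: "(\<And>s. a \<le> s \<Longrightarrow> s \<le> t \<Longrightarrow> l s = k s) \<Longrightarrow> a \<le> t \<Longrightarrow> ou_path A \<Sigma> a l t = ou_path A \<Sigma> a k t"
  unfolding ou_path_def by (intro arg_cong2[where f = "(+)"] Henstock_Kurzweil_Integration.integral_cong) auto

section \<open>Construction of the representatives\<close>

context stationary_noise begin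

lemma ou_version:
  fixes A \<Sigma> :: "real^'d^'d"
  assumes X: "\<And>t. 0 \<le> t \<Longrightarrow> has_stoch_integral M L (\<lambda>s. indicator {..t} s *\<^sub>R (mexp A (t - s) ** \<Sigma>)) (X t)"
  shows "\<exists>X0\<in>borel_measurable (incr_filtration M L 0).
    \<forall>t\<ge>0. AE w in M. X t w = mexp A t *v X0 w + ou_path A \<Sigma> 0 (\<lambda>s. L s w - L 0 w) t"
proof -
  obtain X0 where X0: "X0 \<in> borel_measurable (incr_filtration M L 0)" "AE w in M. X 0 w = X0 w"
    by (rule ou_initial_version[OF X[OF order_refl]]) blast
  have "AE w in M. X t w = mexp A t *v X0 w + ou_path A \<Sigma> 0 (\<lambda>s. L s w - L 0 w) t" if t: "0 \<le> t" for t
  proof (cases "t = 0")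
    case True
    show ?thesis using X0(2) by eventually_elim (simp add: True ou_path_initial)
  next
    case False
    then have "AE w in M. X t w = mexp A t *v X 0 w + ou_path A \<Sigma> 0 (\<lambda>s. L s w - L 0 w) t"
      using t by (intro ou_recursion X cadlag) auto
    then show ?thesis using X0(2) by eventually_elim simp
  qed
  with X0(1) show ?thesis by blast
qed

text \<open>\<open>l\<close> is an adapted driving path that almost surely equals
  \<open>L - L 0\<close>: the centred path itself for cadlag representatives, the stopped one for
  continuous representatives.\<close>

lemma ou_representative:
  fixes A \<Sigma> :: "real^'d^'d" and l :: "real \<Rightarrow> 'w \<Rightarrow> real^'d"
  assumes X: "\<And>t. 0 \<le> t \<Longrightarrow> has_stoch_integral M L (\<lambda>s. indicator {..t} s *\<^sub>R (mexp A (t - s) ** \<Sigma>)) (X t)"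
    and cad: "\<And>w. w \<in> space M \<Longrightarrow> cadlag_on {0..} (\<lambda>t. l t w)" and l0: "\<And>w. w \<in> space M \<Longrightarrow> l 0 w = 0"
    and adapted: "\<And>s t. 0 \<le> s \<Longrightarrow> s \<le> t \<Longrightarrow> l s \<in> borel_measurable (incr_filtration M L t)"
    and eq: "AE w in M. \<forall>t\<ge>0. l t w = L t w - L 0 w"
  obtains X0 where "modification_of M X (\<lambda>t w. mexp A t *v X0 w + ou_path A \<Sigma> 0 (\<lambda>s. l s w) t)"
    "adapted_on {0..} (incr_filtration M L) (\<lambda>t w. mexp A t *v X0 w + ou_path A \<Sigma> 0 (\<lambda>s. l s w) t)"
proof -
  obtain X0 where X0: "X0 \<in> borel_measurable (incr_filtration M L 0)"
    "\<And>t. 0 \<le> t \<Longrightarrow> AE w in M. X t w = mexp A t *v X0 w + ou_path A \<Sigma> 0 (\<lambda>s. L s w - L 0 w) t"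
    using ou_version[of A \<Sigma> X, OF X] by blast
  show thesis
  proof (rule that[of X0])
    show "modification_of M X (\<lambda>t w. mexp A t *v X0 w + ou_path A \<Sigma> 0 (\<lambda>s. l s w) t)"
      unfolding modification_of_def
    proof (intro allI impI)
      fix t :: real assume t: "0 \<le> t"
      show "AE w in M. mexp A t *v X0 w + ou_path A \<Sigma> 0 (\<lambda>s. l s w) t = X t w"
        using eq X0(2)[OF t]
      proof eventually_elim
        case (elim w)
        have "ou_path A \<Sigma> 0 (\<lambda>s. l s w) t = ou_path A \<Sigma> 0 (\<lambda>s. L s w - L 0 w) t"
          using elim(1) t by (intro ou_path_cong) auto
        then show ?case using elim(2) by simp
      qed
    qed
    show "adapted_on {0..} (incr_filtration M L) (\<lambda>t w. mexp A t *v X0 w + ou_path A \<Sigma> 0 (\<lambda>s. l s w) t)"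
      unfolding adapted_on_def
    proof
      fix t :: real assume t: "t \<in> {0..}"
      have "X0 \<in> borel_measurable (incr_filtration M L t)"
        by (rule measurable_from_subalg[OF _ X0(1)]) (use incr_filtration_mono[of 0 t] t in \<open>simp add: subalgebra_def\<close>)
      moreover have "(\<lambda>w. ou_path A \<Sigma> 0 (\<lambda>s. l s w) t) \<in> borel_measurable (incr_filtration M L t)"
        using t by (intro ou_path_measurable adapted l0 cadlag_on_subset[OF cad]) auto
      ultimately show "(\<lambda>w. mexp A t *v X0 w + ou_path A \<Sigma> 0 (\<lambda>s. l s w) t) \<in> borel_measurable (incr_filtration M L t)"
        by (intro borel_measurable_add measurable_matrix_vector)
    qed
  qed
qed

lemma CSBP_representative:
  fixes A \<Sigma> :: "real^'d^'d"
  assumes X: "\<And>t. 0 \<le> t \<Longrightarrow> has_stoch_integral M L (\<lambda>s. indicator {..t} s *\<^sub>R (mexp A (t - s) ** \<Sigma>)) (X t)"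
    and sb: small_ball and det: "det \<Sigma> \<noteq> 0" and Y: "cadlag_representative M (incr_filtration M L) X Y"
  shows "CSBP M (incr_filtration M L) T Y"
proof (rule CSBP_of_small_ball[OF sb det])
  obtain X0 where X0: "\<And>t. 0 \<le> t \<Longrightarrow> AE w in M. X t w = mexp A t *v X0 w + ou_path A \<Sigma> 0 (\<lambda>s. L s w - L 0 w) t"
    using ou_version[of A \<Sigma> X, OF X] by blast
  have YX: "AE w in M. Y t w = X t w" if "0 \<le> t" for t
    using Y that by (simp add: cadlag_representative_def modification_of_def)
  show "AE w in M. Y t w = mexp A t *v Y 0 w + ou_path A \<Sigma> 0 (\<lambda>s. L s w - L 0 w) t" if t: "0 \<le> t" for t
    using YX[OF t] YX[OF order_refl] X0[OF t] X0[OF order_refl]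
    by eventually_elim (simp add: ou_path_initial)
qed (use Y in \<open>auto simp: cadlag_representative_def\<close>)

lemma cadlag_representative_exists:
  fixes A \<Sigma> :: "real^'d^'d"
  assumes X: "\<And>t. 0 \<le> t \<Longrightarrow> has_stoch_integral M L (\<lambda>s. indicator {..t} s *\<^sub>R (mexp A (t - s) ** \<Sigma>)) (X t)"
  shows "\<exists>Y. cadlag_representative M (incr_filtration M L) X Y"
proof -
  obtain X0 where X0: "modification_of M X (\<lambda>t w. mexp A t *v X0 w + ou_path A \<Sigma> 0 (\<lambda>s. L s w - L 0 w) t)"
    "adapted_on {0..} (incr_filtration M L) (\<lambda>t w. mexp A t *v X0 w + ou_path A \<Sigma> 0 (\<lambda>s. L s w - L 0 w) t)"
    by (rule ou_representative[OF X, of "\<lambda>s w. L s w - L 0 w"])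
      (use cadlag_centred incr_measurable_filtration in auto)
  show ?thesis
    unfolding cadlag_representative_def using X0 ou_process_cadlag[OF cadlag_centred] by blast
qed

text \<open>The paths of \<open>L\<close> are continuous only almost surely, and changing them on a
  null set could destroy adaptedness. The stopped path is continuous for every outcome, adapted, and
  almost surely unchanged.\<close>

lemma continuous_representative_exists:
  fixes A \<Sigma> :: "real^'d^'d"
  assumes X: "\<And>t. 0 \<le> t \<Longrightarrow> has_stoch_integral M L (\<lambda>s. indicator {..t} s *\<^sub>R (mexp A (t - s) ** \<Sigma>)) (X t)"
    and cont: "AE w in M. continuous_on {0..} (\<lambda>t. L t w)"
  shows "\<exists>Y. continuous_representative M (incr_filtration M L) X Y"
proof -
  define l where "l s w = stop_path (\<lambda>u. L u w) s - L 0 w" for s w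
  have lc: "continuous_on {0..} (\<lambda>s. l s w)" if "w \<in> space M" for w
    unfolding l_def by (intro continuous_intros stop_path(1) cadlag that)
  have eq: "AE w in M. \<forall>t\<ge>0. l t w = L t w - L 0 w"
    using cont by (rule AE_mp) (intro AE_I2, simp add: l_def stop_path(4)[OF cadlag])
  obtain X0 where X0: "modification_of M X (\<lambda>t w. mexp A t *v X0 w + ou_path A \<Sigma> 0 (\<lambda>s. l s w) t)"
    "adapted_on {0..} (incr_filtration M L) (\<lambda>t w. mexp A t *v X0 w + ou_path A \<Sigma> 0 (\<lambda>s. l s w) t)"
  proof (rule ou_representative[OF X _ _ _ eq])
    show "cadlag_on {0..} (\<lambda>t. l t w)" if "w \<in> space M" for w
      by (rule continuous_on_imp_cadlag_on[OF lc[OF that]])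
    show "l 0 w = 0" if "w \<in> space M" for w by (simp add: l_def stop_path(2)[OF cadlag[OF that]])
    show "l s \<in> borel_measurable (incr_filtration M L t)" if "0 \<le> s" "s \<le> t" for s t
      using stop_path_measurable[OF that] by (simp add: l_def[abs_def])
  qed
  have "continuous_on {0..} (\<lambda>t. mexp A t *v X0 w + ou_path A \<Sigma> 0 (\<lambda>s. l s w) t)" if "w \<in> space M" for w
    by (intro continuous_intros continuous_on_matrix_vector_mult ou_path_continuous lc that)
  then show ?thesis unfolding continuous_representative_def using X0 by blast
qed

end

theorem corollary3p10:
  fixes M :: "'w measure"
    and L X :: "real \<Rightarrow> 'w \<Rightarrow> real ^ 'd"
    and b :: "real ^ 'd"
    and S A \<Sigma> :: "real ^ 'd ^ 'd"
    and \<Lambda> :: "(real ^ 'd) measure"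
  assumes "prob_space M"
    and "two_sided_levy_process M L"
    and "has_triplet M L b S \<Lambda>"
    and "integrable M (\<lambda>\<omega>. (norm (L 1 \<omega>))\<^sup>2)"
    and "(LINT \<omega>|M. L 1 \<omega>) = 0"
    and "stable_matrix A"
    and "det \<Sigma> \<noteq> 0"
    and "levy_ou_process M L A \<Sigma> X"
  shows "(S = 0 \<and> (\<forall>\<epsilon>>0. 0 \<in> interior (convex hull (measure_support (restrict_ball \<Lambda> \<epsilon>)))) \<longrightarrow>
           (\<exists>Y. cadlag_representative M (incr_filtration M L) X Y) \<and>
           (\<forall>Y. cadlag_representative M (incr_filtration M L) X Y \<longrightarrow>
                (\<forall>T>0. CSBP M (incr_filtration M L) T Y))) \<and>
         (\<Lambda> = null_measure borel \<and> det S \<noteq> 0 \<longrightarrow>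
           (\<exists>Y. continuous_representative M (incr_filtration M L) X Y) \<and>
           (\<forall>Y. continuous_representative M (incr_filtration M L) X Y \<longrightarrow>
                (\<forall>T>0. CFS M (incr_filtration M L) T Y)))"
proof -
  have X: "has_stoch_integral M L (\<lambda>s. indicator {..t} s *\<^sub>R (mexp A (t - s) ** \<Sigma>)) (X t)" if "0 \<le> t" for t
    using assms(8) that by (simp add: levy_ou_process_def mexp_def)
  \<comment> \<open>The existence of a random measure extending the increments is part of the
    existence of the integral.\<close>
  obtain Z where Z: "levy_random_measure M L Z" using X[OF order_refl] unfolding has_stoch_integral_def by blast
  define \<psi> where "\<psi> = levy_khintchine_exponent b S \<Lambda>"
  have noise: "levy_noise M L Z \<psi>"
    unfolding \<psi>_def by (rule two_sided_levy_noise[OF assms(1-3) Z])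
  have levy: "levy_process M L" using assms(2) by (simp add: two_sided_levy_process_def)
  interpret stationary_noise M L Z \<psi>
    by (intro stationary_noise.intro noise stationary_noise_axioms.intro levy_process_cadlag[OF levy] levy_process_stationary[OF levy])
  have \<Lambda>: "levy_measure \<Lambda>" and Ssym: "transpose S = S" and Spsd: "\<And>x. 0 \<le> x \<bullet> (S *v x)"
    using assms(3) by (auto simp: has_triplet_def)
  have sets\<Lambda>: "sets \<Lambda> = sets borel" using \<Lambda> by (simp add: levy_measure_def)
  have "(\<exists>Y. cadlag_representative M (incr_filtration M L) X Y) \<and>
      (\<forall>Y. cadlag_representative M (incr_filtration M L) X Y \<longrightarrow> (\<forall>T>0. CSBP M (incr_filtration M L) T Y))"
    if S0: "S = 0" and supp: "\<forall>\<epsilon>>0. 0 \<in> interior (convex hull (measure_support (restrict_ball \<Lambda> \<epsilon>)))"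
  proof -
    have noise0: "levy_noise M L Z (levy_khintchine_exponent b 0 \<Lambda>)" using noise by (simp add: \<psi>_def S0)
    have small_ball
    proof (rule small_ball_jumps)
      fix \<epsilon> :: real assume \<epsilon>: "\<epsilon> > 0"
      let ?S = "measure_support (restrict_ball \<Lambda> \<epsilon>)"
      show "\<exists>S. compact S \<and> (\<forall>x\<in>S. norm x \<le> \<epsilon>) \<and> 0 \<in> interior (convex hull S) \<and>
        (\<forall>x\<in>S. \<forall>r. x \<noteq> 0 \<longrightarrow> r > 0 \<longrightarrow> (\<exists>c>0. \<forall>s. s \<longlonglongrightarrow> 0 \<longrightarrow> (\<forall>m. 0 < s m) \<longrightarrow>
          (\<forall>\<^sub>F m in sequentially. prob {w\<in>space M. norm (L (s m) w - L 0 w - x) < r} \<ge> c * s m)))"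
      proof (intro exI[of _ ?S] conjI ballI allI impI)
        show "compact ?S" by (rule measure_support_restrict_ball(1)[OF sets\<Lambda>])
        show "norm x \<le> \<epsilon>" if "x \<in> ?S" for x by (rule measure_support_restrict_ball(2)[OF sets\<Lambda> that])
        show "0 \<in> interior (convex hull ?S)" using supp \<epsilon> by blast
        fix x r assume x: "x \<in> ?S" "x \<noteq> 0" and r: "(r::real) > 0"
        show "\<exists>c>0. \<forall>s. s \<longlonglongrightarrow> 0 \<longrightarrow> (\<forall>m. 0 < s m) \<longrightarrow>
          (\<forall>\<^sub>F m in sequentially. prob {w\<in>space M. norm (L (s m) w - L 0 w - x) < r} \<ge> c * s m)"
          by (rule small_time_lower_bound[OF noise0 \<Lambda> x(2) measure_support_restrict_ball(3)[OF sets\<Lambda> x(1)] r])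
      qed
    qed
    then show ?thesis using cadlag_representative_exists[OF X] CSBP_representative[OF X _ assms(7)] by blast
  qed
  moreover have "(\<exists>Y. continuous_representative M (incr_filtration M L) X Y) \<and>
      (\<forall>Y. continuous_representative M (incr_filtration M L) X Y \<longrightarrow> (\<forall>T>0. CFS M (incr_filtration M L) T Y))"
    if \<Lambda>0: "\<Lambda> = null_measure borel" and S: "det S \<noteq> 0"
  proof -
    interpret gaussian_noise M L Z \<psi> b S
      by unfold_locales (simp_all add: \<psi>_def levy_khintchine_exponent_def \<Lambda>0 Ssym Spsd S)
    have "CFS M (incr_filtration M L) T Y" if Y: "continuous_representative M (incr_filtration M L) X Y" for Y T
      unfolding CFS_def
    proof
      have "cadlag_representative M (incr_filtration M L) X Y"
        using Y by (auto simp: continuous_representative_def cadlag_representative_def intro: continuous_on_imp_cadlag_on)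
      moreover have small_ball by (rule small_ball_gaussian)
      ultimately show "CSBP M (incr_filtration M L) T Y" by (intro CSBP_representative[of A \<Sigma> X, OF X _ assms(7)])
      show "\<forall>w\<in>space M. continuous_on {0..T} (\<lambda>t. Y t w)"
        using Y by (auto simp: continuous_representative_def intro: continuous_on_subset)
    qed
    then show ?thesis using continuous_representative_exists[OF X paths_continuous] by blast
  qed
  ultimately show ?thesis by blast
qed

end
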